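(* Let $X$ and $Y$ be Banach spaces over $\mathbb{K}$ ($\mathbb{K}=\mathbb{R}$ or $\mathbb{C}$) and let $N\in\mathbb{N}$. Suppose that the dual $X'$ is separable and has the approximation property. Then the set of all polynomials $P\in\mathcal{P}(^NX;Y')$ whose Aron-Berner extension $\overline{P}\in\mathcal{P}(^NX'';Y''')$ attains its norm is dense in $\mathcal{P}(^NX;Y')$.
   Context: $X'$, $X''$ denote the topological dual and bidual, $B_X$ the closed unit ball. $\mathcal{P}(^NX;Z)$ is the Banach space of continuous $N$-homogeneous polynomials $P:X\to Z$ (i.e. $P(x)=\Phi(x,\dots,x)$ for some continuous $N$-linear $\Phi:X\times\cdots\times X\to Z$) with norm $\|P\|=\sup_{x\in B_X}\|P(x)\|$. A polynomial $P\in\mathcal{P}(^NX;Z)$ attains its norm if there is $a\in B_X$ with $\|P(a)\|=\|P\|$ (and likewise for polynomials on $X''$, with $a\in B_{X''}$). Aron-Berner extension: for a continuous $N$-linear map $\Phi:X\times\cdots\times X\to Z$ its canonical (Arens) extension $\overline\Phi:X''\times\cdots\times X''\to Z''$ is $\overline{\Phi}(x_1'',\dots,x_N'')=w^*\text{-}\lim_{\alpha_1}\cdots\lim_{\alpha_N}\Phi(x_{1,\alpha_1},\dots,x_{N,\alpha_N})$, where $(x_{j,\alpha_j})_{\alpha_j}\subset X$ is a net $w^*$-convergent to $x_j''$ (iterated limits). For $P\in\mathcal{P}(^NX;Z)$ with associated symmetric $N$-linear map $\Phi$, $\overline{P}(x'')=\overline{\Phi}(x'',\dots,x'')$, so $\overline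 P\in\mathcal{P}(^NX'';Z'')$. *)

theory Defs
  imports "HOL-Analysis.Analysis" "HOL-Library.Function_Algebras"
begin

(* The scalar field: a normed field isometrically isomorphic to the reals or to the
   complex numbers (phi is injective because it is additive and isometric). *)
class real_or_complex = real_normed_field +
  assumes real_or_complex:
    "\<exists>\<phi> :: 'a \<Rightarrow> complex.
       (\<forall>x y. \<phi> (x + y) = \<phi> x + \<phi> y \<and> \<phi> (x * y) = \<phi> x * \<phi> y) \<and>
       (\<forall>x. norm (\<phi> x) = norm x) \<and>
       (range \<phi> = \<real> \<or> range \<phi> = UNIV)"

instance real :: real_or_complex
  by standard (rule exI[of _ complex_of_real], simp add: Reals_def)

instance complex :: real_or_complex
  by standard (rule exI[of _ "\<lambda>x. x"], simp)

(* A normed space over 'k lives on a subset of a type that supplies the addition. This allows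
   duals, biduals, ... and spaces of polynomials to be formed uniformly over both fields, as
   spaces of functions with pointwise operations. *)
record ('k, 'v) nspace =
  vecs :: "'v set"
  smul :: "'k \<Rightarrow> 'v \<Rightarrow> 'v"
  nrm :: "'v \<Rightarrow> real"

(* The values outside the carrier only serve to meet the requirements of Metric_space, which
   asks for symmetry and nonnegativity on the whole type. *)
definition ndist :: "('k, 'v::ab_group_add) nspace \<Rightarrow> 'v \<Rightarrow> 'v \<Rightarrow> real" where
  "ndist E x y = (if x \<in> vecs E \<and> y \<in> vecs E then nrm E (x - y) else 0)"

definition norm_topology :: "('k, 'v::ab_group_add) nspace \<Rightarrow> 'v topology" where
  "norm_topology E = Metric_space.mtopology (vecs E) (ndist E)"

locale normed_space =
  fixes E :: "('k::real_or_complex, 'v::ab_group_add) nspace"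
  assumes zero_mem: "0 \<in> vecs E"
    and add_mem: "\<lbrakk>x \<in> vecs E; y \<in> vecs E\<rbrakk> \<Longrightarrow> x + y \<in> vecs E"
    and smul_mem: "x \<in> vecs E \<Longrightarrow> smul E c x \<in> vecs E"
    and smul_add: "\<lbrakk>x \<in> vecs E; y \<in> vecs E\<rbrakk> \<Longrightarrow> smul E c (x + y) = smul E c x + smul E c y"
    and add_smul: "x \<in> vecs E \<Longrightarrow> smul E (c + d) x = smul E c x + smul E d x"
    and smul_smul: "x \<in> vecs E \<Longrightarrow> smul E c (smul E d x) = smul E (c * d) x"
    and one_smul: "x \<in> vecs E \<Longrightarrow> smul E 1 x = x"
    and nrm_eq_0: "x \<in> vecs E \<Longrightarrow> nrm E x = 0 \<longleftrightarrow> x = 0"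
    and nrm_add: "\<lbrakk>x \<in> vecs E; y \<in> vecs E\<rbrakk> \<Longrightarrow> nrm E (x + y) \<le> nrm E x + nrm E y"
    and nrm_smul: "x \<in> vecs E \<Longrightarrow> nrm E (smul E c x) = norm c * nrm E x"
begin

lemma smul_minus_one: "x \<in> vecs E \<Longrightarrow> smul E (- 1) x = - x"
  using add_smul[of x 1 "- 1"] add_smul[of x 0 0] one_smul[of x]
  by (simp add: eq_neg_iff_add_eq_0 add.commute)

lemma diff_mem: "\<lbrakk>x \<in> vecs E; y \<in> vecs E\<rbrakk> \<Longrightarrow> x - y \<in> vecs E"
  using add_mem[of x "- y"] smul_mem[of y "- 1"] by (simp add: smul_minus_one)

lemma nrm_minus: "x \<in> vecs E \<Longrightarrow> nrm E (- x) = nrm E x"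
  using nrm_smul[of x "- 1"] by (simp add: smul_minus_one)

lemma nrm_nonneg: "x \<in> vecs E \<Longrightarrow> 0 \<le> nrm E x"
  using nrm_add[of x "- x"] nrm_minus[of x] diff_mem[OF zero_mem, of x] nrm_eq_0[OF zero_mem]
  by simp

lemma Metric_space: "Metric_space (vecs E) (ndist E)"
proof
  fix x y z assume xyz: "x \<in> vecs E" "y \<in> vecs E" "z \<in> vecs E"
  then show "ndist E x z \<le> ndist E x y + ndist E y z"
    using nrm_add[of "x - y" "y - z"] by (simp add: ndist_def diff_mem)
qed (use nrm_minus diff_mem in \<open>force simp: ndist_def nrm_nonneg nrm_eq_0\<close>)+

end

locale banach_space = normed_space +
  assumes complete: "Metric_space.mcomplete (vecs E) (ndist E)"

lemma banach_space_real: "banach_space \<lparr>vecs = UNIV :: 'a::banach set, smul = scaleR, nrm = norm\<rparr>"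
proof -
  have d: "ndist \<lparr>vecs = UNIV :: 'a set, smul = scaleR, nrm = norm\<rparr> = dist"
    by (intro ext) (simp add: ndist_def dist_norm)
  show ?thesis
    by unfold_locales
      (simp_all add: d norm_triangle_ineq scaleR_add_right scaleR_add_left
        complete_UNIV Met_TC.mcomplete_def flip: Cauchy_convergent_iff)
qed

definition unit_ball :: "('k, 'v) nspace \<Rightarrow> 'v set" where
  "unit_ball E = {x \<in> vecs E. nrm E x \<le> 1}"

definition sup_norm :: "('k, 'v) nspace \<Rightarrow> ('l, 'w) nspace \<Rightarrow> ('v \<Rightarrow> 'w) \<Rightarrow> real" where
  "sup_norm E F P = (SUP x\<in>unit_ball E. nrm F (P x))"

definition linear_map :: "('k, 'v::ab_group_add) nspace \<Rightarrow> ('k, 'w::ab_group_add) nspace \<Rightarrow> ('v \<Rightarrow> 'w) \<Rightarrow> bool" where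
  "linear_map E F T \<longleftrightarrow>
     (\<forall>x\<in>vecs E. T x \<in> vecs F) \<and>
     (\<forall>x\<in>vecs E. \<forall>y\<in>vecs E. T (x + y) = T x + T y) \<and>
     (\<forall>c. \<forall>x\<in>vecs E. T (smul E c x) = smul F c (T x))"

definition scalars :: "('k::real_or_complex, 'k) nspace" where
  "scalars = \<lparr>vecs = UNIV, smul = (*), nrm = norm\<rparr>"

(* Functions on a carrier are represented by total functions vanishing outside of it. *)
definition dual :: "('k::real_or_complex, 'v::ab_group_add) nspace \<Rightarrow> ('k, 'v \<Rightarrow> 'k) nspace" where
  "dual E = \<lparr>vecs = {f. linear_map E scalars f \<and>
                        continuous_map (norm_topology E) (norm_topology scalars) f \<and>
                        (\<forall>x. x \<notin> vecs E \<longrightarrow> f x = 0)},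
             smul = (\<lambda>c f x. c * f x),
             nrm = sup_norm E scalars\<rparr>"

abbreviation bidual :: "('k::real_or_complex, 'v::ab_group_add) nspace \<Rightarrow> ('k, ('v \<Rightarrow> 'k) \<Rightarrow> 'k) nspace" where
  "bidual E \<equiv> dual (dual E)"

definition canonical_embedding ::
    "('k::real_or_complex, 'v::ab_group_add) nspace \<Rightarrow> 'v \<Rightarrow> ('v \<Rightarrow> 'k) \<Rightarrow> 'k" where
  "canonical_embedding E x = (\<lambda>f. if f \<in> vecs (dual E) then f x else 0)"

definition approximation_property :: "('k::real_or_complex, 'v::ab_group_add) nspace \<Rightarrow> bool" where
  "approximation_property E \<longleftrightarrow>
     (\<forall>C \<epsilon>. compactin (norm_topology E) C \<and> \<epsilon> > 0 \<longrightarrow>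
        (\<exists>T. linear_map E E T \<and> continuous_map (norm_topology E) (norm_topology E) T \<and>
             (\<exists>B. finite B \<and> B \<subseteq> vecs E \<and>
                  (\<forall>x\<in>vecs E. \<exists>c. T x = (\<Sum>b\<in>B. smul E (c b) b))) \<and>
             (\<forall>x\<in>C. nrm E (T x - x) \<le> \<epsilon>)))"

(* N-tuples are extensional functions on {..<N}. *)
definition tuples :: "nat \<Rightarrow> ('k, 'v) nspace \<Rightarrow> (nat \<Rightarrow> 'v) set" where
  "tuples N E = {..<N} \<rightarrow>\<^sub>E vecs E"

definition diag :: "nat \<Rightarrow> 'v \<Rightarrow> nat \<Rightarrow> 'v" where
  "diag N x = (\<lambda>i\<in>{..<N}. x)"

definition multilinear_maps ::
    "nat \<Rightarrow> ('k, 'v::ab_group_add) nspace \<Rightarrow> ('k, 'w::ab_group_add) nspace \<Rightarrow> ((nat \<Rightarrow> 'v) \<Rightarrow> 'w) set" where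
  "multilinear_maps N E F = {\<Phi>.
     (\<forall>x\<in>tuples N E. \<Phi> x \<in> vecs F \<and> (\<forall>i<N. linear_map E F (\<lambda>y. \<Phi> (x(i := y))))) \<and>
     continuous_map (product_topology (\<lambda>_. norm_topology E) {..<N}) (norm_topology F) \<Phi> \<and>
     (\<forall>x. x \<notin> tuples N E \<longrightarrow> \<Phi> x = 0)}"

definition symmetric :: "nat \<Rightarrow> ('k, 'v) nspace \<Rightarrow> ((nat \<Rightarrow> 'v) \<Rightarrow> 'w) \<Rightarrow> bool" where
  "symmetric N E \<Phi> \<longleftrightarrow> (\<forall>\<pi>. \<pi> permutes {..<N} \<longrightarrow> (\<forall>x\<in>tuples N E. \<Phi> (x \<circ> \<pi>) = \<Phi> x))"

definition polynomials ::
    "nat \<Rightarrow> ('k, 'v::ab_group_add) nspace \<Rightarrow> ('k, 'w::ab_group_add) nspace \<Rightarrow> ('k, 'v \<Rightarrow> 'w) nspace" where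
  "polynomials N E F =
     \<lparr>vecs = {P. (\<exists>\<Phi>\<in>multilinear_maps N E F. \<forall>x\<in>vecs E. P x = \<Phi> (diag N x)) \<and>
                (\<forall>x. x \<notin> vecs E \<longrightarrow> P x = 0)},
      smul = (\<lambda>c P x. smul F c (P x)),
      nrm = sup_norm E F\<rparr>"

definition attains_norm ::
    "('k, 'v) nspace \<Rightarrow> ('k, 'w) nspace \<Rightarrow> ('v \<Rightarrow> 'w) \<Rightarrow> bool" where
  "attains_norm E F P \<longleftrightarrow> (\<exists>a\<in>unit_ball E. nrm F (P a) = sup_norm E F P)"

definition associated_symmetric ::
    "nat \<Rightarrow> ('k, 'v::ab_group_add) nspace \<Rightarrow> ('k, 'w::ab_group_add) nspace \<Rightarrow> ('v \<Rightarrow> 'w) \<Rightarrow> (nat \<Rightarrow> 'v) \<Rightarrow> 'w" where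
  "associated_symmetric N E F P =
     (THE \<Phi>. \<Phi> \<in> multilinear_maps N E F \<and> symmetric N E \<Phi> \<and> (\<forall>x\<in>vecs E. P x = \<Phi> (diag N x)))"

(* The library topology on a function type is that of pointwise convergence. Since functionals
   vanish outside their domain, it induces the weak-* topology on a bidual.

   The filter below is generated by the traces on E of the weak-* neighbourhoods of u. A net in
   E is weak-* convergent to u iff it converges along this filter (its eventuality filter is
   finer), so limits along it are limits along every such net. *)
definition weak_star_net ::
    "('k::real_or_complex, 'v::ab_group_add) nspace \<Rightarrow> (('v \<Rightarrow> 'k) \<Rightarrow> 'k) \<Rightarrow> 'v filter" where
  "weak_star_net E u = inf (filtercomap (canonical_embedding E) (nhds u)) (principal (vecs E))"

(* iterated_lim A N h = lim_{x 0 along A 0} ... lim_{x (N-1) along A (N-1)} h x, innermost limit in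
   the last variable. The library's Lim is not usable here, since function types are not declared
   to be Hausdorff. *)
primrec iterated_lim ::
    "(nat \<Rightarrow> 'v filter) \<Rightarrow> nat \<Rightarrow> ((nat \<Rightarrow> 'v) \<Rightarrow> 'z::topological_space) \<Rightarrow> 'z" where
  "iterated_lim A 0 h = h (\<lambda>_. undefined)"
| "iterated_lim A (Suc n) h =
     iterated_lim A n (\<lambda>x. THE l. ((\<lambda>y. h (x(n := y))) \<longlongrightarrow> l) (A n))"

definition arens_extension ::
    "nat \<Rightarrow> ('k::real_or_complex, 'v::ab_group_add) nspace \<Rightarrow> ('k, 'w::ab_group_add) nspace \<Rightarrow>
     ((nat \<Rightarrow> 'v) \<Rightarrow> 'w) \<Rightarrow> (nat \<Rightarrow> ('v \<Rightarrow> 'k) \<Rightarrow> 'k) \<Rightarrow> ('w \<Rightarrow> 'k) \<Rightarrow> 'k" where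
  "arens_extension N E F \<Phi> u =
     (if u \<in> tuples N (bidual E)
      then iterated_lim (\<lambda>i. weak_star_net E (u i)) N (\<lambda>x. canonical_embedding F (\<Phi> x))
      else 0)"

definition aron_berner_extension ::
    "nat \<Rightarrow> ('k::real_or_complex, 'v::ab_group_add) nspace \<Rightarrow> ('k, 'w::ab_group_add) nspace \<Rightarrow>
     ('v \<Rightarrow> 'w) \<Rightarrow> (('v \<Rightarrow> 'k) \<Rightarrow> 'k) \<Rightarrow> ('w \<Rightarrow> 'k) \<Rightarrow> 'k" where
  "aron_berner_extension N E F P u =
     (if u \<in> vecs (bidual E)
      then arens_extension N E F (associated_symmetric N E F P) (diag N u)
      else 0)"

end

(* Bishop and Phelps, applied to the space of absolutely convergent sums of the point evaluations
   P |-> P x y (x and y in the unit balls), give Q near a given polynomial P0 and a functional u with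
   norm (u Q) >= sup_norm Q such that u is, for every eta > 0, a sum of point evaluations of total
   mass less than 1 + eta. An ultrafilter turns these sums into one measure of mass at most 1 on pairs
   of bidual vectors: all moments of the form prod_l f_l(x) * c(y) are represented by it.

   Since dual X is separable and has the approximation property, the moments determine the
   integral of the Aron-Berner value: replacing one functional-valued random variable after the other by
   its image under a finite rank operator reduces that integral to moments. Comparing the measure with a
   single one of the sums shows that u Q is the integral of the Aron-Berner extension of Q.
   By Davie and Gamelin the integrand is bounded by sup_norm Q, so it reaches this bound at some point. *)
theory Submission
  imports Defs
begin

section \<open>Scalars\<close>

text \<open>The functional u has quotient norm at most 1 but need not be a sum of point evaluations
  of mass at most 1; the masses only come down to 1 in a limit. Limits of points live in the
  biduals, where the Aron-Berner value is in general not weak-star continuous, so the limit measure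
  inherits only the moments. All the sums represent the same u, and the integrand of a moment is
  itself a polynomial. Hence the limit measure and any single sum have exactly equal moments, and
  what is left is a uniqueness statement about two measures. For it, an operator on X' whose
  coefficients are evaluations at vectors of X turns z (h), with z a random bidual vector and h a
  random functional, into products z (\<phi> r) * h (a r). Separability expands h in a deterministic
  summable sequence on which such operators are uniformly good, and makes z (h) measurable. Since Y
  is arbitrary, the weak-star ball of its bidual may fail to be metrizable; the measure is therefore
  a Loeb measure on sequences of pairs, where evaluations at functionals are measurable by
  construction.\<close>

definition scalar_embedding :: "'k::real_or_complex \<Rightarrow> complex" where
  "scalar_embedding = (SOME \<phi>.
     (\<forall>x y. \<phi> (x + y) = \<phi> x + \<phi> y \<and> \<phi> (x * y) = \<phi> x * \<phi> y) \<and>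
     (\<forall>x. norm (\<phi> x) = norm x) \<and> (range \<phi> = \<real> \<or> range \<phi> = UNIV))"

definition re :: "'k::real_or_complex \<Rightarrow> real" where
  "re c = Re (scalar_embedding c)"

lemma scalar_embedding:
  fixes x y :: "'k::real_or_complex"
  shows scalar_embedding_add: "scalar_embedding (x + y) = scalar_embedding x + scalar_embedding y"
    and scalar_embedding_mult: "scalar_embedding (x * y) = scalar_embedding x * scalar_embedding y"
    and norm_scalar_embedding: "norm (scalar_embedding x) = norm x"
    and range_scalar_embedding: "range (scalar_embedding :: 'k \<Rightarrow> complex) = \<real> \<or>
      range (scalar_embedding :: 'k \<Rightarrow> complex) = UNIV"
  using someI_ex[OF real_or_complex[where 'a = 'k]] unfolding scalar_embedding_def[symmetric]
  by blast+

lemma additive_scalar_embedding: "Modules.additive (scalar_embedding :: 'k::real_or_complex \<Rightarrow> complex)"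
  by standard (rule scalar_embedding_add)

lemmas scalar_embedding_diff = Modules.additive.diff[OF additive_scalar_embedding]
  and scalar_embedding_minus = Modules.additive.minus[OF additive_scalar_embedding]
  and scalar_embedding_zero = Modules.additive.zero[OF additive_scalar_embedding]

lemma dist_scalar_embedding: "dist (scalar_embedding x) (scalar_embedding y) = dist x y"
  by (simp add: dist_norm norm_scalar_embedding flip: scalar_embedding_diff)

lemma inj_scalar_embedding: "scalar_embedding x = scalar_embedding y \<longleftrightarrow> x = y"
  using dist_scalar_embedding[of x y] by auto

lemma scalar_embedding_one: "scalar_embedding 1 = 1"
proof -
  have "scalar_embedding (1::'a) \<noteq> 0"
    using norm_scalar_embedding[of "1::'a"] by auto
  moreover have "scalar_embedding (1::'a) * scalar_embedding (1::'a) = scalar_embedding (1::'a)"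
    by (simp flip: scalar_embedding_mult)
  ultimately show ?thesis by simp
qed

text \<open>An isometry that fixes 0 and 1 has no choice at a real number r: its value z satisfies
  |z| = |r| and |z - 1| = |r - 1|, and these two circles touch only in r.\<close>

lemma scalar_embedding_of_real: "scalar_embedding (of_real r :: 'k::real_or_complex) = of_real r"
proof -
  let ?z = "scalar_embedding (of_real r :: 'k)"
  have "norm ?z = \<bar>r\<bar>" by (simp add: norm_scalar_embedding)
  then have 1: "(Re ?z)\<^sup>2 + (Im ?z)\<^sup>2 = r\<^sup>2"
    by (metis cmod_power2 power2_abs)
  have "?z - 1 = scalar_embedding (of_real (r - 1) :: 'k)"
    by (simp add: scalar_embedding_diff scalar_embedding_one)
  then have "norm (?z - 1) = \<bar>r - 1\<bar>" by (metis norm_scalar_embedding norm_of_real)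
  then have 2: "(Re ?z - 1)\<^sup>2 + (Im ?z)\<^sup>2 = (r - 1)\<^sup>2"
    by (metis cmod_power2 power2_abs Re_complex_of_real minus_complex.simps one_complex.simps diff_zero)
  from 1 2 have "Re ?z = r" by (simp add: power2_eq_square algebra_simps)
  with 1 show ?thesis by (simp add: complex_eq_iff)
qed

text \<open>This and the next two instances carry the analysis of the complex numbers over to the
  scalar field: compactness of balls serves for ultrafilter limits, completeness for infinite sums
  and integrals, second countability for Borel measurability. Limits are extracted in the complex
  numbers; they come back because the range of the embedding is closed.\<close>

instance real_or_complex \<subseteq> heine_borel
proof
  fix f :: "nat \<Rightarrow> 'a" assume "bounded (range f)"
  then obtain B where B: "\<And>n. norm (f n) \<le> B" by (auto simp: bounded_iff)
  let ?g = "\<lambda>n. scalar_embedding (f n)"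
  have "bounded (range ?g)"
    using B by (auto simp: bounded_iff norm_scalar_embedding)
  then obtain l r where r: "strict_mono r" and lim: "(?g \<circ> r) \<longlonglongrightarrow> l"
    using bounded_imp_convergent_subsequence by blast
  have "closed (range (scalar_embedding :: 'a \<Rightarrow> complex))"
    using range_scalar_embedding by (metis closed_UNIV closed_complex_Reals)
  then have "l \<in> range (scalar_embedding :: 'a \<Rightarrow> complex)"
    by (rule closed_sequentially[OF _ _ lim]) simp
  then obtain k :: 'a where k: "l = scalar_embedding k" by auto
  have "(f \<circ> r) \<longlonglongrightarrow> k"
    using lim unfolding k tendsto_dist_iff[of _ "scalar_embedding k"] tendsto_dist_iff[of _ k]
    by (simp add: dist_scalar_embedding)
  with r show "\<exists>l r. strict_mono r \<and> (f \<circ> r) \<longlonglongrightarrow> l" by blast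
qed

instance real_or_complex \<subseteq> banach
  by standard (metis Cauchy_converges_subseq cauchy_imp_bounded bounded_imp_convergent_subsequence convergent_def)

instance real_or_complex \<subseteq> second_countable_topology
proof
  obtain B :: "complex set set" where B: "countable B" "topological_basis B"
    using ex_countable_basis by blast
  let ?C = "(\<lambda>U. (scalar_embedding :: 'a \<Rightarrow> complex) -` U) ` B"
  have cont: "continuous_on UNIV (scalar_embedding :: 'a \<Rightarrow> complex)"
    unfolding continuous_on_iff by (auto simp: dist_scalar_embedding)
  have "topological_basis ?C"
  proof (rule topological_basisI)
    show "open U" if "U \<in> ?C" for U
      using that topological_basis_open[OF B(2)] open_vimage[OF _ cont] by blast
    show "\<exists>U\<in>?C. x \<in> U \<and> U \<subseteq> S" if "open S" "x \<in> S" for S and x :: 'a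
    proof -
      obtain r where r: "r > 0" "ball x r \<subseteq> S" using openE[OF \<open>open S\<close> \<open>x \<in> S\<close>] by blast
      obtain U where U: "U \<in> B" "scalar_embedding x \<in> U" "U \<subseteq> ball (scalar_embedding x) r"
        using topological_basisE[OF B(2) open_ball centre_in_ball[THEN iffD2, OF r(1)]] by blast
      then have "scalar_embedding -` U \<subseteq> ball x r"
        by (auto simp: subset_iff dist_scalar_embedding)
      from this r(2) have "scalar_embedding -` U \<subseteq> S" by (rule order.trans)
      with U(1,2) show ?thesis by (intro bexI[of _ "scalar_embedding -` U"]) auto
    qed
  qed
  then show "\<exists>B::'a set set. countable B \<and> open = generate_topology B"
    using B(1) topological_basis_imp_subbasis by blast
qed

lemma re_add: "re (x + y) = re x + re y"
  and re_zero [simp]: "re 0 = 0"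
  and re_minus: "re (- x) = - re x"
  and re_diff: "re (x - y) = re x - re y"
  by (simp_all add: re_def scalar_embedding_add scalar_embedding_zero scalar_embedding_minus scalar_embedding_diff)

lemma re_of_real_mult: "re (of_real r * x) = r * re x"
  by (simp add: re_def scalar_embedding_mult scalar_embedding_of_real)

lemma re_of_real [simp]: "re (of_real r) = r"
  by (simp add: re_def scalar_embedding_of_real)

lemma abs_re_le: "\<bar>re x\<bar> \<le> norm x"
  unfolding re_def by (metis abs_Re_le_cmod norm_scalar_embedding)

lemma re_le: "re x \<le> norm x"
  using abs_re_le[of x] by linarith

lemma obtain_phase:
  fixes x :: "'k::real_or_complex"
  obtains c where "norm c = 1" "c * x = of_real (norm x)"
proof (cases "x = 0")
  case True
  then show thesis using that[of 1] by simp
next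
  case False
  then show thesis using that[of "of_real (norm x) / x"] by (simp add: norm_divide)
qed

section \<open>Scalar-linear functionals with a prescribed real part\<close>

definition subspace_fun :: "('a \<Rightarrow> 'k::real_or_complex) set \<Rightarrow> bool" where
  "subspace_fun V \<longleftrightarrow> 0 \<in> V \<and> (\<forall>v\<in>V. \<forall>w\<in>V. v + w \<in> V) \<and> (\<forall>c. \<forall>v\<in>V. (\<lambda>i. c * v i) \<in> V)"

definition linear_fun :: "('a \<Rightarrow> 'k::real_or_complex) set \<Rightarrow> (('a \<Rightarrow> 'k) \<Rightarrow> 'k) \<Rightarrow> bool" where
  "linear_fun V G \<longleftrightarrow> (\<forall>v\<in>V. \<forall>w\<in>V. G (v + w) = G v + G w) \<and> (\<forall>c. \<forall>v\<in>V. G (\<lambda>i. c * v i) = c * G v)"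

text \<open>Over the complex scalars the functional is G v = g v - i g (i v), with j in the role of
  i; over the real scalars it is g itself. The Hahn-Banach argument can therefore be carried out
  with real-valued functionals only.\<close>

lemma complexification:
  fixes V :: "('a \<Rightarrow> 'k::real_or_complex) set"
  assumes V: "subspace_fun V"
    and add: "\<And>v w. \<lbrakk>v \<in> V; w \<in> V\<rbrakk> \<Longrightarrow> g (v + w) = g v + g w"
    and scale: "\<And>r v. v \<in> V \<Longrightarrow> g (\<lambda>i. of_real r * v i) = r * g v"
  shows "\<exists>G. linear_fun V G \<and> (\<forall>v\<in>V. re (G v) = g v)"
  using range_scalar_embedding[where 'k = 'k]
proof
  assume R: "range (scalar_embedding :: 'k \<Rightarrow> complex) = \<real>"
  have c: "c = of_real (re c)" for c :: 'k
  proof -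
    have "scalar_embedding c \<in> \<real>" using R by blast
    then have "scalar_embedding c = scalar_embedding (of_real (re c) :: 'k)"
      by (simp add: re_def scalar_embedding_of_real)
    then show ?thesis by (simp add: inj_scalar_embedding)
  qed
  have "G' (\<lambda>i. c * v i) = c * G' v" if "v \<in> V" "G' = (\<lambda>v. of_real (g v))" for c :: 'k and v G'
    using that scale[of v "re c"] unfolding c[of c, symmetric] by (simp flip: c)
  then show ?thesis
    by (intro exI[of _ "\<lambda>v. of_real (g v)"]) (auto simp: linear_fun_def add)
next
  assume R: "range (scalar_embedding :: 'k \<Rightarrow> complex) = UNIV"
  obtain j :: 'k where j: "scalar_embedding j = \<i>" using R by (metis surj_def)
  have jj: "j * j = - 1"
    using inj_scalar_embedding[of "j * j" "- 1"] by (simp add: scalar_embedding_mult j scalar_embedding_minus scalar_embedding_one)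
  have re_j: "re (of_real a * j) = 0" for a
    by (simp add: re_def scalar_embedding_mult scalar_embedding_of_real j)
  define im where "im c = Im (scalar_embedding c)" for c :: 'k
  have c: "c = of_real (re c) + of_real (im c) * j" for c :: 'k
    using inj_scalar_embedding[of c "of_real (re c) + of_real (im c) * j"]
    by (simp add: scalar_embedding_add scalar_embedding_mult scalar_embedding_of_real j re_def im_def complex_eq_iff)
  define G where "G v = of_real (g v) - of_real (g (\<lambda>i. j * v i)) * j" for v
  have mem: "(\<lambda>i. c * v i) \<in> V" if "v \<in> V" for c v using V that unfolding subspace_fun_def by blast
  have Gadd: "G (v + w) = G v + G w" if "v \<in> V" "w \<in> V" for v w
    using add[OF that] add[OF mem[OF that(1), of j] mem[OF that(2), of j]]
    by (simp add: G_def plus_fun_def algebra_simps)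
  have Greal: "G (\<lambda>i. of_real r * v i) = of_real r * G v" if "v \<in> V" for r v
    using scale[OF that, of r] scale[OF mem[OF that, of j], of r]
    by (simp add: G_def algebra_simps)
  have Gj: "G (\<lambda>i. j * v i) = j * G v" if "v \<in> V" for v
  proof -
    have "g (\<lambda>i. j * (j * v i)) = - g v"
      using scale[OF that, of "-1"] by (simp add: jj flip: mult.assoc)
    then show ?thesis
      by (simp add: G_def algebra_simps jj) (simp add: jj flip: mult.assoc)
  qed
  have "G (\<lambda>i. c * v i) = c * G v" if v: "v \<in> V" for c v
  proof -
    have "(\<lambda>i. c * v i) = (\<lambda>i. of_real (re c) * v i) + (\<lambda>i. of_real (im c) * (j * v i))"
      by (subst c[of c]) (simp add: plus_fun_def algebra_simps)
    then have "G (\<lambda>i. c * v i) = of_real (re c) * G v + of_real (im c) * (j * G v)"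
      using v by (simp add: Gadd mem Greal[OF mem[OF v]] Greal Gj)
    also have "\<dots> = c * G v" by (subst (3) c[of c]) (simp add: algebra_simps)
    finally show ?thesis .
  qed
  moreover have "re (G v) = g v" for v
    by (simp add: G_def re_diff re_j)
  ultimately have "linear_fun V G \<and> (\<forall>v\<in>V. re (G v) = g v)"
    unfolding linear_fun_def using Gadd by blast
  then show ?thesis by blast
qed

section \<open>Hahn--Banach for function spaces\<close>

definition rscale :: "real \<Rightarrow> ('a \<Rightarrow> 'k::real_or_complex) \<Rightarrow> 'a \<Rightarrow> 'k" where
  "rscale r v = (\<lambda>i. of_real r * v i)"

lemma rscale_simps [simp]:
  "rscale 0 v = 0" "rscale 1 v = v" "rscale r (rscale t v) = rscale (r * t) v" "rscale r 0 = 0"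
  by (simp_all add: rscale_def zero_fun_def mult.assoc)

lemma rscale_add_right: "rscale r (v + w) = rscale r v + rscale r w"
  and rscale_add_left: "rscale (r + t) v = rscale r v + rscale t v"
  and rscale_minus_one: "rscale (- 1) v = - v"
  by (auto simp: rscale_def plus_fun_def fun_Compl_def algebra_simps fun_eq_iff)

lemma subspace_funD:
  assumes "subspace_fun V"
  shows subspace_fun_zero: "0 \<in> V"
    and subspace_fun_add: "\<lbrakk>v \<in> V; w \<in> V\<rbrakk> \<Longrightarrow> v + w \<in> V"
    and subspace_fun_scale: "v \<in> V \<Longrightarrow> (\<lambda>i. c * v i) \<in> V"
    and subspace_fun_rscale: "v \<in> V \<Longrightarrow> rscale r v \<in> V"
  using assms by (simp_all add: subspace_fun_def rscale_def)

lemma subspace_fun_minus: "subspace_fun V \<Longrightarrow> v \<in> V \<Longrightarrow> - v \<in> V"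
  using subspace_fun_rscale[of V v "-1"] by (simp add: rscale_minus_one)

lemma subspace_fun_diff: "subspace_fun V \<Longrightarrow> v \<in> V \<Longrightarrow> w \<in> V \<Longrightarrow> v - w \<in> V"
  using subspace_fun_add[of V v "- w"] by (simp add: subspace_fun_minus)

definition sublinear :: "('a \<Rightarrow> 'k::real_or_complex) set \<Rightarrow> (('a \<Rightarrow> 'k) \<Rightarrow> real) \<Rightarrow> bool" where
  "sublinear V p \<longleftrightarrow> (\<forall>v\<in>V. \<forall>w\<in>V. p (v + w) \<le> p v + p w) \<and>
     (\<forall>r\<ge>0. \<forall>v\<in>V. p (rscale r v) = r * p v)"

text \<open>One inequality for positive factors is enough: applied with 1 / r it yields the opposite
  one.\<close>

lemma sublinearI:
  assumes V: "subspace_fun V"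
    and sub: "\<And>v w. \<lbrakk>v \<in> V; w \<in> V\<rbrakk> \<Longrightarrow> p (v + w) \<le> p v + p w"
    and scale: "\<And>r v. \<lbrakk>r > 0; v \<in> V\<rbrakk> \<Longrightarrow> p (rscale r v) \<le> r * p v"
    and zero: "p 0 = 0"
  shows "sublinear V p"
  unfolding sublinear_def
proof (intro conjI ballI allI impI sub)
  fix r :: real and v assume r: "r \<ge> 0" and v: "v \<in> V"
  show "p (rscale r v) = r * p v"
  proof (cases "r = 0")
    case True
    then show ?thesis by (simp add: zero)
  next
    case False
    then have r: "r > 0" using r by simp
    then have "p v \<le> (1 / r) * p (rscale r v)"
      using scale[of "1 / r" "rscale r v"] subspace_fun_rscale[OF V v] by simp
    then have "r * p v \<le> p (rscale r v)" using r by (simp add: field_simps)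
    then show ?thesis using scale[OF r v] by simp
  qed
qed auto

text \<open>With w = 0 it shows that every sublinear functional below p is at least - p (- v) at v;
  bounds of this kind keep the infima that follow finite.\<close>

lemma sublinear_lower:
  assumes V: "subspace_fun V" and p: "sublinear V p" and v: "v \<in> V" and w: "w \<in> V"
  shows "p v \<ge> p w - p (w - v)"
proof -
  have "w - v \<in> V" by (rule subspace_fun_diff[OF V w v])
  with p v have "p (v + (w - v)) \<le> p v + p (w - v)" unfolding sublinear_def by blast
  then show ?thesis by simp
qed

lemma sublinear_zero: "subspace_fun V \<Longrightarrow> sublinear V p \<Longrightarrow> p 0 = 0"
  unfolding sublinear_def using subspace_fun_zero[of V] by (metis mult_zero_left order_refl rscale_simps(1))

text \<open>Hahn-Banach is obtained without extending functionals from subspaces: Zorn's lemma gives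
  a minimal sublinear functional, and minimality will force it to be additive.\<close>

lemma minimal_sublinear_exists:
  assumes V: "subspace_fun V" and p: "sublinear V p"
  obtains m where "sublinear V m" "\<forall>v\<in>V. m v \<le> p v"
    "\<And>q. \<lbrakk>sublinear V q; \<forall>v\<in>V. q v \<le> m v\<rbrakk> \<Longrightarrow> \<forall>v\<in>V. q v = m v"
proof -
  \<comment> \<open>The members vanish off V, so that the order P can compare them at all functions
    and infima of chains exist there too.\<close>
  define A where "A = {q. sublinear V q \<and> (\<forall>v\<in>V. q v \<le> p v) \<and> (\<forall>v. v \<notin> V \<longrightarrow> q v = 0)}"
  define P where "P q q' \<longleftrightarrow> (\<forall>v. q' v \<le> q v)" for q q' :: "('a \<Rightarrow> 'b) \<Rightarrow> real"
  have restr: "(\<lambda>v. if v \<in> V then q v else 0) \<in> A" if "sublinear V q" "\<forall>v\<in>V. q v \<le> p v" for q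
    using that V unfolding A_def sublinear_def by (simp add: subspace_fun_add subspace_fun_rscale)
  have "\<exists>m\<in>A. \<forall>a\<in>A. P m a \<longrightarrow> a = m"
  proof (rule predicate_Zorn)
    show "partial_order_on A (relation_of P A)"
      by (rule partial_order_on_relation_ofI) (auto simp: P_def fun_eq_iff intro: order.trans order.antisym)
  next
    fix C assume "C \<in> Chains (relation_of P A)"
    then have CA: "C \<subseteq> A" and chain: "\<And>q q'. \<lbrakk>q \<in> C; q' \<in> C\<rbrakk> \<Longrightarrow> P q q' \<or> P q' q"
      by (auto simp: Chains_def relation_of_def)
    show "\<exists>u\<in>A. \<forall>a\<in>C. P a u"
    proof (cases "C = {}")
      case True
      then show ?thesis using restr[OF p] by auto
    next
      case ne: False
      have sl: "sublinear V q" if "q \<in> C" for q using that CA by (auto simp: A_def)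
      have qp: "q v \<le> p v" if "q \<in> C" "v \<in> V" for q v using that CA by (auto simp: A_def)
      have lower: "- p (- v) \<le> q v" if "q \<in> C" "v \<in> V" for q v
        using sublinear_lower[OF V sl[OF that(1)] that(2) subspace_fun_zero[OF V]]
          sublinear_zero[OF V sl[OF that(1)]] qp[OF that(1) subspace_fun_minus[OF V that(2)]] by simp
      define u where "u v = (INF q\<in>C. q v)" for v
      have u_le: "u v \<le> q v" if "q \<in> C" "v \<in> V" for q v
        unfolding u_def by (rule cINF_lower[OF _ that(1)]) (use lower that(2) in \<open>auto intro!: bdd_belowI\<close>)
      have u_ge: "x \<le> u v" if "\<And>q. q \<in> C \<Longrightarrow> x \<le> q v" for x v
        unfolding u_def by (rule cINF_greatest[OF ne that])
      have "sublinear V u"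
      proof (rule sublinearI[OF V])
        fix v w assume v: "v \<in> V" and w: "w \<in> V"
        have "u (v + w) \<le> q v + q' w" if q: "q \<in> C" "q' \<in> C" for q q'
        proof -
          \<comment> \<open>Of two members of a chain one lies below the other; it serves for q at v
            and for q' at w at the same time.\<close>
          obtain r where r: "r \<in> C" "r v \<le> q v" "r w \<le> q' w"
            using chain[OF q] q by (auto simp: P_def)
          then have "u (v + w) \<le> r (v + w)" by (intro u_le subspace_fun_add[OF V] v w)
          also have "\<dots> \<le> r v + r w" using sl[OF r(1)] v w by (auto simp: sublinear_def)
          finally show ?thesis using r by simp
        qed
        then have "u (v + w) - q' w \<le> u v" if "q' \<in> C" for q'
          using that by (intro u_ge) (simp add: algebra_simps)
        then have "u (v + w) - u v \<le> u w"
          by (intro u_ge) (simp add: algebra_simps)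
        then show "u (v + w) \<le> u v + u w" by simp
      next
        fix r :: real and v assume r: "r > 0" and v: "v \<in> V"
        have "u (rscale r v) / r \<le> q v" if "q \<in> C" for q
          using u_le[OF that subspace_fun_rscale[OF V v], of r] sl[OF that] r v
          by (auto simp: sublinear_def field_simps)
        then have "u (rscale r v) / r \<le> u v" by (rule u_ge)
        then show "u (rscale r v) \<le> r * u v" using r by (simp add: field_simps)
      next
        have "u 0 = (INF q\<in>C. 0)"
          unfolding u_def by (rule INF_cong) (auto simp: sublinear_zero[OF V sl])
        then show "u 0 = 0" using ne by simp
      qed
      moreover have "\<forall>v\<in>V. u v \<le> p v" using ne u_le qp by (meson ex_in_conv order.trans)
      ultimately have "(\<lambda>v. if v \<in> V then u v else 0) \<in> A" by (rule restr)
      moreover have "\<forall>a\<in>C. P a (\<lambda>v. if v \<in> V then u v else 0)"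
        using u_le CA by (auto simp: P_def A_def)
      ultimately show ?thesis by blast
    qed
  qed
  then obtain m where m: "m \<in> A" and min: "\<And>a. \<lbrakk>a \<in> A; P m a\<rbrakk> \<Longrightarrow> a = m" by blast
  show thesis
  proof (rule that)
    fix q assume q: "sublinear V q" "\<forall>v\<in>V. q v \<le> m v"
    then have "\<forall>v\<in>V. q v \<le> p v" using m by (force simp: A_def)
    then have eq: "(\<lambda>v. if v \<in> V then q v else 0) = m"
      using q m by (intro min restr) (auto simp: P_def A_def)
    show "\<forall>v\<in>V. q v = m v" by (simp flip: eq)
  qed (use m in \<open>auto simp: A_def\<close>)
qed

text \<open>q is the infimum over t of m (v + t v0) - t m v0. It lies below m (take t = 0) and
  satisfies q (- v0) \<le> - m v0 (take t = 1), so a linear functional below q has at least the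
  value m v0 at v0.\<close>

lemma tangent_sublinear:
  assumes V: "subspace_fun V" and m: "sublinear V m" and v0: "v0 \<in> V"
  shows "\<exists>q. sublinear V q \<and> (\<forall>v\<in>V. \<forall>t\<ge>0. q v \<le> m (v + rscale t v0) - t * m v0)"
proof -
  note cl = subspace_fun_add[OF V] subspace_fun_rscale[OF V] subspace_fun_zero[OF V]
  have msub: "m (v + w) \<le> m v + m w" if "v \<in> V" "w \<in> V" for v w using m that by (auto simp: sublinear_def)
  have mscale: "m (rscale r v) = r * m v" if "v \<in> V" "r \<ge> 0" for v r using m that by (auto simp: sublinear_def)
  define T :: "real set" where "T = {0..}"
  define q where "q v = (INF t\<in>T. m (v + rscale t v0) - t * m v0)" for v
  have lower: "- m (- v) \<le> m (v + rscale t v0) - t * m v0" if "v \<in> V" "t \<in> T" for t v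
    using sublinear_lower[OF V m, of "v + rscale t v0" "rscale t v0"] that v0
    by (simp add: cl mscale T_def)
  have q_le: "q v \<le> m (v + rscale t v0) - t * m v0" if "v \<in> V" "t \<ge> 0" for t v
    unfolding q_def by (rule cINF_lower) (use lower that in \<open>auto intro!: bdd_belowI simp: T_def\<close>)
  have q_ge: "x \<le> q v" if "\<And>t. t \<ge> 0 \<Longrightarrow> x \<le> m (v + rscale t v0) - t * m v0" for x v
    unfolding q_def by (rule cINF_greatest) (use that in \<open>auto simp: T_def\<close>)
  have "sublinear V q"
  proof (rule sublinearI[OF V])
    fix v w assume vw: "v \<in> V" "w \<in> V"
    have le: "q (v + w) \<le> (m (v + rscale t v0) - t * m v0) + (m (w + rscale s v0) - s * m v0)"
      if "t \<ge> 0" "s \<ge> 0" for s t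
    proof -
      have "q (v + w) \<le> m ((v + w) + rscale (t + s) v0) - (t + s) * m v0"
        using that vw by (intro q_le cl) auto
      also have "(v + w) + rscale (t + s) v0 = (v + rscale t v0) + (w + rscale s v0)"
        by (simp add: rscale_add_left algebra_simps)
      also have "m \<dots> \<le> m (v + rscale t v0) + m (w + rscale s v0)"
        by (intro msub cl vw v0)
      finally show ?thesis unfolding distrib_right by linarith
    qed
    have "q (v + w) - (m (w + rscale s v0) - s * m v0) \<le> q v" if "s \<ge> 0" for s
      using le[OF _ that] by (intro q_ge) (simp add: algebra_simps)
    then have "q (v + w) - q v \<le> q w"
      by (intro q_ge) (simp add: algebra_simps)
    then show "q (v + w) \<le> q v + q w" by simp
  next
    fix r :: real and v assume r: "r > 0" and v: "v \<in> V"
    have "q (rscale r v) / r \<le> m (v + rscale t v0) - t * m v0" if "t \<ge> 0" for t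
    proof -
      have "q (rscale r v) \<le> m (rscale r v + rscale (r * t) v0) - (r * t) * m v0"
        using r that v by (intro q_le cl) auto
      also have "rscale r v + rscale (r * t) v0 = rscale r (v + rscale t v0)"
        by (simp add: rscale_add_right)
      also have "m \<dots> = r * m (v + rscale t v0)" using r v v0 by (intro mscale cl) auto
      finally show ?thesis using r by (simp add: field_simps)
    qed
    then have "q (rscale r v) / r \<le> q v" by (rule q_ge)
    then show "q (rscale r v) \<le> r * q v" using r by (simp add: field_simps)
  next
    have "q 0 = (INF t\<in>T. 0)"
      unfolding q_def by (rule INF_cong) (auto simp: mscale[OF v0] T_def)
    then show "q 0 = 0" by (simp add: T_def)
  qed
  with q_le show ?thesis by blast
qed

text \<open>For a minimal m, the tangent functional q at any v0 must coincide with m. Then m v = q v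
  \<le> m (v + v0) - m v0, so m is superadditive as well as subadditive.\<close>

lemma sublinear_minorant:
  fixes V :: "('a \<Rightarrow> 'k::real_or_complex) set"
  assumes V: "subspace_fun V" and p: "sublinear V p"
  shows "\<exists>G. linear_fun V G \<and> (\<forall>v\<in>V. re (G v) \<le> p v)"
proof -
  obtain m where m: "sublinear V m" "\<forall>v\<in>V. m v \<le> p v"
    and min: "\<And>q. \<lbrakk>sublinear V q; \<forall>v\<in>V. q v \<le> m v\<rbrakk> \<Longrightarrow> \<forall>v\<in>V. q v = m v"
    using minimal_sublinear_exists[OF V p] by blast
  note cl = subspace_fun_add[OF V] subspace_fun_rscale[OF V] subspace_fun_zero[OF V]
  have msub: "m (v + w) \<le> m v + m w" if "v \<in> V" "w \<in> V" for v w using m that by (auto simp: sublinear_def)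
  have mscale: "m (rscale r v) = r * m v" if "v \<in> V" "r \<ge> 0" for v r using m that by (auto simp: sublinear_def)
  have super: "m v + m v0 \<le> m (v + v0)" if v: "v \<in> V" and v0: "v0 \<in> V" for v v0
  proof -
    obtain q where q: "sublinear V q"
      and q_le: "\<And>v t. \<lbrakk>v \<in> V; t \<ge> 0\<rbrakk> \<Longrightarrow> q v \<le> m (v + rscale t v0) - t * m v0"
      using tangent_sublinear[OF V m(1) v0] by blast
    have "\<forall>v\<in>V. q v \<le> m v" using q_le[of _ 0] by simp
    with q have "q v = m v" using min v by blast
    moreover have "q v \<le> m (v + v0) - m v0" using q_le[OF v, of 1] by simp
    ultimately show ?thesis by simp
  qed
  have add: "m (v + w) = m v + m w" if "v \<in> V" "w \<in> V" for v w
    using super[OF that] msub[OF that] by simp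
  have scale: "m (rscale r v) = r * m v" if v: "v \<in> V" for r v
  proof (cases "r \<ge> 0")
    case True
    then show ?thesis using mscale[OF v] by simp
  next
    case False
    have "m (rscale r v + rscale (- r) v) = m (rscale r v) + m (rscale (- r) v)"
      by (intro add cl v)
    moreover have "rscale r v + rscale (- r) v = 0" by (simp flip: rscale_add_left)
    ultimately show ?thesis
      using mscale[OF v, of "- r"] False sublinear_zero[OF V m(1)] by simp
  qed
  obtain G where "linear_fun V G" "\<forall>v\<in>V. re (G v) = m v"
    using complexification[OF V, of m] add scale by (auto simp: rscale_def)
  with m(2) show ?thesis by (metis)
qed

lemma linear_funD:
  assumes "linear_fun V G"
  shows linear_fun_add: "\<lbrakk>v \<in> V; w \<in> V\<rbrakk> \<Longrightarrow> G (v + w) = G v + G w"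
    and linear_fun_scale: "v \<in> V \<Longrightarrow> G (\<lambda>i. c * v i) = c * G v"
    and linear_fun_rscale: "v \<in> V \<Longrightarrow> G (rscale r v) = of_real r * G v"
  using assms by (simp_all add: linear_fun_def rscale_def)

lemma linear_fun_zero: "linear_fun V G \<Longrightarrow> subspace_fun V \<Longrightarrow> G 0 = 0"
  using linear_fun_rscale[of V G 0 0] subspace_fun_zero[of V] by simp

lemma linear_fun_minus: "linear_fun V G \<Longrightarrow> v \<in> V \<Longrightarrow> G (- v) = - G v"
  using linear_fun_rscale[of V G v "-1"] by (simp add: rscale_minus_one)

lemma linear_fun_diff:
  "linear_fun V G \<Longrightarrow> subspace_fun V \<Longrightarrow> v \<in> V \<Longrightarrow> w \<in> V \<Longrightarrow> G (v - w) = G v - G w"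
  using linear_fun_add[of V G v "- w"] by (simp add: linear_fun_minus subspace_fun_minus)

definition seminorm_fun :: "('a \<Rightarrow> 'k::real_or_complex) set \<Rightarrow> (('a \<Rightarrow> 'k) \<Rightarrow> real) \<Rightarrow> bool" where
  "seminorm_fun V p \<longleftrightarrow> (\<forall>v\<in>V. \<forall>w\<in>V. p (v + w) \<le> p v + p w) \<and>
     (\<forall>c. \<forall>v\<in>V. p (\<lambda>i. c * v i) = norm c * p v)"

lemma seminorm_funD:
  assumes "seminorm_fun V p"
  shows seminorm_fun_add: "\<lbrakk>v \<in> V; w \<in> V\<rbrakk> \<Longrightarrow> p (v + w) \<le> p v + p w"
    and seminorm_fun_scale: "v \<in> V \<Longrightarrow> p (\<lambda>i. c * v i) = norm c * p v"
    and seminorm_fun_rscale: "v \<in> V \<Longrightarrow> p (rscale r v) = \<bar>r\<bar> * p v"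
    and seminorm_fun_minus: "v \<in> V \<Longrightarrow> p (- v) = p v"
proof -
  show scale: "v \<in> V \<Longrightarrow> p (\<lambda>i. c * v i) = norm c * p v" for c
    using assms by (auto simp: seminorm_fun_def)
  show "v \<in> V \<Longrightarrow> p (rscale r v) = \<bar>r\<bar> * p v" for r
    by (simp add: scale rscale_def)
  from this[of "-1"] show "v \<in> V \<Longrightarrow> p (- v) = p v"
    by (simp add: rscale_minus_one)
qed (use assms in \<open>simp add: seminorm_fun_def\<close>)

lemma seminorm_fun_zero: "seminorm_fun V p \<Longrightarrow> subspace_fun V \<Longrightarrow> p 0 = 0"
  using seminorm_fun_rscale[of V p 0 0] subspace_fun_zero[of V] by simp

lemma seminorm_fun_nonneg:
  assumes "seminorm_fun V p" "subspace_fun V" "v \<in> V" shows "0 \<le> p v"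
  using seminorm_fun_add[OF assms(1,3) subspace_fun_minus[OF assms(2,3)]]
    seminorm_fun_minus[OF assms(1,3)] seminorm_fun_zero[OF assms(1,2)] by simp

lemma seminorm_fun_diff:
  "seminorm_fun V p \<Longrightarrow> subspace_fun V \<Longrightarrow> v \<in> V \<Longrightarrow> w \<in> V \<Longrightarrow> p (v - w) \<le> p v + p w"
  using seminorm_fun_add[of V p v "- w"] by (simp add: subspace_fun_minus seminorm_fun_minus)

text \<open>Multiplying v by a phase makes G v real and nonnegative without changing p v.\<close>

lemma norm_le_of_re_le:
  assumes V: "subspace_fun V" and p: "seminorm_fun V p" and G: "linear_fun V G"
    and le: "\<And>v. v \<in> V \<Longrightarrow> re (G v) \<le> p v" and v: "v \<in> V"
  shows "norm (G v) \<le> p v"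
proof -
  obtain c where c: "norm c = 1" "c * G v = of_real (norm (G v))" by (rule obtain_phase)
  have "norm (G v) = re (G (\<lambda>i. c * v i))" by (simp add: linear_fun_scale[OF G v] c)
  also have "\<dots> \<le> p (\<lambda>i. c * v i)" by (intro le subspace_fun_scale V v)
  also have "\<dots> = p v" by (simp add: seminorm_fun_scale[OF p v] c)
  finally show ?thesis .
qed

text \<open>A linear G below the tangent functional of p at v0 has re (G (- v0)) \<le> - p v0, which
  forces equality in norm (G v0) \<le> p v0.\<close>

lemma norming_functional:
  fixes V :: "('a \<Rightarrow> 'k::real_or_complex) set"
  assumes V: "subspace_fun V" and p: "seminorm_fun V p" and v0: "v0 \<in> V"
  shows "\<exists>G. linear_fun V G \<and> (\<forall>v\<in>V. norm (G v) \<le> p v) \<and> norm (G v0) = p v0"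
proof -
  have "sublinear V p"
    using p seminorm_fun_rscale[OF p] by (auto simp: sublinear_def seminorm_fun_def)
  from tangent_sublinear[OF V this v0] obtain q where "sublinear V q"
    and q_le: "\<And>v t. \<lbrakk>v \<in> V; t \<ge> 0\<rbrakk> \<Longrightarrow> q v \<le> p (v + rscale t v0) - t * p v0"
    by blast
  from sublinear_minorant[OF V \<open>sublinear V q\<close>] obtain G where G: "linear_fun V G" "\<And>v. v \<in> V \<Longrightarrow> re (G v) \<le> q v"
    by blast
  have le: "norm (G v) \<le> p v" if "v \<in> V" for v
    by (rule norm_le_of_re_le[OF V p G(1) _ that]) (use G(2) q_le[of _ 0] in force)
  have "re (G (- v0)) \<le> q (- v0)" by (intro G subspace_fun_minus V v0)
  also have "\<dots> \<le> - p v0"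
    using q_le[of "- v0" 1] seminorm_fun_zero[OF p V] by (simp add: subspace_fun_minus V v0)
  finally have "p v0 \<le> norm (G v0)"
    using re_le[of "G v0"] by (simp add: linear_fun_minus[OF G(1) v0] re_minus)
  with le[OF v0] have "norm (G v0) = p v0" by simp
  with G(1) le show ?thesis by blast
qed

section \<open>Normed spaces and their duals\<close>

context normed_space
begin

lemma nrm_zero [simp]: "nrm E 0 = 0"
  using nrm_eq_0[OF zero_mem] by simp

lemma smul_zero_right [simp]: "smul E c 0 = 0"
  using smul_add[OF zero_mem zero_mem, of c] by simp

lemma smul_zero_left: "x \<in> vecs E \<Longrightarrow> smul E 0 x = 0"
  using add_smul[of x 0 0] by simp

lemma minus_mem: "x \<in> vecs E \<Longrightarrow> - x \<in> vecs E"
  using diff_mem[OF zero_mem, of x] by simp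

lemma nrm_diff: "\<lbrakk>x \<in> vecs E; y \<in> vecs E\<rbrakk> \<Longrightarrow> nrm E (x - y) \<le> nrm E x + nrm E y"
  using nrm_add[of x "- y"] by (simp add: minus_mem nrm_minus)

lemma nrm_diff_commute: "\<lbrakk>x \<in> vecs E; y \<in> vecs E\<rbrakk> \<Longrightarrow> nrm E (x - y) = nrm E (y - x)"
  using nrm_minus[OF diff_mem, of x y] by simp

lemma sum_mem: "(\<And>i. i \<in> I \<Longrightarrow> f i \<in> vecs E) \<Longrightarrow> sum f I \<in> vecs E"
  by (induction I rule: infinite_finite_induct) (auto intro: zero_mem add_mem)

lemma nrm_sum: "(\<And>i. i \<in> I \<Longrightarrow> f i \<in> vecs E) \<Longrightarrow> nrm E (sum f I) \<le> (\<Sum>i\<in>I. nrm E (f i))"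
proof (induction I rule: infinite_finite_induct)
  case (insert i I)
  then show ?case using nrm_add[of "f i" "sum f I"] sum_mem[of I f] by force
qed auto

lemma topspace_norm_topology: "topspace (norm_topology E) = vecs E"
  unfolding norm_topology_def by (rule Metric_space.topspace_mtopology[OF Metric_space])

text \<open>Norm at most 1, rather than equal to 1, covers x = 0 and even the space whose only
  vector is 0.\<close>

lemma obtain_unit_vector:
  assumes "x \<in> vecs E"
  obtains u where "u \<in> vecs E" "nrm E u \<le> 1" "x = smul E (of_real (nrm E x)) u"
proof (cases "x = 0")
  case True
  then show thesis using that[of 0] by (simp add: zero_mem)
next
  case False
  then have "nrm E x > 0" using nrm_nonneg[OF assms] nrm_eq_0[OF assms] by simp
  then show thesis
    using that[of "smul E (of_real (1 / nrm E x)) x"] assms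
    by (simp add: smul_mem nrm_smul smul_smul one_smul norm_divide)
qed

end

lemma linear_mapD:
  assumes "linear_map E F T"
  shows linear_map_mem: "x \<in> vecs E \<Longrightarrow> T x \<in> vecs F"
    and linear_map_add: "\<lbrakk>x \<in> vecs E; y \<in> vecs E\<rbrakk> \<Longrightarrow> T (x + y) = T x + T y"
    and linear_map_smul: "x \<in> vecs E \<Longrightarrow> T (smul E c x) = smul F c (T x)"
  using assms by (simp_all add: linear_map_def)

lemma linear_map_zero:
  assumes "normed_space E" "linear_map E F T" shows "T 0 = 0"
  using linear_map_add[OF assms(2), of 0 0] normed_space.zero_mem[OF assms(1)] by simp

lemma linear_map_diff:
  assumes E: "normed_space E" and T: "linear_map E F T" and x: "x \<in> vecs E" and y: "y \<in> vecs E"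
  shows "T (x - y) = T x - T y"
  using linear_map_add[OF T normed_space.diff_mem[OF E x y] y] by simp

lemma linear_map_sum:
  assumes E: "normed_space E" and T: "linear_map E F T"
  shows "(\<And>i. i \<in> I \<Longrightarrow> f i \<in> vecs E) \<Longrightarrow> T (sum f I) = (\<Sum>i\<in>I. T (f i))"
proof (induction I rule: infinite_finite_induct)
  case (insert i I)
  then show ?case
    using linear_map_add[OF T, of "f i" "sum f I"] normed_space.sum_mem[OF E, of I f] by simp
qed (auto simp: linear_map_zero[OF E T])

lemma continuous_norm_topology_iff:
  assumes E: "normed_space E" and F: "normed_space F"
  shows "continuous_map (norm_topology E) (norm_topology F) T \<longleftrightarrow>
    T ` vecs E \<subseteq> vecs F \<and> (\<forall>a\<in>vecs E. \<forall>\<epsilon>>0. \<exists>\<delta>>0. \<forall>x\<in>vecs E. nrm E (x - a) < \<delta> \<longrightarrow> nrm F (T x - T a) < \<epsilon>)"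
  unfolding norm_topology_def
    Metric_space.metric_continuous_map[OF normed_space.Metric_space[OF E] normed_space.Metric_space[OF F]]
  by (intro conj_cong refl ball_cong all_cong imp_cong ex_cong)
    (auto simp: ndist_def image_subset_iff normed_space.nrm_diff_commute[OF E] normed_space.nrm_diff_commute[OF F])

lemma continuous_linear_iff_bounded:
  assumes E: "normed_space E" and F: "normed_space F" and T: "linear_map E F T"
  shows "continuous_map (norm_topology E) (norm_topology F) T \<longleftrightarrow> (\<exists>C\<ge>0. \<forall>x\<in>vecs E. nrm F (T x) \<le> C * nrm E x)"
    (is "?L \<longleftrightarrow> ?R")
proof
  interpret E: normed_space E by (rule E)
  interpret F: normed_space F by (rule F)
  assume ?L
  then obtain \<delta> where \<delta>: "\<delta> > 0" "\<And>x. \<lbrakk>x \<in> vecs E; nrm E x < \<delta>\<rbrakk> \<Longrightarrow> nrm F (T x) < 1"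
    unfolding continuous_norm_topology_iff[OF E F] using E.zero_mem linear_map_zero[OF E T]
    by (metis diff_zero zero_less_one)
  have "nrm F (T x) \<le> (2 / \<delta>) * nrm E x" if x: "x \<in> vecs E" for x
  proof -
    obtain u where u: "u \<in> vecs E" "nrm E u \<le> 1" "x = smul E (of_real (nrm E x)) u"
      using E.obtain_unit_vector[OF x] by blast
    have "nrm F (T (smul E (of_real (\<delta> / 2)) u)) < 1"
      using \<delta>(1) u by (intro \<delta>(2) E.smul_mem) (auto simp: E.nrm_smul)
    then have "(\<delta> / 2) * nrm F (T u) < 1"
      using u(1) \<delta>(1) by (simp add: linear_map_smul[OF T] F.nrm_smul linear_map_mem[OF T])
    then have "nrm F (T u) \<le> 2 / \<delta>" using \<delta>(1) by (simp add: field_simps)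
    moreover have "nrm F (T x) = nrm E x * nrm F (T u)"
      by (subst u(3)) (simp add: linear_map_smul[OF T u(1)] F.nrm_smul linear_map_mem[OF T u(1)] E.nrm_nonneg[OF x])
    ultimately show ?thesis
      using E.nrm_nonneg[OF x] by (metis mult.commute mult_left_mono)
  qed
  then show ?R using \<delta>(1) by (intro exI[of _ "2 / \<delta>"]) auto
next
  interpret E: normed_space E by (rule E)
  interpret F: normed_space F by (rule F)
  assume ?R
  then obtain C where C: "C \<ge> 0" "\<And>x. x \<in> vecs E \<Longrightarrow> nrm F (T x) \<le> C * nrm E x" by blast
  have "\<exists>\<delta>>0. \<forall>x\<in>vecs E. nrm E (x - a) < \<delta> \<longrightarrow> nrm F (T x - T a) < \<epsilon>" if a: "a \<in> vecs E" and \<epsilon>: "\<epsilon> > 0" for a \<epsilon>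
  proof (intro exI[of _ "\<epsilon> / (C + 1)"] conjI ballI impI)
    fix x assume x: "x \<in> vecs E" "nrm E (x - a) < \<epsilon> / (C + 1)"
    have "nrm F (T x - T a) \<le> C * nrm E (x - a)"
      using C(2)[OF E.diff_mem[OF x(1) a]] by (simp add: linear_map_diff[OF E T x(1) a])
    also have "\<dots> \<le> C * (\<epsilon> / (C + 1))" using x C(1) by (intro mult_left_mono) auto
    also have "\<dots> < \<epsilon>" using \<epsilon> C(1) by (simp add: field_simps)
    finally show "nrm F (T x - T a) < \<epsilon>" .
  qed (use \<epsilon> C(1) in auto)
  then show ?L
    unfolding continuous_norm_topology_iff[OF E F] using linear_map_mem[OF T] by blast
qed

lemma scalars_sel [simp]: "vecs scalars = UNIV" "smul scalars = (*)" "nrm scalars = norm"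
  by (simp_all add: scalars_def)

lemma normed_space_scalars: "normed_space (scalars :: ('k::real_or_complex, 'k) nspace)"
  by standard (simp_all add: norm_triangle_ineq norm_mult algebra_simps)

lemma sup_norm_le:
  assumes "unit_ball E \<noteq> {}" "\<And>x. x \<in> unit_ball E \<Longrightarrow> nrm F (P x) \<le> C"
  shows "sup_norm E F P \<le> C"
  unfolding sup_norm_def by (rule cSUP_least) (use assms in auto)

lemma le_sup_norm:
  assumes "\<And>x. x \<in> unit_ball E \<Longrightarrow> nrm F (P x) \<le> C" "x \<in> unit_ball E"
  shows "nrm F (P x) \<le> sup_norm E F P"
  unfolding sup_norm_def by (rule cSUP_upper) (use assms in \<open>auto intro!: bdd_aboveI2\<close>)

lemma dual_sel [simp]: "smul (dual E) c f = (\<lambda>x. c * f x)" "nrm (dual E) = sup_norm E scalars"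
  by (simp_all add: dual_def)

context normed_space
begin

lemma unit_ball_nonempty: "unit_ball E \<noteq> {}"
  using zero_mem by (auto simp: unit_ball_def intro!: exI[of _ 0])

lemma mem_dual_iff:
  "f \<in> vecs (dual E) \<longleftrightarrow> linear_map E scalars f \<and> (\<exists>C\<ge>0. \<forall>x\<in>vecs E. norm (f x) \<le> C * nrm E x) \<and>
     (\<forall>x. x \<notin> vecs E \<longrightarrow> f x = 0)"
  using continuous_linear_iff_bounded[OF normed_space_axioms normed_space_scalars, of f]
  by (auto simp: dual_def)

lemma dual_linear: "f \<in> vecs (dual E) \<Longrightarrow> linear_map E scalars f"
  by (simp add: mem_dual_iff)

lemma dual_outside: "f \<in> vecs (dual E) \<Longrightarrow> x \<notin> vecs E \<Longrightarrow> f x = 0"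
  by (simp add: mem_dual_iff)

lemma dual_add: "f \<in> vecs (dual E) \<Longrightarrow> x \<in> vecs E \<Longrightarrow> y \<in> vecs E \<Longrightarrow> f (x + y) = f x + f y"
  by (rule linear_map_add[OF dual_linear])

lemma dual_smul: "f \<in> vecs (dual E) \<Longrightarrow> x \<in> vecs E \<Longrightarrow> f (smul E c x) = c * f x"
  using linear_map_smul[OF dual_linear] by simp

lemma dual_diff: "f \<in> vecs (dual E) \<Longrightarrow> x \<in> vecs E \<Longrightarrow> y \<in> vecs E \<Longrightarrow> f (x - y) = f x - f y"
  by (rule linear_map_diff[OF normed_space_axioms dual_linear])

lemma dual_sum: "f \<in> vecs (dual E) \<Longrightarrow> (\<And>i. i \<in> I \<Longrightarrow> g i \<in> vecs E) \<Longrightarrow> f (sum g I) = (\<Sum>i\<in>I. f (g i))"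
  by (rule linear_map_sum[OF normed_space_axioms dual_linear])

lemma dual_ball_le:
  assumes f: "f \<in> vecs (dual E)" and x: "x \<in> vecs E" "nrm E x \<le> 1"
  shows "norm (f x) \<le> nrm (dual E) f"
proof -
  obtain C where C: "C \<ge> 0" "\<And>x. x \<in> vecs E \<Longrightarrow> norm (f x) \<le> C * nrm E x"
    using f by (auto simp: mem_dual_iff)
  have "norm (f v) \<le> C" if "v \<in> unit_ball E" for v
  proof -
    have "norm (f v) \<le> C * nrm E v" using that C(2) by (simp add: unit_ball_def)
    also have "\<dots> \<le> C * 1" using that C(1) by (intro mult_left_mono) (auto simp: unit_ball_def)
    finally show ?thesis by simp
  qed
  then show ?thesis
    using le_sup_norm[of E scalars f C x] x by (simp add: unit_ball_def)
qed

lemma dual_norm_le: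
  assumes f: "f \<in> vecs (dual E)" and x: "x \<in> vecs E"
  shows "norm (f x) \<le> nrm (dual E) f * nrm E x"
proof -
  obtain u where u: "u \<in> vecs E" "nrm E u \<le> 1" "x = smul E (of_real (nrm E x)) u"
    using obtain_unit_vector[OF x] by blast
  have "norm (f x) = nrm E x * norm (f u)"
    by (subst u(3)) (simp add: dual_smul[OF f u(1)] norm_mult nrm_nonneg[OF x])
  then show ?thesis
    using nrm_nonneg[OF x] dual_ball_le[OF f u(1,2)] by (metis mult.commute mult_left_mono)
qed

lemma dual_nrm_le:
  assumes "\<And>x. \<lbrakk>x \<in> vecs E; nrm E x \<le> 1\<rbrakk> \<Longrightarrow> norm (f x) \<le> C"
  shows "nrm (dual E) f \<le> C"
  unfolding dual_sel by (rule sup_norm_le[OF unit_ball_nonempty]) (use assms in \<open>auto simp: unit_ball_def\<close>)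

text \<open>C carries no sign condition; the proof replaces it by max C 0.\<close>

lemma dual_memI:
  assumes "\<And>x y. \<lbrakk>x \<in> vecs E; y \<in> vecs E\<rbrakk> \<Longrightarrow> f (x + y) = f x + f y"
    and "\<And>c x. x \<in> vecs E \<Longrightarrow> f (smul E c x) = c * f x"
    and "\<And>x. x \<in> vecs E \<Longrightarrow> norm (f x) \<le> C * nrm E x"
    and "\<And>x. x \<notin> vecs E \<Longrightarrow> f x = 0"
  shows "f \<in> vecs (dual E)"
proof -
  have "norm (f x) \<le> max C 0 * nrm E x" if "x \<in> vecs E" for x
  proof -
    have "C * nrm E x \<le> max C 0 * nrm E x" by (intro mult_right_mono nrm_nonneg[OF that]) auto
    then show ?thesis using assms(3)[OF that] by linarith
  qed
  then show ?thesis unfolding mem_dual_iff linear_map_def using assms by (auto intro!: exI[of _ "max C 0"])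
qed

lemma dual_sup_nonneg: "f \<in> vecs (dual E) \<Longrightarrow> 0 \<le> nrm (dual E) f"
  using order.trans[OF norm_ge_zero dual_ball_le[of f 0]] zero_mem by simp

lemma normed_space_dual: "normed_space (dual E)"
proof
  show "0 \<in> vecs (dual E)" by (rule dual_memI[of _ 0]) auto
next
  fix f g assume f: "f \<in> vecs (dual E)" and g: "g \<in> vecs (dual E)"
  have le: "norm ((f + g) x) \<le> (nrm (dual E) f + nrm (dual E) g) * nrm E x" if "x \<in> vecs E" for x
    using dual_norm_le[OF f that] dual_norm_le[OF g that] norm_triangle_ineq[of "f x" "g x"]
    by (simp add: distrib_right)
  show "f + g \<in> vecs (dual E)"
    by (rule dual_memI[OF _ _ le])
      (simp_all add: dual_add[OF f] dual_add[OF g] dual_smul[OF f] dual_smul[OF g] dual_outside[OF f] dual_outside[OF g] algebra_simps)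
  show "nrm (dual E) (f + g) \<le> nrm (dual E) f + nrm (dual E) g"
  proof (rule dual_nrm_le)
    fix x assume x: "x \<in> vecs E" "nrm E x \<le> 1"
    have "(nrm (dual E) f + nrm (dual E) g) * nrm E x \<le> (nrm (dual E) f + nrm (dual E) g) * 1"
      using x f g by (intro mult_left_mono add_nonneg_nonneg dual_sup_nonneg)
    then show "norm ((f + g) x) \<le> nrm (dual E) f + nrm (dual E) g"
      using order.trans[OF le[OF x(1)]] by (simp only: mult_1_right)
  qed
next
  fix f c assume f: "f \<in> vecs (dual E)"
  have le: "norm (c * f x) \<le> (norm c * nrm (dual E) f) * nrm E x" if "x \<in> vecs E" for x c
    using mult_left_mono[OF dual_norm_le[OF f that] norm_ge_zero[of c]] by (simp add: norm_mult mult.assoc)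
  have mem: "smul (dual E) c f \<in> vecs (dual E)" for c
    unfolding dual_sel
    by (rule dual_memI[OF _ _ le]) (simp_all add: dual_add[OF f] dual_smul[OF f] dual_outside[OF f] algebra_simps)
  then show "smul (dual E) c f \<in> vecs (dual E)" .
  have nle: "nrm (dual E) (smul (dual E) c f) \<le> norm c * nrm (dual E) f" for c
  proof (rule dual_nrm_le)
    fix x assume x: "x \<in> vecs E" "nrm E x \<le> 1"
    have "(norm c * nrm (dual E) f) * nrm E x \<le> (norm c * nrm (dual E) f) * 1"
      using x f by (intro mult_left_mono mult_nonneg_nonneg dual_sup_nonneg norm_ge_zero)
    then show "norm (smul (dual E) c f x) \<le> norm c * nrm (dual E) f"
      using le[OF x(1), of c] by simp
  qed
  show "nrm (dual E) (smul (dual E) c f) = norm c * nrm (dual E) f"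
  proof (rule antisym[OF nle])
    show "norm c * nrm (dual E) f \<le> nrm (dual E) (smul (dual E) c f)"
    proof (cases "c = 0")
      case True
      then show ?thesis using dual_sup_nonneg[OF mem[of c]] by simp
    next
      case False
      have "nrm (dual E) f \<le> nrm (dual E) (smul (dual E) c f) / norm c"
      proof (rule dual_nrm_le)
        fix x assume x: "x \<in> vecs E" "nrm E x \<le> 1"
        have "norm (c * f x) \<le> nrm (dual E) (smul (dual E) c f) * nrm E x"
          using dual_norm_le[OF mem[of c] x(1)] by simp
        also have "\<dots> \<le> nrm (dual E) (smul (dual E) c f) * 1"
          using x dual_sup_nonneg[OF mem[of c]] by (intro mult_left_mono)
        finally show "norm (f x) \<le> nrm (dual E) (smul (dual E) c f) / norm c"
          using False by (simp add: norm_mult field_simps)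
      qed
      then show ?thesis using False by (simp add: field_simps)
    qed
  qed
next
  fix f assume f: "f \<in> vecs (dual E)"
  have "f = 0" if "nrm (dual E) f = 0"
  proof
    fix x show "f x = 0 x"
      using dual_norm_le[OF f, of x] dual_outside[OF f, of x] that by (cases "x \<in> vecs E") auto
  qed
  moreover have "nrm (dual E) 0 = 0"
    using unit_ball_nonempty by (simp add: sup_norm_def)
  ultimately show "nrm (dual E) f = 0 \<longleftrightarrow> f = 0" by auto
qed (auto simp: algebra_simps)

end

section \<open>Multilinear maps\<close>

lemma tuples_upd: "\<lbrakk>x \<in> tuples n E; i < n; y \<in> vecs E\<rbrakk> \<Longrightarrow> x(i := y) \<in> tuples n E"
  by (auto simp: tuples_def PiE_iff extensional_def)

lemma tuples_upd_Suc: "\<lbrakk>x \<in> tuples n E; y \<in> vecs E\<rbrakk> \<Longrightarrow> x(n := y) \<in> tuples (Suc n) E"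
  by (auto simp: tuples_def PiE_iff extensional_def)

lemma tuples_mem: "\<lbrakk>x \<in> tuples n E; i < n\<rbrakk> \<Longrightarrow> x i \<in> vecs E"
  by (auto simp: tuples_def)

lemma tuplesI: "(\<And>i. i < n \<Longrightarrow> x i \<in> vecs E) \<Longrightarrow> (\<lambda>i\<in>{..<n}. x i) \<in> tuples n E"
  by (auto simp: tuples_def)

lemma tuples_eqI: "\<lbrakk>x \<in> tuples n E; y \<in> tuples n E; \<And>i. i < n \<Longrightarrow> x i = y i\<rbrakk> \<Longrightarrow> x = y"
  by (auto simp: tuples_def intro: PiE_ext)

lemma restrict_tuple: "x \<in> tuples n E \<Longrightarrow> (\<lambda>i\<in>{..<n}. x i) = x"
  by (auto simp: tuples_def PiE_restrict)

lemma diag_tuple: "x \<in> vecs E \<Longrightarrow> diag n x \<in> tuples n E"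
  by (simp add: diag_def tuplesI)

text \<open>The algebraic half of \<open>multilinear_maps\<close>. Continuity is expressed by
  \<open>multilinear_bound\<close>, and the values off the tuples are left open;
  \<open>multilinear_maps_iff\<close> puts the pieces together.\<close>

definition multilinear :: "nat \<Rightarrow> ('k, 'v::ab_group_add) nspace \<Rightarrow> ('k, 'w::ab_group_add) nspace \<Rightarrow> ((nat \<Rightarrow> 'v) \<Rightarrow> 'w) \<Rightarrow> bool" where
  "multilinear n E F \<Phi> \<longleftrightarrow> (\<forall>x\<in>tuples n E. \<Phi> x \<in> vecs F \<and> (\<forall>i<n. linear_map E F (\<lambda>y. \<Phi> (x(i := y)))))"

definition multilinear_bound :: "nat \<Rightarrow> ('k, 'v) nspace \<Rightarrow> ('k, 'w) nspace \<Rightarrow> ((nat \<Rightarrow> 'v) \<Rightarrow> 'w) \<Rightarrow> real \<Rightarrow> bool" where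
  "multilinear_bound n E F \<Phi> C \<longleftrightarrow> (\<forall>x\<in>tuples n E. nrm F (\<Phi> x) \<le> C * (\<Prod>i<n. nrm E (x i)))"

lemma multilinear_boundD:
  "multilinear_bound n E F \<Phi> C \<Longrightarrow> x \<in> tuples n E \<Longrightarrow> nrm F (\<Phi> x) \<le> C * (\<Prod>i<n. nrm E (x i))"
  by (simp add: multilinear_bound_def)

lemma multilinear_mem: "multilinear n E F \<Phi> \<Longrightarrow> x \<in> tuples n E \<Longrightarrow> \<Phi> x \<in> vecs F"
  by (simp add: multilinear_def)

lemma multilinear_slot: "multilinear n E F \<Phi> \<Longrightarrow> x \<in> tuples n E \<Longrightarrow> i < n \<Longrightarrow> linear_map E F (\<lambda>y. \<Phi> (x(i := y)))"
  by (simp add: multilinear_def)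

lemma multilinear_scale:
  fixes E :: "('k::real_or_complex, 'v::ab_group_add) nspace"
  assumes E: "normed_space E" and F: "normed_space F" and \<Phi>: "multilinear n E F \<Phi>" and x: "x \<in> tuples n E"
  shows "\<Phi> (\<lambda>i\<in>{..<n}. smul E (c i) (x i)) = smul F (\<Prod>i<n. c i) (\<Phi> x)"
proof -
  interpret E: normed_space E by (rule E)
  interpret F: normed_space F by (rule F)
  \<comment> \<open>The first k slots are scaled, one more in each step.\<close>
  have "\<Phi> (\<lambda>i\<in>{..<n}. if i < k then smul E (c i) (x i) else x i) = smul F (\<Prod>i<k. c i) (\<Phi> x)" if "k \<le> n" for k
    using that
  proof (induction k)
    case 0
    then show ?case using restrict_tuple[OF x] multilinear_mem[OF \<Phi> x] by (simp add: F.one_smul)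
  next
    case (Suc k)
    let ?z = "\<lambda>i\<in>{..<n}. if i < k then smul E (c i) (x i) else x i"
    have z: "?z \<in> tuples n E" using tuples_mem[OF x] by (intro tuplesI) (auto intro: E.smul_mem)
    have 1: "(\<lambda>i\<in>{..<n}. if i < Suc k then smul E (c i) (x i) else x i) = ?z(k := smul E (c k) (x k))"
      using Suc.prems by (auto simp: fun_eq_iff)
    have 2: "?z(k := x k) = ?z" using Suc.prems by (auto simp: fun_eq_iff)
    have 3: "\<Phi> (?z(k := smul E (c k) (x k))) = smul F (c k) (\<Phi> (?z(k := x k)))"
      using Suc.prems by (intro linear_map_smul[OF multilinear_slot[OF \<Phi> z]] tuples_mem[OF x]) auto
    have IH: "\<Phi> ?z = smul F (\<Prod>i<k. c i) (\<Phi> x)" by (rule Suc.IH) (use Suc.prems in simp)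
    show ?case unfolding 1 3 2 IH
      using multilinear_mem[OF \<Phi> x] by (simp add: F.smul_smul mult.commute)
  qed
  moreover have "(\<lambda>i\<in>{..<n}. if i < n then smul E (c i) (x i) else x i) = (\<lambda>i\<in>{..<n}. smul E (c i) (x i))"
    by (auto simp: restrict_def fun_eq_iff)
  ultimately show ?thesis by (metis order_refl)
qed

lemma multilinear_sum:
  fixes E :: "('k::real_or_complex, 'v::ab_group_add) nspace"
  assumes E: "normed_space E" and \<Phi>: "multilinear n E F \<Phi>" and K: "finite K"
    and v: "\<And>i j. i < n \<Longrightarrow> j \<in> K \<Longrightarrow> v i j \<in> vecs E"
  shows "\<Phi> (\<lambda>i\<in>{..<n}. \<Sum>j\<in>K. v i j) = (\<Sum>f\<in>{..<n} \<rightarrow>\<^sub>E K. \<Phi> (\<lambda>i\<in>{..<n}. v i (f i)))"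
proof -
  interpret E: normed_space E by (rule E)
  define w where "w i = (\<Sum>j\<in>K. v i j)" for i
  have w: "w i \<in> vecs E" if "i < n" for i unfolding w_def using v[OF that] by (rule E.sum_mem)
  \<comment> \<open>The first k slots are expanded; f records the summand chosen in each of
    them.\<close>
  have "\<Phi> (\<lambda>i\<in>{..<n}. w i) = (\<Sum>f\<in>{..<k} \<rightarrow>\<^sub>E K. \<Phi> (\<lambda>i\<in>{..<n}. if i < k then v i (f i) else w i))" if "k \<le> n" for k
    using that
  proof (induction k)
    case 0
    then show ?case by (simp add: PiE_empty_domain)
  next
    case (Suc k)
    have step: "\<Phi> (\<lambda>i\<in>{..<n}. if i < k then v i (f i) else w i) =
        (\<Sum>j\<in>K. \<Phi> (\<lambda>i\<in>{..<n}. if i < Suc k then v i ((f(k := j)) i) else w i))"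
      if f: "f \<in> {..<k} \<rightarrow>\<^sub>E K" for f
    proof -
      let ?z = "\<lambda>i\<in>{..<n}. if i < k then v i (f i) else w i"
      have z: "?z \<in> tuples n E" using f by (intro tuplesI) (auto intro: v w PiE_mem)
      have 1: "?z = ?z(k := \<Sum>j\<in>K. v k j)"
        using Suc.prems by (auto simp: fun_eq_iff w_def)
      have 2: "(\<lambda>i\<in>{..<n}. if i < Suc k then v i ((f(k := j)) i) else w i) = ?z(k := v k j)" for j
        using Suc.prems by (auto simp: fun_eq_iff less_Suc_eq)
      show ?thesis unfolding 2
        by (subst 1, rule linear_map_sum[OF E multilinear_slot[OF \<Phi> z]]) (use Suc.prems v in auto)
    qed
    have "\<Phi> (\<lambda>i\<in>{..<n}. w i) = (\<Sum>f\<in>{..<k} \<rightarrow>\<^sub>E K. \<Sum>j\<in>K. \<Phi> (\<lambda>i\<in>{..<n}. if i < Suc k then v i ((f(k := j)) i) else w i))"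
      unfolding Suc.IH[OF Suc_leD[OF Suc.prems]] by (intro sum.cong refl step)
    also have "\<dots> = (\<Sum>j\<in>K. \<Sum>f\<in>{..<k} \<rightarrow>\<^sub>E K. \<Phi> (\<lambda>i\<in>{..<n}. if i < Suc k then v i ((f(k := j)) i) else w i))"
      by (rule sum.swap)
    also have "\<dots> = (\<Sum>(j, f)\<in>K \<times> ({..<k} \<rightarrow>\<^sub>E K). \<Phi> (\<lambda>i\<in>{..<n}. if i < Suc k then v i ((f(k := j)) i) else w i))"
      by (rule sum.cartesian_product)
    also have "\<dots> = (\<Sum>f\<in>{..<Suc k} \<rightarrow>\<^sub>E K. \<Phi> (\<lambda>i\<in>{..<n}. if i < Suc k then v i (f i) else w i))"
      unfolding lessThan_Suc PiE_insert_eq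
      by (subst sum.reindex[OF inj_combinator]) (auto simp: case_prod_unfold o_def)
    finally show ?case .
  qed
  moreover have "(\<lambda>i\<in>{..<n}. if i < n then v i (f i) else w i) = (\<lambda>i\<in>{..<n}. v i (f i))" for f
    by (auto simp: restrict_def fun_eq_iff)
  ultimately have "\<Phi> (\<lambda>i\<in>{..<n}. w i) = (\<Sum>f\<in>{..<n} \<rightarrow>\<^sub>E K. \<Phi> (\<lambda>i\<in>{..<n}. v i (f i)))"
    using order_refl[of n] by presburger
  then show ?thesis unfolding w_def .
qed

lemma prod_nrm_nonneg:
  assumes "normed_space E" "x \<in> tuples n E" shows "0 \<le> (\<Prod>i<n. nrm E (x i))"
  using assms by (intro prod_nonneg) (auto intro!: normed_space.nrm_nonneg tuples_mem)

lemma multilinear_bound_mono: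
  assumes "normed_space E" "multilinear_bound n E F \<Phi> C" "C \<le> D"
  shows "multilinear_bound n E F \<Phi> D"
  unfolding multilinear_bound_def
proof
  fix x assume x: "x \<in> tuples n E"
  have "nrm F (\<Phi> x) \<le> C * (\<Prod>i<n. nrm E (x i))" using assms(2) x by (simp add: multilinear_bound_def)
  also have "\<dots> \<le> D * (\<Prod>i<n. nrm E (x i))"
    by (intro mult_right_mono assms(3) prod_nrm_nonneg[OF assms(1) x])
  finally show "nrm F (\<Phi> x) \<le> D * (\<Prod>i<n. nrm E (x i))" .
qed

lemma multilinear_boundI:
  fixes E :: "('k::real_or_complex, 'v::ab_group_add) nspace"
  assumes E: "normed_space E" and F: "normed_space F" and \<Phi>: "multilinear n E F \<Phi>"
    and le: "\<And>x. \<lbrakk>x \<in> tuples n E; \<And>i. i < n \<Longrightarrow> nrm E (x i) \<le> 1\<rbrakk> \<Longrightarrow> nrm F (\<Phi> x) \<le> C"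
  shows "multilinear_bound n E F \<Phi> C"
  unfolding multilinear_bound_def
proof
  interpret E: normed_space E by (rule E)
  interpret F: normed_space F by (rule F)
  fix x assume x: "x \<in> tuples n E"
  have "\<exists>u. u \<in> vecs E \<and> nrm E u \<le> 1 \<and> x i = smul E (of_real (nrm E (x i))) u" if "i < n" for i
    using E.obtain_unit_vector[OF tuples_mem[OF x that]] by blast
  then obtain u where u: "\<And>i. i < n \<Longrightarrow> u i \<in> vecs E" "\<And>i. i < n \<Longrightarrow> nrm E (u i) \<le> 1"
    "\<And>i. i < n \<Longrightarrow> smul E (of_real (nrm E (x i))) (u i) = x i"
    by metis
  let ?u = "\<lambda>i\<in>{..<n}. u i"
  have ut: "?u \<in> tuples n E" using u by (intro tuplesI) auto
  have "(\<lambda>i\<in>{..<n}. smul E (of_real (nrm E (x i))) (?u i)) = (\<lambda>i\<in>{..<n}. x i)"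
    using u(3) by (intro restrict_ext) simp
  then have "nrm F (\<Phi> x) = nrm F (smul F (\<Prod>i<n. of_real (nrm E (x i))) (\<Phi> ?u))"
    unfolding restrict_tuple[OF x]
    using multilinear_scale[OF E F \<Phi> ut, of "\<lambda>i. of_real (nrm E (x i))"] by simp
  also have "\<dots> = (\<Prod>i<n. nrm E (x i)) * nrm F (\<Phi> ?u)"
    using prod_nrm_nonneg[OF E x] by (simp add: F.nrm_smul multilinear_mem[OF \<Phi> ut] flip: of_real_prod)
  also have "\<dots> \<le> (\<Prod>i<n. nrm E (x i)) * C"
    using u by (intro mult_left_mono le ut prod_nrm_nonneg[OF E x]) auto
  finally show "nrm F (\<Phi> x) \<le> C * (\<Prod>i<n. nrm E (x i))" by (simp add: mult.commute)
qed

lemma topspace_tuples: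
  assumes "normed_space E"
  shows "topspace (product_topology (\<lambda>_. norm_topology E) {..<n}) = tuples n E"
  by (simp add: normed_space.topspace_norm_topology[OF assms] tuples_def)

lemma openin_ball:
  assumes E: "normed_space E" and a: "a \<in> vecs E"
  shows "openin (norm_topology E) {x \<in> vecs E. nrm E (x - a) < r}"
proof -
  have "{x \<in> vecs E. nrm E (x - a) < r} = Metric_space.mball (vecs E) (ndist E) a r"
    using a by (auto simp: Metric_space.in_mball[OF normed_space.Metric_space[OF E]] ndist_def
        normed_space.nrm_diff_commute[OF E])
  then show ?thesis
    unfolding norm_topology_def using Metric_space.openin_mball[OF normed_space.Metric_space[OF E]] by metis
qed

text \<open>Continuity at the zero tuple gives a box of radii r i on which the values stay close to
  the value there. Scaling slot i by r i / 2 moves a tuple of unit vectors into the box, and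
  homogeneity undoes this with the factor P.\<close>

lemma continuous_multilinear_bounded:
  fixes E :: "('k::real_or_complex, 'v::ab_group_add) nspace"
  assumes E: "normed_space E" and F: "normed_space F" and \<Phi>: "multilinear n E F \<Phi>"
    and cont: "continuous_map (product_topology (\<lambda>_. norm_topology E) {..<n}) (norm_topology F) \<Phi>"
  shows "\<exists>C\<ge>0. multilinear_bound n E F \<Phi> C"
proof -
  interpret E: normed_space E by (rule E)
  interpret F: normed_space F by (rule F)
  let ?T = "product_topology (\<lambda>_. norm_topology E) {..<n}"
  let ?z = "\<lambda>i\<in>{..<n}. 0::'v"
  have z: "?z \<in> tuples n E" by (intro tuplesI E.zero_mem)
  let ?V = "{x \<in> topspace ?T. \<Phi> x \<in> {y \<in> vecs F. nrm F (y - \<Phi> ?z) < 1}}"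
  have "openin ?T ?V"
    by (rule openin_continuous_map_preimage[OF cont openin_ball[OF F multilinear_mem[OF \<Phi> z]]])
  moreover have "?z \<in> ?V" unfolding topspace_tuples[OF E] using z multilinear_mem[OF \<Phi> z] by simp
  ultimately have "\<exists>U. finite {i \<in> {..<n}. U i \<noteq> topspace (norm_topology E)} \<and>
      (\<forall>i\<in>{..<n}. openin (norm_topology E) (U i)) \<and> ?z \<in> Pi\<^sub>E {..<n} U \<and> Pi\<^sub>E {..<n} U \<subseteq> ?V"
    unfolding openin_product_topology_alt by (rule bspec)
  then obtain U where U: "\<forall>i\<in>{..<n}. openin (norm_topology E) (U i)"
    "?z \<in> Pi\<^sub>E {..<n} U" "Pi\<^sub>E {..<n} U \<subseteq> ?V"
    by (elim exE conjE)
  have "\<exists>r>0. \<forall>x\<in>vecs E. nrm E x < r \<longrightarrow> x \<in> U i" if i: "i < n" for i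
  proof -
    have "0 \<in> U i" using U(2) i by (auto simp: PiE_iff)
    then obtain r where r: "r > 0" "Metric_space.mball (vecs E) (ndist E) 0 r \<subseteq> U i"
      using bspec[OF U(1), of i] i unfolding norm_topology_def Metric_space.openin_mtopology[OF E.Metric_space] by blast
    have "x \<in> Metric_space.mball (vecs E) (ndist E) 0 r" if "x \<in> vecs E" "nrm E x < r" for x
      using that by (simp add: Metric_space.in_mball[OF E.Metric_space] ndist_def E.zero_mem E.nrm_minus)
    with r show ?thesis by blast
  qed
  then obtain r where r: "\<And>i. i < n \<Longrightarrow> r i > 0" "\<And>i x. \<lbrakk>i < n; x \<in> vecs E; nrm E x < r i\<rbrakk> \<Longrightarrow> x \<in> U i"
    by metis
  define P where "P = (\<Prod>i<n. r i / 2)"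
  have P: "P > 0" unfolding P_def using r(1) by (intro prod_pos) auto
  \<comment> \<open>The value at \<open>?z\<close> is kept in the bound because it need not vanish
    when n = 0.\<close>
  have near: "nrm F (\<Phi> x) \<le> 1 + nrm F (\<Phi> ?z)" if x: "x \<in> tuples n E" "\<And>i. i < n \<Longrightarrow> nrm E (x i) < r i" for x
  proof -
    have "x \<in> Pi\<^sub>E {..<n} U" using x r(2) by (auto simp: tuples_def PiE_iff)
    then have "nrm F (\<Phi> x - \<Phi> ?z) < 1" using U(3) by auto
    then show ?thesis
      using F.nrm_add[OF F.diff_mem, of "\<Phi> x" "\<Phi> ?z" "\<Phi> ?z"] multilinear_mem[OF \<Phi> z] multilinear_mem[OF \<Phi> x(1)] by simp
  qed
  have "multilinear_bound n E F \<Phi> ((1 + nrm F (\<Phi> ?z)) / P)"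
  proof (rule multilinear_boundI[OF E F \<Phi>])
    fix x assume x: "x \<in> tuples n E" "\<And>i. i < n \<Longrightarrow> nrm E (x i) \<le> 1"
    let ?y = "\<lambda>i\<in>{..<n}. smul E (of_real (r i / 2)) (x i)"
    have "nrm F (\<Phi> ?y) \<le> 1 + nrm F (\<Phi> ?z)"
    proof (rule near)
      show "?y \<in> tuples n E" using x by (intro tuplesI E.smul_mem tuples_mem[OF x(1)])
      show "nrm E (?y i) < r i" if "i < n" for i
      proof -
        have "nrm E (?y i) = (r i / 2) * nrm E (x i)"
          using that r(1)[OF that] by (simp add: E.nrm_smul tuples_mem[OF x(1) that])
        also have "\<dots> \<le> (r i / 2) * 1"
          using that r(1)[OF that] x(2)[OF that] by (intro mult_left_mono) auto
        also have "\<dots> < r i" using r(1)[OF that] by simp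
        finally show ?thesis .
      qed
    qed
    moreover have "nrm F (\<Phi> ?y) = P * nrm F (\<Phi> x)"
      unfolding multilinear_scale[OF E F \<Phi> x(1)] F.nrm_smul[OF multilinear_mem[OF \<Phi> x(1)]]
        of_real_prod[symmetric] norm_of_real P_def[symmetric] using P by simp
    ultimately show "nrm F (\<Phi> x) \<le> (1 + nrm F (\<Phi> ?z)) / P"
      using P by (simp add: field_simps)
  qed
  moreover have "(1 + nrm F (\<Phi> ?z)) / P \<ge> 0"
    using P F.nrm_nonneg[OF multilinear_mem[OF \<Phi> z]] by simp
  ultimately show ?thesis by blast
qed

text \<open>The tuple a is turned into x one slot at a time; each exchange costs a factor d and n -
  1 factors of size at most R. Because R \<ge> 1, the exponent may be raised from n - 1 to
  n.\<close>

lemma multilinear_diff_le: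
  fixes E :: "('k::real_or_complex, 'v::ab_group_add) nspace"
  assumes E: "normed_space E" and F: "normed_space F" and \<Phi>: "multilinear n E F \<Phi>"
    and C: "multilinear_bound n E F \<Phi> C" "C \<ge> 0"
    and x: "x \<in> tuples n E" and a: "a \<in> tuples n E"
    and R: "\<And>i. i < n \<Longrightarrow> nrm E (x i) \<le> R" "\<And>i. i < n \<Longrightarrow> nrm E (a i) \<le> R" "R \<ge> 1"
    and d: "\<And>i. i < n \<Longrightarrow> nrm E (x i - a i) \<le> d"
  shows "nrm F (\<Phi> x - \<Phi> a) \<le> n * (C * (d * R ^ n))"
proof -
  interpret E: normed_space E by (rule E)
  interpret F: normed_space F by (rule F)
  let ?z = "\<lambda>k. \<lambda>i\<in>{..<n}. if i < k then x i else a i"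
  have zt: "?z k \<in> tuples n E" for k using tuples_mem[OF x] tuples_mem[OF a] by (intro tuplesI) auto
  have step: "nrm F (\<Phi> (?z (Suc k)) - \<Phi> (?z k)) \<le> C * (d * R ^ n)" if k: "k < n" for k
  proof -
    have 1: "?z (Suc k) = (?z k)(k := x k)" "?z k = (?z k)(k := a k)"
      using k by (auto simp: fun_eq_iff)
    have xa: "x k \<in> vecs E" "a k \<in> vecs E" using tuples_mem[OF x k] tuples_mem[OF a k] .
    have "\<Phi> ((?z k)(k := x k - a k)) = \<Phi> ((?z k)(k := x k)) - \<Phi> ((?z k)(k := a k))"
      by (rule linear_map_diff[OF E multilinear_slot[OF \<Phi> zt k] xa])
    also have "\<dots> = \<Phi> (?z (Suc k)) - \<Phi> (?z k)" using 1 by metis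
    finally have eq: "\<Phi> (?z (Suc k)) - \<Phi> (?z k) = \<Phi> ((?z k)(k := x k - a k))" ..
    have mem: "(?z k)(k := x k - a k) \<in> tuples n E" by (intro tuples_upd zt k E.diff_mem xa)
    have d0: "0 \<le> d" using d[OF k] E.nrm_nonneg[OF E.diff_mem[OF xa]] by linarith
    have "nrm F (\<Phi> ((?z k)(k := x k - a k))) \<le> C * (\<Prod>i<n. nrm E (((?z k)(k := x k - a k)) i))"
      by (rule multilinear_boundD[OF C(1) mem])
    also have "\<dots> \<le> C * (\<Prod>i<n. if i = k then d else R)"
      using d R C(2) by (intro mult_left_mono prod_mono conjI E.nrm_nonneg tuples_mem[OF mem]) auto
    also have "(\<Prod>i<n. if i = k then d else R) = d * R ^ (n - 1)"
      using k by (subst prod.remove[of _ k]) (auto simp: prod_constant)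
    also have "C * (d * R ^ (n - 1)) \<le> C * (d * R ^ n)"
      using C(2) d0 R(3) by (intro mult_left_mono power_increasing) auto
    finally show ?thesis unfolding eq .
  qed
  have "nrm F (\<Phi> (?z k) - \<Phi> (?z 0)) \<le> k * (C * (d * R ^ n))" if "k \<le> n" for k
    using that
  proof (induction k)
    case (Suc k)
    have "nrm F (\<Phi> (?z (Suc k)) - \<Phi> (?z 0)) = nrm F ((\<Phi> (?z (Suc k)) - \<Phi> (?z k)) + (\<Phi> (?z k) - \<Phi> (?z 0)))"
      by simp
    also have "\<dots> \<le> nrm F (\<Phi> (?z (Suc k)) - \<Phi> (?z k)) + nrm F (\<Phi> (?z k) - \<Phi> (?z 0))"
      by (intro F.nrm_add F.diff_mem multilinear_mem[OF \<Phi>] zt)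
    also have "\<dots> \<le> C * (d * R ^ n) + k * (C * (d * R ^ n))"
      by (intro add_mono step Suc.IH) (use Suc.prems in auto)
    finally show ?case by (simp only: of_nat_Suc distrib_right mult_1_left add.commute)
  qed (simp)
  moreover have "?z n = x" "?z 0 = a"
    by (rule tuples_eqI[OF zt x], simp) (rule tuples_eqI[OF zt a], simp)
  ultimately show ?thesis by (metis order_refl)
qed

lemma bounded_multilinear_continuous:
  fixes E :: "('k::real_or_complex, 'v::ab_group_add) nspace"
  assumes E: "normed_space E" and F: "normed_space F" and \<Phi>: "multilinear n E F \<Phi>"
    and C: "multilinear_bound n E F \<Phi> C"
  shows "continuous_map (product_topology (\<lambda>_. norm_topology E) {..<n}) (norm_topology F) \<Phi>"
proof -
  interpret E: normed_space E by (rule E)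
  interpret F: normed_space F by (rule F)
  note C' = multilinear_bound_mono[OF E C, of "max C 0"]
  have "\<exists>U. openin (product_topology (\<lambda>_. norm_topology E) {..<n}) U \<and> a \<in> U \<and>
      (\<forall>y\<in>U. \<Phi> y \<in> Metric_space.mball (vecs F) (ndist F) (\<Phi> a) \<epsilon>)"
    if a: "a \<in> tuples n E" and \<epsilon>: "\<epsilon> > 0" for a \<epsilon>
  proof -
    \<comment> \<open>R bounds the entries of a with room for a perturbation of size at most 1, and
      it is at least 1 as \<open>multilinear_diff_le\<close> requires.\<close>
    define R where "R = 2 + (\<Sum>i<n. nrm E (a i))"
    have aR: "nrm E (a i) \<le> R - 2" if "i < n" for i
      unfolding R_def using member_le_sum[of i "{..<n}" "\<lambda>i. nrm E (a i)"] that E.nrm_nonneg[OF tuples_mem[OF a]] by auto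
    have R: "R \<ge> 2" unfolding R_def using E.nrm_nonneg[OF tuples_mem[OF a]] by (auto intro: sum_nonneg)
    define K where "K = n * (max C 0 * R ^ n) + 1"
    have K: "K \<ge> 1" unfolding K_def using R by auto
    define d where "d = min 1 (\<epsilon> / (2 * K))"
    have d: "d > 0" "d \<le> 1" "d * K < \<epsilon>" using \<epsilon> K by (auto simp: d_def min_def field_simps)
    let ?U = "Pi\<^sub>E {..<n} (\<lambda>i. {x \<in> vecs E. nrm E (x - a i) < d})"
    have "openin (product_topology (\<lambda>_. norm_topology E) {..<n}) ?U"
      unfolding openin_PiE[OF finite_lessThan] using openin_ball[OF E tuples_mem[OF a]] by auto
    moreover have "a \<in> ?U" using a d(1) by (auto simp: PiE_iff tuples_def)
    moreover have "\<Phi> y \<in> Metric_space.mball (vecs F) (ndist F) (\<Phi> a) \<epsilon>" if y: "y \<in> ?U" for y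
    proof -
      have yt: "y \<in> tuples n E" and yd: "\<And>i. i < n \<Longrightarrow> nrm E (y i - a i) < d"
        using y by (auto simp: PiE_iff tuples_def)
      have yR: "nrm E (y i) \<le> R" if "i < n" for i
        using E.nrm_add[OF E.diff_mem, of "y i" "a i" "a i"] tuples_mem[OF yt that] tuples_mem[OF a that] yd[OF that] aR[OF that] d(2)
        by simp
      have "nrm F (\<Phi> y - \<Phi> a) \<le> n * (max C 0 * (d * R ^ n))"
        using yR aR R yd by (intro multilinear_diff_le[OF E F \<Phi> C' _ yt a]) (auto intro: less_imp_le order.trans[OF aR])
      also have "\<dots> \<le> d * K" using d(1) by (simp add: K_def algebra_simps)
      also have "\<dots> < \<epsilon>" by (rule d(3))
      finally show ?thesis
        using multilinear_mem[OF \<Phi> yt] multilinear_mem[OF \<Phi> a]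
        by (simp add: Metric_space.in_mball[OF F.Metric_space] ndist_def F.nrm_diff_commute)
    qed
    ultimately show ?thesis by blast
  qed
  then show ?thesis
    unfolding norm_topology_def[of F] Metric_space.continuous_map_to_metric[OF F.Metric_space]
    by (simp only: topspace_tuples[OF E] ball_simps) blast
qed

lemma multilinear_maps_iff:
  fixes E :: "('k::real_or_complex, 'v::ab_group_add) nspace"
  assumes E: "normed_space E" and F: "normed_space F"
  shows "\<Phi> \<in> multilinear_maps n E F \<longleftrightarrow>
    multilinear n E F \<Phi> \<and> (\<exists>C\<ge>0. multilinear_bound n E F \<Phi> C) \<and> (\<forall>x. x \<notin> tuples n E \<longrightarrow> \<Phi> x = 0)"
  unfolding multilinear_maps_def mem_Collect_eq multilinear_def[symmetric]
  using continuous_multilinear_bounded[OF E F] bounded_multilinear_continuous[OF E F] by blast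

section \<open>Polynomials\<close>

lemma linear_map_cong:
  assumes "normed_space E" "\<And>x. x \<in> vecs E \<Longrightarrow> T x = S x"
  shows "linear_map E F T \<longleftrightarrow> linear_map E F S"
  using assms normed_space.add_mem[OF assms(1)] normed_space.smul_mem[OF assms(1)]
  by (simp add: linear_map_def cong: ball_cong)

lemma linear_map_plus:
  assumes "normed_space F" "linear_map E F T" "linear_map E F S"
  shows "linear_map E F (\<lambda>x. T x + S x)"
  using assms unfolding linear_map_def
  by (auto simp: normed_space.add_mem normed_space.smul_add algebra_simps)

lemma linear_map_scaled:
  assumes "normed_space F" "linear_map E F T"
  shows "linear_map E F (\<lambda>x. smul F c (T x))"
  using assms unfolding linear_map_def
  by (auto simp: normed_space.smul_mem normed_space.smul_add normed_space.smul_smul mult.commute)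

lemma linear_map_zero_fun:
  assumes "normed_space F" shows "linear_map E F (\<lambda>x. 0)"
  using normed_space.zero_mem[OF assms] by (simp add: linear_map_def normed_space.smul_zero_right[OF assms])

lemma linear_map_finite_sum:
  assumes F: "normed_space F"
  shows "(\<And>i. i \<in> I \<Longrightarrow> linear_map E F (T i)) \<Longrightarrow> linear_map E F (\<lambda>x. \<Sum>i\<in>I. T i x)"
  by (induction I rule: infinite_finite_induct) (auto intro: linear_map_plus[OF F] linear_map_zero_fun[OF F])

lemma multilinear_cong:
  assumes "normed_space E" "\<And>x. x \<in> tuples n E \<Longrightarrow> \<Phi> x = \<Psi> x" "multilinear n E F \<Phi>"
  shows "multilinear n E F \<Psi>"
  unfolding multilinear_def
proof (intro ballI conjI allI impI)
  fix x assume x: "x \<in> tuples n E"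
  show "\<Psi> x \<in> vecs F" using multilinear_mem[OF assms(3) x] assms(2)[OF x] by simp
  fix i assume i: "i < n"
  show "linear_map E F (\<lambda>y. \<Psi> (x(i := y)))"
    by (subst linear_map_cong[OF assms(1), of _ "\<lambda>y. \<Phi> (x(i := y))"])
      (auto simp: assms(2) tuples_upd[OF x i] multilinear_slot[OF assms(3) x i])
qed

lemma multilinear_plus:
  assumes "normed_space F" "multilinear n E F \<Phi>" "multilinear n E F \<Psi>"
  shows "multilinear n E F (\<lambda>x. \<Phi> x + \<Psi> x)"
  using assms unfolding multilinear_def by (auto intro: linear_map_plus normed_space.add_mem)

lemma multilinear_scaled:
  assumes "normed_space F" "multilinear n E F \<Phi>"
  shows "multilinear n E F (\<lambda>x. smul F c (\<Phi> x))"
  using assms unfolding multilinear_def by (auto intro: linear_map_scaled normed_space.smul_mem)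

lemma multilinear_finite_sum:
  assumes "normed_space F" "\<And>j. j \<in> I \<Longrightarrow> multilinear n E F (\<Phi> j)"
  shows "multilinear n E F (\<lambda>x. \<Sum>j\<in>I. \<Phi> j x)"
  using assms unfolding multilinear_def by (auto intro: linear_map_finite_sum normed_space.sum_mem)

lemma multilinear_apply:
  assumes "multilinear n E (dual Y) \<Phi>"
  shows "multilinear n E scalars (\<lambda>x. \<Phi> x y)"
  using assms unfolding multilinear_def linear_map_def by (auto simp: fun_eq_iff)

section \<open>Symmetrization and polarization\<close>

lemma comp_permutation_tuple:
  assumes \<pi>: "\<pi> permutes {..<n}" and x: "x \<in> tuples n E"
  shows "x \<circ> \<pi> \<in> tuples n E"
proof -
  have "\<pi> i < n \<longleftrightarrow> i < n" for i using permutes_in_image[OF \<pi>, of i] by simp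
  then show ?thesis using x by (auto simp: tuples_def PiE_iff extensional_def)
qed

lemma multilinear_permute:
  assumes E: "normed_space E" and \<Phi>: "multilinear n E F \<Phi>" and \<pi>: "\<pi> permutes {..<n}"
  shows "multilinear n E F (\<lambda>x. \<Phi> (x \<circ> \<pi>))"
  unfolding multilinear_def
proof (intro ballI conjI allI impI)
  fix x assume x: "x \<in> tuples n E"
  show "\<Phi> (x \<circ> \<pi>) \<in> vecs F" by (rule multilinear_mem[OF \<Phi> comp_permutation_tuple[OF \<pi> x]])
  fix i assume i: "i < n"
  have "inv \<pi> i < n" using permutes_in_image[OF permutes_inv[OF \<pi>], of i] i by simp
  moreover have "(x(i := y)) \<circ> \<pi> = (x \<circ> \<pi>)(inv \<pi> i := y)" for y
    using permutes_inverses[OF \<pi>] by (auto simp: fun_eq_iff)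
  ultimately show "linear_map E F (\<lambda>y. \<Phi> ((x(i := y)) \<circ> \<pi>))"
    using multilinear_slot[OF \<Phi> comp_permutation_tuple[OF \<pi> x]] by simp
qed

lemma diag_comp_permutation:
  assumes "\<pi> permutes {..<n}" shows "diag n x \<circ> \<pi> = diag n x"
proof -
  have "\<pi> i < n \<longleftrightarrow> i < n" for i using permutes_in_image[OF assms, of i] by simp
  then show ?thesis by (auto simp: diag_def fun_eq_iff restrict_def)
qed

definition symmetrize ::
    "nat \<Rightarrow> ('k::real_or_complex, 'v::ab_group_add) nspace \<Rightarrow> ('k, 'w::ab_group_add) nspace \<Rightarrow> ((nat \<Rightarrow> 'v) \<Rightarrow> 'w) \<Rightarrow> (nat \<Rightarrow> 'v) \<Rightarrow> 'w" where
  "symmetrize n E F \<Phi> x =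
     (if x \<in> tuples n E then smul F (1 / fact n) (\<Sum>\<pi> | \<pi> permutes {..<n}. \<Phi> (x \<circ> \<pi>)) else 0)"

lemma symmetrize:
  fixes E :: "('k::real_or_complex, 'v::ab_group_add) nspace"
  assumes E: "normed_space E" and F: "normed_space F" and \<Phi>: "\<Phi> \<in> multilinear_maps n E F"
  shows symmetrize_multilinear: "symmetrize n E F \<Phi> \<in> multilinear_maps n E F"
    and symmetric_symmetrize: "symmetric n E (symmetrize n E F \<Phi>)"
    and symmetrize_diag: "x \<in> vecs E \<Longrightarrow> symmetrize n E F \<Phi> (diag n x) = \<Phi> (diag n x)"
proof -
  interpret E: normed_space E by (rule E)
  interpret F: normed_space F by (rule F)
  obtain C where ml: "multilinear n E F \<Phi>" and C: "multilinear_bound n E F \<Phi> C" "C \<ge> 0"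
    using \<Phi> unfolding multilinear_maps_iff[OF E F] by blast
  let ?S = "{\<pi>. \<pi> permutes {..<n}}"
  have mem: "\<Phi> (x \<circ> \<pi>) \<in> vecs F" if "x \<in> tuples n E" "\<pi> \<in> ?S" for x \<pi>
    using that by (auto intro: multilinear_mem[OF ml] comp_permutation_tuple)
  have "multilinear n E F (\<lambda>x. smul F (1 / fact n) (\<Sum>\<pi>\<in>?S. \<Phi> (x \<circ> \<pi>)))"
    by (intro multilinear_scaled[OF F] multilinear_finite_sum[OF F] multilinear_permute[OF E ml]) simp
  then have 1: "multilinear n E F (symmetrize n E F \<Phi>)"
    by (rule multilinear_cong[OF E, rotated]) (simp add: symmetrize_def)
  have "multilinear_bound n E F (symmetrize n E F \<Phi>) (norm (1 / fact n :: 'k) * (card ?S * C))"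
    unfolding multilinear_bound_def
  proof
    fix x assume x: "x \<in> tuples n E"
    have "nrm F (\<Phi> (x \<circ> \<pi>)) \<le> C * (\<Prod>i<n. nrm E (x i))" if "\<pi> \<in> ?S" for \<pi>
      using multilinear_boundD[OF C(1) comp_permutation_tuple[of \<pi> n x E]] that x
        prod.permute[of \<pi> "{..<n}" "\<lambda>i. nrm E (x i)"] by (simp add: o_def)
    then have "(\<Sum>\<pi>\<in>?S. nrm F (\<Phi> (x \<circ> \<pi>))) \<le> card ?S * (C * (\<Prod>i<n. nrm E (x i)))"
      by (rule sum_bounded_above)
    then have "nrm F (\<Sum>\<pi>\<in>?S. \<Phi> (x \<circ> \<pi>)) \<le> card ?S * (C * (\<Prod>i<n. nrm E (x i)))"
      using F.nrm_sum[of ?S "\<lambda>\<pi>. \<Phi> (x \<circ> \<pi>)"] mem[OF x] by fastforce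
    then have "norm (1 / fact n :: 'k) * nrm F (\<Sum>\<pi>\<in>?S. \<Phi> (x \<circ> \<pi>)) \<le>
        norm (1 / fact n :: 'k) * (card ?S * (C * (\<Prod>i<n. nrm E (x i))))"
      by (rule mult_left_mono) simp
    moreover have "nrm F (symmetrize n E F \<Phi> x) = norm (1 / fact n :: 'k) * nrm F (\<Sum>\<pi>\<in>?S. \<Phi> (x \<circ> \<pi>))"
      using x mem by (simp only: symmetrize_def if_True) (intro F.nrm_smul F.sum_mem)
    ultimately show "nrm F (symmetrize n E F \<Phi> x) \<le> norm (1 / fact n :: 'k) * (card ?S * C) * (\<Prod>i<n. nrm E (x i))"
      by (simp only: mult.assoc)
  qed
  moreover have "norm (1 / fact n :: 'k) * (card ?S * C) \<ge> 0" using C(2) by simp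
  ultimately show "symmetrize n E F \<Phi> \<in> multilinear_maps n E F"
    unfolding multilinear_maps_iff[OF E F] using 1 by (auto simp: symmetrize_def)
  show "symmetric n E (symmetrize n E F \<Phi>)"
    unfolding symmetric_def
  proof (intro allI impI ballI)
    fix \<sigma> x assume \<sigma>: "\<sigma> permutes {..<n}" and x: "x \<in> tuples n E"
    have "(\<Sum>\<pi>\<in>?S. \<Phi> ((x \<circ> \<sigma>) \<circ> \<pi>)) = (\<Sum>\<pi>\<in>?S. \<Phi> (x \<circ> \<pi>))"
      using setum_permutations_compose_left[OF \<sigma>, of "\<lambda>\<pi>. \<Phi> (x \<circ> \<pi>)"] by (simp add: comp_assoc)
    then show "symmetrize n E F \<Phi> (x \<circ> \<sigma>) = symmetrize n E F \<Phi> x"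
      using x comp_permutation_tuple[OF \<sigma> x] by (simp add: symmetrize_def)
  qed
  fix x assume x: "x \<in> vecs E"
  have \<Phi>x: "\<Phi> (diag n x) \<in> vecs F" by (rule multilinear_mem[OF ml diag_tuple[OF x]])
  have rep: "(\<Sum>i\<in>I. \<Phi> (diag n x)) = smul F (of_nat (card I)) (\<Phi> (diag n x))" if "finite I" for I :: "(nat \<Rightarrow> nat) set"
    using that by (induction I) (auto simp: F.add_smul[OF \<Phi>x] F.one_smul[OF \<Phi>x] F.smul_zero_left[OF \<Phi>x])
  have "(\<Sum>\<pi>\<in>?S. \<Phi> (diag n x \<circ> \<pi>)) = (\<Sum>\<pi>\<in>?S. \<Phi> (diag n x))"
    by (intro sum.cong refl) (simp add: diag_comp_permutation)
  also have "\<dots> = smul F (of_nat (card ?S)) (\<Phi> (diag n x))"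
    by (intro rep finite_permutations) simp
  also have "card ?S = fact n" by (intro card_permutations) simp_all
  finally show "symmetrize n E F \<Phi> (diag n x) = \<Phi> (diag n x)"
    unfolding symmetrize_def using diag_tuple[OF x, of n] \<Phi>x
    by (simp only: if_True F.smul_smul) (simp add: F.one_smul)
qed

text \<open>On a finite set the surjective self-maps are the injective ones. They index the terms
  that survive in \<open>polarization\<close>.\<close>

lemma card_surjective_self_maps:
  "card {f \<in> {..<n} \<rightarrow>\<^sub>E {..<n}. {..<n} \<subseteq> f ` {..<n}} = fact n"
proof -
  have "{f \<in> {..<n} \<rightarrow>\<^sub>E {..<n}. {..<n} \<subseteq> f ` {..<n}} = {f \<in> {..<n} \<rightarrow>\<^sub>E {..<n}. inj_on f {..<n}}" (is "?L = ?R")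
  proof (intro Collect_cong conj_cong refl)
    fix f assume "f \<in> {..<n} \<rightarrow>\<^sub>E {..<n}"
    then have "f ` {..<n} \<subseteq> {..<n}" by auto
    then show "{..<n} \<subseteq> f ` {..<n} \<longleftrightarrow> inj_on f {..<n}"
      using inj_on_iff_surj endo_inj_surj[of "{..<n}" f] finite_surj_inj[of "{..<n}" f] by auto
  qed
  then show ?thesis
    by (simp add: card_inj_on_subset_funcset fact_prod_rev)
qed

text \<open>Expanding a at the sum over S gives one term for each map f into S. In the signed sum
  the term of f is weighted by the sum of (-1)^(n - |S|) over all S that contain the image of f,
  which vanishes unless f is onto. The maps that are onto are permutations, and by symmetry each of
  them contributes a x.\<close>

lemma polarization:
  fixes E :: "('k::real_or_complex, 'v::ab_group_add) nspace"
  assumes E: "normed_space E" and a: "multilinear n E scalars a" and sym: "symmetric n E a" and x: "x \<in> tuples n E"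
  shows "fact n * a x = (\<Sum>S\<in>Pow {..<n}. (- 1) ^ (n - card S) * a (diag n (\<Sum>i\<in>S. x i)))"
proof -
  let ?A = "{..<n}"
  let ?F = "?A \<rightarrow>\<^sub>E ?A"
  let ?a = "\<lambda>f. a (\<lambda>i\<in>?A. x (f i))"
  have fin: "finite ?F" by (intro finite_PiE) auto
  have expand: "a (diag n (\<Sum>i\<in>S. x i)) = (\<Sum>f\<in>?F. (if f ` ?A \<subseteq> S then 1 else 0) * ?a f)" if S: "S \<in> Pow ?A" for S
  proof -
    have "finite S" using S finite_subset by blast
    then have "a (diag n (\<Sum>i\<in>S. x i)) = (\<Sum>f\<in>?A \<rightarrow>\<^sub>E S. ?a f)"
      unfolding diag_def using S by (intro multilinear_sum[OF E a] tuples_mem[OF x]) auto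
    also have "?A \<rightarrow>\<^sub>E S = {f \<in> ?F. f ` ?A \<subseteq> S}" using S by (auto simp: PiE_def Pi_iff)
    also have "(\<Sum>f\<in>{f \<in> ?F. f ` ?A \<subseteq> S}. ?a f) = (\<Sum>f\<in>?F. if f ` ?A \<subseteq> S then ?a f else 0)"
      by (rule sum.inter_filter[OF fin])
    finally show ?thesis by (simp add: if_distrib[of "\<lambda>c. c * _"] cong: if_cong)
  qed
  \<comment> \<open>The signed sum is the expansion of a product of factors 1 -
    [i is not in the image of f]; a point that f misses makes its factor 0.\<close>
  have signs: "(\<Sum>S\<in>Pow ?A. (- 1) ^ (n - card S) * (if f ` ?A \<subseteq> S then 1 else 0)) = (if ?A \<subseteq> f ` ?A then 1 else 0 :: 'k)"
    if f: "f \<in> ?F" for f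
  proof -
    have "(\<Sum>S\<in>Pow ?A. (- 1) ^ (n - card S) * (if f ` ?A \<subseteq> S then 1 else 0 :: 'k)) =
        (\<Sum>S\<in>Pow ?A. (- 1) ^ (card ?A - card S) * (\<Prod>i\<in>S. 1) * (\<Prod>i\<in>?A - S. if i \<notin> f ` ?A then 1 else 0))"
    proof (intro sum.cong refl)
      fix S assume S: "S \<in> Pow ?A"
      have "(\<Prod>i\<in>?A - S. if i \<notin> f ` ?A then 1 else 0) = (if f ` ?A \<subseteq> S then 1 else 0 :: 'k)"
      proof (cases "f ` ?A \<subseteq> S")
        case True
        then show ?thesis by (auto intro!: prod.neutral)
      next
        case False
        then obtain i where i: "i \<in> f ` ?A" "i \<notin> S" by blast
        moreover have "f ` ?A \<subseteq> ?A" using f by auto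
        ultimately show ?thesis using False by (subst prod_zero) auto
      qed
      then show "(- 1) ^ (n - card S) * (if f ` ?A \<subseteq> S then 1 else 0 :: 'k) =
          (- 1) ^ (card ?A - card S) * (\<Prod>i\<in>S. 1) * (\<Prod>i\<in>?A - S. if i \<notin> f ` ?A then 1 else 0)"
        by (simp only: card_lessThan prod.neutral_const mult_1_right)
    qed
    also have "\<dots> = (\<Prod>i\<in>?A. 1 - (if i \<notin> f ` ?A then 1 else 0 :: 'k))"
      by (rule prod_diff_conv_sum'[symmetric]) simp
    also have "\<dots> = (if ?A \<subseteq> f ` ?A then 1 else 0)"
    proof (cases "?A \<subseteq> f ` ?A")
      case True
      have "(\<Prod>i\<in>?A. 1 - (if i \<notin> f ` ?A then 1 else 0 :: 'k)) = 1"
        using True by (intro prod.neutral) (auto simp: subset_iff)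
      then show ?thesis using True by (simp only: if_True)
    next
      case False
      then obtain i where "i \<in> ?A" "i \<notin> f ` ?A" by blast
      then have "(\<Prod>i\<in>?A. 1 - (if i \<notin> f ` ?A then 1 else 0 :: 'k)) = 0"
        by (intro prod_zero) auto
      then show ?thesis using False by (simp only: if_False)
    qed
    finally show ?thesis .
  qed
  have surj: "?a f = a x" if f: "f \<in> ?F" "?A \<subseteq> f ` ?A" for f
  proof -
    \<comment> \<open>f is continued by the identity, as \<open>permutes\<close> demands.\<close>
    let ?p = "\<lambda>i. if i < n then f i else i"
    have "f ` ?A = ?A" using f by auto
    then have "bij_betw f ?A ?A" using finite_surj_inj[of ?A f] by (auto simp: bij_betw_def)
    then have "bij_betw ?p ?A ?A" by (subst bij_betw_cong[of _ _ f]) auto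
    then have p: "?p permutes ?A" by (rule bij_imp_permutes) auto
    have "(\<lambda>i\<in>?A. x (f i)) = x \<circ> ?p"
      using f(1) by (intro tuples_eqI[OF tuplesI comp_permutation_tuple[OF p x]] tuples_mem[OF x]) auto
    then show ?thesis using sym p x unfolding symmetric_def by metis
  qed
  have "(\<Sum>S\<in>Pow ?A. (- 1) ^ (n - card S) * a (diag n (\<Sum>i\<in>S. x i))) =
      (\<Sum>S\<in>Pow ?A. \<Sum>f\<in>?F. (- 1) ^ (n - card S) * (if f ` ?A \<subseteq> S then 1 else 0) * ?a f)"
    by (intro sum.cong refl) (simp only: expand sum_distrib_left mult.assoc)
  also have "\<dots> = (\<Sum>f\<in>?F. \<Sum>S\<in>Pow ?A. (- 1) ^ (n - card S) * (if f ` ?A \<subseteq> S then 1 else 0) * ?a f)"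
    by (rule sum.swap)
  also have "\<dots> = (\<Sum>f\<in>?F. if ?A \<subseteq> f ` ?A then a x else 0)"
    by (intro sum.cong refl) (simp only: sum_distrib_right[symmetric] signs, use surj in auto)
  also have "\<dots> = (\<Sum>f\<in>{f \<in> ?F. ?A \<subseteq> f ` ?A}. a x)"
    by (rule sum.inter_filter[OF fin, symmetric])
  also have "\<dots> = of_nat (fact n) * a x" by (simp only: sum_constant card_surjective_self_maps)
  finally show ?thesis by simp
qed

text \<open>The range is a dual space, so that scalar-valued polarization can be applied to the
  values at each y separately.\<close>

lemma symmetric_unique:
  fixes E :: "('k::real_or_complex, 'v::ab_group_add) nspace"
  assumes E: "normed_space E" and Y: "normed_space Y"
    and \<Phi>: "\<Phi> \<in> multilinear_maps n E (dual Y)" "symmetric n E \<Phi>"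
    and \<Psi>: "\<Psi> \<in> multilinear_maps n E (dual Y)" "symmetric n E \<Psi>"
    and eq: "\<And>x. x \<in> vecs E \<Longrightarrow> \<Phi> (diag n x) = \<Psi> (diag n x)"
  shows "\<Phi> = \<Psi>"
proof
  fix x
  note iff = multilinear_maps_iff[OF E normed_space.normed_space_dual[OF Y]]
  show "\<Phi> x = \<Psi> x"
  proof (cases "x \<in> tuples n E")
    case x: True
    show ?thesis
    proof
      fix y
      have sum_mem: "(\<Sum>i\<in>S. x i) \<in> vecs E" if "S \<in> Pow {..<n}" for S
        using that by (intro normed_space.sum_mem[OF E] tuples_mem[OF x]) auto
      have "fact n * \<Phi> x y = (\<Sum>S\<in>Pow {..<n}. (- 1) ^ (n - card S) * \<Phi> (diag n (\<Sum>i\<in>S. x i)) y)"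
        using \<Phi> unfolding iff by (intro polarization[OF E _ _ x] multilinear_apply) (auto simp: symmetric_def)
      also have "\<dots> = (\<Sum>S\<in>Pow {..<n}. (- 1) ^ (n - card S) * \<Psi> (diag n (\<Sum>i\<in>S. x i)) y)"
        by (intro sum.cong refl) (simp add: eq[OF sum_mem])
      also have "\<dots> = fact n * \<Psi> x y"
        using \<Psi> unfolding iff by (intro polarization[OF E _ _ x, symmetric] multilinear_apply) (auto simp: symmetric_def)
      finally show "\<Phi> x y = \<Psi> x y" by simp
    qed
  qed (use \<Phi> \<Psi> iff in auto)
qed

lemma polynomials_sel [simp]: "smul (polynomials n E F) c P = (\<lambda>x. smul F c (P x))" "nrm (polynomials n E F) = sup_norm E F"
  by (simp_all add: polynomials_def)

lemma mem_polynomials: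
  "P \<in> vecs (polynomials n E F) \<longleftrightarrow> (\<exists>\<Phi>\<in>multilinear_maps n E F. \<forall>x\<in>vecs E. P x = \<Phi> (diag n x)) \<and> (\<forall>x. x \<notin> vecs E \<longrightarrow> P x = 0)"
  by (simp add: polynomials_def)

text \<open>Existence comes from symmetrization and uniqueness from polarization, so the definite
  description denotes what it should.\<close>

lemma associated_symmetric:
  fixes E :: "('k::real_or_complex, 'v::ab_group_add) nspace"
  assumes E: "normed_space E" and Y: "normed_space Y" and P: "P \<in> vecs (polynomials n E (dual Y))"
  shows associated_symmetric_multilinear: "associated_symmetric n E (dual Y) P \<in> multilinear_maps n E (dual Y)"
    and symmetric_associated_symmetric: "symmetric n E (associated_symmetric n E (dual Y) P)"
    and associated_symmetric_diag: "x \<in> vecs E \<Longrightarrow> associated_symmetric n E (dual Y) P (diag n x) = P x"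
proof -
  let ?Q = "\<lambda>\<Phi>. \<Phi> \<in> multilinear_maps n E (dual Y) \<and> symmetric n E \<Phi> \<and> (\<forall>x\<in>vecs E. P x = \<Phi> (diag n x))"
  obtain \<Phi> where \<Phi>: "\<Phi> \<in> multilinear_maps n E (dual Y)" "\<forall>x\<in>vecs E. P x = \<Phi> (diag n x)"
    using P by (auto simp: mem_polynomials)
  have "?Q (symmetrize n E (dual Y) \<Phi>)"
    using symmetrize[OF E normed_space.normed_space_dual[OF Y] \<Phi>(1)] \<Phi>(2) by auto
  moreover have "\<And>\<Psi>. ?Q \<Psi> \<Longrightarrow> \<Psi> = symmetrize n E (dual Y) \<Phi>"
    using calculation by (intro symmetric_unique[OF E Y]) auto
  ultimately have "?Q (associated_symmetric n E (dual Y) P)"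
    unfolding associated_symmetric_def by (rule theI)
  then show "associated_symmetric n E (dual Y) P \<in> multilinear_maps n E (dual Y)"
    "symmetric n E (associated_symmetric n E (dual Y) P)"
    "x \<in> vecs E \<Longrightarrow> associated_symmetric n E (dual Y) P (diag n x) = P x"
    by auto
qed

lemma diag_smul: "(\<lambda>i\<in>{..<n}. smul E c (diag n x i)) = diag n (smul E c x)"
  by (auto simp: diag_def)

lemma prod_diag: "(\<Prod>i<n. f (diag n x i)) = f x ^ n"
  by (simp add: diag_def)

section \<open>Norm estimates and the normed space of polynomials\<close>

context
  fixes E :: "('k::real_or_complex, 'v::ab_group_add) nspace" and F :: "('k, 'w::ab_group_add) nspace"
  assumes E: "normed_space E" and F: "normed_space F"
begin

interpretation E: normed_space E by (rule E)
interpretation F: normed_space F by (rule F)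

lemma polynomialE:
  assumes "P \<in> vecs (polynomials n E F)"
  obtains \<Phi> C where "multilinear n E F \<Phi>" "\<And>x. x \<in> vecs E \<Longrightarrow> P x = \<Phi> (diag n x)"
    "\<And>x. x \<notin> tuples n E \<Longrightarrow> \<Phi> x = 0" "multilinear_bound n E F \<Phi> C" "C \<ge> 0"
  using assms unfolding mem_polynomials Bex_def multilinear_maps_iff[OF E F] by blast

lemma polynomial_outside: "P \<in> vecs (polynomials n E F) \<Longrightarrow> x \<notin> vecs E \<Longrightarrow> P x = 0"
  by (simp add: mem_polynomials)

lemma polynomial_mem:
  assumes "P \<in> vecs (polynomials n E F)" shows "P x \<in> vecs F"
proof (cases "x \<in> vecs E")
  case True
  then show ?thesis
    using polynomialE[OF assms] multilinear_mem diag_tuple[OF True, of n] by metis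
qed (use assms F.zero_mem in \<open>auto simp: mem_polynomials\<close>)

lemma polynomial_smul:
  assumes "P \<in> vecs (polynomials n E F)" and x: "x \<in> vecs E"
  shows "P (smul E c x) = smul F (c ^ n) (P x)"
proof -
  obtain \<Phi> where \<Phi>: "multilinear n E F \<Phi>" "\<And>x. x \<in> vecs E \<Longrightarrow> P x = \<Phi> (diag n x)"
    using polynomialE[OF assms(1)] by metis
  show ?thesis
    using multilinear_scale[OF E F \<Phi>(1) diag_tuple[OF x], of "\<lambda>_. c"] x
    by (simp add: \<Phi>(2) E.smul_mem diag_smul)
qed

lemma polynomial_ball_le:
  assumes "P \<in> vecs (polynomials n E F)" and x: "x \<in> vecs E" "nrm E x \<le> 1"
  shows "nrm F (P x) \<le> sup_norm E F P"
proof -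
  obtain \<Phi> C where \<Phi>: "\<And>x. x \<in> vecs E \<Longrightarrow> P x = \<Phi> (diag n x)" and C: "multilinear_bound n E F \<Phi> C" "C \<ge> 0"
    using polynomialE[OF assms(1)] by metis
  have bd: "nrm F (P x) \<le> C" if x: "x \<in> unit_ball E" for x
  proof -
    have xE: "x \<in> vecs E" "nrm E x \<le> 1" using x by (auto simp: unit_ball_def)
    have "nrm F (P x) \<le> C * nrm E x ^ n"
      using multilinear_boundD[OF C(1) diag_tuple[OF xE(1)]] by (simp add: \<Phi>[OF xE(1)] prod_diag)
    also have "\<dots> \<le> C * 1"
      using xE C(2) E.nrm_nonneg by (intro mult_left_mono power_le_one) auto
    finally show ?thesis by simp
  qed
  show ?thesis by (rule le_sup_norm[OF bd]) (simp_all add: unit_ball_def x)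
qed

lemma polynomial_norm_le:
  assumes P: "P \<in> vecs (polynomials n E F)" and x: "x \<in> vecs E"
  shows "nrm F (P x) \<le> sup_norm E F P * nrm E x ^ n"
proof -
  obtain u where u: "u \<in> vecs E" "nrm E u \<le> 1" "x = smul E (of_real (nrm E x)) u"
    using E.obtain_unit_vector[OF x] by blast
  have "nrm F (P x) = nrm E x ^ n * nrm F (P u)"
    by (subst u(3)) (simp add: polynomial_smul[OF P u(1)] F.nrm_smul[OF polynomial_mem[OF P]] norm_power E.nrm_nonneg[OF x])
  also have "\<dots> \<le> nrm E x ^ n * sup_norm E F P"
    by (intro mult_left_mono polynomial_ball_le[OF P u(1,2)] zero_le_power E.nrm_nonneg[OF x])
  finally show ?thesis by (simp add: mult.commute)
qed

lemma polynomial_sup_nonneg: "P \<in> vecs (polynomials n E F) \<Longrightarrow> 0 \<le> sup_norm E F P"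
  using F.nrm_nonneg[OF polynomial_mem, of P n 0] polynomial_ball_le[of P n 0] E.zero_mem by simp

lemma polynomial_sup_le:
  assumes "\<And>x. \<lbrakk>x \<in> vecs E; nrm E x \<le> 1\<rbrakk> \<Longrightarrow> nrm F (P x) \<le> C"
  shows "sup_norm E F P \<le> C"
  by (rule sup_norm_le[OF E.unit_ball_nonempty]) (use assms in \<open>auto simp: unit_ball_def\<close>)

lemma polynomial_plus:
  assumes "P \<in> vecs (polynomials n E F)" "Q \<in> vecs (polynomials n E F)"
  shows "P + Q \<in> vecs (polynomials n E F)"
proof -
  obtain \<Phi> C where \<Phi>: "multilinear n E F \<Phi>" "\<And>x. x \<in> vecs E \<Longrightarrow> P x = \<Phi> (diag n x)" "\<And>x. x \<notin> tuples n E \<Longrightarrow> \<Phi> x = 0"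
    and C: "multilinear_bound n E F \<Phi> C" "C \<ge> 0"
    using polynomialE[OF assms(1)] by blast
  obtain \<Psi> D where \<Psi>: "multilinear n E F \<Psi>" "\<And>x. x \<in> vecs E \<Longrightarrow> Q x = \<Psi> (diag n x)" "\<And>x. x \<notin> tuples n E \<Longrightarrow> \<Psi> x = 0"
    and D: "multilinear_bound n E F \<Psi> D" "D \<ge> 0"
    using polynomialE[OF assms(2)] by blast
  have "multilinear_bound n E F (\<lambda>x. \<Phi> x + \<Psi> x) (C + D)"
    unfolding multilinear_bound_def distrib_right
    by (intro ballI order.trans[OF F.nrm_add] add_mono multilinear_boundD[OF C(1)] multilinear_boundD[OF D(1)]
        multilinear_mem[OF \<Phi>(1)] multilinear_mem[OF \<Psi>(1)])
  moreover have "C + D \<ge> 0" using C D by simp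
  ultimately have "(\<lambda>x. \<Phi> x + \<Psi> x) \<in> multilinear_maps n E F"
    unfolding multilinear_maps_iff[OF E F] using multilinear_plus[OF F \<Phi>(1) \<Psi>(1)] \<Phi>(3) \<Psi>(3) by auto
  then show ?thesis
    unfolding mem_polynomials using \<Phi>(2) \<Psi>(2) polynomial_outside[OF assms(1)] polynomial_outside[OF assms(2)]
    by (auto intro!: bexI[of _ "\<lambda>x. \<Phi> x + \<Psi> x"])
qed

lemma polynomial_scaled:
  assumes "P \<in> vecs (polynomials n E F)"
  shows "(\<lambda>x. smul F c (P x)) \<in> vecs (polynomials n E F)"
proof -
  obtain \<Phi> C where \<Phi>: "multilinear n E F \<Phi>" "\<And>x. x \<in> vecs E \<Longrightarrow> P x = \<Phi> (diag n x)" "\<And>x. x \<notin> tuples n E \<Longrightarrow> \<Phi> x = 0"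
    and C: "multilinear_bound n E F \<Phi> C" "C \<ge> 0"
    using polynomialE[OF assms(1)] by blast
  have "multilinear_bound n E F (\<lambda>x. smul F c (\<Phi> x)) (norm c * C)"
    unfolding multilinear_bound_def mult.assoc
    by (intro ballI, subst F.nrm_smul) (auto intro: multilinear_mem[OF \<Phi>(1)] mult_left_mono multilinear_boundD[OF C(1)])
  moreover have "norm c * C \<ge> 0" using C by simp
  ultimately have "(\<lambda>x. smul F c (\<Phi> x)) \<in> multilinear_maps n E F"
    unfolding multilinear_maps_iff[OF E F] using multilinear_scaled[OF F \<Phi>(1)] \<Phi>(3) by auto
  then show ?thesis
    unfolding mem_polynomials using \<Phi>(2) polynomial_outside[OF assms(1)]
    by (auto intro!: bexI[of _ "\<lambda>x. smul F c (\<Phi> x)"])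
qed

lemma polynomial_zero: "0 \<in> vecs (polynomials n E F)"
proof -
  have "(\<lambda>x. 0) \<in> multilinear_maps n E F"
    unfolding multilinear_maps_iff[OF E F] multilinear_def multilinear_bound_def
    by (auto simp: F.zero_mem linear_map_zero_fun[OF F] intro!: exI[of _ 0])
  then show ?thesis unfolding mem_polynomials by (auto intro!: bexI[of _ "\<lambda>x. 0"])
qed

lemma normed_space_polynomials: "normed_space (polynomials n E F)"
proof
  fix P Q assume P: "P \<in> vecs (polynomials n E F)" and Q: "Q \<in> vecs (polynomials n E F)"
  show "P + Q \<in> vecs (polynomials n E F)" by (rule polynomial_plus[OF P Q])
  show "nrm (polynomials n E F) (P + Q) \<le> nrm (polynomials n E F) P + nrm (polynomials n E F) Q"
    unfolding polynomials_sel plus_fun_apply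
    by (rule polynomial_sup_le)
      (auto intro!: order.trans[OF F.nrm_add] add_mono polynomial_ball_le P Q polynomial_mem[OF P] polynomial_mem[OF Q])
next
  fix P :: "'v \<Rightarrow> 'w" and c assume P: "P \<in> vecs (polynomials n E F)"
  show cP: "smul (polynomials n E F) c P \<in> vecs (polynomials n E F)" for c
    using polynomial_scaled[OF P] by simp
  show "nrm (polynomials n E F) (smul (polynomials n E F) c P) = norm c * nrm (polynomials n E F) P"
    unfolding polynomials_sel
  proof (rule antisym)
    show "sup_norm E F (\<lambda>x. smul F c (P x)) \<le> norm c * sup_norm E F P"
      by (rule polynomial_sup_le)
        (auto simp: F.nrm_smul[OF polynomial_mem[OF P]] intro!: mult_left_mono polynomial_ball_le[OF P])
    show "norm c * sup_norm E F P \<le> sup_norm E F (\<lambda>x. smul F c (P x))"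
    proof (cases "c = 0")
      case True
      then show ?thesis using polynomial_sup_nonneg[OF polynomial_scaled[OF P]] by simp
    next
      case False
      have "nrm F (P x) \<le> sup_norm E F (\<lambda>x. smul F c (P x)) / norm c" if "x \<in> vecs E" "nrm E x \<le> 1" for x
        using polynomial_ball_le[OF polynomial_scaled[OF P] that, of c] False
        by (simp add: F.nrm_smul[OF polynomial_mem[OF P]] field_simps)
      then have "sup_norm E F P \<le> sup_norm E F (\<lambda>x. smul F c (P x)) / norm c"
        by (rule polynomial_sup_le)
      then show ?thesis using False by (simp add: field_simps)
    qed
  qed
  have "P = 0" if "sup_norm E F P = 0"
  proof
    fix x show "P x = 0 x"
    proof (cases "x \<in> vecs E")
      case True
      then show ?thesis
        using polynomial_norm_le[OF P True] that F.nrm_nonneg[OF polynomial_mem[OF P]] F.nrm_eq_0[OF polynomial_mem[OF P]]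
        by (metis antisym mult_zero_left zero_fun_apply)
    qed (use P in \<open>simp add: mem_polynomials\<close>)
  qed
  moreover have "sup_norm E F 0 = 0" using E.unit_ball_nonempty by (simp add: sup_norm_def)
  ultimately show "nrm (polynomials n E F) P = 0 \<longleftrightarrow> P = 0" by auto
qed (auto simp: polynomial_zero fun_eq_iff polynomial_mem F.smul_add F.add_smul F.smul_smul F.one_smul)

end

section \<open>The Aron--Berner extension\<close>

lemma tendsto_fun_iff:
  fixes f :: "'a \<Rightarrow> 'i \<Rightarrow> 'b::topological_space"
  shows "(f \<longlongrightarrow> l) F \<longleftrightarrow> (\<forall>i. ((\<lambda>y. f y i) \<longlongrightarrow> l i) F)"
proof -
  have "(f \<longlongrightarrow> l) F \<longleftrightarrow> limitin (product_topology (\<lambda>_. euclidean) UNIV) f l F"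
    unfolding euclidean_product_topology by simp
  then show ?thesis by (simp add: limitin_componentwise)
qed

section \<open>Goldstine's theorem and the weak-star filter\<close>

lemma seminorm_funI:
  assumes "\<And>v w. \<lbrakk>v \<in> V; w \<in> V\<rbrakk> \<Longrightarrow> p (v + w) \<le> p v + p w"
    and scale: "\<And>c v. v \<in> V \<Longrightarrow> p (\<lambda>i. c * v i) \<le> norm c * p v"
    and nonneg: "\<And>v. v \<in> V \<Longrightarrow> 0 \<le> p v"
    and V: "subspace_fun V"
  shows "seminorm_fun V p"
  unfolding seminorm_fun_def
proof (intro conjI ballI allI)
  fix c :: 'b and v assume v: "v \<in> V"
  show "p (\<lambda>i. c * v i) = norm c * p v"
  proof (cases "c = 0")
    case True
    then show ?thesis using scale[OF v, of 0] nonneg[OF subspace_fun_scale[OF V v, of 0]] by simp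
  next
    case False
    have "(\<lambda>i. inverse c * (c * v i)) = v" using False by (simp add: fun_eq_iff flip: mult.assoc)
    then have "p v \<le> norm (inverse c) * p (\<lambda>i. c * v i)"
      using scale[OF subspace_fun_scale[OF V v, of c], of "inverse c"] by simp
    then have "norm c * p v \<le> norm c * (norm (inverse c) * p (\<lambda>i. c * v i))"
      by (rule mult_left_mono) simp
    also have "\<dots> = p (\<lambda>i. c * v i)"
      using False by (simp add: norm_inverse flip: mult.assoc)
    finally have "norm c * p v \<le> p (\<lambda>i. c * v i)" .
    then show ?thesis using scale[OF v, of c] by simp
  qed
qed (use assms in auto)

lemma linear_fun_finite_support:
  fixes G :: "('a \<Rightarrow> 'k::real_or_complex) \<Rightarrow> 'k"
  assumes G: "linear_fun UNIV G" and "finite I"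
  shows "G (\<lambda>f. if f \<in> I then v f else 0) = (\<Sum>f\<in>I. G (\<lambda>g. if g = f then 1 else 0) * v f)"
  using assms(2)
proof induction
  case empty
  have "G (\<lambda>f. 0) = 0" using linear_fun_scale[OF G, of "\<lambda>f. 0" 0] by simp
  then show ?case by simp
next
  case (insert h I)
  have "(\<lambda>f. if f \<in> insert h I then v f else 0) =
      (\<lambda>f. if f \<in> I then v f else 0) + (\<lambda>f. v h * (if f = h then 1 else 0))"
    using insert.hyps by (auto simp: fun_eq_iff)
  then have "G (\<lambda>f. if f \<in> insert h I then v f else 0) =
      G (\<lambda>f. if f \<in> I then v f else 0) + G (\<lambda>f. v h * (if f = h then 1 else 0))"
    by (simp only: linear_fun_add[OF G UNIV_I UNIV_I])
  also have "G (\<lambda>f. v h * (if f = h then 1 else 0)) = v h * G (\<lambda>f. if f = h then 1 else 0)"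
    by (rule linear_fun_scale[OF G]) simp
  finally show ?case using insert by (simp add: mult.commute)
qed

text \<open>Let p v be the infimum over x of |x| + K \<Sum> |v f - f x|, the sum over f in I. This
  seminorm vanishes on functions that are 0 on I, so a functional G with |G| \<le> p is a finite
  combination of the coordinates in I, that is, evaluation at some g in the span of I. Since p is at
  most |x| at the evaluation in x, g has norm at most 1; choosing G norming for u gives p u = |u g|
  \<le> |u| < r. Some x then has N u x < r.\<close>

lemma goldstine:
  fixes E :: "('k::real_or_complex, 'v::ab_group_add) nspace"
  assumes E: "normed_space E" and u: "u \<in> vecs (bidual E)" and r: "nrm (bidual E) u < r"
    and I: "finite I" "I \<subseteq> vecs (dual E)" and \<eta>: "\<eta> > 0"
  obtains x where "x \<in> vecs E" "nrm E x < r" "\<And>f. f \<in> I \<Longrightarrow> norm (f x - u f) < \<eta>"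
proof -
  interpret E: normed_space E by (rule E)
  interpret D: normed_space "dual E" by (rule E.normed_space_dual)
  have r0: "r > 0" using r D.dual_sup_nonneg[OF u] by linarith
  \<comment> \<open>With this K, N u x < r bounds the norm of x by r and the deviation on I by r / K
    = \<eta>.\<close>
  define K where "K = r / \<eta>"
  have K: "K > 0" unfolding K_def using r0 \<eta> by simp
  define N where "N v x = nrm E x + K * (\<Sum>f\<in>I. norm (v f - f x))" for v x
  define p where "p v = (INF x\<in>vecs E. N v x)" for v
  have N0: "0 \<le> N v x" if "x \<in> vecs E" for v x
    unfolding N_def using that K E.nrm_nonneg by (auto intro!: add_nonneg_nonneg mult_nonneg_nonneg sum_nonneg)
  have ne: "vecs E \<noteq> {}" using E.zero_mem by auto
  have p_le: "p v \<le> N v x" if "x \<in> vecs E" for v x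
    unfolding p_def by (rule cINF_lower[OF _ that]) (use N0 in \<open>auto intro!: bdd_belowI\<close>)
  have p_ge: "c \<le> p v" if "\<And>x. x \<in> vecs E \<Longrightarrow> c \<le> N v x" for c v
    unfolding p_def by (rule cINF_greatest[OF ne that])
  have UV: "subspace_fun (UNIV :: (('v \<Rightarrow> 'k) \<Rightarrow> 'k) set)" by (simp add: subspace_fun_def)
  have I': "\<And>f. f \<in> I \<Longrightarrow> f \<in> vecs (dual E)" using I(2) by blast
  have "seminorm_fun UNIV p"
  proof (rule seminorm_funI)
    fix v w
    have le: "p (v + w) \<le> N v x + N w y" if xy: "x \<in> vecs E" "y \<in> vecs E" for x y
    proof -
      have "p (v + w) \<le> N (v + w) (x + y)" by (intro p_le E.add_mem xy)
      also have "\<dots> \<le> (nrm E x + nrm E y) + K * (\<Sum>f\<in>I. norm (v f - f x) + norm (w f - f y))"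
        unfolding N_def
      proof (intro add_mono mult_left_mono sum_mono E.nrm_add xy)
        fix f assume "f \<in> I"
        then have "(v + w) f - f (x + y) = (v f - f x) + (w f - f y)"
          using E.dual_add[OF I'[OF \<open>f \<in> I\<close>] xy] by simp
        then show "norm ((v + w) f - f (x + y)) \<le> norm (v f - f x) + norm (w f - f y)"
          by (metis norm_triangle_ineq)
      qed (use K in auto)
      also have "\<dots> = N v x + N w y" by (simp add: N_def sum.distrib distrib_left)
      finally show ?thesis .
    qed
    have "p (v + w) - N w y \<le> p v" if "y \<in> vecs E" for y
      using le[OF _ that] by (intro p_ge) (simp add: algebra_simps)
    then have "p (v + w) - p v \<le> p w" by (intro p_ge) (simp add: algebra_simps)
    then show "p (v + w) \<le> p v + p w" by simp
  next
    fix c :: 'k and v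
    have "p (\<lambda>i. c * v i) \<le> norm c * N v x" if x: "x \<in> vecs E" for x
    proof -
      have "p (\<lambda>i. c * v i) \<le> N (\<lambda>i. c * v i) (smul E c x)" by (intro p_le E.smul_mem x)
      also have "\<dots> = norm c * nrm E x + K * (\<Sum>f\<in>I. norm c * norm (v f - f x))"
        unfolding N_def using E.dual_smul[OF I' x]
        by (simp add: E.nrm_smul[OF x] norm_mult[symmetric] right_diff_distrib cong: sum.cong)
      also have "\<dots> = norm c * N v x" by (simp add: N_def sum_distrib_left[symmetric] algebra_simps)
      finally show ?thesis .
    qed
    note le = this
    show "p (\<lambda>i. c * v i) \<le> norm c * p v"
    proof (cases "c = 0")
      case True
      then show ?thesis using le[OF E.zero_mem] by simp
    next
      case False
      then have "p (\<lambda>i. c * v i) / norm c \<le> p v" using le by (intro p_ge) (simp add: field_simps)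
      then show ?thesis using False by (simp add: field_simps)
    qed
  qed (use p_ge N0 UV in auto)
  from norming_functional[OF UV this UNIV_I, of u] obtain G where
    G: "linear_fun UNIV G" "\<And>v. norm (G v) \<le> p v" "norm (G u) = p u" by auto
  define e where "e f = G (\<lambda>g. if g = f then 1 else 0)" for f
  have G_eq: "G v = (\<Sum>f\<in>I. e f * v f)" for v
  proof -
    let ?v = "\<lambda>f. if f \<in> I then v f else 0"
    have "(\<Sum>f\<in>I. norm ((v - ?v) f - f 0)) = 0"
      by (rule sum.neutral) (simp add: linear_map_zero[OF E E.dual_linear[OF I']])
    then have "N (v - ?v) 0 = 0" unfolding N_def by simp
    then have "norm (G (v - ?v)) \<le> 0"
      using order.trans[OF G(2)[of "v - ?v"] p_le[OF E.zero_mem]] by metis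
    then have "G (v - ?v) = 0" unfolding norm_le_zero_iff .
    then have "G v = G ?v" by (simp add: linear_fun_diff[OF G(1) UV])
    then show ?thesis by (simp only: linear_fun_finite_support[OF G(1) I(1)] e_def)
  qed
  define g where "g = (\<Sum>f\<in>I. smul (dual E) (e f) f)"
  have sm: "smul (dual E) (e f) f \<in> vecs (dual E)" if "f \<in> I" for f by (intro D.smul_mem I' that)
  have g: "g \<in> vecs (dual E)" unfolding g_def by (intro D.sum_mem sm)
  have gx: "g x = G (\<lambda>f. f x)" for x
    unfolding g_def G_eq by (induction I rule: infinite_finite_induct) auto
  have "nrm (dual E) g \<le> 1"
  proof (rule E.dual_nrm_le)
    fix x assume x: "x \<in> vecs E" "nrm E x \<le> 1"
    have "norm (g x) \<le> p (\<lambda>f. f x)" unfolding gx by (rule G(2))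
    also have "\<dots> \<le> N (\<lambda>f. f x) x" by (rule p_le[OF x(1)])
    also have "\<dots> = nrm E x" by (simp add: N_def)
    finally show "norm (g x) \<le> 1" using x(2) by simp
  qed
  then have "norm (u g) \<le> nrm (bidual E) u" by (intro D.dual_ball_le[OF u g])
  moreover have "u g = G u"
  proof -
    have "u g = (\<Sum>f\<in>I. u (smul (dual E) (e f) f))"
      unfolding g_def by (rule D.dual_sum[OF u sm])
    also have "\<dots> = G u"
      unfolding G_eq by (intro sum.cong refl D.dual_smul[OF u I'])
    finally show ?thesis .
  qed
  ultimately have "p u < r" using G(3) r by simp
  then obtain x where x: "x \<in> vecs E" "N u x < r"
    using p_ge[of r u] by (meson not_le)
  show thesis
  proof (rule that[OF x(1)])
    have "0 \<le> K * (\<Sum>f\<in>I. norm (u f - f x))" using K by (intro mult_nonneg_nonneg sum_nonneg) auto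
    then show "nrm E x < r" using x(2) by (simp add: N_def)
    fix f assume "f \<in> I"
    then have "norm (f x - u f) \<le> (\<Sum>f\<in>I. norm (u f - f x))"
      using member_le_sum[of f I "\<lambda>f. norm (u f - f x)"] I(1) by (simp add: norm_minus_commute)
    moreover have "K * (\<Sum>f\<in>I. norm (u f - f x)) < r"
      using x(2) E.nrm_nonneg[OF x(1)] by (simp add: N_def)
    then have "(\<Sum>f\<in>I. norm (u f - f x)) < \<eta>" using r0 \<eta> by (simp add: K_def field_simps)
    ultimately show "norm (f x - u f) < \<eta>" by linarith
  qed
qed

text \<open>Goldstine's theorem makes the traces of weak-star neighbourhoods nonempty; this is what
  makes limits along the filter unique.\<close>

lemma weak_star_net_nontrivial:
  fixes E :: "('k::real_or_complex, 'v::ab_group_add) nspace"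
  assumes E: "normed_space E" and u: "u \<in> vecs (bidual E)"
  shows "weak_star_net E u \<noteq> bot"
proof
  assume "weak_star_net E u = bot"
  then have "eventually (\<lambda>_. False) (weak_star_net E u)" by simp
  then obtain S where S: "open S" "u \<in> S" and no: "\<And>x. \<lbrakk>x \<in> vecs E; canonical_embedding E x \<in> S\<rbrakk> \<Longrightarrow> False"
    unfolding weak_star_net_def eventually_inf_principal eventually_filtercomap eventually_nhds by blast
  have "openin (product_topology (\<lambda>_. euclidean) UNIV) S" using S(1) by (simp add: open_fun_def)
  then obtain U where U: "finite {f. U f \<noteq> UNIV}" "\<And>f. open (U f)" "u \<in> Pi\<^sub>E UNIV U" "Pi\<^sub>E UNIV U \<subseteq> S"
    using S(2) unfolding openin_product_topology_alt by force
  define I where "I = {f. U f \<noteq> UNIV} \<inter> vecs (dual E)"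
  have "\<exists>\<epsilon>>0. \<forall>f\<in>I. ball (u f) \<epsilon> \<subseteq> U f"
  proof -
    have "\<exists>\<epsilon>>0. ball (u f) \<epsilon> \<subseteq> U f" for f using U(2,3) open_contains_ball[of "U f"] by auto
    then obtain \<epsilon> where \<epsilon>: "\<And>f. \<epsilon> f > 0" "\<And>f. ball (u f) (\<epsilon> f) \<subseteq> U f" by metis
    let ?m = "Min (insert 1 (\<epsilon> ` I))"
    have fin: "finite I" using U(1) by (simp add: I_def)
    have "?m > 0" using fin \<epsilon>(1) by (auto simp: Min_gr_iff)
    moreover have "ball (u f) ?m \<subseteq> U f" if "f \<in> I" for f
    proof -
      have "?m \<le> \<epsilon> f" using fin that by (intro Min_le) auto
      then show ?thesis using \<epsilon>(2)[of f] by (meson subset_ball subset_trans)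
    qed
    ultimately show ?thesis by blast
  qed
  then obtain \<epsilon> where \<epsilon>: "\<epsilon> > 0" "\<And>f. f \<in> I \<Longrightarrow> ball (u f) \<epsilon> \<subseteq> U f" by blast
  obtain x where x: "x \<in> vecs E" "\<And>f. f \<in> I \<Longrightarrow> norm (f x - u f) < \<epsilon>"
    using goldstine[OF E u less_add_one, of I \<epsilon>] U(1) \<epsilon>(1) by (metis I_def finite_Int inf_le2)
  have "canonical_embedding E x f \<in> U f" for f
  proof (cases "f \<in> vecs (dual E)")
    case True
    then show ?thesis
      using x(2)[of f] \<epsilon>(2)[of f] by (cases "U f = UNIV") (auto simp: I_def canonical_embedding_def dist_norm norm_minus_commute subset_iff)
  next
    \<comment> \<open>At arguments that are not continuous functionals both functions vanish, and
      the constraint is met because u meets it.\<close>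
    case False
    then have "u f = 0" using normed_space.dual_outside[OF normed_space.normed_space_dual[OF E] u] by simp
    moreover have "u f \<in> U f" using U(3) by auto
    ultimately show ?thesis using False by (simp add: canonical_embedding_def)
  qed
  then have "canonical_embedding E x \<in> S" using U(4) by (auto simp: PiE_UNIV_domain)
  with no[OF x(1)] show False .
qed

lemma weak_star_net_carrier: "eventually (\<lambda>x. x \<in> vecs E) (weak_star_net E u)"
  unfolding weak_star_net_def eventually_inf_principal by simp

lemma weak_star_net_tendsto:
  assumes f: "f \<in> vecs (dual E)" and h: "\<And>x. x \<in> vecs E \<Longrightarrow> h x = f x"
  shows "(h \<longlongrightarrow> u f) (weak_star_net E u)"
proof -
  have "filterlim (canonical_embedding E) (nhds u) (weak_star_net E u)"
    unfolding weak_star_net_def by (rule filterlim_mono[OF filterlim_filtercomap order_refl inf_le1])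
  then have "((\<lambda>x. canonical_embedding E x f) \<longlongrightarrow> u f) (weak_star_net E u)"
    using tendsto_fun_iff[of "canonical_embedding E" u] by blast
  moreover have "eventually (\<lambda>x. canonical_embedding E x f = h x) (weak_star_net E u)"
    using weak_star_net_carrier by eventually_elim (simp add: canonical_embedding_def f h)
  ultimately show ?thesis by (rule Lim_transform_eventually)
qed

section \<open>Slotwise extension to the bidual and the iterated limits\<close>

lemma multilinear_functional:
  fixes E :: "('k::real_or_complex, 'v::ab_group_add) nspace" and F :: "('k, 'w::ab_group_add) nspace"
  assumes F: "normed_space F" and S: "multilinear n E F S" "multilinear_bound n E F S C" and w: "w \<in> vecs (dual F)"
  shows "multilinear n E scalars (\<lambda>x. w (S x))"
    and "multilinear_bound n E scalars (\<lambda>x. w (S x)) (nrm (dual F) w * C)"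
proof -
  show "multilinear n E scalars (\<lambda>x. w (S x))"
    using S(1) normed_space.dual_linear[OF F w] unfolding multilinear_def linear_map_def by simp
  show "multilinear_bound n E scalars (\<lambda>x. w (S x)) (nrm (dual F) w * C)"
    unfolding multilinear_bound_def
  proof
    fix x assume x: "x \<in> tuples n E"
    have "norm (w (S x)) \<le> nrm (dual F) w * nrm F (S x)"
      by (rule normed_space.dual_norm_le[OF F w multilinear_mem[OF S(1) x]])
    also have "\<dots> \<le> nrm (dual F) w * (C * (\<Prod>i<n. nrm E (x i)))"
      by (intro mult_left_mono multilinear_boundD[OF S(2) x] normed_space.dual_sup_nonneg[OF F w])
    finally show "nrm scalars (w (S x)) \<le> nrm (dual F) w * C * (\<Prod>i<n. nrm E (x i))"
      by (simp add: mult.assoc)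
  qed
qed

text \<open>The value 0 off the carrier turns the function of the i-th variable into an element of
  the dual, so that u can be applied to it.\<close>

definition slot :: "('k::real_or_complex, 'v::ab_group_add) nspace \<Rightarrow> (('v \<Rightarrow> 'k) \<Rightarrow> 'k) \<Rightarrow> nat \<Rightarrow> ((nat \<Rightarrow> 'v) \<Rightarrow> 'k) \<Rightarrow> (nat \<Rightarrow> 'v) \<Rightarrow> 'v \<Rightarrow> 'k" where
  "slot E u i a x = (\<lambda>y. if y \<in> vecs E then a (x(i := y)) else 0)"

(* Extends the slots i with n <= i < N to the bidual, the last one first. *)
definition partial_ext :: "('k::real_or_complex, 'v::ab_group_add) nspace \<Rightarrow> (('v \<Rightarrow> 'k) \<Rightarrow> 'k) \<Rightarrow> nat \<Rightarrow> nat \<Rightarrow> ((nat \<Rightarrow> 'v) \<Rightarrow> 'k) \<Rightarrow> (nat \<Rightarrow> 'v) \<Rightarrow> 'k" where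
  "partial_ext E u n N a = foldr (\<lambda>i b x. u (slot E u i b x)) [n..<N] a"

lemma partial_ext_same [simp]: "partial_ext E u n n a = a"
  by (simp add: partial_ext_def)

lemma partial_ext_step: "n < N \<Longrightarrow> partial_ext E u n N a x = u (slot E u n (partial_ext E u (Suc n) N a) x)"
  by (simp add: partial_ext_def upt_conv_Cons)

context
  fixes E :: "('k::real_or_complex, 'v::ab_group_add) nspace"
  assumes E: "normed_space E"
begin

interpretation E: normed_space E by (rule E)
interpretation D: normed_space "dual E" by (rule E.normed_space_dual)

lemma slot_mem:
  assumes a: "multilinear (Suc n) E scalars a" "multilinear_bound (Suc n) E scalars a C" "C \<ge> 0"
    and x: "x \<in> tuples n E"
  shows "slot E u n a x \<in> vecs (dual E)"
    and "nrm (dual E) (slot E u n a x) \<le> C * (\<Prod>i<n. nrm E (x i))"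
proof -
  let ?c = "C * (\<Prod>i<n. nrm E (x i))"
  have upd: "x(n := y) \<in> tuples (Suc n) E" if "y \<in> vecs E" for y by (rule tuples_upd_Suc[OF x that])
  have lin: "linear_map E scalars (\<lambda>y. a (x(n := y)))"
    using multilinear_slot[OF a(1) upd[OF E.zero_mem], of n] by simp
  have le: "norm (a (x(n := y))) \<le> ?c * nrm E y" if "y \<in> vecs E" for y
    using multilinear_boundD[OF a(2) upd[OF that]] by (simp add: mult.assoc)
  show "slot E u n a x \<in> vecs (dual E)"
    unfolding slot_def
    by (rule E.dual_memI[of _ ?c])
      (use le linear_map_add[OF lin] linear_map_smul[OF lin] in \<open>auto simp: E.add_mem E.smul_mem\<close>)
  have c0: "?c \<ge> 0" by (intro mult_nonneg_nonneg a(3) prod_nrm_nonneg[OF E x])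
  show "nrm (dual E) (slot E u n a x) \<le> ?c"
  proof (rule E.dual_nrm_le)
    fix y assume y: "y \<in> vecs E" "nrm E y \<le> 1"
    have "?c * nrm E y \<le> ?c * 1" by (intro mult_left_mono y c0)
    then show "norm (slot E u n a x y) \<le> ?c"
      using le[OF y(1)] y(1) unfolding slot_def by simp
  qed
qed

lemma slot_multilinear:
  assumes u: "u \<in> vecs (bidual E)"
    and a: "multilinear (Suc n) E scalars a" "multilinear_bound (Suc n) E scalars a C" "C \<ge> 0"
  shows "multilinear n E scalars (\<lambda>x. u (slot E u n a x))"
    and "multilinear_bound n E scalars (\<lambda>x. u (slot E u n a x)) (nrm (bidual E) u * C)"
proof -
  show "multilinear n E scalars (\<lambda>x. u (slot E u n a x))"
    unfolding multilinear_def linear_map_def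
  proof (intro ballI conjI allI impI)
    fix x i and y z :: 'v and c :: 'k
    assume x: "x \<in> tuples n E" and i: "i < n" and y: "y \<in> vecs E"
    have lin: "linear_map E scalars (\<lambda>y. a ((x(n := w))(i := y)))" if "w \<in> vecs E" for w
      using multilinear_slot[OF a(1) tuples_upd_Suc[OF x that], of i] i by simp
    have twist: "x(i := y, n := w) = x(n := w, i := y)" for y w using i by auto
    have mem: "slot E u n a (x(i := y)) \<in> vecs (dual E)" if "y \<in> vecs E" for y
      by (rule slot_mem[OF a tuples_upd[OF x i that]])
    show "u (slot E u n a (x(i := y + z))) = u (slot E u n a (x(i := y))) + u (slot E u n a (x(i := z)))"
      if z: "z \<in> vecs E"
    proof -
      have "slot E u n a (x(i := y + z)) = slot E u n a (x(i := y)) + slot E u n a (x(i := z))"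
        using linear_map_add[OF lin y z] by (auto simp: slot_def twist)
      then show ?thesis using D.dual_add[OF u mem[OF y] mem[OF z]] by simp
    qed
    show "u (slot E u n a (x(i := smul E c y))) = smul scalars c (u (slot E u n a (x(i := y))))"
    proof -
      have "slot E u n a (x(i := smul E c y)) = smul (dual E) c (slot E u n a (x(i := y)))"
        using linear_map_smul[OF lin y] by (auto simp: slot_def twist)
      then show ?thesis using D.dual_smul[OF u mem[OF y], of c] by simp
    qed
  qed auto
  show "multilinear_bound n E scalars (\<lambda>x. u (slot E u n a x)) (nrm (bidual E) u * C)"
    unfolding multilinear_bound_def
  proof
    fix x assume x: "x \<in> tuples n E"
    have "norm (u (slot E u n a x)) \<le> nrm (bidual E) u * nrm (dual E) (slot E u n a x)"
      by (rule D.dual_norm_le[OF u slot_mem(1)[OF a x]])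
    also have "\<dots> \<le> nrm (bidual E) u * (C * (\<Prod>i<n. nrm E (x i)))"
      by (intro mult_left_mono slot_mem(2)[OF a x] D.dual_sup_nonneg[OF u])
    finally show "nrm scalars (u (slot E u n a x)) \<le> nrm (bidual E) u * C * (\<Prod>i<n. nrm E (x i))"
      by (simp add: mult.assoc)
  qed
qed

lemma partial_ext_multilinear:
  assumes u: "u \<in> vecs (bidual E)"
    and a: "multilinear N E scalars a" "multilinear_bound N E scalars a C" "C \<ge> 0" and "n \<le> N"
  shows "multilinear n E scalars (partial_ext E u n N a) \<and>
    multilinear_bound n E scalars (partial_ext E u n N a) (nrm (bidual E) u ^ (N - n) * C)"
  using \<open>n \<le> N\<close>
proof (induction rule: inc_induct)
  case base
  then show ?case using a by simp
next
  case (step n)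
  have eq: "partial_ext E u n N a = (\<lambda>x. u (slot E u n (partial_ext E u (Suc n) N a) x))"
    by (intro ext partial_ext_step[OF step.hyps(2)])
  have "N - n = Suc (N - Suc n)" using step.hyps by simp
  then show ?case
    unfolding eq
    using slot_multilinear[OF u step.IH[THEN conjunct1] step.IH[THEN conjunct2]] a(3) D.dual_sup_nonneg[OF u]
    by (simp add: mult.assoc)
qed

lemma iterated_lim_cong:
  assumes "\<And>i. i < n \<Longrightarrow> eventually (\<lambda>x. x \<in> vecs E) (A i)" "\<And>x. x \<in> tuples n E \<Longrightarrow> h x = h' x"
  shows "iterated_lim A n h = iterated_lim A n h'"
  using assms
proof (induction n arbitrary: h h')
  case 0
  then show ?case by (simp add: tuples_def)
next
  case (Suc n)
  have eq: "(THE l. ((\<lambda>y. h (x(n := y))) \<longlongrightarrow> l) (A n)) = (THE l. ((\<lambda>y. h' (x(n := y))) \<longlongrightarrow> l) (A n))"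
    if x: "x \<in> tuples n E" for x
  proof -
    have "eventually (\<lambda>y. h (x(n := y)) = h' (x(n := y))) (A n)"
      using Suc.prems(1)[of n, OF lessI] by eventually_elim (auto intro!: Suc.prems(2) tuples_upd_Suc[OF x])
    then have "((\<lambda>y. h (x(n := y))) \<longlongrightarrow> l) (A n) \<longleftrightarrow> ((\<lambda>y. h' (x(n := y))) \<longlongrightarrow> l) (A n)" for l
      by (rule tendsto_cong)
    then show ?thesis by simp
  qed
  show ?case unfolding iterated_lim.simps by (rule Suc.IH[OF Suc.prems(1)[OF less_SucI] eq])
qed

text \<open>The innermost limit is found coordinate by coordinate: for fixed v the map in the last
  variable is an element of the dual, so along the weak-star filter it converges to the value of u
  there. What remains is again multilinear in the other variables, which is why the induction lets h
  vary.\<close>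

lemma iterated_lim_eq:
  fixes h :: "(nat \<Rightarrow> 'v) \<Rightarrow> 'i \<Rightarrow> 'k"
  assumes u: "u \<in> vecs (bidual E)" and A: "\<And>i. i < n \<Longrightarrow> A i = weak_star_net E u"
    and h: "\<And>v. multilinear n E scalars (\<lambda>x. h x v)" "\<And>v. \<exists>C\<ge>0. multilinear_bound n E scalars (\<lambda>x. h x v) C"
  shows "iterated_lim A n h v = partial_ext E u 0 n (\<lambda>x. h x v) (\<lambda>_. undefined)"
  using A h
proof (induction n arbitrary: h)
  case 0
  then show ?case by simp
next
  case (Suc n)
  let ?g = "\<lambda>x v. u (slot E u n (\<lambda>x. h x v) x)"
  have lim: "(THE l. ((\<lambda>y. h (x(n := y))) \<longlongrightarrow> l) (A n)) = ?g x" if x: "x \<in> tuples n E" for x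
  proof (rule the_equality)
    have "((\<lambda>y. h (x(n := y)) v) \<longlongrightarrow> ?g x v) (weak_star_net E u)" for v
    proof -
      obtain C where C: "C \<ge> 0" "multilinear_bound (Suc n) E scalars (\<lambda>x. h x v) C" using Suc.prems(3) by blast
      show ?thesis
        by (rule weak_star_net_tendsto[OF slot_mem(1)[OF Suc.prems(2) C(2,1) x]]) (simp add: slot_def)
    qed
    then show lim: "((\<lambda>y. h (x(n := y))) \<longlongrightarrow> ?g x) (A n)"
      unfolding Suc.prems(1)[OF lessI] by (subst tendsto_fun_iff) blast
    fix l assume "((\<lambda>y. h (x(n := y))) \<longlongrightarrow> l) (A n)"
    then have "((\<lambda>y. h (x(n := y)) v) \<longlongrightarrow> l v) (weak_star_net E u)" for v
      unfolding Suc.prems(1)[OF lessI] using tendsto_fun_iff[of "\<lambda>y. h (x(n := y))" l] by blast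
    moreover have "((\<lambda>y. h (x(n := y)) v) \<longlongrightarrow> ?g x v) (weak_star_net E u)" for v
      using lim unfolding Suc.prems(1)[OF lessI] using tendsto_fun_iff[of "\<lambda>y. h (x(n := y))" "?g x"] by blast
    ultimately have "l v = ?g x v" for v
      by (rule tendsto_unique[OF weak_star_net_nontrivial[OF E u]])
    then show "l = ?g x" by (rule ext)
  qed
  have "iterated_lim A (Suc n) h = iterated_lim A n ?g"
    unfolding iterated_lim.simps
    by (rule iterated_lim_cong) (use Suc.prems(1) weak_star_net_carrier lim in auto)
  moreover have "iterated_lim A n ?g v = partial_ext E u 0 n (\<lambda>x. ?g x v) (\<lambda>_. undefined)"
  proof (rule Suc.IH)
    fix v
    obtain C where C: "C \<ge> 0" "multilinear_bound (Suc n) E scalars (\<lambda>x. h x v) C" using Suc.prems(3) by blast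
    note sm = slot_multilinear[OF u Suc.prems(2) C(2,1)]
    show "multilinear n E scalars (\<lambda>x. ?g x v)" by (rule sm(1))
    show "\<exists>C\<ge>0. multilinear_bound n E scalars (\<lambda>x. ?g x v) C"
      using sm(2) C(1) D.dual_sup_nonneg[OF u] by (intro exI[of _ "nrm (bidual E) u * C"]) auto
  qed (use Suc.prems(1) in auto)
  ultimately show ?case by (simp add: partial_ext_def)
qed

lemma aron_berner_extension_eq:
  fixes Y :: "('k, 'y::ab_group_add) nspace"
  assumes Y: "normed_space Y" and P: "P \<in> vecs (polynomials N E (dual Y))"
    and u: "u \<in> vecs (bidual E)" and v: "v \<in> vecs (bidual Y)"
  shows "aron_berner_extension N E (dual Y) P u v =
    partial_ext E u 0 N (\<lambda>x. v (associated_symmetric N E (dual Y) P x)) (\<lambda>_. undefined)"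
proof -
  let ?S = "associated_symmetric N E (dual Y) P"
  note DY = normed_space.normed_space_dual[OF Y]
  obtain C where S: "multilinear N E (dual Y) ?S" "multilinear_bound N E (dual Y) ?S C" "C \<ge> 0"
    using associated_symmetric_multilinear[OF E Y P] unfolding multilinear_maps_iff[OF E DY] by blast
  let ?h = "\<lambda>x. canonical_embedding (dual Y) (?S x)"
  have "multilinear N E scalars (\<lambda>x. ?h x w) \<and> (\<exists>C\<ge>0. multilinear_bound N E scalars (\<lambda>x. ?h x w) C)" for w
  proof (cases "w \<in> vecs (bidual Y)")
    case w: True
    have "nrm (bidual Y) w * C \<ge> 0"
      using normed_space.dual_sup_nonneg[OF DY w] S(3) by simp
    with multilinear_functional[OF DY S(1,2) w] show ?thesis using w by (auto simp: canonical_embedding_def)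
  next
    \<comment> \<open>The limits are taken in the full function type, so coordinates w outside the
      bidual of Y have to be covered too; there the embedded values are 0.\<close>
    case False
    then show ?thesis
      by (auto simp: canonical_embedding_def multilinear_def multilinear_bound_def linear_map_def intro!: exI[of _ 0])
  qed
  then have "iterated_lim (\<lambda>i. weak_star_net E (diag N u i)) N ?h v = partial_ext E u 0 N (\<lambda>x. ?h x v) (\<lambda>_. undefined)"
    by (intro iterated_lim_eq u) (auto simp: diag_def)
  then show ?thesis
    using u v diag_tuple[OF u, of N] by (simp add: aron_berner_extension_def arens_extension_def canonical_embedding_def)
qed

end

section \<open>The Davie--Gamelin theorem\<close>

text \<open>The quotient is the proportion of injective maps among all maps from N points to M
  points.\<close>

lemma tendsto_falling_factorial_ratio:
  "(\<lambda>M. real (prod ((-) M) {0..<N}) / real M ^ N) \<longlonglongrightarrow> 1"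
proof -
  have "(\<lambda>M. real (M - i) / real M) \<longlonglongrightarrow> 1" for i
  proof (rule Lim_transform_eventually)
    show "(\<lambda>M. 1 - real i / real M) \<longlonglongrightarrow> 1"
      using tendsto_diff[OF tendsto_const lim_const_over_n[of "real i"], of 1] by simp
    show "eventually (\<lambda>M. 1 - real i / real M = real (M - i) / real M) sequentially"
      using eventually_gt_at_top[of i] by eventually_elim (simp add: of_nat_diff diff_divide_distrib)
  qed
  then have "(\<lambda>M. \<Prod>i\<in>{0..<N}. real (M - i) / real M) \<longlonglongrightarrow> (\<Prod>i\<in>{0..<N}. 1)"
    by (intro tendsto_prod)
  then show ?thesis by (simp add: prod_dividef)
qed

lemma sorting_permutation:
  fixes t :: "nat \<Rightarrow> nat"
  assumes inj: "inj_on t {..<N}"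
  obtains \<pi> where "\<pi> permutes {..<N}" "strict_mono_on {..<N} (t \<circ> \<pi>)"
proof -
  have card: "card (t ` {..<N}) = N" using inj by (simp add: card_image)
  obtain h where h: "bij_betw h {..<N} (t ` {..<N})" "strict_mono_on {..<N} h"
    using ex_bij_betw_strict_mono_card[of "t ` {..<N}"] card by auto
  define \<pi> where "\<pi> i = (if i < N then inv_into {..<N} t (h i) else i)" for i
  have "bij_betw (inv_into {..<N} t \<circ> h) {..<N} {..<N}"
    by (rule bij_betw_trans[OF h(1) bij_betw_inv_into[OF inj_on_imp_bij_betw[OF inj]]])
  then have "bij_betw \<pi> {..<N} {..<N}"
    by (subst bij_betw_cong[of _ _ "inv_into {..<N} t \<circ> h"]) (auto simp: \<pi>_def)
  then have "\<pi> permutes {..<N}" by (rule bij_imp_permutes) (simp add: \<pi>_def)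
  moreover have "t (\<pi> i) = h i" if "i < N" for i
    using that bij_betwE[OF h(1)] by (auto simp: \<pi>_def intro: f_inv_into_f)
  then have "strict_mono_on {..<N} (t \<circ> \<pi>)"
    using h(2) by (auto simp: strict_mono_on_def)
  ultimately show thesis by (rule that)
qed

context
  fixes E :: "('k::real_or_complex, 'v::ab_group_add) nspace" and u and N and a :: "(nat \<Rightarrow> 'v) \<Rightarrow> 'k" and C
  assumes E: "normed_space E"
    and u: "u \<in> vecs (bidual E)" "nrm (bidual E) u \<le> 1"
    and a: "multilinear N E scalars a" "multilinear_bound N E scalars a C" "C \<ge> 0"
begin

interpretation E: normed_space E by (rule E)
interpretation D: normed_space "dual E" by (rule E.normed_space_dual)

text \<open>The z i are chosen one after the other by Goldstine's theorem: z i imitates u on the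
  finitely many functionals that arise by filling slots with earlier vectors. Exchanging u in slot n
  for z i then changes the value by less than \<eta>, provided that the slots before n carry vectors
  of smaller index.\<close>

lemma asymptotic_sequence:
  assumes r: "r > 1" and \<eta>: "\<eta> > 0"
  obtains z :: "nat \<Rightarrow> 'v" where "\<And>i. z i \<in> vecs E" "\<And>i. nrm E (z i) < r"
    "\<And>i n t. \<lbrakk>n < N; t \<in> {..<n} \<rightarrow>\<^sub>E {..<i}\<rbrakk> \<Longrightarrow>
       norm (partial_ext E u (Suc n) N a ((\<lambda>j\<in>{..<n}. z (t j))(n := z i)) -
         partial_ext E u n N a (\<lambda>j\<in>{..<n}. z (t j))) < \<eta>"
proof -
  let ?e = "\<lambda>n. partial_ext E u n N a"
  define P where "P f i y \<longleftrightarrow> y \<in> vecs E \<and> nrm E y < r \<and> (\<forall>n<N. \<forall>t\<in>{..<n} \<rightarrow>\<^sub>E {..<i}.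
      norm (?e (Suc n) ((\<lambda>j\<in>{..<n}. f (t j))(n := y)) - ?e n (\<lambda>j\<in>{..<n}. f (t j))) < \<eta>)" for f :: "nat \<Rightarrow> 'v" and i y
  \<comment> \<open>P f i y looks at f only below i, as the well-founded choice principle
    requires.\<close>
  have "\<exists>z. \<forall>i. P z i (z i)"
  proof (rule dependent_wf_choice[OF wf_less, where P = P])
    fix f g :: "nat \<Rightarrow> 'v" and i y
    assume "\<And>j. (j, i) \<in> {(x, y). x < y} \<Longrightarrow> f j = g j"
    then have eq: "(\<lambda>j\<in>{..<n}. f (t j)) = (\<lambda>j\<in>{..<n}. g (t j))" if "t \<in> {..<n} \<rightarrow>\<^sub>E {..<i}" for n t
      using that by (intro restrict_ext) auto
    show "P f i y = P g i y"
      unfolding P_def by (intro conj_cong refl all_cong ball_cong) (simp only: eq)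
  next
    fix i and f :: "nat \<Rightarrow> 'v"
    assume "\<And>j. (j, i) \<in> {(x, y). x < y} \<Longrightarrow> P f j (f j)"
    then have f: "f j \<in> vecs E" if "j < i" for j using that by (simp add: P_def)
    have ft: "(\<lambda>j\<in>{..<n}. f (t j)) \<in> tuples n E" if "t \<in> {..<n} \<rightarrow>\<^sub>E {..<i}" for n t
      using that by (intro tuplesI f) auto
    define I where "I = (\<Union>n\<in>{..<N}. (\<lambda>t. slot E u n (?e (Suc n)) (\<lambda>j\<in>{..<n}. f (t j))) ` ({..<n} \<rightarrow>\<^sub>E {..<i}))"
    have "finite I" unfolding I_def by (intro finite_UN_I finite_imageI finite_PiE) auto
    moreover have "I \<subseteq> vecs (dual E)"
    proof
      fix g assume "g \<in> I"
      then obtain n t where nt: "n < N" "t \<in> {..<n} \<rightarrow>\<^sub>E {..<i}" "g = slot E u n (?e (Suc n)) (\<lambda>j\<in>{..<n}. f (t j))"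
        by (auto simp: I_def)
      have "Suc n \<le> N" using nt(1) by simp
      note pe = partial_ext_multilinear[OF E u(1) a this]
      have "nrm (bidual E) u ^ (N - Suc n) * C \<ge> 0" using a(3) D.dual_sup_nonneg[OF u(1)] by simp
      then show "g \<in> vecs (dual E)"
        unfolding nt(3) by (intro slot_mem(1)[OF E pe[THEN conjunct1] pe[THEN conjunct2] _ ft[OF nt(2)]])
    qed
    moreover have "nrm (bidual E) u < r" using u(2) r by simp
    ultimately obtain y where y: "y \<in> vecs E" "nrm E y < r" "\<And>g. g \<in> I \<Longrightarrow> norm (g y - u g) < \<eta>"
      using goldstine[OF E u(1) _ _ _ \<eta>] by metis
    have "norm (?e (Suc n) ((\<lambda>j\<in>{..<n}. f (t j))(n := y)) - ?e n (\<lambda>j\<in>{..<n}. f (t j))) < \<eta>"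
      if nt: "n < N" "t \<in> {..<n} \<rightarrow>\<^sub>E {..<i}" for n t
    proof -
      let ?g = "slot E u n (?e (Suc n)) (\<lambda>j\<in>{..<n}. f (t j))"
      have "?g \<in> I" unfolding I_def using nt by blast
      from y(3)[OF this] show ?thesis
        unfolding partial_ext_step[OF nt(1)] by (simp only: slot_def y(1) if_True)
    qed
    then show "\<exists>y. P f i y" unfolding P_def using y by blast
  qed
  then obtain z where z: "\<And>i. P z i (z i)" by blast
  show thesis by (rule that[of z]) (use z in \<open>auto simp: P_def\<close>)
qed

text \<open>The average x of z 0, ..., z (M - 1) has norm at most r, and a at the diagonal of x is
  the mean of a over all index maps t. If t is injective, symmetry allows its indices to be sorted
  increasingly, and then the value of a is within N \<eta> of the extension. The proportion of the
  other maps tends to 0 as M grows.\<close>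

lemma davie_gamelin:
  assumes sym: "symmetric N E a" and q: "q \<ge> 0" "\<And>x. x \<in> vecs E \<Longrightarrow> norm (a (diag N x)) \<le> q * nrm E x ^ N"
  shows "norm (partial_ext E u 0 N a (\<lambda>_. undefined)) \<le> q"
proof -
  let ?e = "\<lambda>n. partial_ext E u n N a"
  let ?l = "?e 0 (\<lambda>_. undefined)"
  have main: "norm ?l \<le> q * r ^ N + N * \<eta>" if r: "r > 1" and \<eta>: "\<eta> > 0" for r \<eta> :: real
  proof -
    obtain z :: "nat \<Rightarrow> 'v" where z: "\<And>i. z i \<in> vecs E" "\<And>i. nrm E (z i) < r"
      and zz: "\<And>i n t. \<lbrakk>n < N; t \<in> {..<n} \<rightarrow>\<^sub>E {..<i}\<rbrakk> \<Longrightarrow>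
       norm (?e (Suc n) ((\<lambda>j\<in>{..<n}. z (t j))(n := z i)) - ?e n (\<lambda>j\<in>{..<n}. z (t j))) < \<eta>"
      using asymptotic_sequence[OF r \<eta>] by blast
    let ?z = "\<lambda>t. \<lambda>j\<in>{..<N}. z (t j)"
    have zt: "?z t \<in> tuples N E" for t by (intro tuplesI z)
    have increasing: "norm (a (?z t) - ?l) \<le> N * \<eta>" if t: "strict_mono_on {..<N} t" for t
    proof -
      have "norm (?e n (\<lambda>j\<in>{..<n}. z (t j)) - ?l) \<le> n * \<eta>" if "n \<le> N" for n
        using that
      proof (induction n)
        case 0
        have "(\<lambda>j\<in>{..<0::nat}. z (t j)) = (\<lambda>_. undefined)" by auto
        then show ?case by (simp only:) simp
      next
        case (Suc n)
        let ?t = "\<lambda>j\<in>{..<n}. t j"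
        have "?t \<in> {..<n} \<rightarrow>\<^sub>E {..<t n}"
          using t Suc.prems by (auto simp: strict_mono_on_def)
        moreover have "(\<lambda>j\<in>{..<n}. z (?t j)) = (\<lambda>j\<in>{..<n}. z (t j))" by (intro restrict_ext) simp
        moreover have "(\<lambda>j\<in>{..<Suc n}. z (t j)) = (\<lambda>j\<in>{..<n}. z (t j))(n := z (t n))"
          by (auto simp: fun_eq_iff less_Suc_eq)
        ultimately have "norm (?e (Suc n) (\<lambda>j\<in>{..<Suc n}. z (t j)) - ?e n (\<lambda>j\<in>{..<n}. z (t j))) < \<eta>"
          using zz[of n ?t "t n"] Suc.prems by (simp only: Suc_le_eq)
        moreover have "norm (?e n (\<lambda>j\<in>{..<n}. z (t j)) - ?l) \<le> n * \<eta>"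
          by (rule Suc.IH) (use Suc.prems in simp)
        ultimately have "norm (?e (Suc n) (\<lambda>j\<in>{..<Suc n}. z (t j)) - ?l) \<le> \<eta> + n * \<eta>"
          using norm_triangle_ineq[of "?e (Suc n) (\<lambda>j\<in>{..<Suc n}. z (t j)) - ?e n (\<lambda>j\<in>{..<n}. z (t j))" "?e n (\<lambda>j\<in>{..<n}. z (t j)) - ?l"]
          by (simp only: diff_add_cancel add_diff_eq)
        then show ?case unfolding of_nat_Suc by (simp only: distrib_right mult_1)
      qed
      from this[OF order_refl] show ?thesis by simp
    qed
    have injective: "norm (a (?z t) - ?l) \<le> N * \<eta>" if t: "inj_on t {..<N}" for t
    proof -
      obtain \<pi> where \<pi>: "\<pi> permutes {..<N}" "strict_mono_on {..<N} (t \<circ> \<pi>)"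
        using sorting_permutation[OF t] by blast
      have "?z t \<circ> \<pi> = ?z (t \<circ> \<pi>)"
        using permutes_in_image[OF \<pi>(1)] by (intro tuples_eqI[OF comp_permutation_tuple[OF \<pi>(1) zt] zt]) auto
      then have "a (?z t) = a (?z (t \<circ> \<pi>))"
        using sym \<pi>(1) zt[of t] unfolding symmetric_def by metis
      then show ?thesis using increasing[OF \<pi>(2)] by simp
    qed
    \<comment> \<open>A crude bound, used for the index maps that are not injective.\<close>
    define B where "B = C * r ^ N + norm ?l"
    have all: "norm (a (?z t) - ?l) \<le> B" for t
    proof -
      have "norm (a (?z t)) \<le> C * (\<Prod>i<N. nrm E (?z t i))"
        using multilinear_boundD[OF a(2) zt] by simp
      also have "\<dots> \<le> C * (\<Prod>i<N. r)"
        using z E.nrm_nonneg[OF z(1)] by (intro mult_left_mono prod_mono a(3)) (auto intro: less_imp_le)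
      finally show ?thesis using norm_triangle_ineq4[of "a (?z t)" ?l] by (simp add: B_def)
    qed
    have B: "B \<ge> 0" using order.trans[OF norm_ge_zero all] .
    define \<rho> where "\<rho> M = real (prod ((-) M) {0..<N}) / real M ^ N" for M
    have est: "norm ?l \<le> q * r ^ N + N * \<eta> + (1 - \<rho> M) * B" if M: "M \<ge> 1" for M :: nat
    proof -
      let ?c = "of_real (1 / real M) :: 'k"
      let ?F = "{..<N} \<rightarrow>\<^sub>E {..<M}"
      let ?J = "{t \<in> ?F. inj_on t {..<N}}"
      have finF: "finite ?F" by (intro finite_PiE) auto
      have cardF: "card ?F = M ^ N" by (simp add: card_PiE)
      have cardJ: "card ?J = prod ((-) M) {0..<N}" by (simp add: card_inj_on_subset_funcset)
      define x where "x = (\<Sum>j\<in>{..<M}. smul E ?c (z j))"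
      have xE: "x \<in> vecs E" unfolding x_def by (intro E.sum_mem E.smul_mem z)
      have "nrm E x \<le> (\<Sum>j\<in>{..<M}. nrm E (smul E ?c (z j)))"
        unfolding x_def by (intro E.nrm_sum E.smul_mem z)
      also have "\<dots> \<le> (\<Sum>j\<in>{..<M}. (1 / M) * r)"
        using z(2) M by (intro sum_mono) (simp add: E.nrm_smul[OF z(1)] norm_divide divide_right_mono less_imp_le)
      also have "\<dots> = r" using M by simp
      finally have xr: "nrm E x \<le> r" .
      have scaled: "a (\<lambda>i\<in>{..<N}. smul E ?c (z (t i))) = ?c ^ N * a (?z t)" for t
      proof -
        have "(\<lambda>i\<in>{..<N}. smul E ?c (z (t i))) = (\<lambda>i\<in>{..<N}. smul E ?c (?z t i))"
          by (intro restrict_ext) simp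
        then show ?thesis
          using multilinear_scale[OF E normed_space_scalars a(1) zt[of t], of "\<lambda>_. ?c"] by simp
      qed
      have "a (diag N x) = (\<Sum>t\<in>?F. a (\<lambda>i\<in>{..<N}. smul E ?c (z (t i))))"
        unfolding diag_def x_def by (intro multilinear_sum[OF E a(1)] E.smul_mem z) auto
      also have "\<dots> = ?c ^ N * (\<Sum>t\<in>?F. a (?z t))" by (simp only: scaled sum_distrib_left)
      also have "\<dots> - ?l = ?c ^ N * (\<Sum>t\<in>?F. a (?z t) - ?l)"
        using M by (simp add: sum_subtractf cardF right_diff_distrib power_divide flip: of_nat_power)
      finally have "norm (a (diag N x) - ?l) = (1 / M) ^ N * norm (\<Sum>t\<in>?F. a (?z t) - ?l)"
        by (simp only: norm_mult norm_power norm_of_real abs_divide abs_one abs_of_nat)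
      also have "\<dots> \<le> (1 / M) ^ N * (\<Sum>t\<in>?F. norm (a (?z t) - ?l))"
        by (intro mult_left_mono norm_sum) simp
      also have "(\<Sum>t\<in>?F. norm (a (?z t) - ?l)) = (\<Sum>t\<in>?F - ?J. norm (a (?z t) - ?l)) + (\<Sum>t\<in>?J. norm (a (?z t) - ?l))"
        by (rule sum.subset_diff) (use finF in auto)
      also have "\<dots> \<le> real (card (?F - ?J)) * B + real (card ?J) * (N * \<eta>)"
        by (intro add_mono sum_bounded_above all injective) auto
      also have "card (?F - ?J) = M ^ N - card ?J"
        using finF by (subst card_Diff_subset) (auto simp: cardF)
      also have "real (M ^ N - card ?J) * B + real (card ?J) * (N * \<eta>) \<le>
          (real M ^ N - real (card ?J)) * B + real M ^ N * (N * \<eta>)"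
      proof -
        have "card ?J \<le> M ^ N" using card_mono[OF finF, of ?J] cardF by auto
        then show ?thesis using \<eta> B
          by (intro add_mono mult_right_mono) (auto simp: of_nat_diff simp flip: of_nat_power)
      qed
      finally have "norm (a (diag N x) - ?l) \<le> (1 / M) ^ N * ((real M ^ N - real (card ?J)) * B + real M ^ N * (N * \<eta>))"
        by (simp add: mult_left_mono)
      also have "\<dots> = (1 - \<rho> M) * B + N * \<eta>"
        using M unfolding cardJ \<rho>_def by (simp add: field_simps power_divide)
      finally have "norm ?l \<le> norm (a (diag N x)) + ((1 - \<rho> M) * B + N * \<eta>)"
        using norm_triangle_ineq2[of ?l "a (diag N x)"] by (simp add: norm_minus_commute)
      also have "norm (a (diag N x)) \<le> q * r ^ N"
        using q(2)[OF xE] mult_left_mono[OF power_mono[OF xr E.nrm_nonneg[OF xE]] q(1), of N] by linarith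
      finally show ?thesis by simp
    qed
    \<comment> \<open>M tends to infinity for fixed r and \<eta>; only afterwards r = 1 + 1 / (k +
      1) and \<eta> = 1 / (k + 1) tend to 1 and 0.\<close>
    have "(\<lambda>M. q * r ^ N + N * \<eta> + (1 - \<rho> M) * B) \<longlonglongrightarrow> q * r ^ N + N * \<eta> + (1 - 1) * B"
      unfolding \<rho>_def by (intro tendsto_intros tendsto_falling_factorial_ratio)
    then have "(\<lambda>M. q * r ^ N + N * \<eta> + (1 - \<rho> M) * B) \<longlonglongrightarrow> q * r ^ N + N * \<eta>" by simp
    with est show ?thesis by (intro LIMSEQ_le_const) auto
  qed
  have "(\<lambda>k. 1 / real (Suc k)) \<longlonglongrightarrow> 0" by (rule LIMSEQ_Suc[OF lim_1_over_n])
  then have "(\<lambda>k. q * (1 + 1 / real (Suc k)) ^ N + N * (1 / real (Suc k))) \<longlonglongrightarrow> q * (1 + 0) ^ N + real N * 0"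
    by (intro tendsto_intros)
  then have "(\<lambda>k. q * (1 + 1 / real (Suc k)) ^ N + N * (1 / real (Suc k))) \<longlonglongrightarrow> q" by simp
  moreover have "norm ?l \<le> q * (1 + 1 / real (Suc k)) ^ N + N * (1 / real (Suc k))" for k
    by (rule main) simp_all
  ultimately show ?thesis by (intro LIMSEQ_le_const) auto
qed

end

section \<open>The Bishop--Phelps theorem\<close>

text \<open>Ekeland's principle yields a point where a slightly perturbed
  cone supports the unit ball, and the separating functional of that cone is the perturbation.\<close>

lemma ekeland_ball:
  fixes V :: "('a \<Rightarrow> 'k::real_or_complex) set"
  assumes V: "subspace_fun V" and \<pi>: "seminorm_fun V \<pi>"
    and complete: "\<And>s. \<lbrakk>\<And>n. s n \<in> V; summable (\<lambda>n. \<pi> (s (Suc n) - s n))\<rbrakk> \<Longrightarrow> \<exists>l\<in>V. (\<lambda>n. \<pi> (s n - l)) \<longlonglongrightarrow> 0"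
    and f: "linear_fun V f" "\<And>v. v \<in> V \<Longrightarrow> norm (f v) \<le> C * \<pi> v" and \<epsilon>: "\<epsilon> > 0"
  obtains u where "u \<in> V" "\<pi> u \<le> 1" "\<And>v. \<lbrakk>v \<in> V; \<pi> v \<le> 1\<rbrakk> \<Longrightarrow> re (f (v - u)) \<le> \<epsilon> * \<pi> (v - u)"
proof -
  note dV = subspace_fun_diff[OF V]
  define \<phi> where "\<phi> v = re (f v)" for v
  have \<phi>_diff: "\<phi> (v - w) = \<phi> v - \<phi> w" if "v \<in> V" "w \<in> V" for v w
    by (simp add: \<phi>_def linear_fun_diff[OF f(1) V that] re_diff)
  have \<phi>_le: "\<bar>\<phi> v\<bar> \<le> C * \<pi> v" if "v \<in> V" for v
    unfolding \<phi>_def using abs_re_le[of "f v"] f(2)[OF that] by linarith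
  have \<pi>_tri: "\<pi> (u - w) \<le> \<pi> (u - v) + \<pi> (v - w)" if "u \<in> V" "v \<in> V" "w \<in> V" for u v w
    using seminorm_fun_add[OF \<pi> dV[OF that(1,2)] dV[OF that(2,3)]] by simp
  have \<pi>_comm: "\<pi> (u - w) = \<pi> (w - u)" if "u \<in> V" "w \<in> V" for u w
    using seminorm_fun_minus[OF \<pi> dV[OF that]] by simp
  define B where "B = {v \<in> V. \<pi> v \<le> 1}"
  have B0: "0 \<in> B" by (simp add: B_def subspace_fun_zero[OF V] seminorm_fun_zero[OF \<pi> V])
  \<comment> \<open>The points above u in Ekeland's order: moving there must gain at least
    \<epsilon> times the distance.\<close>
  define S where "S u = {v \<in> B. \<epsilon> * \<pi> (v - u) \<le> \<phi> v - \<phi> u}" for u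
  have BV: "v \<in> V" if "v \<in> B" for v using that by (simp add: B_def)
  have bound: "\<phi> v \<le> max C 0" if "v \<in> B" for v
  proof -
    have "\<phi> v \<le> C * \<pi> v" using \<phi>_le[OF BV[OF that]] by linarith
    also have "\<dots> \<le> max C 0 * \<pi> v"
      using seminorm_fun_nonneg[OF \<pi> V BV[OF that]] by (intro mult_right_mono) auto
    also have "\<dots> \<le> max C 0 * 1" using that by (intro mult_left_mono) (auto simp: B_def)
    finally show ?thesis by simp
  qed
  have self: "u \<in> S u" if "u \<in> B" for u using that by (simp add: S_def seminorm_fun_zero[OF \<pi> V])
  have trans: "w \<in> S u" if "v \<in> S u" "w \<in> S v" "u \<in> B" for u v w
    using that \<epsilon> \<pi>_tri[of w v u] by (auto simp: S_def BV dest: mult_left_mono[of _ _ \<epsilon>] simp: distrib_left)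
  \<comment> \<open>s (n + 1) is chosen in S (s n) within 2^-n of the supremum of \<phi>
    there.\<close>
  have "\<exists>s. \<forall>n. s n \<in> B \<and> (s (Suc n) \<in> S (s n) \<and> (\<forall>v\<in>S (s n). \<phi> v \<le> \<phi> (s (Suc n)) + (1 / 2) ^ n))"
  proof (rule dependent_nat_choice)
    show "\<exists>x. x \<in> B" using B0 by blast
    fix u and n :: nat assume u: "u \<in> B"
    have ne: "S u \<noteq> {}" using self[OF u] by blast
    have bdd: "bdd_above (\<phi> ` S u)" using bound by (auto intro!: bdd_aboveI2[of _ _ "max C 0"] simp: S_def)
    have "(SUP v\<in>S u. \<phi> v) - (1 / 2) ^ n < (SUP v\<in>S u. \<phi> v)" by simp
    then obtain w where w: "w \<in> S u" "(SUP v\<in>S u. \<phi> v) - (1 / 2) ^ n < \<phi> w"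
      using less_cSUP_iff[OF ne bdd] by blast
    have "\<phi> v \<le> \<phi> w + (1 / 2) ^ n" if "v \<in> S u" for v
      using cSUP_upper[OF that bdd] w(2) by linarith
    with w(1) show "\<exists>y. y \<in> B \<and> (y \<in> S u \<and> (\<forall>v\<in>S u. \<phi> v \<le> \<phi> y + (1 / 2) ^ n))"
      by (auto simp: S_def)
  qed
  then obtain s where s: "\<And>n. s n \<in> B" "\<And>n. s (Suc n) \<in> S (s n)"
    "\<And>n v. v \<in> S (s n) \<Longrightarrow> \<phi> v \<le> \<phi> (s (Suc n)) + (1 / 2) ^ n" by blast
  have step: "\<epsilon> * \<pi> (s (Suc n) - s n) \<le> \<phi> (s (Suc n)) - \<phi> (s n)" for n
    using s(2)[of n] by (simp add: S_def)
  \<comment> \<open>The gains telescope and \<phi> is bounded on the ball, so the path s has finite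
    length and converges.\<close>
  have tele: "(\<Sum>n<m. \<epsilon> * \<pi> (s (Suc n) - s n)) \<le> \<phi> (s m) - \<phi> (s 0)" for m
  proof (induction m)
    case (Suc m)
    then show ?case using step[of m] unfolding sum.lessThan_Suc by linarith
  qed simp
  have nn: "0 \<le> \<pi> (s (Suc n) - s n)" for n
    by (intro seminorm_fun_nonneg[OF \<pi> V] dV BV s(1))
  have "summable (\<lambda>n. \<epsilon> * \<pi> (s (Suc n) - s n))"
  proof (rule bounded_imp_summable[of _ "max C 0 - \<phi> (s 0)"])
    show "(\<Sum>n\<le>m. \<epsilon> * \<pi> (s (Suc n) - s n)) \<le> max C 0 - \<phi> (s 0)" for m
      using tele[of "Suc m"] bound[OF s(1), of "Suc m"] by (simp add: lessThan_Suc_atMost)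
  qed (use nn \<epsilon> in simp)
  then have "summable (\<lambda>n. \<pi> (s (Suc n) - s n))"
    using \<epsilon> by (simp add: summable_cmult_iff)
  then obtain l where l: "l \<in> V" and lim: "(\<lambda>n. \<pi> (s n - l)) \<longlonglongrightarrow> 0"
    using complete[of s] s(1) BV by blast
  have lim_\<phi>: "(\<lambda>n. \<phi> (s n)) \<longlonglongrightarrow> \<phi> l"
  proof (rule LIM_zero_cancel, rule tendsto_0_le[OF lim])
    show "eventually (\<lambda>n. norm (\<phi> (s n) - \<phi> l) \<le> norm (\<pi> (s n - l)) * \<bar>C\<bar>) sequentially"
    proof (rule always_eventually, rule allI)
      fix n
      have "\<bar>\<phi> (s n - l)\<bar> \<le> C * \<pi> (s n - l)" by (intro \<phi>_le dV BV s(1) l)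
      also have "\<dots> \<le> \<bar>C\<bar> * \<bar>\<pi> (s n - l)\<bar>" by (metis abs_ge_self abs_mult)
      finally show "norm (\<phi> (s n) - \<phi> l) \<le> norm (\<pi> (s n - l)) * \<bar>C\<bar>"
        by (simp add: \<phi>_diff[OF BV[OF s(1)] l] mult.commute)
    qed
  qed
  have lim_\<pi>: "(\<lambda>n. \<pi> (s n - w)) \<longlonglongrightarrow> \<pi> (l - w)" if w: "w \<in> V" for w
  proof (rule LIM_zero_cancel, rule tendsto_0_le[OF lim])
    show "eventually (\<lambda>n. norm (\<pi> (s n - w) - \<pi> (l - w)) \<le> norm (\<pi> (s n - l)) * 1) sequentially"
    proof (rule always_eventually, rule allI)
      fix n
      have sV: "s n \<in> V" by (rule BV[OF s(1)])
      have "\<bar>\<pi> (s n - w) - \<pi> (l - w)\<bar> \<le> \<pi> (s n - l)"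
        using \<pi>_tri[OF sV l w] \<pi>_tri[OF l sV w] \<pi>_comm[OF l sV] by simp
      then show "norm (\<pi> (s n - w) - \<pi> (l - w)) \<le> norm (\<pi> (s n - l)) * 1"
        by simp
    qed
  qed
  have "s m \<in> S (s n)" if "n \<le> m" for n m
    using that by (induction m rule: dec_induct) (use self s trans in blast)+
  then have mem: "\<epsilon> * \<pi> (s m - s n) \<le> \<phi> (s m) - \<phi> (s n)" if "n \<le> m" for n m
    using that by (simp add: S_def)
  have lS: "\<epsilon> * \<pi> (l - s n) \<le> \<phi> l - \<phi> (s n)" for n
  proof (rule LIMSEQ_le)
    show "(\<lambda>m. \<epsilon> * \<pi> (s m - s n)) \<longlonglongrightarrow> \<epsilon> * \<pi> (l - s n)"
      by (intro tendsto_mult_left lim_\<pi> BV s(1))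
    show "(\<lambda>m. \<phi> (s m) - \<phi> (s n)) \<longlonglongrightarrow> \<phi> l - \<phi> (s n)"
      by (intro tendsto_diff lim_\<phi> tendsto_const)
    show "\<exists>N. \<forall>m\<ge>N. \<epsilon> * \<pi> (s m - s n) \<le> \<phi> (s m) - \<phi> (s n)" using mem by blast
  qed
  have "\<pi> l \<le> 1"
    using lim_\<pi>[OF subspace_fun_zero[OF V]] s(1) by (intro LIMSEQ_le_const2[of "\<lambda>n. \<pi> (s n - 0)"]) (auto simp: B_def)
  then have lB: "l \<in> B" using l by (simp add: B_def)
  show thesis
  proof (rule that[OF l \<open>\<pi> l \<le> 1\<close>], rule ccontr)
    fix v assume v: "v \<in> V" "\<pi> v \<le> 1" and "\<not> re (f (v - l)) \<le> \<epsilon> * \<pi> (v - l)"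
    then have gt: "\<epsilon> * \<pi> (v - l) < \<phi> v - \<phi> l" using \<phi>_diff[OF v(1) l] by (simp add: \<phi>_def)
    have vl: "v \<in> S l" using gt v by (simp add: S_def B_def)
    \<comment> \<open>By transitivity a point above l is above every s n, where hardly anything is
      left to gain.\<close>
    have "\<phi> v \<le> \<phi> l + (1 / 2) ^ n" for n
    proof -
      have "v \<in> S (s n)"
      proof (rule trans[OF _ vl s(1)])
        show "l \<in> S (s n)" using lS[of n] lB by (simp add: S_def)
      qed
      moreover have "\<phi> (s (Suc n)) \<le> \<phi> l"
      proof -
        have "0 \<le> \<epsilon> * \<pi> (l - s (Suc n))"
          using \<epsilon> seminorm_fun_nonneg[OF \<pi> V dV[OF l BV[OF s(1)]]] by simp
        then show ?thesis using lS[of "Suc n"] by linarith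
      qed
      ultimately show ?thesis using s(3)[of v n] by linarith
    qed
    moreover have "(\<lambda>n. \<phi> l + (1 / 2) ^ n) \<longlonglongrightarrow> \<phi> l + 0"
      by (intro tendsto_intros LIMSEQ_realpow_zero) auto
    ultimately have "\<phi> v \<le> \<phi> l" by (intro LIMSEQ_le_const[of _ _ "\<phi> v"]) auto
    moreover have "0 \<le> \<epsilon> * \<pi> (v - l)" using \<epsilon> seminorm_fun_nonneg[OF \<pi> V dV[OF v(1) l]] by simp
    ultimately show False using gt by linarith
  qed
qed

text \<open>K is the cone of directions from u into the ball. The functional p w, the infimum over k
  in K of \<epsilon> \<pi> (w - k) - \<phi> k, satisfies p w \<le> \<epsilon> \<pi> w (take k = 0)
  and p k \<le> - \<phi> k on K. It is finite because \<phi> \<le> \<epsilon> \<pi> on K, which is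
  what Ekeland's principle provides. A linear G with re G \<le> p is therefore small, and re (f + G)
  is at most 0 on K, so its maximum on the ball is at u.\<close>

lemma bishop_phelps:
  fixes V :: "('a \<Rightarrow> 'k::real_or_complex) set"
  assumes V: "subspace_fun V" and \<pi>: "seminorm_fun V \<pi>"
    and complete: "\<And>s. \<lbrakk>\<And>n. s n \<in> V; summable (\<lambda>n. \<pi> (s (Suc n) - s n))\<rbrakk> \<Longrightarrow> \<exists>l\<in>V. (\<lambda>n. \<pi> (s n - l)) \<longlonglongrightarrow> 0"
    and f: "linear_fun V f" "\<And>v. v \<in> V \<Longrightarrow> norm (f v) \<le> C * \<pi> v" and \<epsilon>: "\<epsilon> > 0"
  obtains u G where "u \<in> V" "\<pi> u \<le> 1" "linear_fun V G" "\<And>v. v \<in> V \<Longrightarrow> norm (G v) \<le> \<epsilon> * \<pi> v"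
    "\<And>v. \<lbrakk>v \<in> V; \<pi> v \<le> 1\<rbrakk> \<Longrightarrow> re (f v + G v) \<le> re (f u + G u)"
proof -
  note cl = subspace_fun_add[OF V] subspace_fun_rscale[OF V] subspace_fun_zero[OF V] subspace_fun_diff[OF V]
  obtain u where u: "u \<in> V" "\<pi> u \<le> 1" and ek: "\<And>v. \<lbrakk>v \<in> V; \<pi> v \<le> 1\<rbrakk> \<Longrightarrow> re (f (v - u)) \<le> \<epsilon> * \<pi> (v - u)"
    using ekeland_ball[OF V \<pi> complete f \<epsilon>] by blast
  define K where "K = {rscale t (v - u) | t v. t \<ge> 0 \<and> v \<in> V \<and> \<pi> v \<le> 1}"
  have KV: "k \<in> V" if "k \<in> K" for k using that u(1) by (auto simp: K_def intro!: cl)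
  have K_u: "v - u \<in> K" if "v \<in> V" "\<pi> v \<le> 1" for v
    unfolding K_def using that by (intro CollectI exI[of _ 1] exI[of _ v]) simp
  have K0: "0 \<in> K" using K_u[OF u] by simp
  have K_scale: "rscale r k \<in> K" if "k \<in> K" "r \<ge> 0" for r k
  proof -
    obtain t v where "k = rscale t (v - u)" "t \<ge> 0" "v \<in> V" "\<pi> v \<le> 1" using \<open>k \<in> K\<close> by (auto simp: K_def)
    then show ?thesis unfolding K_def using \<open>r \<ge> 0\<close> by (intro CollectI exI[of _ "r * t"] exI[of _ v]) simp
  qed
  have K_add: "k + k' \<in> K" if "k \<in> K" "k' \<in> K" for k k'
  proof -
    obtain t v where k: "k = rscale t (v - u)" "t \<ge> 0" "v \<in> V" "\<pi> v \<le> 1" using \<open>k \<in> K\<close> by (auto simp: K_def)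
    obtain t' v' where k': "k' = rscale t' (v' - u)" "t' \<ge> 0" "v' \<in> V" "\<pi> v' \<le> 1" using \<open>k' \<in> K\<close> by (auto simp: K_def)
    show ?thesis
    proof (cases "t + t' = 0")
      case True
      then have "t = 0" "t' = 0" using k(2) k'(2) by auto
      then show ?thesis using k k' K0 by simp
    next
      case False
      then have T: "t + t' > 0" using k(2) k'(2) by linarith
      \<comment> \<open>A sum of multiples t and t' of two directions is the multiple t + t' of the
        direction to this convex combination.\<close>
      let ?w = "rscale (t / (t + t')) v + rscale (t' / (t + t')) v'"
      have "\<pi> ?w \<le> (t / (t + t')) * \<pi> v + (t' / (t + t')) * \<pi> v'"
        using seminorm_fun_add[OF \<pi>, of "rscale (t / (t + t')) v" "rscale (t' / (t + t')) v'"] k k' T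
        by (simp add: cl seminorm_fun_rscale[OF \<pi>])
      also have "\<dots> \<le> (t / (t + t')) * 1 + (t' / (t + t')) * 1"
        using k k' T by (intro add_mono mult_left_mono) auto
      also have "\<dots> = 1" using T by (simp add: add_divide_distrib[symmetric])
      finally have "\<pi> ?w \<le> 1" .
      moreover have "k + k' = rscale (t + t') (?w - u)"
      proof -
        have "rscale (t + t') (?w - u) = rscale (t + t') ?w + rscale (t + t') (rscale (- 1) u)"
          unfolding rscale_add_right[symmetric] rscale_minus_one by simp
        also have "\<dots> = (rscale t v + rscale t (rscale (- 1) u)) + (rscale t' v' + rscale t' (rscale (- 1) u))"
        proof -
          have "rscale (t + t') ?w = rscale t v + rscale t' v'"
            using T by (simp only: rscale_add_right rscale_simps) simp
          then show ?thesis
            unfolding rscale_add_left[of t t' "rscale (- 1) u"] by (simp only: add.assoc add.left_commute)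
        qed
        also have "\<dots> = k + k'"
          unfolding k k' rscale_add_right[symmetric] rscale_minus_one by simp
        finally show ?thesis by simp
      qed
      ultimately show ?thesis
        unfolding K_def using T k k' by (intro CollectI exI[of _ "t + t'"] exI[of _ ?w]) (auto intro!: cl)
    qed
  qed
  define \<phi> where "\<phi> v = re (f v)" for v
  have \<phi>_add: "\<phi> (v + w) = \<phi> v + \<phi> w" if "v \<in> V" "w \<in> V" for v w
    by (simp add: \<phi>_def linear_fun_add[OF f(1) that] re_add)
  have \<phi>_scale: "\<phi> (rscale r v) = r * \<phi> v" if "v \<in> V" for r v
    by (simp add: \<phi>_def linear_fun_rscale[OF f(1) that] re_of_real_mult)
  have \<phi>_K: "\<phi> k \<le> \<epsilon> * \<pi> k" if "k \<in> K" for k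
  proof -
    obtain t v where k: "k = rscale t (v - u)" "t \<ge> 0" "v \<in> V" "\<pi> v \<le> 1" using \<open>k \<in> K\<close> by (auto simp: K_def)
    have vu: "v - u \<in> V" by (intro cl k u)
    have "t * \<phi> (v - u) \<le> t * (\<epsilon> * \<pi> (v - u))"
      using ek[OF k(3,4)] k(2) by (intro mult_left_mono) (auto simp: \<phi>_def)
    then show ?thesis unfolding k(1) using k(2) by (simp add: \<phi>_scale[OF vu] seminorm_fun_rscale[OF \<pi> vu] mult.left_commute)
  qed
  define q where "q w k = \<epsilon> * \<pi> (w - k) - \<phi> k" for w k
  define p where "p w = (INF k\<in>K. q w k)" for w
  have lower: "- (\<epsilon> * \<pi> w) \<le> q w k" if w: "w \<in> V" and k: "k \<in> K" for w k
  proof -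
    have "\<pi> k \<le> \<pi> w + \<pi> (w - k)"
      using seminorm_fun_diff[OF \<pi> V w cl(4)[OF w KV[OF k]]] by simp
    then have "\<epsilon> * \<pi> k \<le> \<epsilon> * \<pi> w + \<epsilon> * \<pi> (w - k)" using \<epsilon> by (simp flip: distrib_left)
    then show ?thesis using \<phi>_K[OF k] by (simp add: q_def)
  qed
  have p_le: "p w \<le> q w k" if "w \<in> V" "k \<in> K" for w k
    unfolding p_def by (rule cINF_lower[OF _ that(2)]) (use lower that(1) in \<open>auto intro!: bdd_belowI\<close>)
  have p_ge: "c \<le> p w" if "\<And>k. k \<in> K \<Longrightarrow> c \<le> q w k" for c w
    unfolding p_def by (rule cINF_greatest) (use K0 that in auto)
  have "sublinear V p"
  proof (rule sublinearI[OF V])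
    fix v w assume vw: "v \<in> V" "w \<in> V"
    have le: "p (v + w) \<le> q v k + q w k'" if k: "k \<in> K" "k' \<in> K" for k k'
    proof -
      have "p (v + w) \<le> q (v + w) (k + k')" by (intro p_le cl vw K_add k)
      moreover have "(v + w) - (k + k') = (v - k) + (w - k')" by (simp add: algebra_simps)
      moreover have "\<pi> ((v - k) + (w - k')) \<le> \<pi> (v - k) + \<pi> (w - k')"
        by (intro seminorm_fun_add[OF \<pi>] cl vw KV k)
      then have "\<epsilon> * \<pi> ((v - k) + (w - k')) \<le> \<epsilon> * \<pi> (v - k) + \<epsilon> * \<pi> (w - k')"
        using \<epsilon> by (simp flip: distrib_left)
      ultimately show ?thesis using \<phi>_add[OF KV[OF k(1)] KV[OF k(2)]] by (simp only: q_def)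
    qed
    have "p (v + w) - q w k' \<le> p v" if "k' \<in> K" for k'
      using le[OF _ that] by (intro p_ge) (simp add: algebra_simps)
    then have "p (v + w) - p v \<le> p w" by (intro p_ge) (simp add: algebra_simps)
    then show "p (v + w) \<le> p v + p w" by simp
  next
    fix r :: real and v assume r: "r > 0" and v: "v \<in> V"
    have "p (rscale r v) / r \<le> q v k" if k: "k \<in> K" for k
    proof -
      have "p (rscale r v) \<le> q (rscale r v) (rscale r k)" using r by (intro p_le cl v K_scale k) auto
      also have "rscale r v - rscale r k = rscale r (v - k)"
        by (auto simp: rscale_def algebra_simps)
      then have "q (rscale r v) (rscale r k) = r * q v k"
        using r seminorm_fun_rscale[OF \<pi> cl(4)[OF v KV[OF k]], of r] \<phi>_scale[OF KV[OF k], of r]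
        by (simp add: q_def algebra_simps)
      finally show ?thesis using r by (simp add: field_simps)
    qed
    then have "p (rscale r v) / r \<le> p v" by (rule p_ge)
    then show "p (rscale r v) \<le> r * p v" using r by (simp add: field_simps)
  next
    have "p 0 \<le> 0"
      using p_le[OF cl(3) K0] \<phi>_scale[OF cl(3), of 0] by (simp add: q_def seminorm_fun_zero[OF \<pi> V])
    moreover have "0 \<le> p 0" using lower[OF cl(3)] by (intro p_ge) (simp add: seminorm_fun_zero[OF \<pi> V])
    ultimately show "p 0 = 0" by simp
  qed
  then obtain G where G: "linear_fun V G" "\<And>v. v \<in> V \<Longrightarrow> re (G v) \<le> p v"
    using sublinear_minorant[OF V] by blast
  have "\<phi> 0 = 0" using \<phi>_scale[OF cl(3), of 0] by simp
  then have re_G: "re (G v) \<le> \<epsilon> * \<pi> v" if "v \<in> V" for v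
    using G(2)[OF that] p_le[OF that K0] by (simp add: q_def)
  have "seminorm_fun V (\<lambda>v. \<epsilon> * \<pi> v)"
    using \<pi> \<epsilon> unfolding seminorm_fun_def by (auto simp: mult.left_commute simp flip: distrib_left)
  from norm_le_of_re_le[OF V this G(1) re_G] have "norm (G v) \<le> \<epsilon> * \<pi> v" if "v \<in> V" for v
    using that by blast
  moreover have "re (f v + G v) \<le> re (f u + G u)" if v: "v \<in> V" "\<pi> v \<le> 1" for v
  proof -
    have vu: "v - u \<in> V" by (intro cl v u)
    have "re (G (v - u)) \<le> q (v - u) (v - u)" using G(2)[OF vu] p_le[OF vu K_u[OF v]] by linarith
    then have "re (G (v - u)) + re (f (v - u)) \<le> 0"
      by (simp add: q_def \<phi>_def seminorm_fun_zero[OF \<pi> V])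
    then show ?thesis
      by (simp add: linear_fun_diff[OF G(1) V v(1) u(1)] linear_fun_diff[OF f(1) V v(1) u(1)] re_diff re_add)
  qed
  ultimately show thesis using that[OF u G(1)] by blast
qed

section \<open>Sums of point evaluations\<close>

definition ell1 :: "('p \<Rightarrow> 'k::real_or_complex) set" where
  "ell1 = {m. (\<lambda>p. norm (m p)) summable_on UNIV}"

definition mass :: "('p \<Rightarrow> 'k::real_or_complex) \<Rightarrow> real" where
  "mass m = (\<Sum>\<^sub>\<infinity>p. norm (m p))"

definition pairing :: "('i \<Rightarrow> 'p \<Rightarrow> 'k::real_or_complex) \<Rightarrow> ('p \<Rightarrow> 'k) \<Rightarrow> 'i \<Rightarrow> 'k" where
  "pairing e m = (\<lambda>P. \<Sum>\<^sub>\<infinity>p. m p * e P p)"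

text \<open>The quotient of \<open>ell1\<close> by the families that pair to 0, realised as a space
  of functions of the index. For \<open>poly_eval\<close> it is a model of the completed projective
  tensor product of the symmetric N-th power of X with Y, whose dual is the space of
  polynomials.\<close>

definition ell1_space :: "('i \<Rightarrow> 'p \<Rightarrow> 'k::real_or_complex) \<Rightarrow> ('i \<Rightarrow> 'k) set" where
  "ell1_space e = pairing e ` ell1"

definition quotient_norm :: "('i \<Rightarrow> 'p \<Rightarrow> 'k::real_or_complex) \<Rightarrow> ('i \<Rightarrow> 'k) \<Rightarrow> real" where
  "quotient_norm e u = (INF m\<in>{m \<in> ell1. pairing e m = u}. mass m)"

lemma mass_nonneg: "0 \<le> mass m"
  unfolding mass_def by (rule infsum_nonneg) simp

lemma ell1_add:
  assumes "m \<in> ell1" "n \<in> ell1"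
  shows "(\<lambda>p. m p + n p) \<in> ell1" and "mass (\<lambda>p. m p + n p) \<le> mass m + mass n"
proof -
  have s: "(\<lambda>p. norm (m p) + norm (n p)) summable_on UNIV"
    using assms by (intro summable_on_add) (auto simp: ell1_def)
  have s': "(\<lambda>p. norm (m p + n p)) summable_on UNIV"
    by (rule Infinite_Sum.abs_summable_on_comparison_test'[OF s]) (rule norm_triangle_ineq)
  then show "(\<lambda>p. m p + n p) \<in> ell1" by (simp add: ell1_def)
  have "mass (\<lambda>p. m p + n p) \<le> (\<Sum>\<^sub>\<infinity>p. norm (m p) + norm (n p))"
    unfolding mass_def by (rule infsum_mono[OF s' s norm_triangle_ineq])
  also have "\<dots> = mass m + mass n"
    using assms unfolding mass_def by (intro infsum_add) (auto simp: ell1_def)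
  finally show "mass (\<lambda>p. m p + n p) \<le> mass m + mass n" .
qed

lemma ell1_scale:
  assumes "m \<in> ell1"
  shows "(\<lambda>p. c * m p) \<in> ell1" and "mass (\<lambda>p. c * m p) = norm c * mass m"
  using assms by (auto simp: ell1_def mass_def norm_mult infsum_cmult_right' intro: summable_on_cmult_right)

lemma ell1_finite_support:
  assumes "finite F"
  shows "(\<lambda>p. if p \<in> F then m p else 0) \<in> ell1" and "mass (\<lambda>p. if p \<in> F then m p else 0) = (\<Sum>p\<in>F. norm (m p))"
proof -
  have eq: "(\<lambda>p. norm (if p \<in> F then m p else 0)) = (\<lambda>p. if p \<in> F then norm (m p) else 0)" by auto
  have "((\<lambda>p. if p \<in> F then norm (m p) else 0) has_sum (\<Sum>p\<in>F. norm (m p))) UNIV"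
    by (subst has_sum_cong_neutral[where T = F and g = "\<lambda>p. norm (m p)"]) (auto intro: has_sum_finite assms)
  then show "(\<lambda>p. if p \<in> F then m p else 0) \<in> ell1" "mass (\<lambda>p. if p \<in> F then m p else 0) = (\<Sum>p\<in>F. norm (m p))"
    unfolding ell1_def mass_def mem_Collect_eq eq by (auto simp: summable_on_def infsumI)
qed

context
  fixes e :: "'i \<Rightarrow> 'p \<Rightarrow> 'k::real_or_complex"
  assumes bounded: "\<exists>c\<ge>0. \<forall>p. norm (e P p) \<le> c"
begin

lemma pairing_summable:
  assumes "m \<in> ell1"
  shows "(\<lambda>p. norm (m p * e P p)) summable_on UNIV" and "(\<lambda>p. m p * e P p) summable_on UNIV"
proof -
  obtain c where c: "c \<ge> 0" "\<And>p. norm (e P p) \<le> c" using bounded by blast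
  show s: "(\<lambda>p. norm (m p * e P p)) summable_on UNIV"
  proof (rule Infinite_Sum.abs_summable_on_comparison_test')
    show "(\<lambda>p. c * norm (m p)) summable_on UNIV"
      using assms by (intro summable_on_cmult_right) (simp add: ell1_def)
    show "norm (m p * e P p) \<le> c * norm (m p)" for p
      using mult_right_mono[OF c(2)[of p], of "norm (m p)"] by (simp add: norm_mult mult.commute)
  qed
  show "(\<lambda>p. m p * e P p) summable_on UNIV" by (rule Infinite_Sum.abs_summable_summable[OF s])
qed

lemma norm_pairing_le:
  assumes m: "m \<in> ell1" and c: "\<And>p. norm (e P p) \<le> c"
  shows "norm (pairing e m P) \<le> c * mass m"
proof -
  have "norm (pairing e m P) \<le> (\<Sum>\<^sub>\<infinity>p. norm (m p * e P p))"
    unfolding pairing_def by (rule norm_infsum_bound[OF pairing_summable(1)[OF m]])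
  also have "\<dots> \<le> (\<Sum>\<^sub>\<infinity>p. c * norm (m p))"
  proof (rule infsum_mono[OF pairing_summable(1)[OF m]])
    show "(\<lambda>p. c * norm (m p)) summable_on UNIV"
      using m by (intro summable_on_cmult_right) (simp add: ell1_def)
    show "norm (m p * e P p) \<le> c * norm (m p)" for p
      using mult_right_mono[OF c[of p], of "norm (m p)"] by (simp add: norm_mult mult.commute)
  qed
  also have "\<dots> = c * mass m" by (simp add: mass_def infsum_cmult_right')
  finally show ?thesis .
qed

lemma pairing_add: "m \<in> ell1 \<Longrightarrow> n \<in> ell1 \<Longrightarrow> pairing e (\<lambda>p. m p + n p) = pairing e m + pairing e n"
  using pairing_summable(2) by (auto simp: pairing_def fun_eq_iff distrib_right intro!: infsum_add)

lemma pairing_scale: "pairing e (\<lambda>p. c * m p) = (\<lambda>P. c * pairing e m P)"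
  by (simp add: pairing_def mult.assoc infsum_cmult_right')

lemma pairing_finite_support:
  assumes "finite F"
  shows "pairing e (\<lambda>p. if p \<in> F then m p else 0) = (\<lambda>P. \<Sum>p\<in>F. m p * e P p)"
proof
  fix P
  have "((\<lambda>p. (if p \<in> F then m p else 0) * e P p) has_sum (\<Sum>p\<in>F. m p * e P p)) UNIV"
    by (subst has_sum_cong_neutral[where T = F and g = "\<lambda>p. m p * e P p"]) (auto intro: has_sum_finite assms)
  then show "pairing e (\<lambda>p. if p \<in> F then m p else 0) P = (\<Sum>p\<in>F. m p * e P p)"
    unfolding pairing_def by (rule infsumI)
qed

lemma subspace_ell1_space: "subspace_fun (ell1_space e)"
  unfolding subspace_fun_def
proof (intro conjI ballI allI)
  have "(\<lambda>p. 0) \<in> ell1" by (simp add: ell1_def)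
  moreover have "pairing e (\<lambda>p. 0) = 0" by (simp add: pairing_def zero_fun_def)
  ultimately show "0 \<in> ell1_space e" unfolding ell1_space_def by (metis imageI)
next
  fix v w assume "v \<in> ell1_space e" "w \<in> ell1_space e"
  then obtain m n where "m \<in> ell1" "n \<in> ell1" "v = pairing e m" "w = pairing e n" by (auto simp: ell1_space_def)
  then show "v + w \<in> ell1_space e"
    unfolding ell1_space_def by (intro image_eqI[of _ _ "\<lambda>p. m p + n p"]) (simp_all add: pairing_add ell1_add(1))
next
  fix c v assume "v \<in> ell1_space e"
  then obtain m where "m \<in> ell1" "v = pairing e m" by (auto simp: ell1_space_def)
  then show "(\<lambda>i. c * v i) \<in> ell1_space e"
    unfolding ell1_space_def by (intro image_eqI[of _ _ "\<lambda>p. c * m p"]) (simp_all add: pairing_scale ell1_scale(1))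
qed

lemma quotient_norm_le: "m \<in> ell1 \<Longrightarrow> quotient_norm e (pairing e m) \<le> mass m"
  unfolding quotient_norm_def by (rule cINF_lower) (auto intro!: bdd_belowI[of _ 0] simp: mass_nonneg)

lemma quotient_norm_approx:
  assumes u: "u \<in> ell1_space e" and \<eta>: "quotient_norm e u < \<eta>"
  shows "\<exists>m\<in>ell1. pairing e m = u \<and> mass m < \<eta>"
proof -
  have ne: "{m \<in> ell1. pairing e m = u} \<noteq> {}" using u by (auto simp: ell1_space_def)
  have "bdd_below (mass ` {m \<in> ell1. pairing e m = u})" by (auto intro!: bdd_belowI[of _ 0] simp: mass_nonneg)
  with \<eta> show ?thesis unfolding quotient_norm_def using cINF_less_iff[OF ne] by blast
qed

lemma quotient_norm_nonneg: "u \<in> ell1_space e \<Longrightarrow> 0 \<le> quotient_norm e u"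
  unfolding quotient_norm_def by (rule cINF_greatest) (auto simp: mass_nonneg ell1_space_def)

lemma seminorm_quotient_norm: "seminorm_fun (ell1_space e) (quotient_norm e)"
proof (rule seminorm_funI)
  fix v w assume vw: "v \<in> ell1_space e" "w \<in> ell1_space e"
  show "quotient_norm e (v + w) \<le> quotient_norm e v + quotient_norm e w"
  proof (rule field_le_epsilon)
    fix \<eta> :: real assume "\<eta> > 0"
    then obtain m n where m: "m \<in> ell1" "pairing e m = v" "mass m < quotient_norm e v + \<eta> / 2"
      and n: "n \<in> ell1" "pairing e n = w" "mass n < quotient_norm e w + \<eta> / 2"
      using quotient_norm_approx[OF vw(1), of "quotient_norm e v + \<eta> / 2"]
        quotient_norm_approx[OF vw(2), of "quotient_norm e w + \<eta> / 2"] by auto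
    have "quotient_norm e (v + w) \<le> mass (\<lambda>p. m p + n p)"
      using quotient_norm_le[OF ell1_add(1)[OF m(1) n(1)]] pairing_add[OF m(1) n(1)] m(2) n(2) by simp
    also have "\<dots> \<le> mass m + mass n" by (rule ell1_add(2)[OF m(1) n(1)])
    finally show "quotient_norm e (v + w) \<le> quotient_norm e v + quotient_norm e w + \<eta>" using m(3) n(3) by simp
  qed
next
  fix c and v assume v: "v \<in> ell1_space e"
  show "quotient_norm e (\<lambda>i. c * v i) \<le> norm c * quotient_norm e v"
  proof (cases "c = 0")
    case True
    have "(\<lambda>p. 0) \<in> ell1" by (simp add: ell1_def)
    from quotient_norm_le[OF this] show ?thesis using True by (simp add: pairing_def mass_def)
  next
    case False
    have "quotient_norm e (\<lambda>i. c * v i) / norm c \<le> quotient_norm e v"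
    proof (rule field_le_epsilon)
      fix \<eta> :: real assume "\<eta> > 0"
      then obtain m where m: "m \<in> ell1" "pairing e m = v" "mass m < quotient_norm e v + \<eta>"
        using quotient_norm_approx[OF v, of "quotient_norm e v + \<eta>"] by auto
      have "quotient_norm e (\<lambda>i. c * v i) \<le> norm c * mass m"
        using quotient_norm_le[OF ell1_scale(1)[OF m(1)], of c] m(2) by (simp add: pairing_scale ell1_scale(2)[OF m(1)])
      then have "quotient_norm e (\<lambda>i. c * v i) / norm c \<le> mass m" using False by (simp add: field_simps)
      then show "quotient_norm e (\<lambda>i. c * v i) / norm c \<le> quotient_norm e v + \<eta>" using m(3) by simp
    qed
    then show ?thesis using False by (simp add: field_simps)
  qed
qed (use quotient_norm_nonneg subspace_ell1_space in auto)

text \<open>The double family m k p is absolutely summable with total \<Sum> mass (m k), so it may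
  be summed over k first; M is the result.\<close>

lemma countable_combination:
  assumes m: "\<And>k::nat. m k \<in> ell1" and sm: "summable (\<lambda>k. mass (m k))"
  obtains M where "M \<in> ell1" "mass M \<le> (\<Sum>k. mass (m k))" "\<And>P. (\<lambda>k. pairing e (m k) P) sums pairing e M P"
proof -
  have smk: "(\<lambda>k. mass (m k)) summable_on UNIV"
    by (rule summable_nonneg_imp_summable_on[OF sm mass_nonneg])
  have inf_mass: "(\<Sum>\<^sub>\<infinity>k. mass (m k)) = (\<Sum>k. mass (m k))"
    by (rule infsumI[OF sums_nonneg_imp_has_sum[OF summable_sums[OF sm] mass_nonneg]])
  have abs: "(\<lambda>x. norm (case x of (k, p) \<Rightarrow> m k p)) summable_on UNIV \<times> UNIV"
    unfolding Infinite_Sum.abs_summable_on_Sigma_iff using m smk by (simp add: ell1_def mass_def[symmetric] mass_nonneg)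
  then have abs': "(\<lambda>x. norm (case x of (p, k) \<Rightarrow> m k p)) summable_on UNIV \<times> UNIV"
    using summable_on_swap[of "\<lambda>x. norm (case x of (k, p) \<Rightarrow> m k p)" UNIV UNIV] by (simp add: case_prod_unfold)
  define M where "M p = (\<Sum>\<^sub>\<infinity>k. m k p)" for p
  have row: "(\<lambda>k. norm (m k p)) summable_on UNIV" and rows: "(\<lambda>p. \<Sum>\<^sub>\<infinity>k. norm (m k p)) summable_on UNIV" for p
    using abs' unfolding Infinite_Sum.abs_summable_on_Sigma_iff by (auto simp: infsum_nonneg)
  have Mle: "norm (M p) \<le> (\<Sum>\<^sub>\<infinity>k. norm (m k p))" for p
    unfolding M_def by (rule norm_infsum_bound[OF row])
  have M: "M \<in> ell1"
    unfolding ell1_def mem_Collect_eq by (rule Infinite_Sum.abs_summable_on_comparison_test'[OF rows Mle])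
  have "mass M \<le> (\<Sum>\<^sub>\<infinity>p. \<Sum>\<^sub>\<infinity>k. norm (m k p))"
    unfolding mass_def using M by (intro infsum_mono rows Mle) (simp add: ell1_def)
  also have "\<dots> = (\<Sum>\<^sub>\<infinity>k. \<Sum>\<^sub>\<infinity>p. norm (m k p))"
    using abs' by (intro infsum_swap_banach) (simp add: case_prod_unfold)
  also have "\<dots> = (\<Sum>k. mass (m k))" unfolding mass_def[symmetric] by (rule inf_mass)
  finally have mM: "mass M \<le> (\<Sum>k. mass (m k))" .
  have "(\<lambda>k. pairing e (m k) P) sums pairing e M P" for P
  proof -
    obtain c where c: "c \<ge> 0" "\<And>p. norm (e P p) \<le> c" using bounded by blast
    have "(\<lambda>x. norm (case x of (k, p) \<Rightarrow> m k p * e P p)) summable_on UNIV \<times> UNIV"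
    proof (rule Infinite_Sum.abs_summable_on_comparison_test')
      show "(\<lambda>x. c * norm (case x of (k, p) \<Rightarrow> m k p)) summable_on UNIV \<times> UNIV"
        by (intro summable_on_cmult_right abs)
      show "norm (case x of (k, p) \<Rightarrow> m k p * e P p) \<le> c * norm (case x of (k, p) \<Rightarrow> m k p)" for x
        using mult_right_mono[OF c(2), of "norm (m (fst x) (snd x))"] by (simp add: norm_mult mult.commute case_prod_unfold)
    qed
    then have s: "(\<lambda>(k, p). m k p * e P p) summable_on UNIV \<times> UNIV" by (rule Infinite_Sum.abs_summable_summable)
    have "(\<lambda>k. \<Sum>\<^sub>\<infinity>p. m k p * e P p) summable_on UNIV"
      using summable_on_Sigma_banach[OF s] by simp
    then have "((\<lambda>k. pairing e (m k) P) has_sum (\<Sum>\<^sub>\<infinity>k. \<Sum>\<^sub>\<infinity>p. m k p * e P p)) UNIV"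
      unfolding pairing_def by (rule has_sum_infsum)
    moreover have "(\<Sum>\<^sub>\<infinity>k. \<Sum>\<^sub>\<infinity>p. m k p * e P p) = (\<Sum>\<^sub>\<infinity>p. \<Sum>\<^sub>\<infinity>k. m k p * e P p)"
      by (rule infsum_swap_banach[OF s])
    moreover have "\<dots> = pairing e M P"
      unfolding pairing_def M_def by (simp add: infsum_cmult_left')
    ultimately show ?thesis by (simp add: has_sum_imp_sums)
  qed
  with M mM show thesis by (rule that)
qed

text \<open>The increments are represented by families of nearly minimal mass, with excess below
  2^-k to keep the masses summable. The combination of the families from n on represents l - s n,
  and its mass is bounded by the tail of a convergent series.\<close>

lemma quotient_complete:
  assumes s: "\<And>n. s n \<in> ell1_space e" and sm: "summable (\<lambda>n. quotient_norm e (s (Suc n) - s n))"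
  shows "\<exists>l\<in>ell1_space e. (\<lambda>n. quotient_norm e (s n - l)) \<longlonglongrightarrow> 0"
proof -
  let ?\<pi> = "quotient_norm e"
  note V = subspace_ell1_space
  have "\<exists>m\<in>ell1. pairing e m = s (Suc k) - s k \<and> mass m < ?\<pi> (s (Suc k) - s k) + (1 / 2) ^ k" for k
    by (rule quotient_norm_approx[OF subspace_fun_diff[OF V s s]]) simp
  then obtain m where m: "\<And>k. m k \<in> ell1" "\<And>k. pairing e (m k) = s (Suc k) - s k"
    "\<And>k. mass (m k) < ?\<pi> (s (Suc k) - s k) + (1 / 2) ^ k" by metis
  have "summable (\<lambda>k. ?\<pi> (s (Suc k) - s k) + (1 / 2) ^ k)"
    by (intro summable_add sm summable_geometric) simp
  then have sm': "summable (\<lambda>k. mass (m k))"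
    by (rule summable_comparison_test'[where N = 0]) (simp add: mass_nonneg less_imp_le[OF m(3)])
  have "\<exists>M. M \<in> ell1 \<and> mass M \<le> (\<Sum>k. mass (m (k + n))) \<and> (\<forall>P. (\<lambda>k. pairing e (m (k + n)) P) sums pairing e M P)" for n
  proof -
    have "summable (\<lambda>k. mass (m (k + n)))" using sm' by (subst summable_iff_shift)
    from countable_combination[of "\<lambda>k. m (k + n)", OF m(1) this] show ?thesis by blast
  qed
  then obtain M where M: "\<And>n. M n \<in> ell1" "\<And>n. mass (M n) \<le> (\<Sum>k. mass (m (k + n)))"
    "\<And>n P. (\<lambda>k. pairing e (m (k + n)) P) sums pairing e (M n) P" by metis
  define l where "l = s 0 + pairing e (M 0)"
  have l: "l \<in> ell1_space e" unfolding l_def by (intro subspace_fun_add[OF V] s) (use M(1) in \<open>auto simp: ell1_space_def\<close>)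
  have diff: "l - s n = pairing e (M n)" for n
  proof
    fix P
    have "(\<Sum>k<n. pairing e (m k) P) = s n P - s 0 P"
      unfolding m(2) by (induction n) auto
    moreover have "(\<lambda>k. pairing e (m (k + n)) P) sums (pairing e (M 0) P - (\<Sum>k<n. pairing e (m k) P))"
      using sums_split_initial_segment[OF M(3)[of 0 P], of n] by simp
    then have "pairing e (M n) P = pairing e (M 0) P - (\<Sum>k<n. pairing e (m k) P)"
      using M(3)[of n P] sums_unique2 by blast
    ultimately show "(l - s n) P = pairing e (M n) P" by (simp add: l_def)
  qed
  have "(\<lambda>n. ?\<pi> (s n - l)) \<longlonglongrightarrow> 0"
  proof (rule tendsto_sandwich)
    show "eventually (\<lambda>n. 0 \<le> ?\<pi> (s n - l)) sequentially"
      by (intro always_eventually allI quotient_norm_nonneg subspace_fun_diff[OF V] s l)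
    have "?\<pi> (s n - l) \<le> (\<Sum>k. mass (m k)) - (\<Sum>k<n. mass (m k))" for n
    proof -
      have "?\<pi> (s n - l) = ?\<pi> (l - s n)"
        using seminorm_fun_minus[OF seminorm_quotient_norm subspace_fun_diff[OF V l s], of n] by simp
      also have "\<dots> \<le> mass (M n)" unfolding diff by (rule quotient_norm_le[OF M(1)])
      also have "\<dots> \<le> (\<Sum>k. mass (m (k + n)))" by (rule M(2))
      also have "\<dots> = (\<Sum>k. mass (m k)) - (\<Sum>k<n. mass (m k))" by (rule suminf_minus_initial_segment[OF sm'])
      finally show ?thesis .
    qed
    then show "eventually (\<lambda>n. ?\<pi> (s n - l) \<le> (\<Sum>k. mass (m k)) - (\<Sum>k<n. mass (m k))) sequentially"
      by simp
    show "(\<lambda>n. (\<Sum>k. mass (m k)) - (\<Sum>k<n. mass (m k))) \<longlonglongrightarrow> 0"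
      using tendsto_diff[OF tendsto_const summable_LIMSEQ[OF sm'], of "\<Sum>k. mass (m k)"] by simp
  qed simp
  with l show ?thesis by blast
qed

lemma point_evaluation:
  shows point_evaluation_mem: "(\<lambda>P. e P p) \<in> ell1_space e" and point_evaluation_norm: "quotient_norm e (\<lambda>P. e P p) \<le> 1"
proof -
  have eq: "pairing e (\<lambda>q. if q \<in> {p} then 1 else 0) = (\<lambda>P. e P p)"
    using pairing_finite_support[of "{p}" "\<lambda>_. 1"] by simp
  show "(\<lambda>P. e P p) \<in> ell1_space e"
    unfolding ell1_space_def eq[symmetric] using ell1_finite_support(1)[of "{p}" "\<lambda>_. 1"] by blast
  show "quotient_norm e (\<lambda>P. e P p) \<le> 1"
    using quotient_norm_le[OF ell1_finite_support(1)[of "{p}" "\<lambda>_. 1"]] ell1_finite_support(2)[of "{p}" "\<lambda>_. 1::'k"]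
    by (simp only: eq finite.intros) simp
qed

text \<open>Even on infinite sums G is determined by its values at point evaluations: cutting m down
  to a finite set F leaves an error of at most \<epsilon> times the mass outside F.\<close>

lemma functional_has_sum:
  assumes G: "linear_fun (ell1_space e) G" "\<And>v. v \<in> ell1_space e \<Longrightarrow> norm (G v) \<le> \<epsilon> * quotient_norm e v"
    and \<epsilon>: "\<epsilon> \<ge> 0" and m: "m \<in> ell1"
  shows "((\<lambda>p. m p * G (\<lambda>P. e P p)) has_sum G (pairing e m)) UNIV"
proof -
  note V = subspace_ell1_space
  have part: "norm (G (pairing e m) - (\<Sum>p\<in>F. m p * G (\<lambda>P. e P p))) \<le> \<epsilon> * (mass m - (\<Sum>p\<in>F. norm (m p)))"
    if F: "finite F" for F
  proof -
    let ?mF = "\<lambda>p. if p \<in> F then m p else 0"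
    let ?r = "\<lambda>p. m p + (- 1) * ?mF p"
    have mF: "?mF \<in> ell1" by (rule ell1_finite_support(1)[OF F])
    have r: "?r \<in> ell1" by (intro ell1_add(1) m ell1_scale(1) mF)
    have diff: "pairing e ?r = pairing e m - pairing e ?mF"
      using pairing_add[OF m ell1_scale(1)[OF mF, of "-1"]] unfolding pairing_scale by (auto simp: fun_eq_iff)
    have mem: "pairing e m \<in> ell1_space e" "pairing e ?mF \<in> ell1_space e"
      using m mF by (auto simp: ell1_space_def)
    have "G (pairing e ?mF) = (\<Sum>p\<in>F. m p * G (\<lambda>P. e P p))"
      unfolding pairing_finite_support[OF F] using F
    proof (induction F)
      case empty
      show ?case using linear_fun_zero[OF G(1) V] by (simp add: zero_fun_def)
    next
      case (insert q F)
      have memq: "(\<lambda>P. m q * e P q) \<in> ell1_space e" by (rule subspace_fun_scale[OF V point_evaluation_mem])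
      have "(\<lambda>P. \<Sum>p\<in>F. m p * e P p) \<in> ell1_space e"
        using pairing_finite_support[OF insert.hyps(1), of m] ell1_finite_support(1)[OF insert.hyps(1), of m]
        by (metis ell1_space_def imageI)
      then have "G ((\<lambda>P. m q * e P q) + (\<lambda>P. \<Sum>p\<in>F. m p * e P p)) = m q * G (\<lambda>P. e P q) + (\<Sum>p\<in>F. m p * G (\<lambda>P. e P p))"
        using linear_fun_add[OF G(1) memq] linear_fun_scale[OF G(1) point_evaluation_mem, of "m q" q] insert.IH by simp
      then show ?case using insert.hyps by (simp add: plus_fun_def)
    qed
    then have "norm (G (pairing e m) - (\<Sum>p\<in>F. m p * G (\<lambda>P. e P p))) = norm (G (pairing e ?r))"
      unfolding diff linear_fun_diff[OF G(1) V mem] by simp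
    also have "\<dots> \<le> \<epsilon> * quotient_norm e (pairing e ?r)" using r by (intro G(2)) (auto simp: ell1_space_def)
    also have "\<dots> \<le> \<epsilon> * mass ?r" by (intro mult_left_mono quotient_norm_le r \<epsilon>)
    also have "mass ?r = mass m - (\<Sum>p\<in>F. norm (m p))"
    proof -
      have "(\<lambda>p. norm (m p)) = (\<lambda>p. norm (?r p) + norm (?mF p))" by (auto simp: fun_eq_iff)
      then have "mass m = mass ?r + mass ?mF"
        unfolding mass_def using r mF infsum_add[of "\<lambda>p. norm (?r p)" UNIV "\<lambda>p. norm (?mF p)"] by (simp add: ell1_def)
      then show ?thesis using ell1_finite_support(2)[OF F, of m] by simp
    qed
    finally show ?thesis .
  qed
  have "((\<lambda>p. norm (m p)) has_sum mass m) UNIV"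
    unfolding mass_def using m by (intro has_sum_infsum) (simp add: ell1_def)
  then have "((\<lambda>F. \<Sum>p\<in>F. norm (m p)) \<longlongrightarrow> mass m) (finite_subsets_at_top UNIV)" by (simp add: has_sum_def)
  then have lim: "((\<lambda>F. \<epsilon> * (mass m - (\<Sum>p\<in>F. norm (m p)))) \<longlongrightarrow> \<epsilon> * (mass m - mass m)) (finite_subsets_at_top UNIV)"
    by (intro tendsto_intros)
  have "((\<lambda>F. norm (G (pairing e m) - (\<Sum>p\<in>F. m p * G (\<lambda>P. e P p)))) \<longlongrightarrow> 0) (finite_subsets_at_top UNIV)"
  proof (rule tendsto_sandwich)
    show "eventually (\<lambda>F. 0 \<le> norm (G (pairing e m) - (\<Sum>p\<in>F. m p * G (\<lambda>P. e P p)))) (finite_subsets_at_top UNIV)"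
      by simp
    show "eventually (\<lambda>F. norm (G (pairing e m) - (\<Sum>p\<in>F. m p * G (\<lambda>P. e P p))) \<le> \<epsilon> * (mass m - (\<Sum>p\<in>F. norm (m p))))
        (finite_subsets_at_top UNIV)"
      using part by (auto intro!: eventually_finite_subsets_at_top_weakI)
    show "((\<lambda>F. \<epsilon> * (mass m - (\<Sum>p\<in>F. norm (m p)))) \<longlongrightarrow> 0) (finite_subsets_at_top UNIV)"
      using lim by simp
  qed simp_all
  then have "((\<lambda>F. \<Sum>p\<in>F. m p * G (\<lambda>P. e P p)) \<longlongrightarrow> G (pairing e m)) (finite_subsets_at_top UNIV)"
    by (subst tendsto_dist_iff) (simp add: dist_norm norm_minus_commute)
  then show ?thesis by (simp add: has_sum_def)
qed

end

section \<open>Polynomials as functionals on sums of point evaluations\<close>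

lemma subspace_fun_sum:
  assumes V: "subspace_fun V"
  shows "(\<And>j. j \<in> J \<Longrightarrow> v j \<in> V) \<Longrightarrow> (\<lambda>i. \<Sum>j\<in>J. c j * v j i) \<in> V"
proof (induction J rule: infinite_finite_induct)
  case (insert j J)
  have "(\<lambda>i. c j * v j i) + (\<lambda>i. \<Sum>j\<in>J. c j * v j i) \<in> V"
    using insert by (intro subspace_fun_add[OF V] subspace_fun_scale[OF V]) auto
  then show ?case using insert.hyps by (simp add: plus_fun_def)
qed (use subspace_fun_zero[OF V] in \<open>auto simp: zero_fun_def\<close>)

lemma seminorm_fun_sum:
  assumes V: "subspace_fun V" and p: "seminorm_fun V p"
  shows "(\<And>j. j \<in> J \<Longrightarrow> v j \<in> V) \<Longrightarrow> p (\<lambda>i. \<Sum>j\<in>J. c j * v j i) \<le> (\<Sum>j\<in>J. norm (c j) * p (v j))"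
proof (induction J rule: infinite_finite_induct)
  case (insert j J)
  have "p ((\<lambda>i. c j * v j i) + (\<lambda>i. \<Sum>j\<in>J. c j * v j i)) \<le> p (\<lambda>i. c j * v j i) + p (\<lambda>i. \<Sum>j\<in>J. c j * v j i)"
    using insert by (intro seminorm_fun_add[OF p] subspace_fun_scale[OF V] subspace_fun_sum[OF V]) auto
  also have "\<dots> \<le> norm (c j) * p (v j) + (\<Sum>j\<in>J. norm (c j) * p (v j))"
    using insert by (intro add_mono) (auto simp: seminorm_fun_scale[OF p])
  finally show ?case using insert.hyps by (simp add: plus_fun_def)
qed (use seminorm_fun_zero[OF p V] in \<open>auto simp: zero_fun_def\<close>)

text \<open>The value 0 at pairs outside the unit balls and at functions that are not polynomials
  lets both arguments range over whole types while every P keeps a finite bound.\<close>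

definition poly_eval ::
    "nat \<Rightarrow> ('k::real_or_complex, 'x::ab_group_add) nspace \<Rightarrow> ('k, 'y::ab_group_add) nspace \<Rightarrow>
     ('x \<Rightarrow> 'y \<Rightarrow> 'k) \<Rightarrow> 'x \<times> 'y \<Rightarrow> 'k" where
  "poly_eval N X Y P p =
     (if P \<in> vecs (polynomials N X (dual Y)) \<and> fst p \<in> unit_ball X \<and> snd p \<in> unit_ball Y
      then P (fst p) (snd p) else 0)"

context
  fixes X :: "('k::real_or_complex, 'x::ab_group_add) nspace" and Y :: "('k, 'y::ab_group_add) nspace"
    and N :: nat
  assumes X: "normed_space X" and Y: "normed_space Y"
begin

interpretation X: normed_space X by (rule X)
interpretation Y: normed_space Y by (rule Y)
interpretation DY: normed_space "dual Y" by (rule Y.normed_space_dual)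

lemma poly_eval_le:
  assumes P: "P \<in> vecs (polynomials N X (dual Y))"
  shows "norm (poly_eval N X Y P p) \<le> sup_norm X (dual Y) P"
proof (cases "fst p \<in> unit_ball X \<and> snd p \<in> unit_ball Y")
  case True
  then have p: "fst p \<in> vecs X" "nrm X (fst p) \<le> 1" "snd p \<in> vecs Y" "nrm Y (snd p) \<le> 1"
    by (auto simp: unit_ball_def)
  have "norm (P (fst p) (snd p)) \<le> nrm (dual Y) (P (fst p))"
    by (rule Y.dual_ball_le[OF polynomial_mem[OF X DY.normed_space_axioms P] p(3,4)])
  also have "\<dots> \<le> sup_norm X (dual Y) P"
    by (rule polynomial_ball_le[OF X DY.normed_space_axioms P p(1,2)])
  finally show ?thesis using True P by (simp add: poly_eval_def)
qed (use polynomial_sup_nonneg[OF X DY.normed_space_axioms P] in \<open>auto simp: poly_eval_def\<close>)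

lemma poly_eval_bounded: "\<exists>c\<ge>0. \<forall>p. norm (poly_eval N X Y P p) \<le> c"
proof (cases "P \<in> vecs (polynomials N X (dual Y))")
  case True
  then show ?thesis
    using poly_eval_le polynomial_sup_nonneg[OF X DY.normed_space_axioms] by blast
qed (auto simp: poly_eval_def)

text \<open>Homogeneity of degree N in x and of degree 1 in y reduces the pair to one in the unit
  balls. The bound is at most 1 on the balls, which is what the norm of a represented polynomial
  needs.\<close>

lemma evaluation_functional:
  assumes x: "x \<in> vecs X" and y: "y \<in> vecs Y"
  defines "v \<equiv> \<lambda>P. if P \<in> vecs (polynomials N X (dual Y)) then P x y else 0"
  shows "v \<in> ell1_space (poly_eval N X Y)"
    and "quotient_norm (poly_eval N X Y) v \<le> nrm X x ^ N * nrm Y y"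
proof -
  let ?e = "poly_eval N X Y"
  note V = subspace_ell1_space[of ?e, OF poly_eval_bounded]
  note \<pi> = seminorm_quotient_norm[of ?e, OF poly_eval_bounded]
  obtain a where a: "a \<in> vecs X" "nrm X a \<le> 1" "x = smul X (of_real (nrm X x)) a"
    using X.obtain_unit_vector[OF x] by blast
  obtain b where b: "b \<in> vecs Y" "nrm Y b \<le> 1" "y = smul Y (of_real (nrm Y y)) b"
    using Y.obtain_unit_vector[OF y] by blast
  let ?c = "of_real (nrm X x ^ N * nrm Y y) :: 'k"
  have "v = (\<lambda>P. ?c * ?e P (a, b))"
  proof
    fix P
    show "v P = ?c * ?e P (a, b)"
    proof (cases "P \<in> vecs (polynomials N X (dual Y))")
      case P: True
      have "P x y = of_real (nrm X x) ^ N * P a y"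
        by (subst a(3)) (simp add: polynomial_smul[OF X DY.normed_space_axioms P a(1)])
      also have "P a y = of_real (nrm Y y) * P a b"
        by (subst b(3)) (rule Y.dual_smul[OF polynomial_mem[OF X DY.normed_space_axioms P] b(1)])
      finally show ?thesis using P a b by (simp add: v_def poly_eval_def unit_ball_def)
    qed (simp add: v_def poly_eval_def)
  qed
  note v = this
  have mem: "(\<lambda>P. ?e P (a, b)) \<in> ell1_space ?e" by (rule point_evaluation_mem[of ?e, OF poly_eval_bounded])
  show "v \<in> ell1_space ?e" unfolding v by (rule subspace_fun_scale[OF V mem])
  have "quotient_norm ?e v = norm ?c * quotient_norm ?e (\<lambda>P. ?e P (a, b))"
    unfolding v by (rule seminorm_fun_scale[OF \<pi> mem])
  also have "norm ?c = nrm X x ^ N * nrm Y y"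
    unfolding norm_of_real using X.nrm_nonneg[OF x] Y.nrm_nonneg[OF y] by simp
  also have "nrm X x ^ N * nrm Y y * quotient_norm ?e (\<lambda>P. ?e P (a, b)) \<le> nrm X x ^ N * nrm Y y * 1"
    using point_evaluation_norm[of ?e, OF poly_eval_bounded] X.nrm_nonneg[OF x] Y.nrm_nonneg[OF y]
    by (intro mult_left_mono) auto
  finally show "quotient_norm ?e v \<le> nrm X x ^ N * nrm Y y" by simp
qed

text \<open>By polarization the symmetric map at a tuple is a finite combination of values of P. The
  bound is crude; it serves only for the continuity of the map built in
  \<open>polynomial_of_functional\<close>.\<close>

lemma tuple_evaluation_functional:
  assumes x: "x \<in> tuples N X" and y: "y \<in> vecs Y"
  defines "v \<equiv> \<lambda>P. if P \<in> vecs (polynomials N X (dual Y)) then associated_symmetric N X (dual Y) P x y else 0"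
  shows "v \<in> ell1_space (poly_eval N X Y)"
    and "quotient_norm (poly_eval N X Y) v \<le> (\<Sum>S\<in>Pow {..<N}. norm (1 / fact N :: 'k) * nrm X (\<Sum>i\<in>S. x i) ^ N) * nrm Y y"
proof -
  let ?e = "poly_eval N X Y"
  note V = subspace_ell1_space[of ?e, OF poly_eval_bounded]
  note \<pi> = seminorm_quotient_norm[of ?e, OF poly_eval_bounded]
  let ?z = "\<lambda>S. \<Sum>i\<in>S. x i"
  let ?w = "\<lambda>S P. if P \<in> vecs (polynomials N X (dual Y)) then P (?z S) y else 0"
  let ?c = "\<lambda>S. (- 1) ^ (N - card S) / fact N :: 'k"
  have z: "?z S \<in> vecs X" if "S \<in> Pow {..<N}" for S
    using that by (intro X.sum_mem tuples_mem[OF x]) auto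
  have v: "v = (\<lambda>P. \<Sum>S\<in>Pow {..<N}. ?c S * ?w S P)"
  proof
    fix P
    show "v P = (\<Sum>S\<in>Pow {..<N}. ?c S * ?w S P)"
    proof (cases "P \<in> vecs (polynomials N X (dual Y))")
      case P: True
      let ?A = "associated_symmetric N X (dual Y) P"
      have ml: "multilinear N X (dual Y) ?A"
        using associated_symmetric_multilinear[OF X Y P] unfolding multilinear_maps_iff[OF X DY.normed_space_axioms] by blast
      have "symmetric N X (\<lambda>x. ?A x y)"
        using symmetric_associated_symmetric[OF X Y P] by (simp add: symmetric_def)
      from polarization[OF X multilinear_apply[OF ml] this x]
      have "fact N * ?A x y = (\<Sum>S\<in>Pow {..<N}. (- 1) ^ (N - card S) * ?A (diag N (?z S)) y)" .
      also have "\<dots> = (\<Sum>S\<in>Pow {..<N}. (- 1) ^ (N - card S) * P (?z S) y)"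
        using z by (intro sum.cong refl) (simp add: associated_symmetric_diag[OF X Y P])
      finally have "?A x y = (\<Sum>S\<in>Pow {..<N}. (- 1) ^ (N - card S) * P (?z S) y) / fact N"
        by (simp add: field_simps)
      then show ?thesis using P by (simp add: v_def sum_divide_distrib)
    qed (simp add: v_def)
  qed
  have w: "?w S \<in> ell1_space ?e" "quotient_norm ?e (?w S) \<le> nrm X (?z S) ^ N * nrm Y y" if "S \<in> Pow {..<N}" for S
    using evaluation_functional[OF z[OF that] y] by auto
  show "v \<in> ell1_space ?e" unfolding v by (rule subspace_fun_sum[OF V w(1)])
  have "quotient_norm ?e v \<le> (\<Sum>S\<in>Pow {..<N}. norm (?c S) * quotient_norm ?e (?w S))"
    unfolding v by (rule seminorm_fun_sum[OF V \<pi> w(1)])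
  also have "\<dots> \<le> (\<Sum>S\<in>Pow {..<N}. norm (1 / fact N :: 'k) * (nrm X (?z S) ^ N * nrm Y y))"
    using w(2) by (intro sum_mono mult_mono) (auto simp: norm_divide norm_power intro!: quotient_norm_nonneg[of ?e, OF poly_eval_bounded] w(1))
  finally show "quotient_norm ?e v \<le> (\<Sum>S\<in>Pow {..<N}. norm (1 / fact N :: 'k) * nrm X (?z S) ^ N) * nrm Y y"
    by (simp add: sum_distrib_right mult.assoc)
qed

text \<open>Bounded functionals on the sums are polynomials. The multilinear map \<Psi> is G applied
  to evaluation at tuples, where additivity in each slot is visible; the norm is then estimated on
  the diagonal, with the better bound of \<open>evaluation_functional\<close>.\<close>

lemma polynomial_of_functional:
  assumes G: "linear_fun (ell1_space (poly_eval N X Y)) G"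
    and G_le: "\<And>v. v \<in> ell1_space (poly_eval N X Y) \<Longrightarrow> norm (G v) \<le> \<epsilon> * quotient_norm (poly_eval N X Y) v"
    and \<epsilon>: "\<epsilon> \<ge> 0"
  defines "R \<equiv> \<lambda>x y. if x \<in> vecs X \<and> y \<in> vecs Y
    then G (\<lambda>P. if P \<in> vecs (polynomials N X (dual Y)) then P x y else 0) else 0"
  shows "R \<in> vecs (polynomials N X (dual Y))" and "sup_norm X (dual Y) R \<le> \<epsilon>"
proof -
  let ?e = "poly_eval N X Y" and ?Pl = "vecs (polynomials N X (dual Y))"
  let ?t = "\<lambda>x y P. if P \<in> ?Pl then associated_symmetric N X (dual Y) P x y else 0"
  define \<Psi> where "\<Psi> x y = (if x \<in> tuples N X \<and> y \<in> vecs Y then G (?t x y) else 0)" for x y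
  define D where "D x = (\<Sum>S\<in>Pow {..<N}. norm (1 / fact N :: 'k) * nrm X (\<Sum>i\<in>S. x i) ^ N)" for x
  have ml: "multilinear N X (dual Y) (associated_symmetric N X (dual Y) P)" if "P \<in> ?Pl" for P
    using associated_symmetric_multilinear[OF X Y that] unfolding multilinear_maps_iff[OF X DY.normed_space_axioms] by blast
  have t_mem: "?t x y \<in> ell1_space ?e" if "x \<in> tuples N X" "y \<in> vecs Y" for x y
    by (rule tuple_evaluation_functional[OF that])
  have \<Psi>_le: "norm (\<Psi> x y) \<le> (\<epsilon> * D x) * nrm Y y" if x: "x \<in> tuples N X" and y: "y \<in> vecs Y" for x y
  proof -
    have "norm (\<Psi> x y) \<le> \<epsilon> * quotient_norm ?e (?t x y)"
      unfolding \<Psi>_def using x y G_le[OF t_mem[OF x y]] by simp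
    also have "\<dots> \<le> \<epsilon> * (D x * nrm Y y)"
      unfolding D_def by (intro mult_left_mono tuple_evaluation_functional(2)[OF x y] \<epsilon>)
    finally show ?thesis by (simp add: mult.assoc)
  qed
  have \<Psi>_dual: "\<Psi> x \<in> vecs (dual Y)" if x: "x \<in> tuples N X" for x
  proof (rule Y.dual_memI[OF _ _ \<Psi>_le[OF x]])
    fix y z assume yz: "y \<in> vecs Y" "z \<in> vecs Y"
    have "?t x (y + z) = ?t x y + ?t x z"
      using Y.dual_add[OF multilinear_mem[OF ml x] yz] by auto
    then show "\<Psi> x (y + z) = \<Psi> x y + \<Psi> x z"
      unfolding \<Psi>_def using x yz linear_fun_add[OF G t_mem[OF x yz(1)] t_mem[OF x yz(2)]] by (simp add: Y.add_mem)
  next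
    fix c y assume y: "y \<in> vecs Y"
    have "?t x (smul Y c y) = (\<lambda>P. c * ?t x y P)"
      using Y.dual_smul[OF multilinear_mem[OF ml x] y] by auto
    then show "\<Psi> x (smul Y c y) = c * \<Psi> x y"
      unfolding \<Psi>_def using x y linear_fun_scale[OF G t_mem[OF x y], of c] by (simp add: Y.smul_mem)
  qed (simp_all add: \<Psi>_def)
  have \<Psi>_lin: "linear_map X (dual Y) (\<lambda>a. \<Psi> (x(i := a)))" if x: "x \<in> tuples N X" and i: "i < N" for x i
    unfolding linear_map_def
  proof (intro conjI ballI allI)
    fix a assume a: "a \<in> vecs X"
    note xa = tuples_upd[OF x i a]
    show "\<Psi> (x(i := a)) \<in> vecs (dual Y)" by (rule \<Psi>_dual[OF xa])
    show "\<Psi> (x(i := a + b)) = \<Psi> (x(i := a)) + \<Psi> (x(i := b))" if b: "b \<in> vecs X" for b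
    proof
      fix y
      note xb = tuples_upd[OF x i b] and xab = tuples_upd[OF x i X.add_mem[OF a b]]
      have eq: "?t (x(i := a + b)) y = ?t (x(i := a)) y + ?t (x(i := b)) y"
        using linear_map_add[OF multilinear_slot[OF ml x i] a b] by auto
      have "G (?t (x(i := a + b)) y) = G (?t (x(i := a)) y) + G (?t (x(i := b)) y)" if "y \<in> vecs Y"
        unfolding eq by (rule linear_fun_add[OF G t_mem[OF xa that] t_mem[OF xb that]])
      then show "\<Psi> (x(i := a + b)) y = (\<Psi> (x(i := a)) + \<Psi> (x(i := b))) y"
        unfolding \<Psi>_def plus_fun_apply using xa xb xab by (cases "y \<in> vecs Y") simp_all
    qed
    show "\<Psi> (x(i := smul X c a)) = smul (dual Y) c (\<Psi> (x(i := a)))" for c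
    proof
      fix y
      note xc = tuples_upd[OF x i X.smul_mem[OF a, of c]]
      have "?t (x(i := smul X c a)) y = (\<lambda>P. c * ?t (x(i := a)) y P)"
        using linear_map_smul[OF multilinear_slot[OF ml x i] a] by auto
      then show "\<Psi> (x(i := smul X c a)) y = smul (dual Y) c (\<Psi> (x(i := a))) y"
        unfolding \<Psi>_def dual_sel using xa xc linear_fun_scale[OF G t_mem[OF xa], of y c] by (simp del: fun_upd_apply)
    qed
  qed
  have ml\<Psi>: "multilinear N X (dual Y) \<Psi>" unfolding multilinear_def using \<Psi>_dual \<Psi>_lin by blast
  \<comment> \<open>A sum of at most N vectors of the unit ball has norm at most N, so B bounds D x
    there.\<close>
  define B where "B = (\<Sum>S\<in>Pow {..<N}. norm (1 / fact N :: 'k) * real N ^ N)"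
  have bound: "multilinear_bound N X (dual Y) \<Psi> (\<epsilon> * B)"
  proof (rule multilinear_boundI[OF X DY.normed_space_axioms ml\<Psi>])
    fix x assume x: "x \<in> tuples N X" "\<And>i. i < N \<Longrightarrow> nrm X (x i) \<le> 1"
    have "nrm X (\<Sum>i\<in>S. x i) \<le> N" if S: "S \<in> Pow {..<N}" for S
    proof -
      have "nrm X (\<Sum>i\<in>S. x i) \<le> (\<Sum>i\<in>S. nrm X (x i))" using S by (intro X.nrm_sum tuples_mem[OF x(1)]) auto
      also have "\<dots> \<le> (\<Sum>i\<in>S. 1)" using S x(2) by (intro sum_mono) auto
      also have "\<dots> \<le> N" using S card_mono[of "{..<N}" S] by simp
      finally show ?thesis .
    qed
    moreover have "0 \<le> nrm X (\<Sum>i\<in>S. x i)" if "S \<in> Pow {..<N}" for S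
      using that by (intro X.nrm_nonneg X.sum_mem tuples_mem[OF x(1)]) auto
    ultimately have "D x \<le> B" unfolding D_def B_def by (intro sum_mono mult_left_mono power_mono) auto
    then have DB: "\<epsilon> * D x \<le> \<epsilon> * B" by (intro mult_left_mono \<epsilon>)
    have D0: "0 \<le> \<epsilon> * D x"
      unfolding D_def using x by (intro mult_nonneg_nonneg \<epsilon> sum_nonneg zero_le_power X.nrm_nonneg X.sum_mem tuples_mem[OF x(1)]) auto
    show "nrm (dual Y) (\<Psi> x) \<le> \<epsilon> * B"
    proof (rule Y.dual_nrm_le)
      fix y assume y: "y \<in> vecs Y" "nrm Y y \<le> 1"
      show "norm (\<Psi> x y) \<le> \<epsilon> * B"
        using \<Psi>_le[OF x(1) y(1)] mult_left_mono[OF y(2) D0] DB by simp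
    qed
  qed
  have "\<epsilon> * B \<ge> 0" unfolding B_def by (intro mult_nonneg_nonneg \<epsilon> sum_nonneg) auto
  with bound ml\<Psi> have \<Psi>: "\<Psi> \<in> multilinear_maps N X (dual Y)"
    unfolding multilinear_maps_iff[OF X DY.normed_space_axioms] by (auto simp: \<Psi>_def fun_eq_iff)
  have "R x = \<Psi> (diag N x)" if x: "x \<in> vecs X" for x
  proof
    fix y
    have "(\<lambda>P. if P \<in> ?Pl then P x y else 0) = ?t (diag N x) y"
      by (auto simp: associated_symmetric_diag[OF X Y _ x])
    then show "R x y = \<Psi> (diag N x) y" using x diag_tuple[OF x, of N] by (simp add: R_def \<Psi>_def)
  qed
  moreover have "R x = 0" if "x \<notin> vecs X" for x using that by (auto simp: R_def)
  ultimately show "R \<in> ?Pl" unfolding mem_polynomials using \<Psi> by blast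
  show "sup_norm X (dual Y) R \<le> \<epsilon>"
  proof (rule polynomial_sup_le[OF X DY.normed_space_axioms], rule Y.dual_nrm_le)
    fix x y assume xy: "x \<in> vecs X" "nrm X x \<le> 1" "y \<in> vecs Y" "nrm Y y \<le> 1"
    note ef = evaluation_functional[OF xy(1,3)]
    have "nrm X x ^ N * nrm Y y \<le> 1"
      using xy X.nrm_nonneg Y.nrm_nonneg by (intro mult_le_one power_le_one) auto
    then have "\<epsilon> * quotient_norm ?e (\<lambda>P. if P \<in> ?Pl then P x y else 0) \<le> \<epsilon> * 1"
      using ef(2) by (intro mult_left_mono \<epsilon>) linarith
    then show "norm (R x y) \<le> \<epsilon>" using G_le[OF ef(1)] xy by (simp add: R_def)
  qed
qed

text \<open>Bishop-Phelps is applied to the functional of evaluation at P0; its perturbation G is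
  given by a polynomial R. At the support point u, P0 + R dominates its real parts at all rotated
  point evaluations, hence its own norm.\<close>

lemma bishop_phelps_polynomials:
  assumes P0: "P0 \<in> vecs (polynomials N X (dual Y))" and \<epsilon>: "\<epsilon> > 0"
  obtains R u where "R \<in> vecs (polynomials N X (dual Y))" "sup_norm X (dual Y) R \<le> \<epsilon>"
    "\<And>\<eta>. \<eta> > 0 \<Longrightarrow> \<exists>m\<in>ell1. pairing (poly_eval N X Y) m = u \<and> mass m < 1 + \<eta>"
    "sup_norm X (dual Y) (P0 + R) \<le> norm (u (P0 + R))"
proof -
  let ?e = "poly_eval N X Y" and ?Pl = "vecs (polynomials N X (dual Y))"
  let ?V = "ell1_space ?e" and ?\<pi> = "quotient_norm ?e"
  note bd = poly_eval_bounded
  note V = subspace_ell1_space[of ?e, OF bd]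
  note \<pi> = seminorm_quotient_norm[of ?e, OF bd]
  have f_lin: "linear_fun ?V (\<lambda>u. u P0)" by (simp add: linear_fun_def)
  have f_le: "norm (v P0) \<le> sup_norm X (dual Y) P0 * ?\<pi> v" if v: "v \<in> ?V" for v
  proof (rule field_le_epsilon)
    let ?c = "sup_norm X (dual Y) P0"
    have c: "?c \<ge> 0" by (rule polynomial_sup_nonneg[OF X DY.normed_space_axioms P0])
    fix \<eta> :: real assume \<eta>: "\<eta> > 0"
    \<comment> \<open>Dividing by c + 1 avoids a division by 0 when P0 = 0.\<close>
    then obtain m where m: "m \<in> ell1" "pairing ?e m = v" "mass m < ?\<pi> v + \<eta> / (?c + 1)"
      using quotient_norm_approx[of ?e, OF bd v, of "?\<pi> v + \<eta> / (?c + 1)"] c by auto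
    have "norm (v P0) \<le> ?c * mass m"
      using norm_pairing_le[of ?e, OF bd m(1) poly_eval_le[OF P0]] m(2) by simp
    also have "\<dots> \<le> ?c * (?\<pi> v + \<eta> / (?c + 1))" using m(3) c by (intro mult_left_mono) auto
    also have "\<dots> \<le> ?c * ?\<pi> v + \<eta>" using c \<eta> by (simp add: field_simps)
    finally show "norm (v P0) \<le> ?c * ?\<pi> v + \<eta>" .
  qed
  obtain u G where u: "u \<in> ?V" "?\<pi> u \<le> 1" and G: "linear_fun ?V G" "\<And>v. v \<in> ?V \<Longrightarrow> norm (G v) \<le> \<epsilon> * ?\<pi> v"
    and max: "\<And>v. \<lbrakk>v \<in> ?V; ?\<pi> v \<le> 1\<rbrakk> \<Longrightarrow> re (v P0 + G v) \<le> re (u P0 + G u)"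
    using bishop_phelps[OF V \<pi> quotient_complete[of ?e, OF bd] f_lin f_le \<epsilon>] by blast
  define R where "R = (\<lambda>x y. if x \<in> vecs X \<and> y \<in> vecs Y then G (\<lambda>P. if P \<in> ?Pl then P x y else 0) else 0)"
  have R: "R \<in> ?Pl" "sup_norm X (dual Y) R \<le> \<epsilon>"
    unfolding R_def using polynomial_of_functional[OF G] \<epsilon> by auto
  have Q: "P0 + R \<in> ?Pl" by (rule polynomial_plus[OF X DY.normed_space_axioms P0 R(1)])
  have approx: "\<exists>m\<in>ell1. pairing ?e m = u \<and> mass m < 1 + \<eta>" if "\<eta> > 0" for \<eta>
    using quotient_norm_approx[of ?e, OF bd u(1), of "1 + \<eta>"] u(2) that by linarith
  obtain m where m: "m \<in> ell1" "pairing ?e m = u" using approx[of 1] by auto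
  have eR: "G (\<lambda>P. ?e P p) = ?e R p" for p
  proof (cases "fst p \<in> unit_ball X \<and> snd p \<in> unit_ball Y")
    case True
    have "(\<lambda>P. ?e P p) = (\<lambda>P. if P \<in> ?Pl then P (fst p) (snd p) else 0)"
      using True by (auto simp: poly_eval_def)
    then show ?thesis using True R(1) by (simp add: poly_eval_def R_def unit_ball_def)
  next
    case False
    then have "(\<lambda>P. ?e P p) = 0" "?e R p = 0" by (auto simp: poly_eval_def)
    then show ?thesis using linear_fun_zero[OF G(1) V] by (simp only:)
  qed
  \<comment> \<open>u is an infinite sum, so G u = u R needs the continuity of G on top of the
    agreement at point evaluations.\<close>
  have "((\<lambda>p. m p * ?e R p) has_sum G u) UNIV"
    using functional_has_sum[of ?e, OF bd G _ m(1)] \<epsilon> unfolding eR m(2) by simp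
  from infsumI[OF this] have "G u = u R" using fun_cong[OF m(2), of R] by (simp add: pairing_def)
  moreover have "u (P0 + R) = u P0 + u R"
  proof -
    have "?e (P0 + R) p = ?e P0 p + ?e R p" for p using P0 R(1) Q by (simp add: poly_eval_def)
    then have "u (P0 + R) = (\<Sum>\<^sub>\<infinity>p. m p * ?e P0 p + m p * ?e R p)"
      unfolding m(2)[symmetric] pairing_def by (simp add: distrib_left)
    also have "\<dots> = u P0 + u R"
      unfolding m(2)[symmetric] pairing_def by (intro infsum_add pairing_summable(2)[of ?e, OF bd m(1)])
    finally show ?thesis .
  qed
  ultimately have uQ: "u P0 + G u = u (P0 + R)" by simp
  have "sup_norm X (dual Y) (P0 + R) \<le> re (u (P0 + R))"
  proof (rule polynomial_sup_le[OF X DY.normed_space_axioms], rule Y.dual_nrm_le)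
    fix x y assume xy: "x \<in> vecs X" "nrm X x \<le> 1" "y \<in> vecs Y" "nrm Y y \<le> 1"
    let ?v = "\<lambda>P. if P \<in> ?Pl then P x y else 0"
    note ef = evaluation_functional[OF xy(1,3)]
    have one: "nrm X x ^ N * nrm Y y \<le> 1"
      using xy X.nrm_nonneg Y.nrm_nonneg by (intro mult_le_one power_le_one) auto
    \<comment> \<open>The phase makes the value at (x, y) equal to its modulus, so that passing to
      real parts loses nothing.\<close>
    obtain c where c: "norm c = 1" "c * (P0 + R) x y = of_real (norm ((P0 + R) x y))" by (rule obtain_phase)
    have "?\<pi> (\<lambda>P. c * ?v P) \<le> 1" using seminorm_fun_scale[OF \<pi> ef(1), of c] c(1) ef(2) one by simp
    then have "re (c * ?v P0 + G (\<lambda>P. c * ?v P)) \<le> re (u P0 + G u)"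
      by (rule max[OF subspace_fun_scale[OF V ef(1)]])
    also have "c * ?v P0 + G (\<lambda>P. c * ?v P) = c * (P0 + R) x y"
      using xy P0 by (simp add: linear_fun_scale[OF G(1) ef(1)] R_def distrib_left)
    finally show "norm ((P0 + R) x y) \<le> re (u (P0 + R))" unfolding c(2) uQ by simp
  qed
  then have "sup_norm X (dual Y) (P0 + R) \<le> norm (u (P0 + R))" using re_le order.trans by blast
  with R approx show thesis by (rule that)
qed

end

section \<open>Measures from ultrafilters\<close>

definition ultrafilter :: "'a filter \<Rightarrow> bool" where
  "ultrafilter U \<longleftrightarrow> U \<noteq> bot \<and> (\<forall>P. eventually P U \<or> eventually (\<lambda>x. \<not> P x) U)"

lemma ultrafilter_below:
  assumes "F \<noteq> bot"
  obtains U where "ultrafilter U" "U \<le> F"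
proof -
  define A where "A = {G. G \<noteq> bot \<and> G \<le> F}"
  have "\<exists>m\<in>A. \<forall>a\<in>A. (\<lambda>G H. H \<le> G) m a \<longrightarrow> a = m"
  proof (rule predicate_Zorn)
    show "partial_order_on A (relation_of (\<lambda>G H. H \<le> G) A)"
      by (rule partial_order_on_relation_ofI) auto
    fix C assume "C \<in> Chains (relation_of (\<lambda>G H. H \<le> G) A)"
    then have CA: "C \<subseteq> A" and chain: "\<And>G H. \<lbrakk>G \<in> C; H \<in> C\<rbrakk> \<Longrightarrow> G \<le> H \<or> H \<le> G"
      by (auto simp: Chains_def relation_of_def)
    show "\<exists>u\<in>A. \<forall>a\<in>C. u \<le> a"
    proof (cases "C = {}")
      case True
      then show ?thesis using assms by (auto simp: A_def)
    next
      case False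
      \<comment> \<open>For a chain, what holds eventually along the infimum already holds
        eventually along a member; so the infimum is still a proper filter.\<close>
      have "eventually (\<lambda>_. False) (Inf C) \<longleftrightarrow> (\<exists>b\<in>C. eventually (\<lambda>_. False) b)"
      proof (rule eventually_Inf_base[OF False])
        fix G H assume GH: "G \<in> C" "H \<in> C"
        then show "\<exists>x\<in>C. x \<le> inf G H" using chain[OF GH] by auto
      qed
      then have "Inf C \<noteq> bot" using CA by (auto simp: A_def trivial_limit_def)
      moreover have "Inf C \<le> F"
      proof -
        obtain c where "c \<in> C" using False by blast
        then show ?thesis using CA by (intro Inf_lower2[of c]) (auto simp: A_def)
      qed
      ultimately show ?thesis by (intro bexI[of _ "Inf C"]) (auto simp: A_def intro: Inf_lower)
    qed
  qed
  then obtain U where U: "U \<in> A" and min: "\<And>G. \<lbrakk>G \<in> A; G \<le> U\<rbrakk> \<Longrightarrow> G = U" by blast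
  have "eventually P U \<or> eventually (\<lambda>x. \<not> P x) U" for P
  proof (cases "eventually (\<lambda>x. \<not> P x) U")
    case False
    \<comment> \<open>Restricting U to P stays proper unless P fails eventually, and minimality then
      gives U back.\<close>
    let ?G = "inf U (principal {x. P x})"
    have "?G \<noteq> bot" using False by (simp add: trivial_limit_def eventually_inf_principal)
    then have "?G \<in> A" using U by (auto simp: A_def intro: le_infI1)
    then have "?G = U" by (rule min) simp
    then have "U \<le> principal {x. P x}" by (metis inf_le2)
    then show ?thesis by (simp add: le_principal)
  qed simp
  then show thesis using U by (intro that[of U]) (auto simp: ultrafilter_def A_def)
qed

lemma ultrafilter_not: "ultrafilter U \<Longrightarrow> eventually (\<lambda>x. \<not> P x) U \<longleftrightarrow> \<not> eventually P U"
proof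
  assume U: "ultrafilter U" and "eventually (\<lambda>x. \<not> P x) U"
  show "\<not> eventually P U"
  proof
    assume "eventually P U"
    then have "eventually (\<lambda>_. False) U" using \<open>eventually (\<lambda>x. \<not> P x) U\<close> by eventually_elim simp
    then show False using U by (simp add: ultrafilter_def)
  qed
qed (auto simp: ultrafilter_def)

lemma ultrafilter_tendsto:
  fixes f :: "'a \<Rightarrow> 'b::{heine_borel,real_normed_vector}"
  assumes U: "ultrafilter U" and f: "\<And>x. norm (f x) \<le> B"
  shows "(f \<longlongrightarrow> Lim U f) U"
proof -
  have nt: "U \<noteq> bot" using U by (simp add: ultrafilter_def)
  have "compact (cball (0::'b) B)" by simp
  moreover have "filtermap f U \<noteq> bot" using nt by (simp add: filtermap_bot_iff)
  moreover have "eventually (\<lambda>x. x \<in> cball 0 B) (filtermap f U)" using f by (simp add: eventually_filtermap)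
  ultimately obtain l where l: "inf (nhds l) (filtermap f U) \<noteq> bot"
    unfolding compact_filter by blast
  have "(f \<longlongrightarrow> l) U"
    unfolding filterlim_iff
  proof (intro allI impI)
    fix P assume P: "eventually P (nhds l)"
    show "eventually (\<lambda>x. P (f x)) U"
    proof (rule ccontr)
      assume "\<not> eventually (\<lambda>x. P (f x)) U"
      then have "eventually (\<lambda>y. \<not> P y) (filtermap f U)" using ultrafilter_not[OF U] by (simp add: eventually_filtermap)
      with P have "eventually (\<lambda>_. False) (inf (nhds l) (filtermap f U))"
        unfolding eventually_inf by (intro exI[of _ P] exI[of _ "\<lambda>y. \<not> P y"]) auto
      with l show False by (simp add: trivial_limit_def)
    qed
  qed
  then show ?thesis using tendsto_Lim[OF nt] by auto
qed

text \<open>The nonstandard extension of a set in the ultrapower; sequences that agree \<open>U\<close>-almost everywhere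
  are not identified.\<close>

definition star :: "nat filter \<Rightarrow> 'p set \<Rightarrow> (nat \<Rightarrow> 'p) set" where
  "star U A = {\<omega>. eventually (\<lambda>n. \<omega> n \<in> A) U}"

lemma const_mem_star: "U \<noteq> bot \<Longrightarrow> (\<lambda>_. p) \<in> star U A \<longleftrightarrow> p \<in> A"
  by (simp add: star_def eventually_const_iff)

lemma star_Int: "star U (A \<inter> B) = star U A \<inter> star U B"
  by (auto simp: star_def eventually_conj_iff)

lemma star_Compl: "ultrafilter U \<Longrightarrow> star U (- A) = - star U A"
  by (auto simp: star_def ultrafilter_not)

lemma star_Diff: "ultrafilter U \<Longrightarrow> star U (A - B) = star U A - star U B"
  by (simp add: Diff_eq star_Int star_Compl)

lemma star_Un: "ultrafilter U \<Longrightarrow> star U (A \<union> B) = star U A \<union> star U B"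
  using star_Compl[of U "- A \<inter> - B"] star_Int[of U "- A" "- B"] by (simp add: star_Compl)

lemma star_empty: "U \<noteq> bot \<Longrightarrow> star U {} = {}"
  by (simp add: star_def)

text \<open>Countable additivity comes for free: a decreasing sequence of sets
  \<open>star U (B i)\<close> with empty intersection must reach the empty set, since otherwise a
  diagonal sequence would lie in all of them. Caratheodory's theorem then extends the finitely
  additive \<mu>.\<close>

lemma loeb_extension:
  fixes \<mu> :: "'p set \<Rightarrow> real"
  assumes U: "ultrafilter U" "U \<le> sequentially"
    and \<mu>: "\<And>A. 0 \<le> \<mu> A" "\<mu> {} = 0" "\<And>A B. A \<inter> B = {} \<Longrightarrow> \<mu> (A \<union> B) = \<mu> A + \<mu> B"
  obtains M where "space M = UNIV" "\<And>A. star U A \<in> sets M" "\<And>A. emeasure M (star U A) = ennreal (\<mu> A)"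
proof -
  have nt: "U \<noteq> bot" using U by (simp add: ultrafilter_def)
  \<comment> \<open>A is recovered from \<open>star U A\<close> by means of constant sequences, so
    \<mu> depends on \<open>star U A\<close> only.\<close>
  define standard where "standard S = {p. (\<lambda>_::nat. p) \<in> S}" for S :: "(nat \<Rightarrow> 'p) set"
  have st: "standard (star U A) = A" for A by (simp add: standard_def const_mem_star[OF nt])
  define f where "f S = ennreal (\<mu> (standard S))" for S
  have f_star: "f (star U A) = ennreal (\<mu> A)" for A by (simp add: f_def st)
  interpret ring_of_sets UNIV "range (star U) :: (nat \<Rightarrow> 'p) set set"
  proof (rule ring_of_setsI)
    show "{} \<in> range (star U :: 'p set \<Rightarrow> _)"
      by (rule image_eqI[of _ _ "{}"]) (simp_all add: star_empty[OF nt])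
    fix a b :: "(nat \<Rightarrow> 'p) set" assume "a \<in> range (star U)" "b \<in> range (star U)"
    then obtain A B where ab: "a = star U A" "b = star U B" by blast
    show "a \<union> b \<in> range (star U)" "a - b \<in> range (star U)"
      unfolding ab star_Un[OF U(1), symmetric] star_Diff[OF U(1), symmetric] by simp_all
  qed simp
  have "\<exists>\<nu>. (\<forall>s\<in>range (star U). \<nu> s = f s) \<and> measure_space (UNIV :: (nat \<Rightarrow> 'p) set) (sigma_sets UNIV (range (star U))) \<nu>"
  proof (rule caratheodory_empty_continuous)
    show "positive (range (star U)) f"
      using f_star[of "{}"] by (simp add: positive_def star_empty[OF nt] \<mu>(2))
    show "additive (range (star U)) f"
      unfolding Measure_Space.additive_def
    proof (intro ballI impI)
      fix a b :: "(nat \<Rightarrow> 'p) set" assume "a \<in> range (star U)" "b \<in> range (star U)" and dis: "a \<inter> b = {}"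
      then obtain A B where ab: "a = star U A" "b = star U B" by blast
      have "star U (A \<inter> B) = star U {}" using dis by (simp add: ab star_Int star_empty[OF nt])
      then have "A \<inter> B = {}" using st by metis
      then show "f (a \<union> b) = f a + f b"
        unfolding ab star_Un[OF U(1), symmetric] f_star by (simp add: \<mu>)
    qed
    show "f a \<noteq> \<infinity>" for a by (simp add: f_def)
    fix A :: "nat \<Rightarrow> (nat \<Rightarrow> 'p) set"
    assume A: "range A \<subseteq> range (star U)" "decseq A" "(\<Inter>i. A i) = {}"
    define B where "B i = standard (A i)" for i
    have AB: "A i = star U (B i)" for i
    proof -
      obtain D where "A i = star U D" using A(1) by blast
      then show ?thesis by (simp add: B_def st)
    qed
    have dec: "B j \<subseteq> B i" if "i \<le> j" for i j
      using decseqD[OF A(2) that] by (auto simp: B_def standard_def)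
    have "\<exists>k. B k = {}"
    proof (rule ccontr)
      assume "\<nexists>k. B k = {}"
      then have "\<forall>n. \<exists>p. p \<in> B n" by auto
      \<comment> \<open>Saturation: \<omega> n lies in B n, hence in B k for all n \<ge> k, and
        every tail belongs to U.\<close>
      from choice[OF this] obtain \<omega> where \<omega>: "\<And>n. \<omega> n \<in> B n" by blast
      have "\<omega> \<in> A k" for k
      proof -
        have "eventually (\<lambda>n. \<omega> n \<in> B k) sequentially"
          using eventually_ge_at_top[of k] by eventually_elim (use \<omega> dec in blast)
        then show ?thesis unfolding AB star_def using U(2) by (simp add: filter_leD)
      qed
      then show False using A(3) by blast
    qed
    then obtain k where "B k = {}" by blast
    then have "f (A i) = 0" if "i \<ge> k" for i
      using dec[OF that] by (simp add: AB f_star \<mu>(2))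
    then show "(\<lambda>i. f (A i)) \<longlonglongrightarrow> 0"
      by (intro tendsto_eventually) (auto simp: eventually_sequentially)
  qed
  then obtain \<nu> where \<nu>: "\<And>A. \<nu> (star U A) = ennreal (\<mu> A)"
    and ms: "measure_space UNIV (sigma_sets UNIV (range (star U))) \<nu>"
    using f_star by auto
  let ?M = "measure_of (UNIV :: (nat \<Rightarrow> 'p) set) (range (star U)) \<nu>"
  show thesis
  proof (rule that[of ?M])
    show "space ?M = UNIV" by simp
    show mem: "star U A \<in> sets ?M" for A by simp
    have "positive (sets ?M) \<nu>" "countably_additive (sets ?M) \<nu>" using ms by (auto simp: measure_space_def)
    then show "emeasure ?M (star U A) = ennreal (\<mu> A)" for A
      using emeasure_measure_of[of ?M UNIV "range (star U)" \<nu> "star U A"] mem \<nu> by simp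
  qed
qed

section \<open>Ultralimits of weighted sums as integrals\<close>

lemma finite_range_approximation:
  fixes F :: "'p \<Rightarrow> 'b::{heine_borel,real_normed_vector}"
  assumes F: "\<And>p. norm (F p) \<le> B" and \<delta>: "\<delta> > 0"
  obtains g where "finite (range g)" "\<And>p. norm (F p - g p) \<le> \<delta>"
proof -
  have cover: "cball (0::'b) B \<subseteq> (\<Union>k\<in>cball 0 B. ball k \<delta>)" using \<delta> by force
  have "\<exists>K. finite K \<and> cball (0::'b) B \<subseteq> (\<Union>k\<in>K. ball k \<delta>)"
    by (rule compactE_image[OF compact_cball open_ball cover], intro exI conjI)
  then obtain K :: "'b set" where K: "finite K" "cball 0 B \<subseteq> (\<Union>k\<in>K. ball k \<delta>)"
    by (elim exE conjE)
  have "\<exists>k\<in>K. norm (F p - k) \<le> \<delta>" for p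
  proof -
    have "F p \<in> cball 0 B" using F by simp
    then obtain k where "k \<in> K" "F p \<in> ball k \<delta>" using K(2) by blast
    then show ?thesis by (intro bexI[of _ k]) (auto simp: dist_norm norm_minus_commute)
  qed
  then obtain g where g: "\<And>p. g p \<in> K" "\<And>p. norm (F p - g p) \<le> \<delta>" by metis
  have "finite (range g)" using g(1) K(1) by (meson finite_subset image_subsetI)
  with g(2) show thesis by (rule that[rotated])
qed

lemma finite_range_expansion:
  fixes g :: "'p \<Rightarrow> 'k::real_normed_algebra_1"
  assumes "finite (range g)"
  shows "g p = (\<Sum>v\<in>range g. v * of_real (indicator (g -` {v}) p))"
proof -
  have "(\<Sum>v\<in>range g. v * of_real (indicator (g -` {v}) p)) = (\<Sum>v\<in>range g. if v = g p then v else 0)"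
    by (intro sum.cong refl) (auto simp: indicator_def)
  also have "\<dots> = g p" using assms by (simp add: sum.delta')
  finally show ?thesis by simp
qed

text \<open>\<mu> A is the ultralimit of the weight that the n-th sum puts on A. For finitely valued
  F the ultralimit of the sums is the integral by construction of \<mu>, and a bounded F is a
  uniform limit of finitely valued functions; the bound C on the masses makes both sides continuous
  under uniform limits.\<close>

lemma loeb_integral:
  fixes w :: "nat \<Rightarrow> 'q \<Rightarrow> real" and T :: "nat \<Rightarrow> 'q \<Rightarrow> 'p"
  assumes U: "ultrafilter U" "U \<le> sequentially"
    and w: "\<And>n q. 0 \<le> w n q" "\<And>n. w n summable_on UNIV" "\<And>n. infsum (w n) UNIV \<le> C"
  obtains M where "finite_measure M" "space M = UNIV"
    "\<And>F :: 'p \<Rightarrow> 'k::real_or_complex. \<And>B. (\<And>p. norm (F p) \<le> B) \<Longrightarrow>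
       (\<lambda>\<omega>. Lim U (\<lambda>n. F (\<omega> n))) \<in> borel_measurable M \<and>
       ((\<lambda>n. \<Sum>\<^sub>\<infinity>q. of_real (w n q) * F (T n q)) \<longlongrightarrow> (\<integral>\<omega>. Lim U (\<lambda>n. F (\<omega> n)) \<partial>M)) U"
proof -
  have nt: "U \<noteq> bot" using U by (simp add: ultrafilter_def)
  have C: "C \<ge> 0" using order.trans[OF infsum_nonneg w(3)] w(1) by blast
  define S where "S n F = (\<Sum>\<^sub>\<infinity>q. of_real (w n q) * F (T n q))" for n and F :: "'p \<Rightarrow> 'k"
  have sm: "(\<lambda>q. of_real (w n q) * F (T n q)) summable_on UNIV"
    and S_le: "norm (S n F) \<le> C * B" if B: "\<And>p. norm (F p) \<le> B" for n B and F :: "'p \<Rightarrow> 'k"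
  proof -
    have B0: "B \<ge> 0" using order.trans[OF norm_ge_zero B] .
    have le: "norm (of_real (w n q) * F (T n q)) \<le> B * w n q" for q
      using mult_right_mono[OF B[of "T n q"] w(1)[of n q]] w(1)[of n q] by (simp add: norm_mult mult.commute)
    have sB: "(\<lambda>q. B * w n q) summable_on UNIV" by (intro summable_on_cmult_right w)
    have abs: "(\<lambda>q. norm (of_real (w n q) * F (T n q))) summable_on UNIV"
      by (rule Infinite_Sum.abs_summable_on_comparison_test'[OF sB le])
    then show "(\<lambda>q. of_real (w n q) * F (T n q)) summable_on UNIV" by (rule Infinite_Sum.abs_summable_summable)
    have "norm (S n F) \<le> (\<Sum>\<^sub>\<infinity>q. norm (of_real (w n q) * F (T n q)))"
      unfolding S_def by (rule norm_infsum_bound[OF abs])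
    also have "\<dots> \<le> (\<Sum>\<^sub>\<infinity>q. B * w n q)" by (rule infsum_mono[OF abs sB le])
    also have "\<dots> \<le> C * B" using mult_left_mono[OF w(3)[of n] B0] by (simp add: infsum_cmult_right' mult.commute)
    finally show "norm (S n F) \<le> C * B" .
  qed
  define I where "I F = Lim U (\<lambda>n. S n F)" for F
  have I: "((\<lambda>n. S n F) \<longlongrightarrow> I F) U" if B: "\<And>p. norm (F p) \<le> B" for F B
    unfolding I_def by (rule ultrafilter_tendsto[OF U(1) S_le[OF B]])
  have I_le: "norm (I F) \<le> C * B" if B: "\<And>p. norm (F p) \<le> B" for F B
    by (rule tendsto_upperbound[OF tendsto_norm[OF I[OF B]] _ nt]) (simp add: S_le[OF B])
  have I_add: "I (\<lambda>p. F p + G p) = I F + I G" if F: "\<And>p. norm (F p) \<le> B" and G: "\<And>p. norm (G p) \<le> D" for F G B D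
  proof (rule tendsto_unique[OF nt])
    show "((\<lambda>n. S n (\<lambda>p. F p + G p)) \<longlongrightarrow> I (\<lambda>p. F p + G p)) U"
      by (rule I[of _ "B + D"]) (intro order.trans[OF norm_triangle_ineq] add_mono F G)
    have "S n (\<lambda>p. F p + G p) = S n F + S n G" for n
      unfolding S_def using infsum_add[OF sm[OF F] sm[OF G]] by (simp add: distrib_left)
    then show "((\<lambda>n. S n (\<lambda>p. F p + G p)) \<longlongrightarrow> I F + I G) U"
      using tendsto_add[OF I[OF F] I[OF G]] by simp
  qed
  have I_scale: "I (\<lambda>p. c * F p) = c * I F" if F: "\<And>p. norm (F p) \<le> B" for F B c
  proof (rule tendsto_unique[OF nt])
    show "((\<lambda>n. S n (\<lambda>p. c * F p)) \<longlongrightarrow> I (\<lambda>p. c * F p)) U"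
      by (rule I[of _ "norm c * B"]) (simp add: norm_mult mult_left_mono F)
    have "S n (\<lambda>p. c * F p) = c * S n F" for n
      unfolding S_def by (simp add: mult.left_commute[of _ c] infsum_cmult_right')
    then show "((\<lambda>n. S n (\<lambda>p. c * F p)) \<longlongrightarrow> c * I F) U"
      using tendsto_mult_left[OF I[OF F]] by simp
  qed
  define m where "m n A = (\<Sum>\<^sub>\<infinity>q. w n q * indicator A (T n q))" for n A
  have sm_m: "(\<lambda>q. w n q * indicator A (T n q)) summable_on UNIV" for n A
    by (rule summable_on_comparison_test[OF w(2)[of n]]) (use w(1) in \<open>auto simp: indicator_def\<close>)
  have m0: "0 \<le> m n A" for n A unfolding m_def using w(1) by (intro infsum_nonneg) auto
  have mC: "m n A \<le> C" for n A
  proof -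
    have "m n A \<le> infsum (w n) UNIV"
      unfolding m_def by (rule infsum_mono[OF sm_m w(2)]) (use w(1) in \<open>auto simp: indicator_def\<close>)
    then show ?thesis using w(3)[of n] by linarith
  qed
  define \<mu> where "\<mu> A = Lim U (\<lambda>n. m n A)" for A
  have \<mu>: "((\<lambda>n. m n A) \<longlongrightarrow> \<mu> A) U" for A
    unfolding \<mu>_def by (rule ultrafilter_tendsto[OF U(1), of _ C]) (simp add: m0 mC)
  have \<mu>0: "0 \<le> \<mu> A" for A by (rule tendsto_lowerbound[OF \<mu> _ nt]) (simp add: m0)
  have \<mu>_empty: "\<mu> {} = 0"
    by (rule tendsto_unique[OF nt \<mu>]) (simp add: m_def)
  have \<mu>_add: "\<mu> (A \<union> B) = \<mu> A + \<mu> B" if "A \<inter> B = {}" for A B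
  proof (rule tendsto_unique[OF nt \<mu>])
    have "m n (A \<union> B) = m n A + m n B" for n
      unfolding m_def using infsum_add[OF sm_m[of n A] sm_m[of n B]] that
      by (simp add: indicator_add[symmetric] distrib_left)
    then show "((\<lambda>n. m n (A \<union> B)) \<longlongrightarrow> \<mu> A + \<mu> B) U" using tendsto_add[OF \<mu> \<mu>] by simp
  qed
  have I_ind: "I (\<lambda>p. of_real (indicator A p)) = of_real (\<mu> A)" for A
  proof (rule tendsto_unique[OF nt])
    show "((\<lambda>n. S n (\<lambda>p. of_real (indicator A p))) \<longlongrightarrow> I (\<lambda>p. of_real (indicator A p))) U"
      by (rule I[of _ 1]) (simp add: indicator_def)
    have "S n (\<lambda>p. of_real (indicator A p)) = of_real (m n A)" for n
    proof -
      have "((\<lambda>q. of_real (w n q * indicator A (T n q)) :: 'k) has_sum of_real (m n A)) UNIV"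
        unfolding has_sum_of_real_iff m_def by (rule has_sum_infsum[OF sm_m])
      then show ?thesis unfolding S_def by (simp add: infsumI)
    qed
    then show "((\<lambda>n. S n (\<lambda>p. of_real (indicator A p))) \<longlongrightarrow> of_real (\<mu> A)) U"
      using tendsto_of_real[OF \<mu>] by simp
  qed
  obtain M where M: "space M = UNIV" "\<And>A. star U A \<in> sets M" "\<And>A. emeasure M (star U A) = ennreal (\<mu> A)"
    using loeb_extension[OF U \<mu>0 \<mu>_empty \<mu>_add] by blast
  have "star U (UNIV :: 'p set) = UNIV" by (simp add: star_def)
  then have "emeasure M (space M) \<noteq> \<infinity>" using M(3)[of UNIV] M(1) by simp
  then interpret finite_measure M by (rule finite_measureI)
  have meas: "measure M (star U A) = \<mu> A" for A by (simp add: measure_def M(3) \<mu>0)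
  let ?L = "\<lambda>F \<omega>. Lim U (\<lambda>n. F (\<omega> n)) :: 'k"
  \<comment> \<open>The ultralimit of g (\<omega> n) for a finitely valued g, written as a simple
    function over the sets \<open>star U\<close>.\<close>
  define G where "G g \<omega> = (\<Sum>v\<in>range g. v * of_real (indicator (star U (g -` {v})) \<omega>))" for g :: "'p \<Rightarrow> 'k" and \<omega>
  have "(\<lambda>\<omega>. of_real (indicator (star U A) \<omega>) :: 'k) \<in> borel_measurable M" for A
    by (rule measurable_compose[OF borel_measurable_indicator[OF M(2)]
        borel_measurable_continuous_onI[OF continuous_on_of_real[OF continuous_on_id]]])
  then have G_meas: "G g \<in> borel_measurable M" for g
    unfolding G_def by (intro borel_measurable_sum borel_measurable_times borel_measurable_const)
  have G_bd: "norm (G g \<omega>) \<le> (\<Sum>v\<in>range g. norm v)" for g \<omega>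
    unfolding G_def by (rule order.trans[OF norm_sum sum_mono]) (auto simp: norm_mult indicator_def)
  have G_int: "(\<integral>\<omega>. G g \<omega> \<partial>M) = I g" if g: "finite (range g)" for g
  proof -
    have int: "integrable M (\<lambda>\<omega>. v * of_real (indicator (star U (g -` {v})) \<omega>) :: 'k)" for v
      by (intro integrable_mult_right integrable_of_real integrable_real_indicator M) (simp add: M)
    have "(\<integral>\<omega>. G g \<omega> \<partial>M) = (\<Sum>v\<in>range g. v * of_real (\<mu> (g -` {v})))"
      unfolding G_def by (subst Bochner_Integration.integral_sum[OF int]) (simp add: M meas)
    also have "\<dots> = I (\<lambda>p. \<Sum>v\<in>range g. v * of_real (indicator (g -` {v}) p))"
    proof -
      have "I (\<lambda>p. \<Sum>v\<in>V. v * of_real (indicator (g -` {v}) p)) = (\<Sum>v\<in>V. v * of_real (\<mu> (g -` {v})))"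
        if "finite V" for V
        using that
      proof (induction V)
        case empty
        have "I (\<lambda>p. 0 * 0) = 0 * I (\<lambda>p. 0)" by (rule I_scale[of _ 0]) simp
        then show ?case by simp
      next
        case (insert x V)
        have 1: "norm (x * of_real (indicator (g -` {x}) p)) \<le> norm x" for p by (simp add: norm_mult indicator_def)
        have 2: "norm (\<Sum>v\<in>V. v * of_real (indicator (g -` {v}) p)) \<le> (\<Sum>v\<in>V. norm v)" for p
          by (rule order.trans[OF norm_sum sum_mono]) (auto simp: norm_mult indicator_def)
        have 3: "I (\<lambda>p. x * of_real (indicator (g -` {x}) p)) = x * of_real (\<mu> (g -` {x}))"
          unfolding I_ind[symmetric] by (rule I_scale[of _ 1]) (simp add: indicator_def)
        show ?case using insert I_add[OF 1 2] 3 by simp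
      qed
      from this[OF g] show ?thesis by simp
    qed
    also have "(\<lambda>p. \<Sum>v\<in>range g. v * of_real (indicator (g -` {v}) p)) = g"
      by (intro ext finite_range_expansion[OF g, symmetric])
    finally show ?thesis .
  qed
  have approx: "norm (?L F \<omega> - G g \<omega>) \<le> \<delta>"
    if F: "\<And>p. norm (F p) \<le> B" and g: "finite (range g)" "\<And>p. norm (F p - g p) \<le> \<delta>" for F g B \<delta> \<omega>
  proof -
    \<comment> \<open>An ultrafilter selects one set from a finite cover: for U-almost all n, g
      (\<omega> n) is a single value v.\<close>
    obtain v where v: "v \<in> range g" "\<omega> \<in> star U (g -` {v})"
    proof -
      have "\<exists>v\<in>V. \<omega> \<in> star U (g -` {v})" if "finite V" "\<omega> \<in> star U (g -` V)" for V
        using that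
      proof (induction V)
        case empty
        then show ?case by (simp add: star_empty[OF nt])
      next
        case (insert x V)
        have "g -` insert x V = g -` {x} \<union> g -` V" by auto
        then show ?case using insert by (auto simp: star_Un[OF U(1)])
      qed
      moreover have "\<omega> \<in> star U (g -` range g)" by (simp add: star_def)
      ultimately show ?thesis using g(1) that by blast
    qed
    have "\<omega> \<notin> star U (g -` {v'})" if "v' \<noteq> v" for v'
    proof
      assume "\<omega> \<in> star U (g -` {v'})"
      then have "\<omega> \<in> star U (g -` {v} \<inter> g -` {v'})" using v(2) by (simp add: star_Int)
      moreover have "g -` {v} \<inter> g -` {v'} = {}" using that by auto
      ultimately show False by (simp add: star_empty[OF nt])
    qed
    then have "G g \<omega> = (\<Sum>v'\<in>range g. if v' = v then v' else 0)"
      unfolding G_def using v(2) by (intro sum.cong refl) (auto simp: indicator_def)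
    then have Gv: "G g \<omega> = v" using v(1) g(1) by (simp add: sum.delta')
    have "((\<lambda>n. norm (F (\<omega> n) - v)) \<longlongrightarrow> norm (?L F \<omega> - v)) U"
      by (intro tendsto_intros ultrafilter_tendsto[OF U(1), of _ B] F)
    moreover have "eventually (\<lambda>n. norm (F (\<omega> n) - v) \<le> \<delta>) U"
      using v(2) unfolding star_def mem_Collect_eq by eventually_elim (use g(2) in force)
    ultimately show ?thesis unfolding Gv by (rule tendsto_upperbound[OF _ _ nt])
  qed
  show thesis
  proof (rule that[of M])
    show "finite_measure M" by (rule finite_measure_axioms)
    show "space M = UNIV" by (rule M)
    fix F :: "'p \<Rightarrow> 'k" and B assume F: "\<And>p. norm (F p) \<le> B"
    have "\<exists>g. finite (range g) \<and> (\<forall>p. norm (F p - g p) \<le> 1 / real (Suc k))" for k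
    proof (rule finite_range_approximation[OF F])
      show "1 / real (Suc k) > 0" by simp
    qed (intro exI conjI allI)
    then have "\<forall>k. \<exists>g. finite (range g) \<and> (\<forall>p. norm (F p - g p) \<le> 1 / real (Suc k))" by (rule allI)
    from choice[OF this] obtain g where g0: "\<forall>k. finite (range (g k)) \<and> (\<forall>p. norm (F p - g k p) \<le> 1 / real (Suc k))"
      by (rule exE)
    have g: "finite (range (g k))" "norm (F p - g k p) \<le> 1 / real (Suc k)" for k p
      using g0[THEN spec[of _ k]] by simp_all
    have lim0: "(\<lambda>k. 1 / real (Suc k)) \<longlonglongrightarrow> 0" by (rule LIMSEQ_Suc[OF lim_1_over_n])
    have lim: "(\<lambda>k. G (g k) \<omega>) \<longlonglongrightarrow> ?L F \<omega>" for \<omega>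
    proof (rule LIM_zero_cancel, rule Lim_null_comparison[OF _ lim0])
      show "eventually (\<lambda>k. norm (G (g k) \<omega> - ?L F \<omega>) \<le> 1 / real (Suc k)) sequentially"
        using approx[OF F g(1) g(2)] by (auto simp: norm_minus_commute)
    qed
    have mL: "?L F \<in> borel_measurable M"
      by (rule borel_measurable_LIMSEQ_metric[OF G_meas lim])
    have L_bd: "norm (?L F \<omega>) \<le> B" for \<omega>
      by (rule tendsto_upperbound[OF tendsto_norm[OF ultrafilter_tendsto[OF U(1), of "\<lambda>n. F (\<omega> n)" B]] _ nt]) (auto simp: F)
    have L_int: "integrable M (?L F)"
      by (rule integrable_const_bound[where B = B]) (auto simp: L_bd mL)
    have G_integrable: "integrable M (G (g k))" for k
      by (rule integrable_const_bound[where B = "\<Sum>v\<in>range (g k). norm v"]) (auto simp: G_bd G_meas)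
    have "norm ((\<integral>\<omega>. ?L F \<omega> \<partial>M) - I F) \<le> (1 / real (Suc k)) * (measure M (space M) + C)" for k
    proof -
      have "norm ((\<integral>\<omega>. ?L F \<omega> \<partial>M) - (\<integral>\<omega>. G (g k) \<omega> \<partial>M)) \<le> (\<integral>\<omega>. norm (?L F \<omega> - G (g k) \<omega>) \<partial>M)"
        unfolding Bochner_Integration.integral_diff[OF L_int G_integrable, symmetric] by (rule integral_norm_bound)
      also have "\<dots> \<le> (\<integral>\<omega>. 1 / real (Suc k) \<partial>M)"
        by (intro integral_mono Bochner_Integration.integrable_norm Bochner_Integration.integrable_diff L_int G_integrable integrable_const
            approx[OF F g(1) g(2)])
      also have "\<dots> = (1 / real (Suc k)) * measure M (space M)" by simp
      finally have 1: "norm ((\<integral>\<omega>. ?L F \<omega> \<partial>M) - I (g k)) \<le> (1 / real (Suc k)) * measure M (space M)"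
        unfolding G_int[OF g(1)] .
      have gb: "norm (g k p) \<le> B + 1" for p
      proof -
        have "1 / real (Suc k) \<le> 1" by simp
        then show ?thesis
          using norm_triangle_ineq3[of "F p" "g k p"] g(2)[of p k] F[of p] by linarith
      qed
      have "I (\<lambda>p. F p + (- 1) * g k p) = I F + (- 1) * I (g k)"
        using I_add[OF F, of "\<lambda>p. (- 1) * g k p" "B + 1"] I_scale[OF gb, of "- 1"] gb by (simp add: norm_mult)
      moreover have "norm (I (\<lambda>p. F p + (- 1) * g k p)) \<le> C * (1 / real (Suc k))"
        by (rule I_le) (use g(2) in simp)
      ultimately have "norm (I (g k) - I F) \<le> (1 / real (Suc k)) * C"
        by (simp add: norm_minus_commute mult.commute)
      with 1 show ?thesis
        using norm_triangle_ineq[of "(\<integral>\<omega>. ?L F \<omega> \<partial>M) - I (g k)" "I (g k) - I F"] by (simp add: distrib_left)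
    qed
    moreover have "(\<lambda>k. (1 / real (Suc k)) * (measure M (space M) + C)) \<longlonglongrightarrow> 0"
      using tendsto_mult_left_zero[OF lim0] by simp
    ultimately have "norm ((\<integral>\<omega>. ?L F \<omega> \<partial>M) - I F) \<le> 0"
      by (intro LIMSEQ_le_const) auto
    then have "(\<integral>\<omega>. ?L F \<omega> \<partial>M) = I F" by simp
    then show "?L F \<in> borel_measurable M \<and> ((\<lambda>n. \<Sum>\<^sub>\<infinity>q. of_real (w n q) * F (T n q)) \<longlongrightarrow> (\<integral>\<omega>. ?L F \<omega> \<partial>M)) U"
      using mL I[OF F] unfolding S_def by simp
  qed
qed

section \<open>Finite rank approximation\<close>

lemma sum_fun_apply: "(\<Sum>i\<in>I. f i) x = (\<Sum>i\<in>I. f i x)"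
  by (induction I rule: infinite_finite_induct) auto

text \<open>With the tails \<open>r m\<close> of the series, the quotients \<open>a m / sqrt (r m)\<close> are dominated by \<open>2 * (sqrt (r m) - sqrt (r (m + 1)))\<close>.\<close>

lemma summable_split:
  fixes a :: "nat \<Rightarrow> real"
  assumes a: "\<And>m. 0 \<le> a m" "summable a"
  obtains b s where "\<And>m. 0 \<le> b m" "\<And>m. 0 \<le> s m" "\<And>m. a m = b m * s m" "summable b" "s \<longlonglongrightarrow> 0"
proof -
  define r where "r m = (\<Sum>k. a (k + m))" for m
  have sm: "summable (\<lambda>k. a (k + m))" for m using a(2) by (subst summable_iff_shift)
  have r0: "r m \<ge> 0" for m unfolding r_def by (rule suminf_nonneg[OF sm a(1)])
  have r_eq: "r m = suminf a - (\<Sum>k<m. a k)" for m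
    unfolding r_def by (rule suminf_minus_initial_segment[OF a(2)])
  have step: "r m = a m + r (Suc m)" for m unfolding r_eq by simp
  have "r \<longlonglongrightarrow> 0"
    unfolding r_eq using tendsto_diff[OF tendsto_const summable_LIMSEQ[OF a(2)], of "suminf a"] by simp
  then have s0: "(\<lambda>m. sqrt (r m)) \<longlonglongrightarrow> 0" using tendsto_real_sqrt by fastforce
  define b where "b m = a m / sqrt (r m)" for m
  have b0: "b m \<ge> 0" for m unfolding b_def using a(1) r0 by simp
  have ab: "a m = b m * sqrt (r m)" for m
  proof (cases "r m = 0")
    case True
    then have "a m = 0" using step[of m] a(1)[of m] r0[of "Suc m"] by linarith
    then show ?thesis using True by simp
  qed (simp add: b_def)
  have b_le: "b m \<le> 2 * (sqrt (r m) - sqrt (r (Suc m)))" for m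
  proof (cases "r m = 0")
    case True
    then have "r (Suc m) = 0" using step[of m] a(1)[of m] r0[of "Suc m"] by linarith
    then show ?thesis using True by (simp add: b_def)
  next
    case False
    let ?s = "sqrt (r m)" and ?t = "sqrt (r (Suc m))"
    have s: "?s > 0" using False r0[of m] by simp
    have t: "0 \<le> ?t" "?t \<le> ?s" using r0 step[of m] a(1)[of m] by auto
    have "?s * ?s = r m" "?t * ?t = r (Suc m)" using r0 by simp_all
    moreover have "(?s - ?t) * (?s + ?t) = ?s * ?s - ?t * ?t" by (simp only: square_diff_square_factored mult.commute)
    ultimately have "a m = (?s - ?t) * (?s + ?t)" using step[of m] by linarith
    also have "\<dots> \<le> (?s - ?t) * (2 * ?s)" using t by (intro mult_left_mono) auto
    finally show ?thesis unfolding b_def using s by (simp add: field_simps)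
  qed
  have "summable b"
  proof (rule bounded_imp_summable[of _ "2 * sqrt (r 0)"])
    fix n
    have "(\<Sum>m\<le>n. b m) \<le> (\<Sum>m<Suc n. 2 * (sqrt (r m) - sqrt (r (Suc m))))"
      unfolding lessThan_Suc_atMost by (intro sum_mono b_le)
    also have "\<dots> = 2 * (sqrt (r 0) - sqrt (r (Suc n)))"
      unfolding sum_distrib_left[symmetric] by (subst sum_lessThan_telescope') simp
    also have "\<dots> \<le> 2 * sqrt (r 0)" using r0 by simp
    finally show "(\<Sum>m\<le>n. b m) \<le> 2 * sqrt (r 0)" .
  qed (rule b0)
  show thesis by (rule that[OF b0 _ ab \<open>summable b\<close> s0]) (simp add: r0)
qed

text \<open>An operator on the dual whose coefficients are evaluations at vectors e r of X, instead
  of arbitrary functionals of the bidual. Applying a bidual vector u to its value at g gives \<Sum>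
  u (\<phi> r) * g (e r), where u no longer meets g.\<close>

definition finite_rank :: "nat \<Rightarrow> (nat \<Rightarrow> 'x) \<Rightarrow> (nat \<Rightarrow> 'x \<Rightarrow> 'k::real_or_complex) \<Rightarrow> ('x \<Rightarrow> 'k) \<Rightarrow> 'x \<Rightarrow> 'k" where
  "finite_rank n e \<phi> g x = (\<Sum>r<n. g (e r) * \<phi> r x)"

lemma finite_rank_add: "finite_rank n e \<phi> (\<lambda>x. g x + h x) x = finite_rank n e \<phi> g x + finite_rank n e \<phi> h x"
  and finite_rank_scale: "finite_rank n e \<phi> (\<lambda>x. c * g x) x = c * finite_rank n e \<phi> g x"
  and finite_rank_diff: "finite_rank n e \<phi> (\<lambda>x. g x - h x) x = finite_rank n e \<phi> g x - finite_rank n e \<phi> h x"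
  and finite_rank_sum: "finite_rank n e \<phi> (\<lambda>x. \<Sum>i\<in>I. f i x) x = (\<Sum>i\<in>I. finite_rank n e \<phi> (f i) x)"
proof -
  show "finite_rank n e \<phi> (\<lambda>x. \<Sum>i\<in>I. f i x) x = (\<Sum>i\<in>I. finite_rank n e \<phi> (f i) x)"
    unfolding finite_rank_def sum_distrib_right by (rule sum.swap)
qed (simp_all add: finite_rank_def distrib_right left_diff_distrib sum.distrib sum_subtractf sum_distrib_left mult.assoc)

context
  fixes X :: "('k::real_or_complex, 'x::ab_group_add) nspace"
  assumes X: "normed_space X"
begin

interpretation X: normed_space X by (rule X)
interpretation D: normed_space "dual X" by (rule X.normed_space_dual)

lemma finite_rank_mem:
  assumes "\<And>r. r < n \<Longrightarrow> \<phi> r \<in> vecs (dual X)"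
  shows "finite_rank n e \<phi> g \<in> vecs (dual X)"
proof -
  have "finite_rank n e \<phi> g = (\<Sum>r<n. smul (dual X) (g (e r)) (\<phi> r))"
    by (auto simp: fun_eq_iff finite_rank_def sum_fun_apply)
  also have "\<dots> \<in> vecs (dual X)" using assms by (intro D.sum_mem D.smul_mem) auto
  finally show ?thesis .
qed

text \<open>A Gram-Schmidt process: the operator T is a projection that fixes B. If b0 is not fixed,
  the remainder b1 = b0 - T b0 is added, together with a vector e' at which b1 has the value 1 and
  all functionals fixed by T vanish.\<close>

lemma biorthogonal_system:
  assumes "finite B" "B \<subseteq> vecs (dual X)"
  shows "\<exists>n e \<phi>. (\<forall>r<n. e r \<in> vecs X \<and> \<phi> r \<in> vecs (dual X) \<and> finite_rank n e \<phi> (\<phi> r) = \<phi> r) \<and>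
    (\<forall>b\<in>B. finite_rank n e \<phi> b = b)"
  using assms
proof (induction B)
  case empty
  show ?case by (intro exI[of _ 0]) simp
next
  case (insert b0 B)
  have "B \<subseteq> vecs (dual X)" using insert.prems by simp
  from insert.IH[OF this] obtain n e \<phi> where
    sys: "\<forall>r<n. e r \<in> vecs X \<and> \<phi> r \<in> vecs (dual X) \<and> finite_rank n e \<phi> (\<phi> r) = \<phi> r" "\<forall>b\<in>B. finite_rank n e \<phi> b = b"
    by blast
  then have e: "\<And>r. r < n \<Longrightarrow> e r \<in> vecs X" and \<phi>: "\<And>r. r < n \<Longrightarrow> \<phi> r \<in> vecs (dual X)"
    and fix\<phi>: "\<And>r. r < n \<Longrightarrow> finite_rank n e \<phi> (\<phi> r) = \<phi> r" and fixB: "\<And>b. b \<in> B \<Longrightarrow> finite_rank n e \<phi> b = b"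
    by simp_all
  let ?T = "finite_rank n e \<phi>"
  have b0: "b0 \<in> vecs (dual X)" using insert.prems by simp
  have idem: "?T (?T g) = ?T g" for g
  proof
    fix x
    have "?T (?T g) x = ?T (\<lambda>x. \<Sum>r<n. g (e r) * \<phi> r x) x" by (simp add: finite_rank_def[abs_def])
    also have "\<dots> = (\<Sum>r<n. g (e r) * ?T (\<phi> r) x)" by (simp only: finite_rank_sum finite_rank_scale)
    also have "\<dots> = ?T g x" by (simp add: fix\<phi> finite_rank_def[of n e \<phi> g])
    finally show "?T (?T g) x = ?T g x" .
  qed
  define b1 where "b1 x = b0 x - ?T b0 x" for x
  have Tb0: "?T b0 \<in> vecs (dual X)" by (rule finite_rank_mem[OF \<phi>])
  have "b1 = b0 - ?T b0" by (auto simp: b1_def)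
  then have b1: "b1 \<in> vecs (dual X)" using D.diff_mem[OF b0 Tb0] by simp
  have Tb1: "?T b1 x = 0" for x
    unfolding b1_def finite_rank_diff idem by simp
  show ?case
  proof (cases "\<forall>x\<in>vecs X. b1 x = 0")
    case True
    then have "b1 x = 0" for x using X.dual_outside[OF b1] by blast
    then have "?T b0 = b0" by (auto simp: b1_def)
    then show ?thesis using e \<phi> fix\<phi> fixB by (intro exI[of _ n] exI[of _ e] exI[of _ \<phi>]) auto
  next
    case False
    then obtain x where x: "x \<in> vecs X" "b1 x \<noteq> 0" by blast
    define x1 where "x1 = smul X (1 / b1 x) x"
    have x1: "x1 \<in> vecs X" "b1 x1 = 1" using x by (auto simp: x1_def X.smul_mem X.dual_smul[OF b1])
    \<comment> \<open>From x1 its image under the operator on X whose adjoint is T is subtracted;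
      hence h e' = (h - T h) x1.\<close>
    define e' where "e' = x1 - (\<Sum>r<n. smul X (\<phi> r x1) (e r))"
    have e': "e' \<in> vecs X" unfolding e'_def by (intro X.diff_mem X.sum_mem X.smul_mem x1 e) auto
    have at_e': "h e' = h x1 - ?T h x1" if h: "h \<in> vecs (dual X)" for h
    proof -
      have mem: "smul X (\<phi> r x1) (e r) \<in> vecs X" if "r \<in> {..<n}" for r using that by (intro X.smul_mem e) auto
      have "h e' = h x1 - h (\<Sum>r<n. smul X (\<phi> r x1) (e r))"
        unfolding e'_def by (intro X.dual_diff[OF h x1(1)] X.sum_mem mem)
      also have "h (\<Sum>r<n. smul X (\<phi> r x1) (e r)) = (\<Sum>r<n. h (smul X (\<phi> r x1) (e r)))"
        by (intro X.dual_sum[OF h] mem)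
      also have "(\<Sum>r<n. h (smul X (\<phi> r x1) (e r))) = ?T h x1"
        unfolding finite_rank_def by (intro sum.cong refl) (simp add: X.dual_smul[OF h e])
      finally show ?thesis .
    qed
    let ?e = "e(n := e')" and ?\<phi> = "\<phi>(n := b1)"
    let ?T' = "finite_rank (Suc n) ?e ?\<phi>"
    have T': "?T' h x = ?T h x + h e' * b1 x" for h x
      unfolding finite_rank_def sum.lessThan_Suc by simp
    have fixed: "?T' h = h" if "h \<in> vecs (dual X)" "?T h = h" for h
      using at_e'[OF that(1)] that(2) by (auto simp: fun_eq_iff T')
    have fix_b1: "?T' b1 = b1" using at_e'[OF b1] x1(2) by (auto simp: fun_eq_iff T' Tb1)
    have "?T' b0 = b0"
    proof
      fix x
      have "?T' b0 x = ?T' (\<lambda>x. b1 x + ?T b0 x) x" by (simp add: b1_def)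
      also have "\<dots> = b1 x + ?T b0 x"
        unfolding finite_rank_add fix_b1 fixed[OF Tb0 idem] ..
      finally show "?T' b0 x = b0 x" by (simp add: b1_def)
    qed
    moreover have "?T' b = b" if "b \<in> B" for b using fixed fixB[OF that] insert.prems that by blast
    moreover have "?e r \<in> vecs X \<and> ?\<phi> r \<in> vecs (dual X) \<and> ?T' (?\<phi> r) = ?\<phi> r" if "r < Suc n" for r
      using that e e' b1 \<phi> fix_b1 fixed[OF \<phi> fix\<phi>] by (cases "r = n") auto
    ultimately have "(\<forall>r<Suc n. ?e r \<in> vecs X \<and> ?\<phi> r \<in> vecs (dual X) \<and> ?T' (?\<phi> r) = ?\<phi> r) \<and>
        (\<forall>b\<in>insert b0 B. ?T' b = b)" by blast
    then show ?thesis by (rule exI[of _ "Suc n", OF exI[of _ ?e, OF exI[of _ ?\<phi>]]])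
  qed
qed

text \<open>The approximation property gives an operator S whose coefficients c r lie in the bidual.
  On the sequence k they can be exchanged for vectors e r of X: Goldstine's theorem deals with
  finitely many k m, and for the remaining ones both values are small because e r and c r have norm
  at most \<rho>.\<close>

lemma approximation_on_null_sequence:
  assumes ap: "approximation_property (dual X)"
    and k: "\<And>m. k m \<in> vecs (dual X)" "(\<lambda>m. nrm (dual X) (k m)) \<longlonglongrightarrow> 0" and \<delta>: "\<delta> > 0"
  obtains n e \<phi> where "\<And>r. r < n \<Longrightarrow> e r \<in> vecs X" "\<And>r. r < n \<Longrightarrow> \<phi> r \<in> vecs (dual X)"
    "\<And>m. nrm (dual X) (finite_rank n e \<phi> (k m) - k m) \<le> \<delta>"
proof -
  let ?K = "insert 0 (range k)"
  have "limitin (norm_topology (dual X)) k 0 sequentially"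
    unfolding norm_topology_def Metric_space.limitin_metric[OF D.Metric_space]
  proof (intro conjI D.zero_mem allI impI)
    fix \<epsilon> :: real assume "\<epsilon> > 0"
    then have "eventually (\<lambda>m. nrm (dual X) (k m) < \<epsilon>) sequentially" using k(2) by (rule order_tendstoD(2)[rotated])
    then show "eventually (\<lambda>m. k m \<in> vecs (dual X) \<and> ndist (dual X) (k m) 0 < \<epsilon>) sequentially"
      by eventually_elim (simp add: k ndist_def D.zero_mem del: dual_sel)
  qed
  then have comp: "compactin (norm_topology (dual X)) ?K"
    by (rule compactin_sequence_with_limit) (auto simp: D.topspace_norm_topology k)
  have half: "\<delta> / 2 > 0" using \<delta> by simp
  obtain S where SS: "linear_map (dual X) (dual X) S \<and>
      continuous_map (norm_topology (dual X)) (norm_topology (dual X)) S \<and>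
      (\<exists>B. finite B \<and> B \<subseteq> vecs (dual X) \<and> (\<forall>g\<in>vecs (dual X). \<exists>c. S g = (\<Sum>b\<in>B. smul (dual X) (c b) b))) \<and>
      (\<forall>g\<in>?K. nrm (dual X) (S g - g) \<le> \<delta> / 2)"
    using ap[unfolded approximation_property_def, THEN spec, THEN spec, THEN mp, OF conjI[OF comp half]] by (rule exE)
  note S = SS[THEN conjunct1] SS[THEN conjunct2, THEN conjunct1]
    and fin = SS[THEN conjunct2, THEN conjunct2, THEN conjunct1]
    and close = SS[THEN conjunct2, THEN conjunct2, THEN conjunct2, THEN bspec]
  from fin obtain B where B: "finite B" "B \<subseteq> vecs (dual X)"
    "\<And>g. g \<in> vecs (dual X) \<Longrightarrow> \<exists>c. S g = (\<Sum>b\<in>B. smul (dual X) (c b) b)" by blast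
  obtain C where C: "C \<ge> 0" "\<And>g. g \<in> vecs (dual X) \<Longrightarrow> nrm (dual X) (S g) \<le> C * nrm (dual X) g"
    using continuous_linear_iff_bounded[OF D.normed_space_axioms D.normed_space_axioms S(1)] S(2) by blast
  obtain n a \<phi> where a: "\<And>r. r < n \<Longrightarrow> a r \<in> vecs X" and \<phi>: "\<And>r. r < n \<Longrightarrow> \<phi> r \<in> vecs (dual X)"
    and fixB: "\<And>b. b \<in> B \<Longrightarrow> finite_rank n a \<phi> b = b"
    using biorthogonal_system[OF B(1,2)] by blast
  \<comment> \<open>The range of S lies in the span of B, which the system (a, \<phi>) reproduces;
    the coefficients of S g are its values at the vectors a r.\<close>
  have S_eq: "S g x = (\<Sum>r<n. S g (a r) * \<phi> r x)" if g: "g \<in> vecs (dual X)" for g x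
  proof -
    obtain c where c: "S g = (\<Sum>b\<in>B. smul (dual X) (c b) b)" using B(3)[OF g] by blast
    have Sx: "S g x = (\<Sum>b\<in>B. c b * b x)" for x unfolding c by (simp add: sum_fun_apply)
    have "(\<Sum>r<n. S g (a r) * \<phi> r x) = finite_rank n a \<phi> (\<lambda>x. \<Sum>b\<in>B. c b * b x) x"
      by (simp add: finite_rank_def Sx)
    also have "\<dots> = (\<Sum>b\<in>B. c b * b x)"
      unfolding finite_rank_sum finite_rank_scale by (intro sum.cong refl) (simp add: fixB)
    finally show ?thesis using Sx by simp
  qed
  define c where "c r = (\<lambda>g. if g \<in> vecs (dual X) then S g (a r) else 0)" for r
  have c: "c r \<in> vecs (bidual X)" if r: "r < n" for r
  proof (rule D.dual_memI)
    fix g assume g: "g \<in> vecs (dual X)"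
    have "norm (S g (a r)) \<le> nrm (dual X) (S g) * nrm X (a r)"
      by (rule X.dual_norm_le[OF linear_map_mem[OF S(1) g] a[OF r]])
    also have "\<dots> \<le> C * nrm (dual X) g * nrm X (a r)" by (intro mult_right_mono C(2)[OF g] X.nrm_nonneg a r)
    finally show "norm (c r g) \<le> (C * nrm X (a r)) * nrm (dual X) g" using g by (simp add: c_def mult_ac)
  qed (use D.add_mem D.smul_mem linear_map_add[OF S(1)] linear_map_smul[OF S(1)] in \<open>auto simp: c_def\<close>)
  \<comment> \<open>An error \<eta> in each coefficient amounts to at most \<eta> * \<Phi> =
    \<delta> / 2 in norm; the summand 1 keeps \<Phi> positive.\<close>
  define \<Phi> where "\<Phi> = (\<Sum>r<n. nrm (dual X) (\<phi> r)) + 1"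
  have \<Phi>: "\<Phi> > 0" unfolding \<Phi>_def using D.nrm_nonneg[OF \<phi>] by (intro add_nonneg_pos sum_nonneg) auto
  define \<eta> where "\<eta> = \<delta> / (2 * \<Phi>)"
  have \<eta>: "\<eta> > 0" using \<delta> \<Phi> by (simp add: \<eta>_def)
  have "\<exists>e. e \<in> vecs X \<and> (\<forall>m. norm (k m e - c r (k m)) \<le> \<eta>)" if r: "r < n" for r
  proof -
    define \<rho> where "\<rho> = nrm (bidual X) (c r) + 1"
    have \<rho>: "\<rho> > 0" unfolding \<rho>_def using D.dual_sup_nonneg[OF c[OF r]] by simp
    \<comment> \<open>From here on the values of e r and of c r at k m are each at most \<eta> /
      2.\<close>
    have "eventually (\<lambda>m. nrm (dual X) (k m) < \<eta> / (2 * \<rho>)) sequentially"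
      using k(2) \<eta> \<rho> by (intro order_tendstoD(2)) auto
    then obtain M where M: "\<And>m. m \<ge> M \<Longrightarrow> nrm (dual X) (k m) < \<eta> / (2 * \<rho>)" by (auto simp: eventually_sequentially)
    obtain e where e: "e \<in> vecs X" "nrm X e < \<rho>" "\<And>f. f \<in> k ` {..<M} \<Longrightarrow> norm (f e - c r f) < \<eta>"
      using goldstine[OF X c[OF r], of \<rho> "k ` {..<M}" \<eta>] k(1) \<eta> unfolding \<rho>_def by (metis finite_imageI finite_lessThan image_subsetI less_add_one)
    have "norm (k m e - c r (k m)) \<le> \<eta>" for m
    proof (cases "m < M")
      case True
      then show ?thesis using e(3)[of "k m"] by simp
    next
      case False
      then have small: "nrm (dual X) (k m) < \<eta> / (2 * \<rho>)" using M by simp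
      have "norm (k m e) \<le> nrm (dual X) (k m) * \<rho>"
        using X.dual_norm_le[OF k(1) e(1), of m] mult_left_mono[OF less_imp_le[OF e(2)] D.nrm_nonneg[OF k(1)], of m] by linarith
      moreover have "norm (c r (k m)) \<le> \<rho> * nrm (dual X) (k m)"
        using D.dual_norm_le[OF c[OF r] k(1), of m] mult_right_mono[OF _ D.nrm_nonneg[OF k(1)], of "nrm (bidual X) (c r)" \<rho> m]
        by (simp add: \<rho>_def)
      moreover have "nrm (dual X) (k m) * (2 * \<rho>) \<le> \<eta>" using small \<rho> by (simp add: field_simps)
      ultimately show ?thesis using norm_triangle_ineq4[of "k m e" "c r (k m)"] by (simp add: algebra_simps)
    qed
    with e(1) show ?thesis by blast
  qed
  then have "\<forall>r. \<exists>e. r < n \<longrightarrow> e \<in> vecs X \<and> (\<forall>m. norm (k m e - c r (k m)) \<le> \<eta>)" by blast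
  from choice[OF this] obtain e where e: "\<forall>r. r < n \<longrightarrow> e r \<in> vecs X \<and> (\<forall>m. norm (k m (e r) - c r (k m)) \<le> \<eta>)" by (rule exE)
  show thesis
  proof (rule that[of n e \<phi>])
    fix m
    let ?T = "finite_rank n e \<phi>"
    have SE: "?T (k m) - S (k m) = (\<Sum>r<n. smul (dual X) (k m (e r) - c r (k m)) (\<phi> r))"
    proof
      fix x
      have "S (k m) x = (\<Sum>r<n. c r (k m) * \<phi> r x)"
        by (rule trans[OF S_eq[OF k(1)]]) (simp add: c_def k(1))
      then show "(?T (k m) - S (k m)) x = (\<Sum>r<n. smul (dual X) (k m (e r) - c r (k m)) (\<phi> r)) x"
        by (simp add: finite_rank_def sum_fun_apply left_diff_distrib sum_subtractf)
    qed
    have "nrm (dual X) (?T (k m) - S (k m)) \<le> (\<Sum>r<n. nrm (dual X) (smul (dual X) (k m (e r) - c r (k m)) (\<phi> r)))"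
      unfolding SE by (intro D.nrm_sum D.smul_mem \<phi>) auto
    also have "\<dots> \<le> (\<Sum>r<n. \<eta> * nrm (dual X) (\<phi> r))"
      using e by (intro sum_mono, subst D.nrm_smul) (auto intro!: mult_right_mono \<phi> D.nrm_nonneg simp del: dual_sel)
    also have "\<dots> \<le> \<eta> * \<Phi>" unfolding sum_distrib_left[symmetric] \<Phi>_def using \<eta> by (intro mult_left_mono) auto
    also have "\<dots> = \<delta> / 2" using \<Phi> by (simp add: \<eta>_def)
    finally have 1: "nrm (dual X) (?T (k m) - S (k m)) \<le> \<delta> / 2" .
    have 2: "nrm (dual X) (S (k m) - k m) \<le> \<delta> / 2" by (rule close) simp
    have Sk: "S (k m) \<in> vecs (dual X)" by (rule linear_map_mem[OF S(1) k(1)])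
    have Tk: "?T (k m) \<in> vecs (dual X)" by (rule finite_rank_mem[OF \<phi>])
    have "nrm (dual X) (?T (k m) - k m) \<le> nrm (dual X) (?T (k m) - S (k m)) + nrm (dual X) (S (k m) - k m)"
      using D.nrm_add[OF D.diff_mem[OF Tk Sk] D.diff_mem[OF Sk k(1)]] by simp
    with 1 2 show "nrm (dual X) (?T (k m) - k m) \<le> \<delta>" by linarith
  qed (use e \<phi> in auto)
qed

text \<open>The norms are split into b m * s m with b summable and s null, and d m = b m * k m for a
  null sequence k. A uniform error \<delta>' on k becomes the summable error b m * \<delta>' on
  d.\<close>

lemma approximation_on_summable_sequence:
  assumes ap: "approximation_property (dual X)"
    and d: "\<And>m. d m \<in> vecs (dual X)" "summable (\<lambda>m. nrm (dual X) (d m))" and \<delta>: "\<delta> > 0"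
  obtains n e \<phi> where "\<And>r. r < n \<Longrightarrow> e r \<in> vecs X" "\<And>r. r < n \<Longrightarrow> \<phi> r \<in> vecs (dual X)"
    "summable (\<lambda>m. nrm (dual X) (finite_rank n e \<phi> (d m) - d m))"
    "(\<Sum>m. nrm (dual X) (finite_rank n e \<phi> (d m) - d m)) \<le> \<delta>"
proof -
  let ?a = "\<lambda>m. nrm (dual X) (d m)"
  obtain b s where b: "\<And>m. 0 \<le> b m" "summable b" and s: "\<And>m. 0 \<le> s m" "s \<longlonglongrightarrow> 0" and ab: "\<And>m. ?a m = b m * s m"
    using summable_split[OF D.nrm_nonneg[OF d(1)] d(2)] by metis
  \<comment> \<open>If d m = 0 the quotient is 0 by convention and k m = 0.\<close>
  define k where "k m = smul (dual X) (of_real (s m / ?a m)) (d m)" for m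
  have k: "k m \<in> vecs (dual X)" for m unfolding k_def by (intro D.smul_mem d)
  have ks: "nrm (dual X) (k m) \<le> s m" for m
    unfolding k_def D.nrm_smul[OF d(1)] norm_of_real
    using s(1)[of m] D.nrm_nonneg[OF d(1), of m] by (cases "?a m = 0") (simp_all del: dual_sel)
  have k0: "(\<lambda>m. nrm (dual X) (k m)) \<longlonglongrightarrow> 0"
    by (intro tendsto_sandwich[OF always_eventually always_eventually tendsto_const s(2)] allI D.nrm_nonneg k ks)
  have dk: "d m = smul (dual X) (of_real (b m)) (k m)" for m
  proof (cases "?a m = 0")
    case True
    then have "d m = 0" using D.nrm_eq_0[OF d(1)] by blast
    then show ?thesis by (simp add: k_def D.smul_zero_right del: dual_sel)
  next
    case False
    have "b m * (s m / ?a m) = 1" using False ab[of m] by (simp del: dual_sel)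
    then have "of_real (b m) * of_real (s m / ?a m) = (1 :: 'k)" by (simp only: of_real_mult[symmetric] of_real_1)
    then show ?thesis by (simp only: k_def D.smul_smul[OF d(1)] D.one_smul[OF d(1)])
  qed
  define \<delta>' where "\<delta>' = \<delta> / (suminf b + 1)"
  have sb: "suminf b \<ge> 0" using b by (intro suminf_nonneg) auto
  have \<delta>': "\<delta>' > 0" using \<delta> sb by (simp add: \<delta>'_def)
  obtain n e \<phi> where e: "\<And>r. r < n \<Longrightarrow> e r \<in> vecs X" and \<phi>: "\<And>r. r < n \<Longrightarrow> \<phi> r \<in> vecs (dual X)"
    and T: "\<And>m. nrm (dual X) (finite_rank n e \<phi> (k m) - k m) \<le> \<delta>'"
    using approximation_on_null_sequence[OF ap k k0 \<delta>'] by metis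
  have Tk: "finite_rank n e \<phi> (k m) - k m \<in> vecs (dual X)" for m
    by (intro D.diff_mem finite_rank_mem[OF \<phi>] k)
  have le: "nrm (dual X) (finite_rank n e \<phi> (d m) - d m) \<le> b m * \<delta>'" for m
  proof -
    have "finite_rank n e \<phi> (d m) - d m = smul (dual X) (of_real (b m)) (finite_rank n e \<phi> (k m) - k m)"
      by (subst (1 2) dk) (auto simp: fun_eq_iff finite_rank_scale right_diff_distrib)
    then have "nrm (dual X) (finite_rank n e \<phi> (d m) - d m) = b m * nrm (dual X) (finite_rank n e \<phi> (k m) - k m)"
      using b(1)[of m] by (simp only: D.nrm_smul[OF Tk] norm_of_real abs_of_nonneg)
    then show ?thesis using mult_left_mono[OF T b(1), of m] by metis
  qed
  have nn: "0 \<le> nrm (dual X) (finite_rank n e \<phi> (d m) - d m)" for m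
    by (intro D.nrm_nonneg D.diff_mem finite_rank_mem[OF \<phi>] d)
  have sm': "summable (\<lambda>m. b m * \<delta>')" by (rule summable_mult2[OF b(2)])
  have sm: "summable (\<lambda>m. nrm (dual X) (finite_rank n e \<phi> (d m) - d m))"
    by (rule summable_comparison_test'[OF sm', where N = 0]) (use le nn in simp)
  have "(\<Sum>m. nrm (dual X) (finite_rank n e \<phi> (d m) - d m)) \<le> (\<Sum>m. b m * \<delta>')"
    by (rule suminf_le[OF le sm sm'])
  also have "\<dots> = suminf b * \<delta>'" by (rule suminf_mult2[OF b(2), symmetric])
  also have "\<dots> \<le> \<delta>" using sb \<delta> by (simp add: \<delta>'_def field_simps)
  finally show thesis using that[OF e \<phi> sm] by blast
qed

end

section \<open>Random functionals\<close>

lemma (in normed_space) dense_sequence: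
  assumes "separable_space (norm_topology E)"
  obtains f :: "nat \<Rightarrow> 'v" where "\<And>j. f j \<in> vecs E" "\<And>x \<epsilon>. \<lbrakk>x \<in> vecs E; \<epsilon> > 0\<rbrakk> \<Longrightarrow> \<exists>j. nrm E (x - f j) < \<epsilon>"
proof -
  obtain C where C: "countable C" "C \<subseteq> vecs E" "norm_topology E closure_of C = vecs E"
    using assms unfolding separable_space_def topspace_norm_topology by blast
  have cl: "\<exists>y\<in>C. nrm E (x - y) < \<epsilon>" if x: "x \<in> vecs E" "\<epsilon> > 0" for x \<epsilon>
  proof -
    have "x \<in> norm_topology E closure_of C" using C(3) x(1) by simp
    then obtain y where "y \<in> C" "y \<in> Metric_space.mball (vecs E) (ndist E) x \<epsilon>"
      unfolding norm_topology_def Metric_space.metric_closure_of[OF Metric_space] using x(2) by blast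
    then show ?thesis
      unfolding Metric_space.in_mball[OF Metric_space] by (intro bexI[of _ y]) (auto simp: ndist_def)
  qed
  have ne: "C \<noteq> {}" using cl[OF zero_mem zero_less_one] by blast
  show thesis
  proof (rule that[of "from_nat_into C"])
    show "from_nat_into C j \<in> vecs E" for j using from_nat_into[OF ne] C(2) by blast
    show "\<exists>j. nrm E (x - from_nat_into C j) < \<epsilon>" if x: "x \<in> vecs E" "\<epsilon> > 0" for x \<epsilon>
    proof -
      obtain y where y: "y \<in> C" "nrm E (x - y) < \<epsilon>" using cl[OF x] by blast
      obtain j where "from_nat_into C j = y" using from_nat_into_surj[OF C(1) y(1)] by blast
      with y(2) show ?thesis by (intro exI[of _ j]) simp
    qed
  qed
qed

text \<open>Vectors that norm each f j up to 1 / (m + 1), for all j and m, norm the whole dual by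
  density. A bound on the norm thus becomes countably many conditions on values.\<close>

lemma (in normed_space) norming_sequence:
  assumes f: "\<And>j. f j \<in> vecs (dual E)" "\<And>g \<epsilon>. \<lbrakk>g \<in> vecs (dual E); \<epsilon> > 0\<rbrakk> \<Longrightarrow> \<exists>j::nat. nrm (dual E) (g - f j) < \<epsilon>"
  obtains e :: "nat \<Rightarrow> 'v" where "\<And>i. e i \<in> vecs E" "\<And>i. nrm E (e i) \<le> 1"
    "\<And>g c. \<lbrakk>g \<in> vecs (dual E); \<And>i. norm (g (e i)) \<le> c\<rbrakk> \<Longrightarrow> nrm (dual E) g \<le> c"
proof -
  interpret D: normed_space "dual E" by (rule normed_space_dual)
  have "\<exists>x. x \<in> vecs E \<and> nrm E x \<le> 1 \<and> nrm (dual E) (f j) - inverse (real (Suc m)) \<le> norm (f j x)" for j m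
  proof (rule ccontr)
    assume "\<nexists>x. x \<in> vecs E \<and> nrm E x \<le> 1 \<and> nrm (dual E) (f j) - inverse (real (Suc m)) \<le> norm (f j x)"
    then have "norm (f j x) \<le> nrm (dual E) (f j) - inverse (real (Suc m))" if "x \<in> unit_ball E" for x
      using that unfolding unit_ball_def by force
    then have "nrm (dual E) (f j) \<le> nrm (dual E) (f j) - inverse (real (Suc m))"
      unfolding dual_sel by (intro sup_norm_le) (auto simp: scalars_sel unit_ball_nonempty)
    then show False by (simp del: of_nat_Suc)
  qed
  then have "\<forall>p. \<exists>x. x \<in> vecs E \<and> nrm E x \<le> 1 \<and>
      nrm (dual E) (f (fst p)) - inverse (real (Suc (snd p))) \<le> norm (f (fst p) x)" by blast
  from choice[OF this] obtain a where a: "\<forall>p. a p \<in> vecs E \<and> nrm E (a p) \<le> 1 \<and>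
      nrm (dual E) (f (fst p)) - inverse (real (Suc (snd p))) \<le> norm (f (fst p) (a p))" by (rule exE)
  show thesis
  proof (rule that[of "\<lambda>i. a (prod_decode i)"])
    show "a (prod_decode i) \<in> vecs E" "nrm E (a (prod_decode i)) \<le> 1" for i using a by blast+
    fix g and c :: real assume g: "g \<in> vecs (dual E)" and c: "\<And>i. norm (g (a (prod_decode i))) \<le> c"
    show "nrm (dual E) g \<le> c"
    proof (rule field_le_epsilon)
      fix \<delta> :: real assume \<delta>: "0 < \<delta>"
      then have \<delta>3: "\<delta> / 3 > 0" by simp
      obtain j where j: "nrm (dual E) (g - f j) < \<delta> / 3" using f(2)[OF g \<delta>3] by blast
      obtain m where m: "inverse (real (Suc m)) < \<delta> / 3" using reals_Archimedean[OF \<delta>3] by blast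
      let ?x = "a (j, m)"
      have x: "?x \<in> vecs E" "nrm E ?x \<le> 1" "nrm (dual E) (f j) - inverse (real (Suc m)) \<le> norm (f j ?x)"
        using a[THEN spec, of "(j, m)"] by (simp_all del: dual_sel of_nat_Suc)
      have gx: "norm (g ?x) \<le> c" using c[of "prod_encode (j, m)"] by simp
      have gf: "g - f j \<in> vecs (dual E)" by (intro D.diff_mem g f)
      have "norm ((g - f j) ?x) \<le> nrm (dual E) (g - f j) * nrm E ?x" by (rule dual_norm_le[OF gf x(1)])
      also have "\<dots> \<le> nrm (dual E) (g - f j)" using mult_left_mono[OF x(2) D.nrm_nonneg[OF gf]] by simp
      finally have "norm (g ?x - f j ?x) \<le> nrm (dual E) (g - f j)" by simp
      then have "norm (f j ?x) \<le> c + \<delta> / 3" using j gx norm_triangle_ineq3[of "g ?x" "f j ?x"] by linarith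
      moreover have "nrm (dual E) g \<le> nrm (dual E) (g - f j) + nrm (dual E) (f j)"
        using D.nrm_add[OF gf f(1)[of j]] by simp
      ultimately show "nrm (dual E) g \<le> c + \<delta>" using j m x(3) by linarith
    qed
  qed
qed

section \<open>Countably valued approximation of random functionals\<close>

lemma nn_integral_countable_valued:
  fixes I :: "'a \<Rightarrow> nat"
  assumes I: "I \<in> measurable M (count_space UNIV)"
  shows "(\<integral>\<^sup>+\<omega>. F (I \<omega>) \<partial>M) = (\<Sum>i. F i * emeasure M (I -` {i} \<inter> space M))"
proof -
  have sets: "I -` {i} \<inter> space M \<in> sets M" for i by (rule measurable_sets[OF I]) simp
  have "(\<integral>\<^sup>+\<omega>. F (I \<omega>) \<partial>M) = (\<integral>\<^sup>+\<omega>. (\<Sum>i. F i * indicator (I -` {i} \<inter> space M) \<omega>) \<partial>M)"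
  proof (rule nn_integral_cong)
    fix \<omega> assume \<omega>: "\<omega> \<in> space M"
    have "(\<Sum>i. F i * indicator (I -` {i} \<inter> space M) \<omega>) = (\<Sum>i\<in>{I \<omega>}. F i * indicator (I -` {i} \<inter> space M) \<omega>)"
      by (rule suminf_finite) auto
    then show "F (I \<omega>) = (\<Sum>i. F i * indicator (I -` {i} \<inter> space M) \<omega>)" using \<omega> by simp
  qed
  also have "\<dots> = (\<Sum>i. \<integral>\<^sup>+\<omega>. F i * indicator (I -` {i} \<inter> space M) \<omega> \<partial>M)"
    by (intro nn_integral_suminf borel_measurable_times_ennreal borel_measurable_const borel_measurable_indicator sets)
  also have "\<dots> = (\<Sum>i. F i * emeasure M (I -` {i} \<inter> space M))"
    by (intro suminf_cong nn_integral_cmult_indicator sets)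
  finally show ?thesis .
qed

text \<open>The two sequences are parameters because the approximations below depend on their
  choice.\<close>

locale separable_dual = normed_space E for E :: "('k::real_or_complex, 'v::ab_group_add) nspace" +
  fixes f :: "nat \<Rightarrow> 'v \<Rightarrow> 'k" and e :: "nat \<Rightarrow> 'v"
  assumes f_mem: "\<And>j. f j \<in> vecs (dual E)"
    and f_dense: "\<And>g \<epsilon>. \<lbrakk>g \<in> vecs (dual E); \<epsilon> > 0\<rbrakk> \<Longrightarrow> \<exists>j::nat. nrm (dual E) (g - f j) < \<epsilon>"
    and e_mem: "\<And>i. e i \<in> vecs E" and e_nrm: "\<And>i. nrm E (e i) \<le> 1"
    and e_norming: "\<And>g c. \<lbrakk>g \<in> vecs (dual E); \<And>i. norm (g (e i)) \<le> c\<rbrakk> \<Longrightarrow> nrm (dual E) g \<le> c"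
begin

interpretation D: normed_space "dual E" by (rule normed_space_dual)

text \<open>Closeness is tested at the vectors e i instead of by the norm, so that only countably
  many evaluations enter and the index is measurable.\<close>

definition index :: "nat \<Rightarrow> ('v \<Rightarrow> 'k) \<Rightarrow> nat" where
  "index m g = (LEAST j. \<forall>i. norm (g (e i) - f j (e i)) \<le> (1/2) ^ m)"

lemma index_close:
  assumes g: "g \<in> vecs (dual E)"
  shows "nrm (dual E) (g - f (index m g)) \<le> (1/2) ^ m"
proof -
  have "(1/2) ^ m > (0::real)" by simp
  then obtain j where j: "nrm (dual E) (g - f j) < (1/2) ^ m" using f_dense[OF g] by blast
  have "norm (g (e i) - f j (e i)) \<le> (1/2) ^ m" for i
    using dual_ball_le[OF D.diff_mem[OF g f_mem] e_mem e_nrm, of j i] j by (simp del: dual_sel)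
  then have "\<forall>i. norm (g (e i) - f j (e i)) \<le> (1/2) ^ m" by blast
  then have "\<forall>i. norm (g (e i) - f (index m g) (e i)) \<le> (1/2) ^ m" unfolding index_def by (rule LeastI)
  then show ?thesis by (intro e_norming D.diff_mem g f_mem) simp
qed

lemma measurable_index:
  assumes [measurable]: "\<And>x. x \<in> vecs E \<Longrightarrow> (\<lambda>\<omega>. h \<omega> x) \<in> borel_measurable M"
  shows "(\<lambda>\<omega>. index m (h \<omega>)) \<in> measurable M (count_space UNIV)"
proof -
  note [measurable] = assms[OF e_mem]
  show ?thesis unfolding index_def by measurable
qed

lemma index_tendsto:
  assumes u: "u \<in> vecs (bidual E)" and g: "g \<in> vecs (dual E)"
  shows "(\<lambda>m. u (f (index m g))) \<longlonglongrightarrow> u g"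
proof -
  have le: "norm (u (f (index m g)) - u g) \<le> nrm (bidual E) u * (1/2) ^ m" for m
  proof -
    have "norm (u (g - f (index m g))) \<le> nrm (bidual E) u * nrm (dual E) (g - f (index m g))"
      by (intro D.dual_norm_le u D.diff_mem g f_mem)
    also have "\<dots> \<le> nrm (bidual E) u * (1/2) ^ m"
      by (intro mult_left_mono index_close g normed_space.nrm_nonneg[OF D.normed_space_dual] u)
    finally show ?thesis by (simp add: D.dual_diff[OF u g f_mem] norm_minus_commute)
  qed
  have lim: "(\<lambda>m. nrm (bidual E) u * (1/2) ^ m) \<longlonglongrightarrow> 0" by (intro tendsto_mult_right_zero LIMSEQ_power_zero) simp
  show ?thesis
    by (rule LIM_zero_cancel, rule Lim_null_comparison[OF always_eventually lim]) (use le in blast)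
qed

text \<open>u at a random functional h is the limit of u at the countably valued approximations of
  h, and for these measurability can be checked value by value.\<close>

lemma measurable_apply:
  assumes u: "\<And>\<omega>. u \<omega> \<in> vecs (bidual E)" "\<And>g. g \<in> vecs (dual E) \<Longrightarrow> (\<lambda>\<omega>. u \<omega> g) \<in> borel_measurable M"
    and h: "\<And>\<omega>. h \<omega> \<in> vecs (dual E)" "\<And>x. x \<in> vecs E \<Longrightarrow> (\<lambda>\<omega>. h \<omega> x) \<in> borel_measurable M"
  shows "(\<lambda>\<omega>. u \<omega> (h \<omega>)) \<in> borel_measurable M"
proof (rule borel_measurable_LIMSEQ_metric)
  show "(\<lambda>\<omega>. u \<omega> (f (index m (h \<omega>)))) \<in> borel_measurable M" for m
    by (rule measurable_compose_countable[OF _ measurable_index[OF h(2)]]) (rule u(2)[OF f_mem])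
  show "(\<lambda>m. u \<omega> (f (index m (h \<omega>)))) \<longlonglongrightarrow> u \<omega> (h \<omega>)" for \<omega>
    by (rule index_tendsto[OF u(1) h(1)])
qed

text \<open>The decomposition telescopes the approximations \<open>f (index k (h \<omega>))\<close> and collects for each
  \<open>k\<close> the countably many values of the increment, weighted by their probabilities.\<close>

lemma summable_decomposition:
  fixes h :: "'w \<Rightarrow> 'v \<Rightarrow> 'k"
  assumes "finite_measure M"
    and h: "\<And>\<omega>. h \<omega> \<in> vecs (dual E)" "\<And>x. x \<in> vecs E \<Longrightarrow> (\<lambda>\<omega>. h \<omega> x) \<in> borel_measurable M"
    and C: "\<And>\<omega>. nrm (dual E) (h \<omega>) \<le> C"
  obtains d where "\<And>m. d m \<in> vecs (dual E)" "summable (\<lambda>m. nrm (dual E) (d m))"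
    "\<And>v q. \<lbrakk>\<And>\<omega>. v \<omega> \<in> vecs (bidual E); \<And>\<omega> g. g \<in> vecs (dual E) \<Longrightarrow> norm (v \<omega> g) \<le> q g;
        \<And>g. g \<in> vecs (dual E) \<Longrightarrow> 0 \<le> q g;
        \<And>c g. g \<in> vecs (dual E) \<Longrightarrow> q (smul (dual E) c g) = norm c * q g\<rbrakk> \<Longrightarrow>
      (\<integral>\<^sup>+\<omega>. ennreal (norm (v \<omega> (h \<omega>))) \<partial>M) \<le> (\<Sum>m. ennreal (q (d m)))"
proof -
  interpret M: finite_measure M by fact
  \<comment> \<open>The present and the preceding index are coded in one number. For k = 0 the
    subtraction returns 0, and P ignores the second component.\<close>
  define I where "I k \<omega> = prod_encode (index k (h \<omega>), index (k - 1) (h \<omega>))" for k \<omega>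
  define P where "P k i = (if k = (0::nat) then f (fst (prod_decode i))
      else f (fst (prod_decode i)) - f (snd (prod_decode i)))" for k i
  have P_mem: "P k i \<in> vecs (dual E)" for k i by (simp add: P_def f_mem D.diff_mem del: dual_sel)
  have I_meas: "I k \<in> measurable M (count_space UNIV)" for k
  proof -
    have "(\<lambda>\<omega>. prod_encode (a, index (k - 1) (h \<omega>))) \<in> measurable M (count_space UNIV)" for a
      by (rule measurable_compose[OF measurable_index[OF h(2)]]) (simp_all add: measurable_count_space_eq1)
    then show ?thesis
      unfolding I_def
      by (rule measurable_compose_countable[where f = "\<lambda>a \<omega>. prod_encode (a, index (k - 1) (h \<omega>))",
            OF _ measurable_index[OF h(2)]])
  qed
  define d where "d m = (let (k, i) = prod_decode m in
      smul (dual E) (of_real (measure M (I k -` {i} \<inter> space M))) (P k i))" for m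
  have d_mem: "d m \<in> vecs (dual E)" for m
    unfolding d_def Let_def case_prod_unfold by (intro D.smul_mem P_mem)
  have PI: "P 0 (I 0 \<omega>) = f (index 0 (h \<omega>))"
    "P (Suc n) (I (Suc n) \<omega>) = f (index (Suc n) (h \<omega>)) - f (index n (h \<omega>))" for n \<omega>
    by (simp_all add: P_def I_def)
  have telescope: "(\<Sum>k<Suc n. P k (I k \<omega>)) = f (index n (h \<omega>))" for n \<omega>
  proof (induction n)
    case 0
    show ?case by (simp add: PI)
  next
    case (Suc n)
    show ?case unfolding sum.lessThan_Suc[of _ "Suc n"] Suc PI by (subst add.commute, rule diff_add_cancel)
  qed
  \<comment> \<open>Homogeneity of q moves the weights out, and the sum over the values becomes an
    integral. It is used with the norm, for summability, and with the q of the claim.\<close>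
  have d_sum: "(\<Sum>m. ennreal (q (d m))) = (\<Sum>k. \<integral>\<^sup>+\<omega>. ennreal (q (P k (I k \<omega>))) \<partial>M)"
    if q: "\<And>g. g \<in> vecs (dual E) \<Longrightarrow> 0 \<le> q g" "\<And>c g. g \<in> vecs (dual E) \<Longrightarrow> q (smul (dual E) c g) = norm c * q g" for q
  proof -
    let ?g = "\<lambda>(k, i). ennreal (q (smul (dual E) (of_real (measure M (I k -` {i} \<inter> space M))) (P k i)))"
    have "(\<Sum>m. ?g (prod_decode m)) = (\<Sum>k. \<integral>\<^sup>+\<omega>. ennreal (q (P k (I k \<omega>))) \<partial>M)"
    proof (rule suminf_ennreal_2dimen)
      fix k
      show "(\<integral>\<^sup>+\<omega>. ennreal (q (P k (I k \<omega>))) \<partial>M) = (\<Sum>i. ?g (k, i))"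
        unfolding nn_integral_countable_valued[OF I_meas, of "\<lambda>i. ennreal (q (P k i))"]
        by (intro suminf_cong)
          (simp add: q(2)[OF P_mem] q(1)[OF P_mem] M.emeasure_eq_measure ennreal_mult mult.commute del: dual_sel)
    qed
    then show ?thesis by (simp add: d_def case_prod_unfold Let_def del: dual_sel)
  qed
  have C0: "C \<ge> 0" using D.nrm_nonneg[OF h(1)] C order_trans by blast
  \<comment> \<open>The term for k = 0 has norm at most C + 1, a later one at most 2^-(k - 1) + 2^-k
    = 3 * 2^-k; C + 4 covers both.\<close>
  have P_le: "nrm (dual E) (P k (I k \<omega>)) \<le> (C + 4) * (1/2) ^ k" for k \<omega>
  proof (cases k)
    case 0
    have "nrm (dual E) (h \<omega> - (h \<omega> - f (index 0 (h \<omega>)))) \<le> nrm (dual E) (h \<omega>) + nrm (dual E) (h \<omega> - f (index 0 (h \<omega>)))"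
      by (intro D.nrm_diff D.diff_mem h f_mem)
    then show ?thesis using C[of \<omega>] index_close[OF h(1)[of \<omega>], of 0] C0 0 by (simp add: PI del: dual_sel)
  next
    case (Suc n)
    let ?a = "h \<omega> - f (index n (h \<omega>))" and ?b = "h \<omega> - f (index k (h \<omega>))"
    have "nrm (dual E) (?a - ?b) \<le> nrm (dual E) ?a + nrm (dual E) ?b" by (intro D.nrm_diff D.diff_mem h f_mem)
    also have "\<dots> \<le> (1/2) ^ n + (1/2) ^ k" by (intro add_mono index_close h)
    also have "\<dots> \<le> (C + 4) * (1/2) ^ k" using C0 by (simp add: Suc field_simps)
    finally show ?thesis by (simp add: PI Suc del: dual_sel)
  qed
  have "(\<Sum>m. ennreal (nrm (dual E) (d m))) = (\<Sum>k. \<integral>\<^sup>+\<omega>. ennreal (nrm (dual E) (P k (I k \<omega>))) \<partial>M)"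
    by (rule d_sum) (rule D.nrm_nonneg D.nrm_smul, assumption)+
  also have "\<dots> \<le> (\<Sum>k. ennreal ((C + 4) * measure M (space M) * (1/2) ^ k))"
  proof (rule suminf_le)
    fix k
    have "(\<integral>\<^sup>+\<omega>. ennreal (nrm (dual E) (P k (I k \<omega>))) \<partial>M) \<le> (\<integral>\<^sup>+\<omega>. ennreal ((C + 4) * (1/2) ^ k) \<partial>M)"
      by (intro nn_integral_mono ennreal_leI P_le)
    also have "\<dots> = ennreal ((C + 4) * measure M (space M) * (1/2) ^ k)"
      using C0 by (simp add: M.emeasure_eq_measure mult_ac flip: ennreal_mult)
    finally show "(\<integral>\<^sup>+\<omega>. ennreal (nrm (dual E) (P k (I k \<omega>))) \<partial>M) \<le> \<dots>" .
  qed simp_all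
  also have "\<dots> = ennreal (\<Sum>k. (C + 4) * measure M (space M) * (1/2) ^ k)"
    by (rule suminf_ennreal2) (use C0 in \<open>auto intro!: summable_mult summable_geometric\<close>)
  also have "\<dots> < top" by simp
  finally have summ: "summable (\<lambda>m. nrm (dual E) (d m))"
    by (intro summable_suminf_not_top D.nrm_nonneg d_mem) simp
  show thesis
  proof (rule that[OF d_mem summ])
    \<comment> \<open>In the application q g is the norm of T g - g for a finite rank operator T,
      and v \<omega> g is the value of a random bidual vector at T g - g.\<close>
    fix v :: "'w \<Rightarrow> ('v \<Rightarrow> 'k) \<Rightarrow> 'k" and q :: "('v \<Rightarrow> 'k) \<Rightarrow> real"
    assume v: "\<And>\<omega>. v \<omega> \<in> vecs (bidual E)" "\<And>\<omega> g. g \<in> vecs (dual E) \<Longrightarrow> norm (v \<omega> g) \<le> q g"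
      and q: "\<And>g. g \<in> vecs (dual E) \<Longrightarrow> 0 \<le> q g" "\<And>c g. g \<in> vecs (dual E) \<Longrightarrow> q (smul (dual E) c g) = norm c * q g"
    have "ennreal (norm (v \<omega> (h \<omega>))) \<le> (\<Sum>k. ennreal (q (P k (I k \<omega>))))" for \<omega>
    proof (rule LIMSEQ_le_const2)
      show "(\<lambda>n. ennreal (norm (v \<omega> (f (index n (h \<omega>)))))) \<longlonglongrightarrow> ennreal (norm (v \<omega> (h \<omega>)))"
        by (intro tendsto_ennrealI tendsto_norm index_tendsto v h)
      have "ennreal (norm (v \<omega> (f (index n (h \<omega>))))) \<le> (\<Sum>k. ennreal (q (P k (I k \<omega>))))" for n
      proof -
        have "v \<omega> (f (index n (h \<omega>))) = (\<Sum>k<Suc n. v \<omega> (P k (I k \<omega>)))"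
          unfolding telescope[symmetric] by (rule D.dual_sum[OF v(1) P_mem])
        then have "norm (v \<omega> (f (index n (h \<omega>)))) \<le> (\<Sum>k<Suc n. q (P k (I k \<omega>)))"
          using sum_norm_le[of "{..<Suc n}" "\<lambda>k. v \<omega> (P k (I k \<omega>))" "\<lambda>k. q (P k (I k \<omega>))"] v(2)[OF P_mem] by simp
        then have "ennreal (norm (v \<omega> (f (index n (h \<omega>))))) \<le> ennreal (\<Sum>k<Suc n. q (P k (I k \<omega>)))" by (rule ennreal_leI)
        also have "\<dots> = (\<Sum>k<Suc n. ennreal (q (P k (I k \<omega>))))" by (rule sum_ennreal[symmetric]) (rule q(1)[OF P_mem])
        also have "\<dots> \<le> (\<Sum>k. ennreal (q (P k (I k \<omega>))))" by (rule sum_le_suminf) auto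
        finally show ?thesis .
      qed
      then show "\<exists>N. \<forall>n\<ge>N. ennreal (norm (v \<omega> (f (index n (h \<omega>))))) \<le> (\<Sum>k. ennreal (q (P k (I k \<omega>))))" by blast
    qed
    then have "(\<integral>\<^sup>+\<omega>. ennreal (norm (v \<omega> (h \<omega>))) \<partial>M) \<le> (\<integral>\<^sup>+\<omega>. (\<Sum>k. ennreal (q (P k (I k \<omega>)))) \<partial>M)"
      by (intro nn_integral_mono) blast
    also have "\<dots> = (\<Sum>k. \<integral>\<^sup>+\<omega>. ennreal (q (P k (I k \<omega>))) \<partial>M)"
      by (rule nn_integral_suminf) (rule measurable_compose_countable[OF _ I_meas], simp)
    also have "\<dots> = (\<Sum>m. ennreal (q (d m)))" by (rule d_sum[OF q, symmetric])
    finally show "(\<integral>\<^sup>+\<omega>. ennreal (norm (v \<omega> (h \<omega>))) \<partial>M) \<le> (\<Sum>m. ennreal (q (d m)))" .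
  qed
qed

end

section \<open>Random bidual vectors and integrals of the extension\<close>

definition random_functional :: "'w measure \<Rightarrow> ('k::real_or_complex, 'v::ab_group_add) nspace \<Rightarrow> ('w \<Rightarrow> ('v \<Rightarrow> 'k) \<Rightarrow> 'k) \<Rightarrow> bool" where
  "random_functional M E u \<longleftrightarrow> (\<forall>\<omega>. u \<omega> \<in> vecs (bidual E) \<and> nrm (bidual E) (u \<omega>) \<le> 1) \<and>
    (\<forall>f\<in>vecs (dual E). (\<lambda>\<omega>. u \<omega> f) \<in> borel_measurable M)"

lemma random_functionalD:
  assumes "random_functional M E u"
  shows "u \<omega> \<in> vecs (bidual E)" "nrm (bidual E) (u \<omega>) \<le> 1" "f \<in> vecs (dual E) \<Longrightarrow> (\<lambda>\<omega>. u \<omega> f) \<in> borel_measurable M"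
  using assms by (simp_all add: random_functional_def del: dual_sel)

lemma random_functional_le:
  assumes E: "normed_space E" and u: "random_functional M E u" and f: "f \<in> vecs (dual E)"
  shows "norm (u \<omega> f) \<le> nrm (dual E) f"
proof -
  interpret D: normed_space "dual E" by (rule normed_space.normed_space_dual[OF E])
  have "norm (u \<omega> f) \<le> nrm (bidual E) (u \<omega>) * nrm (dual E) f"
    by (rule D.dual_norm_le[OF random_functionalD(1)[OF u] f])
  also have "\<dots> \<le> 1 * nrm (dual E) f" by (intro mult_right_mono random_functionalD(2)[OF u] D.nrm_nonneg f)
  finally show ?thesis by simp
qed

lemma sum_even_odd: "(\<Sum>m<2 * n. F m) = (\<Sum>j<n. F (2 * j) + F (Suc (2 * j)))" for F :: "nat \<Rightarrow> 'a::comm_monoid_add"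
  by (induction n) (simp_all add: add.assoc)

text \<open>Two sequences of functionals, one for each of two measures, are interleaved so that a
  single finite rank operator can be chosen for both; \<open>summable_even_odd\<close> recovers the
  separate estimates.\<close>

lemma summable_interleave:
  fixes a b :: "nat \<Rightarrow> real"
  assumes "summable a" "summable b" "\<And>j. 0 \<le> a j" "\<And>j. 0 \<le> b j"
  shows "summable (\<lambda>m. if even m then a (m div 2) else b (m div 2))"
proof (rule summableI_nonneg_bounded)
  let ?F = "\<lambda>m. if even m then a (m div 2) else b (m div 2)"
  show "0 \<le> ?F m" for m using assms(3,4) by simp
  fix n
  have "sum ?F {..<n} \<le> sum ?F {..<2 * n}" using assms(3,4) by (intro sum_mono2) auto
  also have "\<dots> = (\<Sum>j<n. a j) + (\<Sum>j<n. b j)" unfolding sum_even_odd by (simp add: sum.distrib)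
  also have "\<dots> \<le> suminf a + suminf b"
    by (intro add_mono sum_le_suminf assms) (auto simp: assms)
  finally show "sum ?F {..<n} \<le> suminf a + suminf b" .
qed

lemma summable_even_odd:
  fixes F :: "nat \<Rightarrow> real"
  assumes F: "summable F" "\<And>m. 0 \<le> F m"
  shows "summable (\<lambda>j. F (2 * j)) \<and> (\<Sum>j. F (2 * j)) \<le> suminf F"
    and "summable (\<lambda>j. F (Suc (2 * j))) \<and> (\<Sum>j. F (Suc (2 * j))) \<le> suminf F"
proof -
  have le: "sum F {..<2 * n} \<le> suminf F" for n by (rule sum_le_suminf) (use F in auto)
  have 1: "(\<Sum>j<n. F (2 * j)) \<le> suminf F" for n
    by (rule order_trans[OF _ le[of n]]) (unfold sum_even_odd, intro sum_mono, simp add: F)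
  have 2: "(\<Sum>j<n. F (Suc (2 * j))) \<le> suminf F" for n
    by (rule order_trans[OF _ le[of n]]) (unfold sum_even_odd, intro sum_mono, simp add: F)
  have s: "summable (\<lambda>j. F (2 * j))" "summable (\<lambda>j. F (Suc (2 * j)))"
    by (rule summableI_nonneg_bounded[OF F(2) 1], rule summableI_nonneg_bounded[OF F(2) 2])
  then show "summable (\<lambda>j. F (2 * j)) \<and> (\<Sum>j. F (2 * j)) \<le> suminf F"
    and "summable (\<lambda>j. F (Suc (2 * j))) \<and> (\<Sum>j. F (Suc (2 * j))) \<le> suminf F"
    using suminf_le_const[OF s(1) 1] suminf_le_const[OF s(2) 2] by simp_all
qed

context separable_dual
begin

interpretation D: normed_space "dual E" by (rule normed_space_dual)

lemma finite_rank_functional: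
  assumes u: "u \<in> vecs (bidual E)" and a: "\<And>r. r < n \<Longrightarrow> a r \<in> vecs E" and \<phi>: "\<And>r. r < n \<Longrightarrow> \<phi> r \<in> vecs (dual E)"
    and g: "g \<in> vecs (dual E)"
  shows "u (finite_rank n a \<phi> g) = (\<Sum>r<n. u (\<phi> r) * g (a r))"
proof -
  have "finite_rank n a \<phi> g = (\<Sum>r<n. smul (dual E) (g (a r)) (\<phi> r))"
    by (auto simp: fun_eq_iff finite_rank_def sum_fun_apply)
  then have "u (finite_rank n a \<phi> g) = u (\<Sum>r<n. smul (dual E) (g (a r)) (\<phi> r))" by (rule arg_cong)
  also have "\<dots> = (\<Sum>r<n. u (smul (dual E) (g (a r)) (\<phi> r)))"
    by (rule D.dual_sum[OF u]) (intro D.smul_mem \<phi>, simp)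
  also have "\<dots> = (\<Sum>r<n. u (\<phi> r) * g (a r))"
    by (intro sum.cong refl) (simp add: D.dual_smul[OF u \<phi>] mult.commute del: dual_sel)
  finally show ?thesis .
qed

text \<open>Boundedness is read off from u (T g - g) = \<Sum> u (\<phi> r) * g (a r) - u g, T being
  the finite rank operator.\<close>

lemma finite_rank_perturbation:
  assumes u: "u \<in> vecs (bidual E)" and a: "\<And>r. r < n \<Longrightarrow> a r \<in> vecs E" and \<phi>: "\<And>r. r < n \<Longrightarrow> \<phi> r \<in> vecs (dual E)"
  shows "(\<lambda>g. if g \<in> vecs (dual E) then u (finite_rank n a \<phi> g - g) else 0) \<in> vecs (bidual E)"
proof (rule D.dual_memI)
  let ?T = "finite_rank n a \<phi>"
  have eq: "u (?T g - g) = (\<Sum>r<n. u (\<phi> r) * g (a r)) - u g" if g: "g \<in> vecs (dual E)" for g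
    by (simp only: D.dual_diff[OF u finite_rank_mem[OF normed_space_axioms \<phi>] g] finite_rank_functional[OF u a \<phi> g])
  fix g assume g: "g \<in> vecs (dual E)"
  have "norm (u (?T g - g)) \<le> (\<Sum>r<n. norm (u (\<phi> r) * g (a r))) + norm (u g)"
    unfolding eq[OF g] by (rule order_trans[OF norm_triangle_ineq4]) (intro add_mono norm_sum order_refl)
  also have "\<dots> \<le> (\<Sum>r<n. norm (u (\<phi> r)) * (nrm (dual E) g * nrm E (a r))) + nrm (bidual E) u * nrm (dual E) g"
    by (intro add_mono sum_mono D.dual_norm_le u g, subst norm_mult, intro mult_left_mono dual_norm_le g a) simp_all
  also have "\<dots> = ((\<Sum>r<n. norm (u (\<phi> r)) * nrm E (a r)) + nrm (bidual E) u) * nrm (dual E) g"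
    by (simp only: distrib_right sum_distrib_right mult.assoc mult.commute[of "nrm (dual E) g"])
  finally show "norm (if g \<in> vecs (dual E) then u (?T g - g) else 0) \<le> \<dots>" using g by simp
  {
    fix c show "(if smul (dual E) c g \<in> vecs (dual E) then u (?T (smul (dual E) c g) - smul (dual E) c g) else 0) =
      c * (if g \<in> vecs (dual E) then u (?T g - g) else 0)"
      using g D.smul_mem[OF g, of c]
      by (simp add: eq D.dual_smul[OF u, unfolded dual_sel] right_diff_distrib sum_distrib_left mult_ac)
  }
  {
    fix h assume h: "h \<in> vecs (dual E)"
    show "(if g + h \<in> vecs (dual E) then u (?T (g + h) - (g + h)) else 0) =
        (if g \<in> vecs (dual E) then u (?T g - g) else 0) + (if h \<in> vecs (dual E) then u (?T h - h) else 0)"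
      by (simp only: D.add_mem[OF g h] g h if_True eq D.dual_add[OF u g h] plus_fun_apply distrib_left sum.distrib)
        (simp add: algebra_simps)
  }
qed simp

text \<open>With v \<omega> g = u \<omega> (T g - g), the decomposition of h bounds the integral of
  |v (h)| by the sum of the distances between T (d m) and d m. The sequence d comes from h and M
  alone, so the operator T may be chosen after it.\<close>

lemma integral_approximation:
  fixes h :: "'w \<Rightarrow> 'v \<Rightarrow> 'k" and c :: "'w \<Rightarrow> 'k"
  assumes "finite_measure M" and u: "random_functional M E u"
    and h: "\<And>\<omega>. h \<omega> \<in> vecs (dual E)" "\<And>x. x \<in> vecs E \<Longrightarrow> (\<lambda>\<omega>. h \<omega> x) \<in> borel_measurable M"
    and C: "\<And>\<omega>. nrm (dual E) (h \<omega>) \<le> C"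
    and c: "c \<in> borel_measurable M" "\<And>\<omega>. norm (c \<omega>) \<le> B"
  obtains d where "\<And>m. d m \<in> vecs (dual E)" "summable (\<lambda>m. nrm (dual E) (d m))"
    "\<And>n a \<phi> \<delta>. \<lbrakk>\<And>r. r < n \<Longrightarrow> a r \<in> vecs E; \<And>r. r < n \<Longrightarrow> \<phi> r \<in> vecs (dual E);
        summable (\<lambda>m. nrm (dual E) (finite_rank n a \<phi> (d m) - d m)) \<and>
        (\<Sum>m. nrm (dual E) (finite_rank n a \<phi> (d m) - d m)) \<le> \<delta>\<rbrakk> \<Longrightarrow>
      norm ((\<Sum>r<n. \<integral>\<omega>. c \<omega> * u \<omega> (\<phi> r) * h \<omega> (a r) \<partial>M) - (\<integral>\<omega>. c \<omega> * u \<omega> (h \<omega>) \<partial>M)) \<le> B * \<delta>"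
proof -
  interpret M: finite_measure M by fact
  note uD = random_functionalD[OF u]
  obtain d where d: "\<And>m. d m \<in> vecs (dual E)" "summable (\<lambda>m. nrm (dual E) (d m))"
    and dec: "\<And>v q. \<lbrakk>\<And>\<omega>. v \<omega> \<in> vecs (bidual E); \<And>\<omega> g. g \<in> vecs (dual E) \<Longrightarrow> norm (v \<omega> g) \<le> q g;
        \<And>g. g \<in> vecs (dual E) \<Longrightarrow> 0 \<le> q g;
        \<And>c g. g \<in> vecs (dual E) \<Longrightarrow> q (smul (dual E) c g) = norm c * q g\<rbrakk> \<Longrightarrow>
      (\<integral>\<^sup>+\<omega>. ennreal (norm (v \<omega> (h \<omega>))) \<partial>M) \<le> (\<Sum>m. ennreal (q (d m)))"
  proof (rule summable_decomposition[OF \<open>finite_measure M\<close> h C])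
    fix d
    assume "\<And>m. d m \<in> vecs (dual E)" "summable (\<lambda>m. nrm (dual E) (d m))"
      "\<And>v q. \<lbrakk>\<And>\<omega>. v \<omega> \<in> vecs (bidual E); \<And>\<omega> g. g \<in> vecs (dual E) \<Longrightarrow> norm (v \<omega> g) \<le> q g;
        \<And>g. g \<in> vecs (dual E) \<Longrightarrow> 0 \<le> q g;
        \<And>c g. g \<in> vecs (dual E) \<Longrightarrow> q (smul (dual E) c g) = norm c * q g\<rbrakk> \<Longrightarrow>
      (\<integral>\<^sup>+\<omega>. ennreal (norm (v \<omega> (h \<omega>))) \<partial>M) \<le> (\<Sum>m. ennreal (q (d m)))"
    then show thesis by (rule that)
  qed
  have B: "B \<ge> 0" using c(2) norm_ge_zero order_trans by blast
  have C0: "C \<ge> 0" using D.nrm_nonneg[OF h(1)] C order_trans by blast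
  have u_h: "(\<lambda>\<omega>. u \<omega> (h \<omega>)) \<in> borel_measurable M" by (rule measurable_apply[OF uD(1) uD(3) h])
  have int: "integrable M (\<lambda>\<omega>. c \<omega> * u \<omega> (h \<omega>))"
  proof (rule M.integrable_const_bound[of _ "B * C"])
    have "norm (u \<omega> (h \<omega>)) \<le> C" for \<omega> using random_functional_le[OF normed_space_axioms u h(1)] C order_trans by blast
    then show "AE \<omega> in M. norm (c \<omega> * u \<omega> (h \<omega>)) \<le> B * C"
      by (intro AE_I2) (auto simp: norm_mult intro!: mult_mono c B)
  qed (intro borel_measurable_times c u_h)
  show thesis
  proof (rule that[OF d])
    fix n and a :: "nat \<Rightarrow> 'v" and \<phi> :: "nat \<Rightarrow> 'v \<Rightarrow> 'k" and \<delta> :: real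
    assume a: "\<And>r. r < n \<Longrightarrow> a r \<in> vecs E" and \<phi>: "\<And>r. r < n \<Longrightarrow> \<phi> r \<in> vecs (dual E)"
      and s: "summable (\<lambda>m. nrm (dual E) (finite_rank n a \<phi> (d m) - d m)) \<and>
        (\<Sum>m. nrm (dual E) (finite_rank n a \<phi> (d m) - d m)) \<le> \<delta>"
    let ?T = "finite_rank n a \<phi>"
    define v where "v \<omega> = (\<lambda>g. if g \<in> vecs (dual E) then u \<omega> (?T g - g) else 0)" for \<omega>
    have T_mem: "?T g \<in> vecs (dual E)" for g by (rule finite_rank_mem[OF normed_space_axioms \<phi>])
    have v: "v \<omega> \<in> vecs (bidual E)" for \<omega> unfolding v_def by (rule finite_rank_perturbation[OF uD(1) a \<phi>])
    have vh: "v \<omega> (h \<omega>) = (\<Sum>r<n. u \<omega> (\<phi> r) * h \<omega> (a r)) - u \<omega> (h \<omega>)" for \<omega>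
      by (simp add: v_def h D.dual_diff[OF uD(1) T_mem h(1)] finite_rank_functional[OF uD(1) a \<phi> h(1)])
    have v_meas: "(\<lambda>\<omega>. v \<omega> (h \<omega>)) \<in> borel_measurable M"
      unfolding vh by (intro borel_measurable_diff borel_measurable_sum borel_measurable_times u_h uD(3) \<phi> h(2) a) auto
    have T_smul: "?T (smul (dual E) k g) - smul (dual E) k g = smul (dual E) k (?T g - g)" for k g
      by (auto simp: fun_eq_iff finite_rank_scale right_diff_distrib)
    have "(\<integral>\<^sup>+\<omega>. ennreal (norm (v \<omega> (h \<omega>))) \<partial>M) \<le> (\<Sum>m. ennreal (nrm (dual E) (?T (d m) - d m)))"
    proof (rule dec[OF v])
      fix g assume g: "g \<in> vecs (dual E)"
      have Tg: "?T g - g \<in> vecs (dual E)" by (intro D.diff_mem T_mem g)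
      show "0 \<le> nrm (dual E) (?T g - g)" by (rule D.nrm_nonneg[OF Tg])
      show "norm (v \<omega> g) \<le> nrm (dual E) (?T g - g)" for \<omega>
        using random_functional_le[OF normed_space_axioms u Tg] g by (simp add: v_def del: dual_sel)
      show "nrm (dual E) (?T (smul (dual E) k g) - smul (dual E) k g) = norm k * nrm (dual E) (?T g - g)" for k
        unfolding T_smul by (rule D.nrm_smul[OF Tg])
    qed
    also have "\<dots> = ennreal (\<Sum>m. nrm (dual E) (?T (d m) - d m))"
      by (intro suminf_ennreal2 D.nrm_nonneg D.diff_mem T_mem d s[THEN conjunct1])
    also have "\<dots> \<le> ennreal \<delta>" by (intro ennreal_leI s[THEN conjunct2])
    finally have v_int: "(\<integral>\<^sup>+\<omega>. ennreal (norm (v \<omega> (h \<omega>))) \<partial>M) \<le> ennreal \<delta>" .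
    have \<delta>: "\<delta> \<ge> 0"
      by (rule order_trans[OF suminf_nonneg[OF s[THEN conjunct1] D.nrm_nonneg[OF D.diff_mem[OF T_mem d(1)]]] s[THEN conjunct2]])
    have int_r: "integrable M (\<lambda>\<omega>. c \<omega> * u \<omega> (\<phi> r) * h \<omega> (a r))" if r: "r < n" for r
    proof (rule M.integrable_const_bound[of _ "B * nrm (dual E) (\<phi> r) * (C * nrm E (a r))"])
      have "norm (h \<omega> (a r)) \<le> C * nrm E (a r)" for \<omega>
        by (rule order_trans[OF dual_norm_le[OF h(1) a[OF r]]]) (intro mult_right_mono C nrm_nonneg a r)
      then show "AE \<omega> in M. norm (c \<omega> * u \<omega> (\<phi> r) * h \<omega> (a r)) \<le> B * nrm (dual E) (\<phi> r) * (C * nrm E (a r))"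
        unfolding norm_mult
        by (intro AE_I2 mult_mono c random_functional_le[OF normed_space_axioms u] \<phi> r mult_nonneg_nonneg B D.nrm_nonneg C0 nrm_nonneg a norm_ge_zero)
    qed (intro borel_measurable_times c uD \<phi> h a r)
    have "(\<Sum>r<n. \<integral>\<omega>. c \<omega> * u \<omega> (\<phi> r) * h \<omega> (a r) \<partial>M) - (\<integral>\<omega>. c \<omega> * u \<omega> (h \<omega>) \<partial>M) =
        (\<integral>\<omega>. (\<Sum>r<n. c \<omega> * u \<omega> (\<phi> r) * h \<omega> (a r)) - c \<omega> * u \<omega> (h \<omega>) \<partial>M)"
      by (subst Bochner_Integration.integral_diff)
        (auto intro!: Bochner_Integration.integrable_sum int_r int Bochner_Integration.integral_sum[symmetric])
    also have "\<dots> = (\<integral>\<omega>. c \<omega> * v \<omega> (h \<omega>) \<partial>M)"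
      by (simp only: vh right_diff_distrib sum_distrib_left mult.assoc)
    finally have eq: "(\<Sum>r<n. \<integral>\<omega>. c \<omega> * u \<omega> (\<phi> r) * h \<omega> (a r) \<partial>M) - (\<integral>\<omega>. c \<omega> * u \<omega> (h \<omega>) \<partial>M) = (\<integral>\<omega>. c \<omega> * v \<omega> (h \<omega>) \<partial>M)" .
    have int_v: "integrable M (\<lambda>\<omega>. c \<omega> * v \<omega> (h \<omega>))"
      unfolding vh right_diff_distrib sum_distrib_left mult.assoc[symmetric]
      by (intro Bochner_Integration.integrable_diff Bochner_Integration.integrable_sum int_r int) auto
    have "ennreal (norm (\<integral>\<omega>. c \<omega> * v \<omega> (h \<omega>) \<partial>M)) \<le> (\<integral>\<^sup>+\<omega>. ennreal (norm (c \<omega> * v \<omega> (h \<omega>))) \<partial>M)"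
      by (rule integral_norm_bound_ennreal[OF int_v])
    also have "\<dots> \<le> (\<integral>\<^sup>+\<omega>. ennreal B * ennreal (norm (v \<omega> (h \<omega>))) \<partial>M)"
      by (intro nn_integral_mono) (simp add: norm_mult B c mult_right_mono flip: ennreal_mult)
    also have "\<dots> = ennreal B * (\<integral>\<^sup>+\<omega>. ennreal (norm (v \<omega> (h \<omega>))) \<partial>M)"
      using v_meas by (intro nn_integral_cmult) simp
    also have "\<dots> \<le> ennreal B * ennreal \<delta>" by (intro mult_left_mono v_int) simp
    also have "\<dots> = ennreal (B * \<delta>)" using B \<delta> by (simp add: ennreal_mult)
    finally show "norm ((\<Sum>r<n. \<integral>\<omega>. c \<omega> * u \<omega> (\<phi> r) * h \<omega> (a r) \<partial>M) - (\<integral>\<omega>. c \<omega> * u \<omega> (h \<omega>) \<partial>M)) \<le> B * \<delta>"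
      unfolding eq using B \<delta> by (simp add: ennreal_le_iff)
  qed
qed

end

lemma norm_triangle_sub_le: "norm (z - x) \<le> a \<Longrightarrow> norm (z - y) \<le> b \<Longrightarrow> norm (x - y) \<le> a + b"
  for x :: "'a::real_normed_vector"
  using norm_triangle_ineq4[of "z - y" "z - x"] by simp

context separable_dual
begin

interpretation D: normed_space "dual E" by (rule normed_space_dual)

context
  fixes Y :: "('k, 'y::ab_group_add) nspace" and N :: nat and A :: "(nat \<Rightarrow> 'v) \<Rightarrow> 'y \<Rightarrow> 'k" and C :: real
  assumes Y: "normed_space Y" and A: "multilinear N E (dual Y) A" "multilinear_bound N E (dual Y) A C" and C: "C \<ge> 0"
begin

interpretation Y: normed_space Y by (rule Y)
interpretation DY: normed_space "dual Y" by (rule Y.normed_space_dual)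

lemma partial_ext_random:
  assumes u: "random_functional M E u" and v: "random_functional M Y v" and n: "n \<le> N"
  shows "multilinear n E scalars (partial_ext E (u \<omega>) n N (\<lambda>z. v \<omega> (A z)))"
    and "multilinear_bound n E scalars (partial_ext E (u \<omega>) n N (\<lambda>z. v \<omega> (A z))) C"
proof -
  note uD = random_functionalD[OF u] and vD = random_functionalD[OF v]
  have a: "multilinear N E scalars (\<lambda>z. v \<omega> (A z))" "multilinear_bound N E scalars (\<lambda>z. v \<omega> (A z)) C"
    using multilinear_functional[OF DY.normed_space_axioms A vD(1)]
      mult_right_mono[OF vD(2) C] by (auto intro: multilinear_bound_mono[OF normed_space_axioms] simp del: dual_sel)
  note ext = partial_ext_multilinear[OF normed_space_axioms uD(1) a C n]
  show "multilinear n E scalars (partial_ext E (u \<omega>) n N (\<lambda>z. v \<omega> (A z)))" by (rule ext[THEN conjunct1])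
  have "nrm (bidual E) (u \<omega>) ^ (N - n) * C \<le> 1 * C"
    by (intro mult_right_mono C power_le_one uD(2)) (rule D.dual_sup_nonneg[OF uD(1), folded dual_sel])
  then show "multilinear_bound n E scalars (partial_ext E (u \<omega>) n N (\<lambda>z. v \<omega> (A z))) C"
    by (intro multilinear_bound_mono[OF normed_space_axioms ext[THEN conjunct2]]) simp
qed

text \<open>The slots are extended from the last to the first, and each time u is applied to a
  functional that is itself random; this is what \<open>measurable_apply\<close> is for.\<close>

lemma measurable_partial_ext:
  assumes u: "random_functional M E u" and v: "random_functional M Y v" and n: "n \<le> N"
  shows "\<forall>x\<in>tuples n E. (\<lambda>\<omega>. partial_ext E (u \<omega>) n N (\<lambda>z. v \<omega> (A z)) x) \<in> borel_measurable M"
  using n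
proof (induction rule: inc_induct)
  case base
  show ?case using random_functionalD(3)[OF v] multilinear_mem[OF A(1)] by simp
next
  case (step n)
  have n: "Suc n \<le> N" using step.hyps by simp
  show ?case
  proof
    fix x assume x: "x \<in> tuples n E"
    let ?s = "\<lambda>\<omega>. slot E (u \<omega>) n (partial_ext E (u \<omega>) (Suc n) N (\<lambda>z. v \<omega> (A z))) x"
    have "(\<lambda>\<omega>. u \<omega> (?s \<omega>)) \<in> borel_measurable M"
    proof (rule measurable_apply[where u = u and h = ?s])
      show "?s \<omega> \<in> vecs (dual E)" for \<omega>
        by (rule slot_mem[OF normed_space_axioms partial_ext_random[OF u v n] C x])
      show "(\<lambda>\<omega>. ?s \<omega> y) \<in> borel_measurable M" if y: "y \<in> vecs E" for y
        unfolding slot_def if_P[OF y] by (rule step.IH[THEN bspec, OF tuples_upd_Suc[OF x y]])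
    qed (use random_functionalD[OF u] in simp_all)
    then show "(\<lambda>\<omega>. partial_ext E (u \<omega>) n N (\<lambda>z. v \<omega> (A z)) x) \<in> borel_measurable M"
      by (simp only: partial_ext_step[OF step.hyps(2)])
  qed
qed

text \<open>This is \<open>integral_approximation\<close> for the random functional in slot n: u
  applied to it is traded for the factor u (\<phi> r), which joins the product, and the vector a r,
  which fills the slot.\<close>

lemma integral_partial_ext_approximation:
  assumes "finite_measure M" and u: "random_functional M E u" and v: "random_functional M Y v"
    and n: "n < N" and x: "x \<in> tuples n E" and f': "\<And>l. l < n \<Longrightarrow> f' l \<in> vecs (dual E)"
  obtains d where "\<And>m. d m \<in> vecs (dual E)" "summable (\<lambda>m. nrm (dual E) (d m))"
    "\<And>k a \<phi> \<delta>. \<lbrakk>\<And>r. r < k \<Longrightarrow> a r \<in> vecs E; \<And>r. r < k \<Longrightarrow> \<phi> r \<in> vecs (dual E);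
        summable (\<lambda>m. nrm (dual E) (finite_rank k a \<phi> (d m) - d m)) \<and>
        (\<Sum>m. nrm (dual E) (finite_rank k a \<phi> (d m) - d m)) \<le> \<delta>\<rbrakk> \<Longrightarrow>
      norm ((\<Sum>r<k. \<integral>\<omega>. (\<Prod>l<Suc n. u \<omega> ((f'(n := \<phi> r)) l)) *
          partial_ext E (u \<omega>) (Suc n) N (\<lambda>z. v \<omega> (A z)) (x(n := a r)) \<partial>M) -
        (\<integral>\<omega>. (\<Prod>l<n. u \<omega> (f' l)) * partial_ext E (u \<omega>) n N (\<lambda>z. v \<omega> (A z)) x \<partial>M))
      \<le> (\<Prod>l<n. nrm (dual E) (f' l)) * \<delta>"
proof -
  let ?h = "\<lambda>\<omega>. slot E (u \<omega>) n (partial_ext E (u \<omega>) (Suc n) N (\<lambda>z. v \<omega> (A z))) x"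
  let ?c = "\<lambda>\<omega>. \<Prod>l<n. u \<omega> (f' l)"
  let ?B = "\<Prod>l<n. nrm (dual E) (f' l)"
  have n': "Suc n \<le> N" using n by simp
  have h: "?h \<omega> \<in> vecs (dual E)" "nrm (dual E) (?h \<omega>) \<le> C * (\<Prod>i<n. nrm E (x i))" for \<omega>
    by (rule slot_mem[OF normed_space_axioms partial_ext_random[OF u v n'] C x])+
  have h_meas: "(\<lambda>\<omega>. ?h \<omega> y) \<in> borel_measurable M" if y: "y \<in> vecs E" for y
    unfolding slot_def if_P[OF y] by (rule measurable_partial_ext[OF u v n', THEN bspec, OF tuples_upd_Suc[OF x y]])
  have c_meas: "?c \<in> borel_measurable M"
    by (intro borel_measurable_prod random_functionalD(3)[OF u] f') simp
  have c_le: "norm (?c \<omega>) \<le> ?B" for \<omega>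
    unfolding prod_norm[symmetric]
    by (intro prod_mono conjI norm_ge_zero random_functional_le[OF normed_space_axioms u] f') simp
  have step: "(\<integral>\<omega>. (\<Prod>l<Suc n. u \<omega> ((f'(n := \<phi>)) l)) * partial_ext E (u \<omega>) (Suc n) N (\<lambda>z. v \<omega> (A z)) (x(n := a)) \<partial>M)
      = (\<integral>\<omega>. ?c \<omega> * u \<omega> \<phi> * ?h \<omega> a \<partial>M)" if a: "a \<in> vecs E" for a \<phi>
    using a by (simp add: slot_def)
  obtain d where d: "\<And>m. d m \<in> vecs (dual E)" "summable (\<lambda>m. nrm (dual E) (d m))"
    and approx: "\<And>k a \<phi> \<delta>. \<lbrakk>\<And>r. r < k \<Longrightarrow> a r \<in> vecs E; \<And>r. r < k \<Longrightarrow> \<phi> r \<in> vecs (dual E);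
        summable (\<lambda>m. nrm (dual E) (finite_rank k a \<phi> (d m) - d m)) \<and>
        (\<Sum>m. nrm (dual E) (finite_rank k a \<phi> (d m) - d m)) \<le> \<delta>\<rbrakk> \<Longrightarrow>
      norm ((\<Sum>r<k. \<integral>\<omega>. ?c \<omega> * u \<omega> (\<phi> r) * ?h \<omega> (a r) \<partial>M) - (\<integral>\<omega>. ?c \<omega> * u \<omega> (?h \<omega>) \<partial>M)) \<le> ?B * \<delta>"
  proof (rule integral_approximation[OF \<open>finite_measure M\<close> u h(1) h_meas h(2) c_meas c_le])
    fix d
    assume "\<And>m. d m \<in> vecs (dual E)" "summable (\<lambda>m. nrm (dual E) (d m))"
      "\<And>k a \<phi> \<delta>. \<lbrakk>\<And>r. r < k \<Longrightarrow> a r \<in> vecs E; \<And>r. r < k \<Longrightarrow> \<phi> r \<in> vecs (dual E);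
        summable (\<lambda>m. nrm (dual E) (finite_rank k a \<phi> (d m) - d m)) \<and>
        (\<Sum>m. nrm (dual E) (finite_rank k a \<phi> (d m) - d m)) \<le> \<delta>\<rbrakk> \<Longrightarrow>
      norm ((\<Sum>r<k. \<integral>\<omega>. ?c \<omega> * u \<omega> (\<phi> r) * ?h \<omega> (a r) \<partial>M) - (\<integral>\<omega>. ?c \<omega> * u \<omega> (?h \<omega>) \<partial>M)) \<le> ?B * \<delta>"
    then show thesis by (rule that)
  qed
  show thesis
  proof (rule that[OF d])
    fix k and a :: "nat \<Rightarrow> 'v" and \<phi> :: "nat \<Rightarrow> 'v \<Rightarrow> 'k" and \<delta> :: real
    assume a: "\<And>r. r < k \<Longrightarrow> a r \<in> vecs E" and \<phi>: "\<And>r. r < k \<Longrightarrow> \<phi> r \<in> vecs (dual E)"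
      and s: "summable (\<lambda>m. nrm (dual E) (finite_rank k a \<phi> (d m) - d m)) \<and>
        (\<Sum>m. nrm (dual E) (finite_rank k a \<phi> (d m) - d m)) \<le> \<delta>"
    have eq: "(\<Sum>r<k. \<integral>\<omega>. (\<Prod>l<Suc n. u \<omega> ((f'(n := \<phi> r)) l)) * partial_ext E (u \<omega>) (Suc n) N (\<lambda>z. v \<omega> (A z)) (x(n := a r)) \<partial>M)
        = (\<Sum>r<k. \<integral>\<omega>. ?c \<omega> * u \<omega> (\<phi> r) * ?h \<omega> (a r) \<partial>M)"
      by (intro sum.cong refl step a) simp
    show "norm ((\<Sum>r<k. \<integral>\<omega>. (\<Prod>l<Suc n. u \<omega> ((f'(n := \<phi> r)) l)) *
          partial_ext E (u \<omega>) (Suc n) N (\<lambda>z. v \<omega> (A z)) (x(n := a r)) \<partial>M) -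
        (\<integral>\<omega>. (\<Prod>l<n. u \<omega> (f' l)) * partial_ext E (u \<omega>) n N (\<lambda>z. v \<omega> (A z)) x \<partial>M))
      \<le> ?B * \<delta>"
      unfolding eq partial_ext_step[OF n] by (rule approx[OF a \<phi> s])
  qed
qed

text \<open>The product moments over \<open>n\<close> functionals involve one evaluation of \<open>u\<close> at the functional
  \<open>slot\<close>, which depends on the random point. Replacing it by its image under a finite rank operator
  reduces them to product moments over \<open>n + 1\<close> functionals.\<close>

lemma integral_partial_ext_eq:
  fixes M\<^sub>1 :: "'w1 measure" and M\<^sub>2 :: "'w2 measure"
  assumes ap: "approximation_property (dual E)"
    and M: "finite_measure M\<^sub>1" "finite_measure M\<^sub>2"
    and u: "random_functional M\<^sub>1 E u\<^sub>1" "random_functional M\<^sub>2 E u\<^sub>2"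
    and v: "random_functional M\<^sub>1 Y v\<^sub>1" "random_functional M\<^sub>2 Y v\<^sub>2"
    and moments: "\<And>f' c. \<lbrakk>\<And>l. l < N \<Longrightarrow> f' l \<in> vecs (dual E); c \<in> vecs (dual Y)\<rbrakk> \<Longrightarrow>
      (\<integral>\<omega>. (\<Prod>l<N. u\<^sub>1 \<omega> (f' l)) * v\<^sub>1 \<omega> c \<partial>M\<^sub>1) = (\<integral>\<omega>. (\<Prod>l<N. u\<^sub>2 \<omega> (f' l)) * v\<^sub>2 \<omega> c \<partial>M\<^sub>2)"
  shows "(\<integral>\<omega>. partial_ext E (u\<^sub>1 \<omega>) 0 N (\<lambda>z. v\<^sub>1 \<omega> (A z)) (\<lambda>_. undefined) \<partial>M\<^sub>1) =
    (\<integral>\<omega>. partial_ext E (u\<^sub>2 \<omega>) 0 N (\<lambda>z. v\<^sub>2 \<omega> (A z)) (\<lambda>_. undefined) \<partial>M\<^sub>2)"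
proof -
  let ?I\<^sub>1 = "\<lambda>n f' x. \<integral>\<omega>. (\<Prod>l<n. u\<^sub>1 \<omega> (f' l)) * partial_ext E (u\<^sub>1 \<omega>) n N (\<lambda>z. v\<^sub>1 \<omega> (A z)) x \<partial>M\<^sub>1"
  let ?I\<^sub>2 = "\<lambda>n f' x. \<integral>\<omega>. (\<Prod>l<n. u\<^sub>2 \<omega> (f' l)) * partial_ext E (u\<^sub>2 \<omega>) n N (\<lambda>z. v\<^sub>2 \<omega> (A z)) x \<partial>M\<^sub>2"
  \<comment> \<open>Downward induction: at n = N nothing is extended and the hypothesis on moments
    applies, while n = 0 is the claim.\<close>
  have "\<forall>f' x. (\<forall>l<n. f' l \<in> vecs (dual E)) \<longrightarrow> x \<in> tuples n E \<longrightarrow> ?I\<^sub>1 n f' x = ?I\<^sub>2 n f' x" if "n \<le> N" for n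
    using that
  proof (induction rule: inc_induct)
    case base
    show ?case
      unfolding partial_ext_same by (intro allI impI moments multilinear_mem[OF A(1)]) auto
  next
    case (step n)
    show ?case
    proof (intro allI impI)
      fix f' x assume f': "\<forall>l<n. f' l \<in> vecs (dual E)" and x: "x \<in> tuples n E"
      let ?B = "\<Prod>l<n. nrm (dual E) (f' l)"
      have B: "?B \<ge> 0" using f' by (intro prod_nonneg D.nrm_nonneg) auto
      let ?a = "\<lambda>k a \<phi> (d :: nat \<Rightarrow> _) \<delta>. summable (\<lambda>m. nrm (dual E) (finite_rank k a \<phi> (d m) - d m)) \<and>
        (\<Sum>m. nrm (dual E) (finite_rank k a \<phi> (d m) - d m)) \<le> \<delta>"
      obtain d\<^sub>1 where d1: "\<And>m. d\<^sub>1 m \<in> vecs (dual E)" "summable (\<lambda>m. nrm (dual E) (d\<^sub>1 m))"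
        and approx1: "\<And>k a \<phi> \<delta>. \<lbrakk>\<And>r. r < k \<Longrightarrow> a r \<in> vecs E; \<And>r. r < k \<Longrightarrow> \<phi> r \<in> vecs (dual E); ?a k a \<phi> d\<^sub>1 \<delta>\<rbrakk> \<Longrightarrow>
          norm ((\<Sum>r<k. ?I\<^sub>1 (Suc n) (f'(n := \<phi> r)) (x(n := a r))) - ?I\<^sub>1 n f' x) \<le> ?B * \<delta>"
      proof (rule integral_partial_ext_approximation[OF M(1) u(1) v(1) step.hyps(2) x f'[rule_format]])
        fix d
        assume "\<And>m. d m \<in> vecs (dual E)" "summable (\<lambda>m. nrm (dual E) (d m))"
          "\<And>k a \<phi> \<delta>. \<lbrakk>\<And>r. r < k \<Longrightarrow> a r \<in> vecs E; \<And>r. r < k \<Longrightarrow> \<phi> r \<in> vecs (dual E); ?a k a \<phi> d \<delta>\<rbrakk> \<Longrightarrow>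
            norm ((\<Sum>r<k. ?I\<^sub>1 (Suc n) (f'(n := \<phi> r)) (x(n := a r))) - ?I\<^sub>1 n f' x) \<le> ?B * \<delta>"
        then show thesis by (rule that)
      qed
      obtain d\<^sub>2 where d2: "\<And>m. d\<^sub>2 m \<in> vecs (dual E)" "summable (\<lambda>m. nrm (dual E) (d\<^sub>2 m))"
        and approx2: "\<And>k a \<phi> \<delta>. \<lbrakk>\<And>r. r < k \<Longrightarrow> a r \<in> vecs E; \<And>r. r < k \<Longrightarrow> \<phi> r \<in> vecs (dual E); ?a k a \<phi> d\<^sub>2 \<delta>\<rbrakk> \<Longrightarrow>
          norm ((\<Sum>r<k. ?I\<^sub>2 (Suc n) (f'(n := \<phi> r)) (x(n := a r))) - ?I\<^sub>2 n f' x) \<le> ?B * \<delta>"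
      proof (rule integral_partial_ext_approximation[OF M(2) u(2) v(2) step.hyps(2) x f'[rule_format]])
        fix d
        assume "\<And>m. d m \<in> vecs (dual E)" "summable (\<lambda>m. nrm (dual E) (d m))"
          "\<And>k a \<phi> \<delta>. \<lbrakk>\<And>r. r < k \<Longrightarrow> a r \<in> vecs E; \<And>r. r < k \<Longrightarrow> \<phi> r \<in> vecs (dual E); ?a k a \<phi> d \<delta>\<rbrakk> \<Longrightarrow>
            norm ((\<Sum>r<k. ?I\<^sub>2 (Suc n) (f'(n := \<phi> r)) (x(n := a r))) - ?I\<^sub>2 n f' x) \<le> ?B * \<delta>"
        then show thesis by (rule that)
      qed
      \<comment> \<open>The same operator has to serve both measures, since only then the two sums
        of integrals agree term by term.\<close>
      define d where "d m = (if even m then d\<^sub>1 (m div 2) else d\<^sub>2 (m div 2))" for m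
      have d_mem: "d m \<in> vecs (dual E)" for m by (simp add: d_def d1 d2)
      have d_nrm: "nrm (dual E) (d m) = (if even m then nrm (dual E) (d\<^sub>1 (m div 2)) else nrm (dual E) (d\<^sub>2 (m div 2)))" for m
        by (simp add: d_def)
      have d_summable: "summable (\<lambda>m. nrm (dual E) (d m))"
        unfolding d_nrm by (intro summable_interleave d1 d2 D.nrm_nonneg)
      have "norm (?I\<^sub>1 n f' x - ?I\<^sub>2 n f' x) \<le> 0"
      proof (rule field_le_epsilon)
        fix \<epsilon> :: real assume \<epsilon>: "0 < \<epsilon>"
        \<comment> \<open>The errors for the two measures add up to 2 * ?B * \<delta>; the summand 1
          keeps the denominator positive.\<close>
        define \<delta> where "\<delta> = \<epsilon> / (2 * ?B + 1)"
        have \<delta>: "\<delta> > 0" unfolding \<delta>_def using B \<epsilon> by (intro divide_pos_pos) linarith+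
        obtain k a \<phi> where a: "\<And>r. r < k \<Longrightarrow> a r \<in> vecs E" and \<phi>: "\<And>r. r < k \<Longrightarrow> \<phi> r \<in> vecs (dual E)"
          and s: "summable (\<lambda>m. nrm (dual E) (finite_rank k a \<phi> (d m) - d m))"
            "(\<Sum>m. nrm (dual E) (finite_rank k a \<phi> (d m) - d m)) \<le> \<delta>"
        proof (rule approximation_on_summable_sequence[OF normed_space_axioms ap d_mem d_summable \<delta>])
          fix k a \<phi>
          assume "\<And>r. r < k \<Longrightarrow> a r \<in> vecs E" "\<And>r. r < k \<Longrightarrow> \<phi> r \<in> vecs (dual E)"
            "summable (\<lambda>m. nrm (dual E) (finite_rank k a \<phi> (d m) - d m))"
            "(\<Sum>m. nrm (dual E) (finite_rank k a \<phi> (d m) - d m)) \<le> \<delta>"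
          then show thesis by (rule that)
        qed
        have nn: "0 \<le> nrm (dual E) (finite_rank k a \<phi> (d m) - d m)" for m
          by (intro D.nrm_nonneg D.diff_mem finite_rank_mem[OF normed_space_axioms \<phi>] d_mem)
        have d_even: "d (2 * j) = d\<^sub>1 j" and d_odd: "d (Suc (2 * j)) = d\<^sub>2 j" for j by (simp_all add: d_def)
        have s1: "?a k a \<phi> d\<^sub>1 \<delta>" using summable_even_odd(1)[OF s(1) nn] s(2) unfolding d_even by auto
        have s2: "?a k a \<phi> d\<^sub>2 \<delta>" using summable_even_odd(2)[OF s(1) nn] s(2) unfolding d_odd by auto
        have eq: "(\<Sum>r<k. ?I\<^sub>1 (Suc n) (f'(n := \<phi> r)) (x(n := a r))) = (\<Sum>r<k. ?I\<^sub>2 (Suc n) (f'(n := \<phi> r)) (x(n := a r)))"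
        proof (rule sum.cong[OF refl])
          fix r assume "r \<in> {..<k}"
          then have r: "r < k" by simp
          show "?I\<^sub>1 (Suc n) (f'(n := \<phi> r)) (x(n := a r)) = ?I\<^sub>2 (Suc n) (f'(n := \<phi> r)) (x(n := a r))"
            by (rule step.IH[rule_format])
              (use f' \<phi>[OF r] in \<open>auto simp: less_Suc_eq intro: tuples_upd_Suc[OF x a[OF r]]\<close>)
        qed
        have "norm (?I\<^sub>1 n f' x - ?I\<^sub>2 n f' x) \<le> ?B * \<delta> + ?B * \<delta>"
          using norm_triangle_sub_le[OF approx1[OF a \<phi> s1, unfolded eq] approx2[OF a \<phi> s2]] .
        also have "\<dots> = (2 * ?B) * \<delta>" by simp
        also have "\<dots> \<le> (2 * ?B + 1) * \<delta>" using \<delta> by (intro mult_right_mono) auto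
        also have "\<dots> = \<epsilon>" unfolding \<delta>_def using B by (intro nonzero_mult_div_cancel_left[THEN trans[OF times_divide_eq_right]]) linarith
        finally show "norm (?I\<^sub>1 n f' x - ?I\<^sub>2 n f' x) \<le> 0 + \<epsilon>" by simp
      qed
      then show "?I\<^sub>1 n f' x = ?I\<^sub>2 n f' x" by simp
    qed
  qed
  from this[of 0, THEN spec, THEN spec, of "\<lambda>_. 0" "\<lambda>_. undefined"] show ?thesis by (simp add: tuples_def)
qed

end

end

section \<open>Representing measures\<close>

text \<open>Coefficients are indexed by all pairs of the types. Sending points outside the ball to 0
  bounds the integrands everywhere and keeps every random vector in the unit ball.\<close>

definition clamp :: "('k, 'v::zero) nspace \<Rightarrow> 'v \<Rightarrow> 'v" where
  "clamp E x = (if x \<in> unit_ball E then x else 0)"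

text \<open>The weak-star limit of the points in the bidual along U, taken one coordinate at a
  time.\<close>

definition limit_functional :: "nat filter \<Rightarrow> ('k::real_or_complex, 'v::ab_group_add) nspace \<Rightarrow> (nat \<Rightarrow> 'v) \<Rightarrow> ('v \<Rightarrow> 'k) \<Rightarrow> 'k" where
  "limit_functional U E x f = (if f \<in> vecs (dual E) then Lim U (\<lambda>n. f (clamp E (x n))) else 0)"

context normed_space
begin

lemma clamp_mem: "clamp E x \<in> vecs E" "nrm E (clamp E x) \<le> 1"
  using zero_mem nrm_eq_0[OF zero_mem] by (auto simp: clamp_def unit_ball_def)

lemma dual_clamp_le: "f \<in> vecs (dual E) \<Longrightarrow> norm (f (clamp E x)) \<le> nrm (dual E) f"
  by (rule dual_ball_le[OF _ clamp_mem])

lemma limit_functional_tendsto: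
  assumes U: "ultrafilter U" and f: "f \<in> vecs (dual E)"
  shows "((\<lambda>n. f (clamp E (x n))) \<longlongrightarrow> limit_functional U E x f) U"
  unfolding limit_functional_def if_P[OF f] by (rule ultrafilter_tendsto[OF U dual_clamp_le[OF f]])

lemma limit_functional_mem:
  assumes U: "ultrafilter U"
  shows "limit_functional U E x \<in> vecs (bidual E)" and "nrm (bidual E) (limit_functional U E x) \<le> 1"
proof -
  interpret D: normed_space "dual E" by (rule normed_space_dual)
  have nt: "U \<noteq> bot" using U by (simp add: ultrafilter_def)
  note lim = limit_functional_tendsto[OF U, of _ x]
  have le: "norm (limit_functional U E x f) \<le> nrm (dual E) f" if f: "f \<in> vecs (dual E)" for f
    by (rule tendsto_upperbound[OF tendsto_norm[OF lim[OF f]] always_eventually nt]) (use dual_clamp_le[OF f] in blast)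
  show "limit_functional U E x \<in> vecs (bidual E)"
  proof (rule D.dual_memI)
    fix f g assume f: "f \<in> vecs (dual E)" and g: "g \<in> vecs (dual E)"
    have "((\<lambda>n. (f + g) (clamp E (x n))) \<longlongrightarrow> limit_functional U E x f + limit_functional U E x g) U"
      unfolding plus_fun_apply by (intro tendsto_add lim f g)
    then show "limit_functional U E x (f + g) = limit_functional U E x f + limit_functional U E x g"
      by (rule tendsto_unique[OF nt lim[OF D.add_mem[OF f g]]])
  next
    fix c f assume f: "f \<in> vecs (dual E)"
    have "((\<lambda>n. smul (dual E) c f (clamp E (x n))) \<longlongrightarrow> c * limit_functional U E x f) U"
      unfolding dual_sel by (intro tendsto_mult_left lim f)
    then show "limit_functional U E x (smul (dual E) c f) = c * limit_functional U E x f"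
      by (rule tendsto_unique[OF nt lim[OF D.smul_mem[OF f]]])
    show "norm (limit_functional U E x f) \<le> 1 * nrm (dual E) f" using le[OF f] by simp
  qed (simp add: limit_functional_def)
  show "nrm (bidual E) (limit_functional U E x) \<le> 1"
    by (rule D.dual_nrm_le) (use le order_trans in blast)
qed

lemma canonical_embedding_mem:
  assumes "x \<in> vecs E" "nrm E x \<le> 1"
  shows "canonical_embedding E x \<in> vecs (bidual E)" "nrm (bidual E) (canonical_embedding E x) \<le> 1"
proof -
  interpret D: normed_space "dual E" by (rule normed_space_dual)
  show "canonical_embedding E x \<in> vecs (bidual E)"
    by (rule D.dual_memI[of _ 1])
      (use D.add_mem D.smul_mem dual_ball_le[OF _ assms] in \<open>auto simp: canonical_embedding_def simp flip: dual_sel(2)\<close>)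
  show "nrm (bidual E) (canonical_embedding E x) \<le> 1"
    by (rule D.dual_nrm_le) (use dual_ball_le[OF _ assms] order_trans in \<open>fastforce simp: canonical_embedding_def simp del: dual_sel\<close>)
qed

text \<open>For a vector x of the space itself, each application of the embedded vector substitutes
  x into a slot.\<close>

lemma partial_ext_canonical_embedding:
  assumes x: "x \<in> vecs E" "nrm E x \<le> 1"
    and a: "multilinear N E scalars a" "multilinear_bound N E scalars a C" "C \<ge> 0"
  shows "partial_ext E (canonical_embedding E x) 0 N a (\<lambda>_. undefined) = a (diag N x)"
proof -
  let ?u = "canonical_embedding E x"
  have "\<forall>z\<in>tuples n E. partial_ext E ?u n N a z = a (\<lambda>i. if i < n then z i else diag N x i)" if "n \<le> N" for n
    using that
  proof (induction rule: inc_induct)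
    case base
    show ?case
    proof
      fix z assume z: "z \<in> tuples N E"
      have "(\<lambda>i. if i < N then z i else diag N x i) = z"
        using z by (auto simp: fun_eq_iff diag_def tuples_def PiE_iff extensional_def)
      then show "partial_ext E ?u N N a z = a (\<lambda>i. if i < N then z i else diag N x i)" by simp
    qed
  next
    case (step n)
    show ?case
    proof
      fix z assume z: "z \<in> tuples n E"
      have n: "Suc n \<le> N" using step.hyps by simp
      note ext = partial_ext_multilinear[OF normed_space_axioms canonical_embedding_mem(1)[OF x] a n]
      have "nrm (bidual E) ?u ^ (N - Suc n) * C \<ge> 0"
        by (intro mult_nonneg_nonneg zero_le_power a(3) normed_space.dual_sup_nonneg[OF normed_space_dual canonical_embedding_mem(1)[OF x]])
      then have "slot E ?u n (partial_ext E ?u (Suc n) N a) z \<in> vecs (dual E)"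
        by (rule slot_mem(1)[OF normed_space_axioms ext[THEN conjunct1] ext[THEN conjunct2] _ z])
      then have "partial_ext E ?u n N a z = partial_ext E ?u (Suc n) N a (z(n := x))"
        unfolding partial_ext_step[OF step.hyps(2)] using x(1)
        by (simp add: canonical_embedding_def slot_def del: fun_upd_apply)
      also have "\<dots> = a (\<lambda>i. if i < Suc n then (z(n := x)) i else diag N x i)"
        by (rule step.IH[THEN bspec, OF tuples_upd_Suc[OF z x(1)]])
      also have "(\<lambda>i. if i < Suc n then (z(n := x)) i else diag N x i) = (\<lambda>i. if i < n then z i else diag N x i)"
        using step.hyps by (auto simp: fun_eq_iff diag_def)
      finally show "partial_ext E ?u n N a z = a (\<lambda>i. if i < n then z i else diag N x i)" .
    qed
  qed
  from this[of 0] show ?thesis by (simp add: tuples_def)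
qed

end

text \<open>The integrand of a moment is the value at y of such a polynomial. Every moment is
  therefore a value of the functional u and does not depend on the sum that represents u.\<close>

lemma monomial_polynomial:
  fixes X :: "('k::real_or_complex, 'x::ab_group_add) nspace" and F :: "('k, 'w::ab_group_add) nspace"
  assumes X: "normed_space X" and F: "normed_space F"
    and f: "\<And>l. l < N \<Longrightarrow> f l \<in> vecs (dual X)" and c: "c \<in> vecs F"
  shows "(\<lambda>x. if x \<in> vecs X then smul F (\<Prod>l<N. f l x) c else 0) \<in> vecs (polynomials N X F)"
proof -
  interpret X: normed_space X by (rule X)
  interpret D: normed_space "dual X" by (rule X.normed_space_dual)
  interpret F: normed_space F by (rule F)
  let ?\<Psi> = "\<lambda>z. if z \<in> tuples N X then smul F (\<Prod>l<N. f l (z l)) c else 0"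
  have upd: "(\<Prod>l<N. f l ((z(i := y)) l)) = f i y * (\<Prod>l\<in>{..<N} - {i}. f l (z l))" if "i < N" for z i y
    using that by (subst prod.remove[of _ i]) (auto intro!: arg_cong2[of _ _ _ _ "(*)"] prod.cong)
  have "multilinear N X F ?\<Psi>"
    unfolding multilinear_def
  proof (intro ballI conjI allI impI)
    fix z assume z: "z \<in> tuples N X"
    show "?\<Psi> z \<in> vecs F" using F.smul_mem[OF c] z by simp
    fix i assume i: "i < N"
    have eq: "?\<Psi> (z(i := y)) = smul F (f i y * (\<Prod>l\<in>{..<N} - {i}. f l (z l))) c" if "y \<in> vecs X" for y
      using tuples_upd[OF z i that] by (simp only: upd[OF i] if_True)
    show "linear_map X F (\<lambda>y. ?\<Psi> (z(i := y)))"
      unfolding linear_map_def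
    proof (intro conjI ballI allI)
      fix x y k assume x: "x \<in> vecs X"
      show "?\<Psi> (z(i := x)) \<in> vecs F" unfolding eq[OF x] by (rule F.smul_mem[OF c])
      show "?\<Psi> (z(i := smul X k x)) = smul F k (?\<Psi> (z(i := x)))"
        unfolding eq[OF x] eq[OF X.smul_mem[OF x]] X.dual_smul[OF f[OF i] x] F.smul_smul[OF c] by (simp only: mult.assoc)
      assume y: "y \<in> vecs X"
      show "?\<Psi> (z(i := x + y)) = ?\<Psi> (z(i := x)) + ?\<Psi> (z(i := y))"
        unfolding eq[OF x] eq[OF y] eq[OF X.add_mem[OF x y]] X.dual_add[OF f[OF i] x y] distrib_right F.add_smul[OF c] ..
    qed
  qed
  moreover have "multilinear_bound N X F ?\<Psi> ((\<Prod>l<N. nrm (dual X) (f l)) * nrm F c)"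
    unfolding multilinear_bound_def
  proof
    fix z assume z: "z \<in> tuples N X"
    have "nrm F (?\<Psi> z) = (\<Prod>l<N. norm (f l (z l))) * nrm F c" using z by (simp add: F.nrm_smul[OF c] prod_norm)
    also have "\<dots> \<le> (\<Prod>l<N. nrm (dual X) (f l) * nrm X (z l)) * nrm F c"
      by (intro mult_right_mono prod_mono conjI norm_ge_zero X.dual_norm_le f tuples_mem[OF z] F.nrm_nonneg c) auto
    finally show "nrm F (?\<Psi> z) \<le> (\<Prod>l<N. nrm (dual X) (f l)) * nrm F c * (\<Prod>i<N. nrm X (z i))"
      by (simp only: prod.distrib mult_ac)
  qed
  moreover have "0 \<le> (\<Prod>l<N. nrm (dual X) (f l)) * nrm F c"
    by (intro mult_nonneg_nonneg prod_nonneg D.nrm_nonneg F.nrm_nonneg f c) auto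
  ultimately have "?\<Psi> \<in> multilinear_maps N X F" unfolding multilinear_maps_iff[OF X F] by auto
  moreover have "smul F (\<Prod>l<N. f l x) c = ?\<Psi> (diag N x)" if "x \<in> vecs X" for x
    using diag_tuple[OF that, of N] by (simp add: diag_def)
  ultimately show ?thesis unfolding mem_polynomials by (intro conjI bexI[of _ ?\<Psi>]) auto
qed

text \<open>Puts a single weighted sum on the same footing as the limit measure, so that both are
  covered by one statement about integrals.\<close>

lemma discrete_measure:
  fixes w :: "'q \<Rightarrow> real"
  assumes w: "\<And>q. 0 \<le> w q" "w summable_on UNIV"
  obtains M where "finite_measure M" "\<And>g :: 'q \<Rightarrow> 'k::real_or_complex. g \<in> borel_measurable M"
    "\<And>(g :: 'q \<Rightarrow> 'k) B. (\<And>q. norm (g q) \<le> B) \<Longrightarrow> (\<integral>q. g q \<partial>M) = (\<Sum>\<^sub>\<infinity>q. of_real (w q) * g q)"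
proof -
  let ?M = "density (count_space UNIV) (\<lambda>q. ennreal (w q))"
  show thesis
  proof (rule that[of ?M])
    have "(\<lambda>q. norm (w q)) summable_on UNIV" using w by simp
    then have "integrable (count_space UNIV) w"
      by (simp only: Infinite_Set_Sum.abs_summable_on_def[symmetric] abs_summable_equivalent)
    then have "(\<integral>\<^sup>+q. ennreal (w q) \<partial>count_space UNIV) \<noteq> \<infinity>"
      using integrableD(2)[of "count_space UNIV" w] w(1) by simp
    then show "finite_measure ?M" by (intro finite_measureI) (simp add: emeasure_density)
    show "g \<in> borel_measurable ?M" for g :: "'q \<Rightarrow> 'k" by simp
    fix g :: "'q \<Rightarrow> 'k" and B assume g: "\<And>q. norm (g q) \<le> B"
    have sm: "(\<lambda>q. norm (of_real (w q) * g q)) summable_on UNIV"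
    proof (rule Infinite_Sum.summable_on_comparison_test[OF summable_on_cmult_left[OF w(2), of B]])
      show "norm (of_real (w q) * g q) \<le> w q * B" for q
        using mult_left_mono[OF g w(1), of q q] w(1)[of q] by (simp add: norm_mult)
    qed simp
    have "(\<integral>q. g q \<partial>?M) = (\<integral>q. w q *\<^sub>R g q \<partial>count_space UNIV)"
      by (rule integral_density) (auto simp: w)
    also have "\<dots> = infsetsum (\<lambda>q. of_real (w q) * g q) UNIV"
      by (simp add: infsetsum_def scaleR_conv_of_real)
    also have "\<dots> = (\<Sum>\<^sub>\<infinity>q. of_real (w q) * g q)"
      by (rule infsetsum_infsum) (use sm in \<open>simp only: abs_summable_equivalent\<close>)
    finally show "(\<integral>q. g q \<partial>?M) = (\<Sum>\<^sub>\<infinity>q. of_real (w q) * g q)" .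
  qed
qed

definition ball_weight :: "('k, 'x) nspace \<Rightarrow> ('k, 'y) nspace \<Rightarrow> ('x \<times> 'y \<Rightarrow> 'k::real_or_complex) \<Rightarrow> 'x \<times> 'y \<Rightarrow> real" where
  "ball_weight X Y m p = (if fst p \<in> unit_ball X \<and> snd p \<in> unit_ball Y then norm (m p) else 0)"

lemma ball_weight_summable:
  assumes "m \<in> ell1"
  shows "ball_weight X Y m summable_on UNIV" and "infsum (ball_weight X Y m) UNIV \<le> mass m"
proof -
  have m: "(\<lambda>p. norm (m p)) summable_on UNIV" using assms by (simp add: ell1_def)
  show s: "ball_weight X Y m summable_on UNIV"
    by (rule summable_on_comparison_test[OF m]) (auto simp: ball_weight_def)
  show "infsum (ball_weight X Y m) UNIV \<le> mass m"
    unfolding mass_def by (rule infsum_mono[OF s m]) (simp add: ball_weight_def)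
qed

(* The coefficient m p is split into its modulus, which becomes a weight, and its phase, which is
   absorbed by the second component of p. *)
definition phase_shift :: "('k, 'y) nspace \<Rightarrow> ('x \<times> 'y \<Rightarrow> 'k::real_or_complex) \<Rightarrow> 'x \<times> 'y \<Rightarrow> 'x \<times> 'y" where
  "phase_shift Y m p = (fst p, smul Y (m p / of_real (norm (m p))) (snd p))"

context
  fixes X :: "('k::real_or_complex, 'x::ab_group_add) nspace" and Y :: "('k, 'y::ab_group_add) nspace"
  assumes X: "normed_space X" and Y: "normed_space Y"
begin

interpretation X: normed_space X by (rule X)
interpretation Y: normed_space Y by (rule Y)
interpretation DY: normed_space "dual Y" by (rule Y.normed_space_dual)

lemma weighted_evaluation_sum:
  assumes P: "P \<in> vecs (polynomials N X (dual Y))"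
  shows "(\<Sum>\<^sub>\<infinity>p. of_real (ball_weight X Y m p) * P (clamp X (fst (phase_shift Y m p))) (clamp Y (snd (phase_shift Y m p))))
    = pairing (poly_eval N X Y) m P"
  unfolding pairing_def
proof (rule infsum_cong)
  fix p
  show "of_real (ball_weight X Y m p) * P (clamp X (fst (phase_shift Y m p))) (clamp Y (snd (phase_shift Y m p)))
    = m p * poly_eval N X Y P p"
  proof (cases "fst p \<in> unit_ball X \<and> snd p \<in> unit_ball Y")
    case True
    then have y: "snd p \<in> vecs Y" "nrm Y (snd p) \<le> 1" by (auto simp: unit_ball_def)
    let ?\<theta> = "m p / of_real (norm (m p))"
    \<comment> \<open>If m p = 0 the phase is 0 / 0 = 0; an inequality is enough to stay in the unit
      ball.\<close>
    have "norm ?\<theta> \<le> 1" by (simp add: norm_divide)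
    then have "smul Y ?\<theta> (snd p) \<in> unit_ball Y"
      using y by (simp add: unit_ball_def Y.smul_mem Y.nrm_smul mult_le_one Y.nrm_nonneg)
    moreover have "P (fst p) \<in> vecs (dual Y)" by (rule polynomial_mem[OF X DY.normed_space_axioms P])
    ultimately show ?thesis
      using True P y by (simp add: ball_weight_def phase_shift_def clamp_def poly_eval_def Y.dual_smul)
  qed (auto simp: ball_weight_def poly_eval_def)
qed

end

section \<open>Norm attainment\<close>

context
  fixes X :: "('k::real_or_complex, 'x::ab_group_add) nspace" and Y :: "('k, 'y::ab_group_add) nspace"
  assumes X: "normed_space X" and Y: "normed_space Y"
begin

interpretation X: normed_space X by (rule X)
interpretation Y: normed_space Y by (rule Y)
interpretation DX: normed_space "dual X" by (rule X.normed_space_dual)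
interpretation DY: normed_space "dual Y" by (rule Y.normed_space_dual)
interpretation DDX: normed_space "bidual X" by (rule DX.normed_space_dual)
interpretation DDY: normed_space "bidual Y" by (rule DY.normed_space_dual)

text \<open>\<open>davie_gamelin\<close> is applied to the scalar-valued symmetric map obtained by
  composing with v, whose diagonal is bounded by that of Q because v has norm at most 1.\<close>

lemma aron_berner_extension_le:
  assumes Q: "Q \<in> vecs (polynomials N X (dual Y))"
    and u: "u \<in> vecs (bidual X)" "nrm (bidual X) u \<le> 1" and v: "v \<in> vecs (bidual Y)" "nrm (bidual Y) v \<le> 1"
  shows "norm (aron_berner_extension N X (dual Y) Q u v) \<le> sup_norm X (dual Y) Q"
proof -
  let ?A = "associated_symmetric N X (dual Y) Q"
  obtain C where A: "multilinear N X (dual Y) ?A" "multilinear_bound N X (dual Y) ?A C" "C \<ge> 0"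
    using associated_symmetric_multilinear[OF X Y Q] unfolding multilinear_maps_iff[OF X DY.normed_space_axioms] by blast
  note a = multilinear_functional[OF DY.normed_space_axioms A(1,2) v(1)]
  have C: "nrm (bidual Y) v * C \<ge> 0" by (intro mult_nonneg_nonneg DDY.nrm_nonneg v A)
  have sym: "symmetric N X (\<lambda>z. v (?A z))"
    using symmetric_associated_symmetric[OF X Y Q] by (auto simp: symmetric_def)
  show ?thesis
    unfolding aron_berner_extension_eq[OF X Y Q u(1) v(1)]
  proof (rule davie_gamelin[OF X u a C sym])
    show "0 \<le> sup_norm X (dual Y) Q" by (rule polynomial_sup_nonneg[OF X DY.normed_space_axioms Q])
    fix x assume x: "x \<in> vecs X"
    have Qx: "Q x \<in> vecs (dual Y)" by (rule polynomial_mem[OF X DY.normed_space_axioms Q])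
    have "norm (v (?A (diag N x))) \<le> nrm (bidual Y) v * nrm (dual Y) (Q x)"
      unfolding associated_symmetric_diag[OF X Y Q x] by (rule DY.dual_norm_le[OF v(1) Qx])
    also have "\<dots> \<le> 1 * nrm (dual Y) (Q x)" by (intro mult_right_mono v DY.nrm_nonneg Qx)
    also have "\<dots> \<le> sup_norm X (dual Y) Q * nrm X x ^ N"
      using polynomial_norm_le[OF X DY.normed_space_axioms Q x] by (simp del: dual_sel)
    finally show "norm (v (?A (diag N x))) \<le> sup_norm X (dual Y) Q * nrm X x ^ N" .
  qed
qed

text \<open>By the preceding bound the extension has norm at most that of Q; one pair (u, v) that
  reaches this value makes the norms equal and u a point of attainment.\<close>

lemma attains_normI:
  assumes Q: "Q \<in> vecs (polynomials N X (dual Y))"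
    and u: "u \<in> vecs (bidual X)" "nrm (bidual X) u \<le> 1" and v: "v \<in> vecs (bidual Y)" "nrm (bidual Y) v \<le> 1"
    and ge: "sup_norm X (dual Y) Q \<le> norm (aron_berner_extension N X (dual Y) Q u v)"
  shows "attains_norm (bidual X) (bidual (dual Y)) (aron_berner_extension N X (dual Y) Q)"
proof -
  let ?e = "aron_berner_extension N X (dual Y) Q" and ?s = "sup_norm X (dual Y) Q"
  have le: "nrm (bidual (dual Y)) (?e a) \<le> ?s" if "a \<in> unit_ball (bidual X)" for a
    by (rule DDY.dual_nrm_le, rule aron_berner_extension_le[OF Q]) (use that in \<open>auto simp: unit_ball_def\<close>)
  have ub: "u \<in> unit_ball (bidual X)" using u by (simp add: unit_ball_def)
  have "norm (?e u v) \<le> sup_norm (bidual Y) scalars (?e u)"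
    using le_sup_norm[of "bidual Y" scalars "?e u" ?s v] aron_berner_extension_le[OF Q u] v
    by (simp add: unit_ball_def)
  then have eq: "nrm (bidual (dual Y)) (?e u) = ?s" using ge le[OF ub] by simp
  have "sup_norm (bidual X) (bidual (dual Y)) ?e \<le> ?s" by (rule sup_norm_le[OF DDX.unit_ball_nonempty le])
  moreover have "nrm (bidual (dual Y)) (?e u) \<le> sup_norm (bidual X) (bidual (dual Y)) ?e" by (rule le_sup_norm[OF le ub])
  ultimately show ?thesis unfolding attains_norm_def using eq ub by (intro bexI[of _ u]) auto
qed

lemma attains_norm_aron_berner:
  fixes Q :: "'x \<Rightarrow> 'y \<Rightarrow> 'k"
  assumes sep: "separable_space (norm_topology (dual X))" and ap: "approximation_property (dual X)"
    and Q: "Q \<in> vecs (polynomials N X (dual Y))"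
    and u: "\<And>\<eta>. \<eta> > 0 \<Longrightarrow> \<exists>m\<in>ell1. pairing (poly_eval N X Y) m = u \<and> mass m < 1 + \<eta>"
    and Q_le: "sup_norm X (dual Y) Q \<le> norm (u Q)"
  shows "attains_norm (bidual X) (bidual (dual Y)) (aron_berner_extension N X (dual Y) Q)"
proof (cases "sup_norm X (dual Y) Q = 0")
  case True
  show ?thesis
    by (rule attains_normI[OF Q DDX.zero_mem _ DDY.zero_mem])
      (use True DDX.nrm_eq_0[OF DDX.zero_mem] DDY.nrm_eq_0[OF DDY.zero_mem] in simp_all)
next
  case False
  let ?s = "sup_norm X (dual Y) Q" and ?A = "associated_symmetric N X (dual Y) Q"
  \<comment> \<open>Positivity will exclude that the limit measure is zero.\<close>
  have s: "?s > 0" using False polynomial_sup_nonneg[OF X DY.normed_space_axioms Q] by simp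
  obtain C where A: "multilinear N X (dual Y) ?A" "multilinear_bound N X (dual Y) ?A C" "C \<ge> 0"
    using associated_symmetric_multilinear[OF X Y Q] unfolding multilinear_maps_iff[OF X DY.normed_space_axioms] by blast
  obtain f where f: "\<And>j::nat. f j \<in> vecs (dual X)" "\<And>g \<epsilon>. \<lbrakk>g \<in> vecs (dual X); \<epsilon> > 0\<rbrakk> \<Longrightarrow> \<exists>j. nrm (dual X) (g - f j) < \<epsilon>"
  proof (rule DX.dense_sequence[OF sep])
    fix f
    assume "\<And>j::nat. f j \<in> vecs (dual X)" "\<And>g \<epsilon>. \<lbrakk>g \<in> vecs (dual X); \<epsilon> > 0\<rbrakk> \<Longrightarrow> \<exists>j. nrm (dual X) (g - f j) < \<epsilon>"
    then show thesis by (rule that)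
  qed
  obtain e where e: "\<And>i::nat. e i \<in> vecs X" "\<And>i. nrm X (e i) \<le> 1"
    "\<And>g c. \<lbrakk>g \<in> vecs (dual X); \<And>i. norm (g (e i)) \<le> c\<rbrakk> \<Longrightarrow> nrm (dual X) g \<le> c"
  proof (rule X.norming_sequence[OF f])
    fix e
    assume "\<And>i::nat. e i \<in> vecs X" "\<And>i. nrm X (e i) \<le> 1"
      "\<And>g c. \<lbrakk>g \<in> vecs (dual X); \<And>i. norm (g (e i)) \<le> c\<rbrakk> \<Longrightarrow> nrm (dual X) g \<le> c"
    then show thesis by (rule that)
  qed
  interpret S: separable_dual X f e by unfold_locales (rule f e; assumption)+
  obtain U :: "nat filter" where U: "ultrafilter U" "U \<le> sequentially"
    by (rule ultrafilter_below[OF sequentially_bot])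
  then have nt: "U \<noteq> bot" by (simp add: ultrafilter_def)
  \<comment> \<open>The representing families all stand for the same u, and the bounds on their
    masses decrease to 1.\<close>
  have "\<forall>n. \<exists>m. m \<in> ell1 \<and> pairing (poly_eval N X Y) m = u \<and> mass m < 1 + inverse (real (Suc n))"
  proof
    fix n
    have "inverse (real (Suc n)) > 0" by simp
    from u[OF this] show "\<exists>m. m \<in> ell1 \<and> pairing (poly_eval N X Y) m = u \<and> mass m < 1 + inverse (real (Suc n))" by blast
  qed
  from choice[OF this] obtain m where "\<forall>n. m n \<in> ell1 \<and> pairing (poly_eval N X Y) (m n) = u \<and> mass (m n) < 1 + inverse (real (Suc n))"
    by (rule exE)
  then have m: "m n \<in> ell1" "pairing (poly_eval N X Y) (m n) = u" "mass (m n) < 1 + inverse (real (Suc n))" for n by simp_all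
  define w where "w n = ball_weight X Y (m n)" for n
  define T where "T n = phase_shift Y (m n)" for n
  have w: "0 \<le> w n p" "w n summable_on UNIV" "infsum (w n) UNIV < 1 + inverse (real (Suc n))" for n p
    using ball_weight_summable[OF m(1), of X Y n] m(3)[of n] unfolding w_def by (auto simp: ball_weight_def)
  have w2: "infsum (w n) UNIV \<le> 2" for n
    using w(3)[of n] inverse_le_1_iff[of "real (Suc n)"] by simp
  have eval: "(\<Sum>\<^sub>\<infinity>p. of_real (w n p) * P (clamp X (fst (T n p))) (clamp Y (snd (T n p)))) = u P"
    if "P \<in> vecs (polynomials N X (dual Y))" for n P
    unfolding w_def T_def weighted_evaluation_sum[OF X Y that] m(2) ..
  \<comment> \<open>M1 is the sum for n = 0 as a discrete measure on pairs; M2 is the limit of all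
    the sums, on sequences of pairs.\<close>
  obtain M1 where M1: "finite_measure M1" "\<And>g :: 'x \<times> 'y \<Rightarrow> 'k. g \<in> borel_measurable M1"
    "\<And>(g :: 'x \<times> 'y \<Rightarrow> 'k) B. (\<And>p. norm (g p) \<le> B) \<Longrightarrow> (\<integral>p. g p \<partial>M1) = (\<Sum>\<^sub>\<infinity>p. of_real (w 0 p) * g p)"
  proof (rule discrete_measure[OF w(1)[of 0] w(2)[of 0]])
    fix M1
    assume "finite_measure M1" "\<And>g :: 'x \<times> 'y \<Rightarrow> 'k. g \<in> borel_measurable M1"
      "\<And>(g :: 'x \<times> 'y \<Rightarrow> 'k) B. (\<And>p. norm (g p) \<le> B) \<Longrightarrow> (\<integral>p. g p \<partial>M1) = (\<Sum>\<^sub>\<infinity>p. of_real (w 0 p) * g p)"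
    then show thesis by (rule that)
  qed
  obtain M2 where M2: "finite_measure M2" "space M2 = UNIV"
    "\<And>(F :: 'x \<times> 'y \<Rightarrow> 'k) B. (\<And>p. norm (F p) \<le> B) \<Longrightarrow>
       (\<lambda>\<omega>. Lim U (\<lambda>n. F (\<omega> n))) \<in> borel_measurable M2 \<and>
       ((\<lambda>n. \<Sum>\<^sub>\<infinity>p. of_real (w n p) * F (T n p)) \<longlongrightarrow> (\<integral>\<omega>. Lim U (\<lambda>n. F (\<omega> n)) \<partial>M2)) U"
  proof (rule loeb_integral[OF U w(1,2) w2, where T = T])
    fix M2
    assume "finite_measure M2" "space M2 = UNIV"
      "\<And>(F :: 'x \<times> 'y \<Rightarrow> 'k) B. (\<And>p. norm (F p) \<le> B) \<Longrightarrow>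
       (\<lambda>\<omega>. Lim U (\<lambda>n. F (\<omega> n))) \<in> borel_measurable M2 \<and>
       ((\<lambda>n. \<Sum>\<^sub>\<infinity>p. of_real (w n p) * F (T n p)) \<longlongrightarrow> (\<integral>\<omega>. Lim U (\<lambda>n. F (\<omega> n)) \<partial>M2)) U"
    then show thesis by (rule that)
  qed
  \<comment> \<open>Under M1 the random vectors are embedded points of X and Y; under M2 they are
    ultralimits in the biduals.\<close>
  define u1 where "u1 p = canonical_embedding X (clamp X (fst (T 0 p)))" for p
  define v1 where "v1 p = canonical_embedding Y (clamp Y (snd (T 0 p)))" for p
  define u2 where "u2 \<omega> = limit_functional U X (\<lambda>n. fst (\<omega> n))" for \<omega> :: "nat \<Rightarrow> 'x \<times> 'y"
  define v2 where "v2 \<omega> = limit_functional U Y (\<lambda>n. snd (\<omega> n))" for \<omega> :: "nat \<Rightarrow> 'x \<times> 'y"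
  have u1: "random_functional M1 X u1" and v1: "random_functional M1 Y v1"
    unfolding random_functional_def u1_def v1_def
    by (intro allI conjI ballI X.canonical_embedding_mem Y.canonical_embedding_mem X.clamp_mem Y.clamp_mem M1(2))+
  have u2: "random_functional M2 X u2"
    unfolding random_functional_def u2_def
  proof (intro allI conjI ballI X.limit_functional_mem[OF U(1)])
    fix g assume g: "g \<in> vecs (dual X)"
    show "(\<lambda>\<omega>. limit_functional U X (\<lambda>n. fst (\<omega> n)) g) \<in> borel_measurable M2"
      unfolding limit_functional_def if_P[OF g]
      by (rule M2(3)[of "\<lambda>p. g (clamp X (fst p))", THEN conjunct1]) (rule X.dual_clamp_le[OF g])
  qed
  have v2: "random_functional M2 Y v2"
    unfolding random_functional_def v2_def
  proof (intro allI conjI ballI Y.limit_functional_mem[OF U(1)])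
    fix g assume g: "g \<in> vecs (dual Y)"
    show "(\<lambda>\<omega>. limit_functional U Y (\<lambda>n. snd (\<omega> n)) g) \<in> borel_measurable M2"
      unfolding limit_functional_def if_P[OF g]
      by (rule M2(3)[of "\<lambda>p. g (clamp Y (snd p))", THEN conjunct1]) (rule Y.dual_clamp_le[OF g])
  qed
  let ?E1 = "\<lambda>p. partial_ext X (u1 p) 0 N (\<lambda>z. v1 p (?A z)) (\<lambda>_. undefined)"
  let ?E2 = "\<lambda>\<omega>. partial_ext X (u2 \<omega>) 0 N (\<lambda>z. v2 \<omega> (?A z)) (\<lambda>_. undefined)"
  \<comment> \<open>Under M1 the extension is Q itself and its integral is u Q by definition of the
    pairing. The equality of moments transfers this value to M2.\<close>
  have E_eq: "(\<integral>p. ?E1 p \<partial>M1) = (\<integral>\<omega>. ?E2 \<omega> \<partial>M2)"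
  proof (rule S.integral_partial_ext_eq[OF Y A ap M1(1) M2(1) u1 u2 v1 v2])
    fix f' c assume f': "\<And>l. l < N \<Longrightarrow> f' l \<in> vecs (dual X)" and c: "c \<in> vecs (dual Y)"
    let ?F = "\<lambda>p. (\<Prod>l<N. f' l (clamp X (fst p))) * c (clamp Y (snd p))"
    let ?B = "(\<Prod>l<N. nrm (dual X) (f' l)) * nrm (dual Y) c"
    let ?P = "\<lambda>x. if x \<in> vecs X then smul (dual Y) (\<Prod>l<N. f' l x) c else 0"
    have P: "?P \<in> vecs (polynomials N X (dual Y))" by (rule monomial_polynomial[OF X DY.normed_space_axioms f' c])
    have F: "norm (?F p) \<le> ?B" for p
      unfolding norm_mult prod_norm[symmetric]
      by (intro mult_mono prod_mono conjI norm_ge_zero X.dual_clamp_le Y.dual_clamp_le f' c prod_nonneg DX.nrm_nonneg) auto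
    have sum: "(\<Sum>\<^sub>\<infinity>p. of_real (w n p) * ?F (T n p)) = u ?P" for n
      using eval[OF P, of n] by (simp add: X.clamp_mem)
    have "(\<integral>p. (\<Prod>l<N. u1 p (f' l)) * v1 p c \<partial>M1) = (\<integral>p. ?F (T 0 p) \<partial>M1)"
      using f' c by (simp add: u1_def v1_def canonical_embedding_def)
    also have "\<dots> = u ?P" unfolding sum[of 0, symmetric] by (rule M1(3)[OF F])
    finally have 1: "(\<integral>p. (\<Prod>l<N. u1 p (f' l)) * v1 p c \<partial>M1) = u ?P" .
    have lim: "Lim U (\<lambda>n. ?F (\<omega> n)) = (\<Prod>l<N. u2 \<omega> (f' l)) * v2 \<omega> c" for \<omega>
      unfolding u2_def v2_def
      by (intro tendsto_Lim nt tendsto_mult tendsto_prod X.limit_functional_tendsto Y.limit_functional_tendsto U f' c) simp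
    have "((\<lambda>n. u ?P) \<longlongrightarrow> (\<integral>\<omega>. (\<Prod>l<N. u2 \<omega> (f' l)) * v2 \<omega> c \<partial>M2)) U"
      using M2(3)[of ?F ?B, OF F] unfolding sum lim by (rule conjunct2)
    from tendsto_unique[OF nt this tendsto_const]
    have 2: "(\<integral>\<omega>. (\<Prod>l<N. u2 \<omega> (f' l)) * v2 \<omega> c \<partial>M2) = u ?P" .
    show "(\<integral>p. (\<Prod>l<N. u1 p (f' l)) * v1 p c \<partial>M1) = (\<integral>\<omega>. (\<Prod>l<N. u2 \<omega> (f' l)) * v2 \<omega> c \<partial>M2)"
      unfolding 1 2 ..
  qed
  have E1: "?E1 p = Q (clamp X (fst (T 0 p))) (clamp Y (snd (T 0 p)))" for p
  proof -
    have v: "v1 p \<in> vecs (bidual Y)" by (rule random_functionalD(1)[OF v1])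
    have "?E1 p = v1 p (?A (diag N (clamp X (fst (T 0 p)))))"
      unfolding u1_def
      by (rule X.partial_ext_canonical_embedding[OF X.clamp_mem multilinear_functional[OF DY.normed_space_axioms A(1,2) v]])
        (intro mult_nonneg_nonneg A DDY.nrm_nonneg v)
    then show ?thesis
      using polynomial_mem[OF X DY.normed_space_axioms Q]
      by (simp add: associated_symmetric_diag[OF X Y Q X.clamp_mem(1)] v1_def canonical_embedding_def)
  qed
  have Q_clamp: "norm (Q (clamp X x) (clamp Y y)) \<le> ?s" for x y
    by (rule order_trans[OF Y.dual_clamp_le[OF polynomial_mem[OF X DY.normed_space_axioms Q]]
          polynomial_ball_le[OF X DY.normed_space_axioms Q X.clamp_mem]])
  have E2_eq: "(\<integral>\<omega>. ?E2 \<omega> \<partial>M2) = u Q"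
    unfolding E_eq[symmetric] E1 eval[OF Q, of 0, symmetric] by (rule M1(3)[OF Q_clamp])
  interpret M2: finite_measure M2 by (rule M2(1))
  \<comment> \<open>The constant function 1 is integrated: the n-th sum has mass below 1 + 1 / (n +
    1).\<close>
  have mass_M2: "measure M2 (space M2) \<le> 1"
  proof -
    have le1: "norm (1 :: 'k) \<le> 1" by simp
    have "((\<lambda>n. \<Sum>\<^sub>\<infinity>p. of_real (w n p) * 1) \<longlongrightarrow> (\<integral>\<omega>. Lim U (\<lambda>n. (1 :: 'k)) \<partial>M2)) U"
      by (rule M2(3)[of "\<lambda>_. 1", THEN conjunct2]) (rule le1)
    moreover have "Lim U (\<lambda>n. (1 :: 'k)) = 1" by (intro tendsto_Lim nt tendsto_const)
    ultimately have "((\<lambda>n. \<Sum>\<^sub>\<infinity>p. of_real (w n p) * (1 :: 'k)) \<longlongrightarrow> of_real (measure M2 (space M2))) U"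
      by (simp add: scaleR_conv_of_real)
    then have "((\<lambda>n. norm (\<Sum>\<^sub>\<infinity>p. of_real (w n p) * (1 :: 'k))) \<longlongrightarrow> norm (of_real (measure M2 (space M2)) :: 'k)) U"
      by (rule tendsto_norm)
    moreover have "((\<lambda>n. 1 + inverse (real (Suc n))) \<longlongrightarrow> 1 + 0) U"
      by (rule tendsto_mono[OF U(2)]) (intro tendsto_add tendsto_const LIMSEQ_inverse_real_of_nat)
    moreover have "norm (\<Sum>\<^sub>\<infinity>p. of_real (w n p) * (1 :: 'k)) \<le> 1 + inverse (real (Suc n))" for n
    proof -
      have "(\<lambda>p. norm (of_real (w n p) * (1 :: 'k))) = w n" using w(1) by (auto simp: norm_mult)
      then have "norm (\<Sum>\<^sub>\<infinity>p. of_real (w n p) * (1 :: 'k)) \<le> infsum (w n) UNIV"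
        using norm_infsum_bound[of "\<lambda>p. of_real (w n p) * (1 :: 'k)" UNIV] w(2) by simp
      then show ?thesis using w(3)[of n] by linarith
    qed
    ultimately have "norm (of_real (measure M2 (space M2)) :: 'k) \<le> 1 + 0"
      by (intro tendsto_le[OF nt]) auto
    then show ?thesis by simp
  qed
  have E2_ext: "?E2 \<omega> = aron_berner_extension N X (dual Y) Q (u2 \<omega>) (v2 \<omega>)" for \<omega>
    by (rule aron_berner_extension_eq[OF X Y Q random_functionalD(1)[OF u2] random_functionalD(1)[OF v2], symmetric])
  \<comment> \<open>If the integrand stayed strictly below s everywhere, its integral against a
    nonzero measure of mass at most 1 would be less than s in modulus, but it equals u Q.\<close>
  have "\<exists>\<omega>. ?s \<le> norm (?E2 \<omega>)"
  proof (rule ccontr)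
    assume "\<nexists>\<omega>. ?s \<le> norm (?E2 \<omega>)"
    then have lt: "norm (?E2 \<omega>) < ?s" for \<omega> by (simp add: not_le)
    have meas: "?E2 \<in> borel_measurable M2"
      by (rule S.measurable_partial_ext[OF Y A u2 v2, THEN bspec]) (simp_all add: tuples_def)
    have int: "integrable M2 ?E2" by (rule M2.integrable_const_bound[of _ ?s, OF _ meas]) (use lt less_imp_le in blast)
    have le: "?s \<le> (\<integral>\<omega>. norm (?E2 \<omega>) \<partial>M2)"
      using Q_le integral_norm_bound[of M2 ?E2] unfolding E2_eq by linarith
    have nz: "emeasure M2 (space M2) \<noteq> 0"
    proof
      assume "emeasure M2 (space M2) = 0"
      then have "(\<integral>\<omega>. norm (?E2 \<omega>) \<partial>M2) = 0"
        by (intro integral_eq_zero_AE AE_I'[of "space M2"] null_setsI) auto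
      then show False using le s by simp
    qed
    have "(\<integral>\<omega>. norm (?E2 \<omega>) \<partial>M2) < (\<integral>\<omega>. ?s \<partial>M2)"
      by (rule M2.integral_less_AE_space[OF integrable_norm[OF int] _ _ nz]) (use lt in auto)
    also have "\<dots> \<le> ?s" using mass_M2 s by (simp add: mult_left_le_one_le mult_left_le)
    finally show False using le by simp
  qed
  then obtain \<omega> where "?s \<le> norm (aron_berner_extension N X (dual Y) Q (u2 \<omega>) (v2 \<omega>))" unfolding E2_ext by (rule exE)
  then show ?thesis
    by (rule attains_normI[OF Q random_functionalD(1,2)[OF u2] random_functionalD(1,2)[OF v2]])
qed

end

theorem theorem2p3:
  fixes X :: "('k::real_or_complex, 'x::ab_group_add) nspace"
    and Y :: "('k, 'y::ab_group_add) nspace"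
    and N :: nat
  assumes "banach_space X"
    and "banach_space Y"
    and "separable_space (norm_topology (dual X))"
    and "approximation_property (dual X)"
  shows "norm_topology (polynomials N X (dual Y)) closure_of
           {P \<in> vecs (polynomials N X (dual Y)).
              attains_norm (bidual X) (bidual (dual Y)) (aron_berner_extension N X (dual Y) P)}
         = vecs (polynomials N X (dual Y))"
proof -
  have X: "normed_space X" and Y: "normed_space Y" using assms(1,2) by (simp_all add: banach_space_def)
  interpret \<P>: normed_space "polynomials N X (dual Y)"
    by (rule normed_space_polynomials[OF X normed_space.normed_space_dual[OF Y]])
  show ?thesis
    unfolding norm_topology_def Metric_space.metric_closure_of[OF \<P>.Metric_space]
  proof (intro Collect_eqI[THEN trans[OF _ Collect_mem_eq]] iffI conjI allI impI; (elim conjE, assumption)?)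
    fix P0 and \<epsilon> :: real assume P0: "P0 \<in> vecs (polynomials N X (dual Y))" and "\<epsilon> > 0"
    \<comment> \<open>The perturbation is only bounded by a weak inequality, so half the radius is
      used to land in the open ball.\<close>
    then have \<epsilon>2: "\<epsilon> / 2 > 0" by simp
    obtain R u
      where R: "R \<in> vecs (polynomials N X (dual Y))" "sup_norm X (dual Y) R \<le> \<epsilon> / 2"
        and u: "\<And>\<eta>. \<eta> > 0 \<Longrightarrow> \<exists>m\<in>ell1. pairing (poly_eval N X Y) m = u \<and> mass m < 1 + \<eta>"
        and le: "sup_norm X (dual Y) (P0 + R) \<le> norm (u (P0 + R))"
    proof (rule bishop_phelps_polynomials[OF X Y P0 \<epsilon>2])
      fix R u
      assume "R \<in> vecs (polynomials N X (dual Y))" "sup_norm X (dual Y) R \<le> \<epsilon> / 2"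
        "\<And>\<eta>. \<eta> > 0 \<Longrightarrow> \<exists>m\<in>ell1. pairing (poly_eval N X Y) m = u \<and> mass m < 1 + \<eta>"
        "sup_norm X (dual Y) (P0 + R) \<le> norm (u (P0 + R))"
      then show thesis by (rule that)
    qed
    have Q: "P0 + R \<in> vecs (polynomials N X (dual Y))" by (rule \<P>.add_mem[OF P0 R(1)])
    have "nrm (polynomials N X (dual Y)) (P0 - (P0 + R)) = sup_norm X (dual Y) R"
      using \<P>.nrm_minus[OF R(1)] by simp
    then have "P0 + R \<in> Metric_space.mball (vecs (polynomials N X (dual Y))) (ndist (polynomials N X (dual Y))) P0 \<epsilon>"
      unfolding Metric_space.in_mball[OF \<P>.Metric_space] ndist_def using P0 Q R(2) \<open>\<epsilon> > 0\<close> by simp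
    moreover have "attains_norm (bidual X) (bidual (dual Y)) (aron_berner_extension N X (dual Y) (P0 + R))"
      by (rule attains_norm_aron_berner[OF X Y assms(3,4) Q u le])
    ultimately show "\<exists>y\<in>{P \<in> vecs (polynomials N X (dual Y)).
          attains_norm (bidual X) (bidual (dual Y)) (aron_berner_extension N X (dual Y) P)}.
        y \<in> Metric_space.mball (vecs (polynomials N X (dual Y))) (ndist (polynomials N X (dual Y))) P0 \<epsilon>"
      using Q by blast
  qed
qed

end
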